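(* Let $X_1,\dots,X_m$ be vector fields on $\mathbb{R}^n$ of class $\mathcal{A}_s$ satisfying the Hörmander condition of step $s$. There are $\sigma_0,r_0,C>0$ such that, for every $I=(i_1,\dots,i_n)\in\mathcal S$, every $j=1,\dots,n$, $\sigma\in(0,\sigma_0]$, $x\in K$ and $h\in Q_I(r_0)$, the $C^1$ map $E^\sigma_{I,x}$ satisfies $$\frac{\partial}{\partial h_j}E^\sigma_{I,x}(h)=U_j^\sigma(E^\sigma_{I,x}(h))+\sum_{v:\ d_j+1\le|v|\le s}a_j^v(h)X_v^\sigma(E^\sigma_{I,x}(h))+\omega_j^\sigma(x,h),$$ where the sum is empty if $d_j=s$, and $$|\omega_j^\sigma(x,h)|\le C\|h\|_I^{s+1-d_j}\quad(x\in K,\ h\in Q_I(r_0),\ \sigma\le\sigma_0),\qquad |a_j^v(h)|\le C\|h\|_I^{|v|-d_j}\quad(h\in Q_I(r_0),\ d_j+1\le|v|\le s).$$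
   Context: Vector fields $X_j=\sum_k f_j^k\partial_k$, $j=1,\dots,m$. For a word $w=j_1\cdots j_\ell$ ($j_i\in\{1,\dots,m\}$, $|w|=\ell$), $X_w=[X_{j_1},[\dots,[X_{j_{\ell-1}},X_{j_\ell}]\dots]]=f_w\cdot\nabla$. Class $\mathcal A_s$ ($s\ge2$): all Euclidean derivatives of order $\le s-2$ of the $f_j$ are locally Lipschitz, and for every word $w$ with $|w|=s-1$ and all $j,k$, $X_kf_w$ exists and is continuous and the distributional derivative $X_j(X_kf_w)$ exists in $L^\infty_{loc}$. Hörmander condition of step $s$: $\{X_w(x):|w|\le s\}$ spans $\mathbb{R}^n$ everywhere. Fix bounded connected open $\Omega'\subset\subset\Omega$, $K=\overline{\Omega'}$. Mollification: $\phi\in C_c^\infty$ nonnegative, supported in the unit ball, $\int\phi=1$; $f^{(\sigma)}(x)=\int f(x-\sigma y)\phi(y)dy$; $X_j^\sigma=\sum_k(f_j^k)^{(\sigma)}\partial_k$, and for a word $w$, $X_w^\sigma$ is the corresponding iterated commutator of the $X_j^\sigma$. $Y_1,\dots,Y_q$ enumerate all $X_w$ with $|w|\le s$ (each with a fixed word), $\ell_i$ the length of $Y_i$, $Y_i^\sigma$ the corresponding mollified commutator; $\mathcal S=\{1,\dots,q\}^n$. For $I=(i_1,\dots,i_n)$ write $U_j=Y_{i_j}$, $U_j^\sigma=Y_{i_j}^\sigma$, $d_j=\ell_{i_j}$; $\|h\|_I=\max_j|h_j|^{1/d_j}$, $Q_I(r)=\{h:\|h\|_I<r\}$. Approximate exponentials: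 $e^{tZ}$ is the time-$t$ flow and products of maps are compositions. $C_\tau(Z_1)=e^{\tau Z_1}$, $C_\tau(Z_1,\dots,Z_\ell)=C_\tau(Z_2,\dots,Z_\ell)^{-1}\circ e^{-\tau Z_1}\circ C_\tau(Z_2,\dots,Z_\ell)\circ e^{\tau Z_1}$ ($\tau>0$). For a word $w=j_1\cdots j_\ell$: $\exp_*(tX^\sigma_w)=C_{t^{1/\ell}}(X^\sigma_{j_1},\dots,X^\sigma_{j_\ell})$ if $t>0$, $C_{|t|^{1/\ell}}(X^\sigma_{j_1},\dots,X^\sigma_{j_\ell})^{-1}$ if $t<0$, identity if $t=0$. $E^\sigma_{I,x}(h)=\exp_*(h_1Y^\sigma_{i_1})\circ\cdots\circ\exp_*(h_nY^\sigma_{i_n})(x)$. *)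

theory Defs
  imports "HOL-Analysis.Analysis"
begin

(* Points of R^n are elements of real^'n (n = CARD('n)).  A vector field X = sum_k f^k d_k
   is represented by its coefficient map f :: real^'n => real^'n.
   A family X_1..X_m is a map f :: nat => real^'n => real^'n, used on indices 1..m. *)

definition Xop :: "(real^'n \<Rightarrow> real^'n) \<Rightarrow> (real^'n \<Rightarrow> 'b::real_normed_vector) \<Rightarrow> real^'n \<Rightarrow> 'b" where
  "Xop F g x = vector_derivative (\<lambda>t. g (x + t *\<^sub>R F x)) (at 0)"

definition Xexists :: "(real^'n \<Rightarrow> real^'n) \<Rightarrow> (real^'n \<Rightarrow> 'b::real_normed_vector) \<Rightarrow> real^'n \<Rightarrow> bool" where
  "Xexists F g x \<longleftrightarrow> (\<lambda>t. g (x + t *\<^sub>R F x)) differentiable (at 0)"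

(* coefficient f_w of the iterated commutator X_w = [X_j1,[...,[X_j(l-1),X_jl]...]];
   [f.grad, g.grad] = (F g - G f).grad *)
fun fw :: "(nat \<Rightarrow> real^'n \<Rightarrow> real^'n) \<Rightarrow> nat list \<Rightarrow> real^'n \<Rightarrow> real^'n" where
  "fw f [] = (\<lambda>x. 0)"
| "fw f [j] = f j"
| "fw f (j # k # w) = (\<lambda>x. Xop (f j) (fw f (k # w)) x - Xop (fw f (k # w)) (f j) x)"

definition pd :: "'n \<Rightarrow> (real^'n \<Rightarrow> 'b::real_normed_vector) \<Rightarrow> real^'n \<Rightarrow> 'b" where
  "pd k g x = vector_derivative (\<lambda>t. g (x + t *\<^sub>R axis k 1)) (at 0)"

fun pds :: "'n list \<Rightarrow> (real^'n \<Rightarrow> 'b::real_normed_vector) \<Rightarrow> real^'n \<Rightarrow> 'b" where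
  "pds [] g = g"
| "pds (k # ks) g = pd k (pds ks g)"

definition pd_exists :: "'n \<Rightarrow> (real^'n \<Rightarrow> 'b::real_normed_vector) \<Rightarrow> real^'n \<Rightarrow> bool" where
  "pd_exists k g x \<longleftrightarrow> (\<lambda>t. g (x + t *\<^sub>R axis k 1)) differentiable (at 0)"

definition loc_lip :: "('a::metric_space \<Rightarrow> 'b::metric_space) \<Rightarrow> bool" where
  "loc_lip g \<longleftrightarrow> (\<forall>x. \<exists>e>0. \<exists>L. L-lipschitz_on (ball x e) g)"

definition deriv_lip :: "nat \<Rightarrow> (real^'n \<Rightarrow> 'b::real_normed_vector) \<Rightarrow> bool" where
  "deriv_lip r g \<longleftrightarrow>
     (\<forall>ks k x. length ks < r \<longrightarrow> pd_exists k (pds ks g) x) \<and>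
     (\<forall>ks. length ks \<le> r \<longrightarrow> loc_lip (pds ks g))"

definition smooth_fn :: "(real^'n \<Rightarrow> 'b::real_normed_vector) \<Rightarrow> bool" where
  "smooth_fn g \<longleftrightarrow> (\<forall>ks k x. pd_exists k (pds ks g) x) \<and> (\<forall>ks. continuous_on UNIV (pds ks g))"

definition test_fn :: "(real^'n \<Rightarrow> real) \<Rightarrow> bool" where
  "test_fn \<psi> \<longleftrightarrow> smooth_fn \<psi> \<and> bounded {x. \<psi> x \<noteq> 0}"

definition Linf_loc :: "(real^'n \<Rightarrow> 'b::euclidean_space) \<Rightarrow> bool" where
  "Linf_loc G \<longleftrightarrow> G \<in> borel_measurable lebesgue \<and>
     (\<forall>B. compact B \<longrightarrow> (\<exists>M. AE x in lebesgue. x \<in> B \<longrightarrow> norm (G x) \<le> M))"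

(* Euclidean divergence (a.e. defined for Lipschitz F) *)
definition divg :: "(real^'n \<Rightarrow> real^'n) \<Rightarrow> real^'n \<Rightarrow> real" where
  "divg F x = (\<Sum>k\<in>UNIV. pd k (\<lambda>y. F y $ k) x)"

(* the distributional derivative F g (F = coefficients of the vector field) exists in L^infinity_loc:
   <F g, psi> = - int g div(psi F) = - int g (F psi + psi div F) *)
definition distX_Linf :: "(real^'n \<Rightarrow> real^'n) \<Rightarrow> (real^'n \<Rightarrow> real^'n) \<Rightarrow> bool" where
  "distX_Linf F g \<longleftrightarrow> (\<exists>G. Linf_loc G \<and>
     (\<forall>\<psi>. test_fn \<psi> \<longrightarrow>
        integral UNIV (\<lambda>x. \<psi> x *\<^sub>R G x) =
        - integral UNIV (\<lambda>x. (Xop F \<psi> x + \<psi> x * divg F x) *\<^sub>R g x)))"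

definition words :: "nat \<Rightarrow> nat \<Rightarrow> nat list set" where
  "words s m = {w. set w \<subseteq> {1..m} \<and> 1 \<le> length w \<and> length w \<le> s}"

definition class_A :: "nat \<Rightarrow> nat \<Rightarrow> (nat \<Rightarrow> real^'n \<Rightarrow> real^'n) \<Rightarrow> bool" where
  "class_A s m f \<longleftrightarrow> 2 \<le> s \<and>
     (\<forall>j\<in>{1..m}. deriv_lip (s - 2) (f j)) \<and>
     (\<forall>w j k. set w \<subseteq> {1..m} \<and> length w = s - 1 \<and> j \<in> {1..m} \<and> k \<in> {1..m} \<longrightarrow>
        (\<forall>x. Xexists (f k) (fw f w) x) \<and> continuous_on UNIV (Xop (f k) (fw f w)) \<and>
        distX_Linf (f j) (Xop (f k) (fw f w)))"

definition hormander :: "nat \<Rightarrow> nat \<Rightarrow> (nat \<Rightarrow> real^'n \<Rightarrow> real^'n) \<Rightarrow> bool" where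
  "hormander s m f \<longleftrightarrow> (\<forall>x. span {fw f w x | w. w \<in> words s m} = UNIV)"

definition mollifier :: "(real^'n \<Rightarrow> real) \<Rightarrow> bool" where
  "mollifier \<phi> \<longleftrightarrow> smooth_fn \<phi> \<and> (\<forall>x. 0 \<le> \<phi> x) \<and>
     closure {x. \<phi> x \<noteq> 0} \<subseteq> cball 0 1 \<and> (\<phi> has_integral 1) UNIV"

definition moll :: "(real^'n \<Rightarrow> real) \<Rightarrow> real \<Rightarrow> (real^'n \<Rightarrow> real^'n) \<Rightarrow> real^'n \<Rightarrow> real^'n" where
  "moll \<phi> \<sigma> F x = integral UNIV (\<lambda>y. \<phi> y *\<^sub>R F (x - \<sigma> *\<^sub>R y))"

definition flow :: "(real^'n \<Rightarrow> real^'n) \<Rightarrow> real \<Rightarrow> real^'n \<Rightarrow> real^'n" where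
  "flow Z t x = (THE y. \<exists>\<gamma>. \<gamma> 0 = x \<and> \<gamma> t = y \<and>
      (\<forall>r\<in>closed_segment 0 t. (\<gamma> has_vector_derivative Z (\<gamma> r)) (at r within closed_segment 0 t)))"

definition run :: "((real^'n \<Rightarrow> real^'n) \<times> real) list \<Rightarrow> real^'n \<Rightarrow> real^'n" where
  "run ps x = fold (\<lambda>(Z, t) y. flow Z t y) ps x"

definition invseq :: "('a \<times> real) list \<Rightarrow> ('a \<times> real) list" where
  "invseq ps = rev (map (\<lambda>(Z, t). (Z, - t)) ps)"

(* C_tau(Z_1,...,Z_l) = C_tau(Z_2..)^{-1} o e^{-tau Z_1} o C_tau(Z_2..) o e^{tau Z_1} *)
fun cseq :: "real \<Rightarrow> 'a list \<Rightarrow> ('a \<times> real) list" where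
  "cseq \<tau> [] = []"
| "cseq \<tau> [Z] = [(Z, \<tau>)]"
| "cseq \<tau> (Z # Z' # Zs) =
     [(Z, \<tau>)] @ cseq \<tau> (Z' # Zs) @ [(Z, - \<tau>)] @ invseq (cseq \<tau> (Z' # Zs))"

definition Cmap :: "real \<Rightarrow> (real^'n \<Rightarrow> real^'n) list \<Rightarrow> real^'n \<Rightarrow> real^'n" where
  "Cmap \<tau> Zs = run (cseq \<tau> Zs)"

definition Cmap_inv :: "real \<Rightarrow> (real^'n \<Rightarrow> real^'n) list \<Rightarrow> real^'n \<Rightarrow> real^'n" where
  "Cmap_inv \<tau> Zs = run (invseq (cseq \<tau> Zs))"

definition expstar :: "(nat \<Rightarrow> real^'n \<Rightarrow> real^'n) \<Rightarrow> nat list \<Rightarrow> real \<Rightarrow> real^'n \<Rightarrow> real^'n" where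
  "expstar fs w t =
     (if 0 < t then Cmap (t powr (1 / real (length w))) (map fs w)
      else if t < 0 then Cmap_inv (\<bar>t\<bar> powr (1 / real (length w))) (map fs w)
      else id)"

(* E_{I,x}(h) = exp_*(h_1 Y_{i_1}) o ... o exp_*(h_n Y_{i_n}) (x);  Y_i = X_{Yw i} *)
definition Emap :: "(nat \<Rightarrow> real^'n \<Rightarrow> real^'n) \<Rightarrow> (nat \<Rightarrow> nat list) \<Rightarrow> (nat \<Rightarrow> nat)
                    \<Rightarrow> real^'n \<Rightarrow> (nat \<Rightarrow> real) \<Rightarrow> real^'n" where
  "Emap fs Yw I x h = foldr (\<lambda>j y. expstar fs (Yw (I j)) (h j) y) [1..<CARD('n) + 1] x"

definition normI :: "nat \<Rightarrow> (nat \<Rightarrow> nat list) \<Rightarrow> (nat \<Rightarrow> nat) \<Rightarrow> (nat \<Rightarrow> real) \<Rightarrow> real" where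
  "normI n Yw I h = Max ((\<lambda>j. \<bar>h j\<bar> powr (1 / real (length (Yw (I j))))) ` {1..n})"

definition QI :: "nat \<Rightarrow> (nat \<Rightarrow> nat list) \<Rightarrow> (nat \<Rightarrow> nat) \<Rightarrow> real \<Rightarrow> (nat \<Rightarrow> real) set" where
  "QI n Yw I r = {h. normI n Yw I h < r}"

definition pdh :: "nat \<Rightarrow> ((nat \<Rightarrow> real) \<Rightarrow> 'b::real_normed_vector) \<Rightarrow> (nat \<Rightarrow> real) \<Rightarrow> 'b" where
  "pdh j E h = vector_derivative (\<lambda>t. E (h(j := t))) (at (h j))"

end

theory Submission
  imports Defs
begin

text \<open>
  The differential of the flow of a smooth field carries a commutator to the truncated Lie series of its
  iterated brackets with that field, up to an error governed by commutators of length \<open>s + 1\<close>. Pushing the velocity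
  of each factor through the remaining factors, the partial derivatives of a product of approximate
  exponentials become combinations of commutators whose coefficients are universal: they depend on the word and on \<open>h\<close>,
  but not on the fields, the point or \<open>\<sigma>\<close>.

  That the coefficients of lower order cancel, leaving exactly \<open>X\<^sub>w\<close> in degree \<open>|w|\<close>, is an identity of
  noncommutative power series: the product of the formal exponentials spelled by \<open>C\<^sub>\<tau>\<close> is \<open>1 + [w] +\<close> higher degree, and its
  degree derivation is the product itself times the Lie series of the coefficients.

  The analytic input is a bound, uniform in \<open>\<sigma>\<close> on compact sets, for mollified commutators of length at most \<open>s + 1\<close>.
  Up to length \<open>s - 1\<close> the commutator of the mollifications differs from the mollification of the commutator by
  \<open>O(\<sigma>)\<close>, with bounded first and second derivatives. At length \<open>s + 1\<close> the second-order term
  \<open>X\<^sub>j\<^sup>\<sigma> X\<^sub>k\<^sup>\<sigma> f\<^sub>w\<^sup>\<sigma>\<close> is handled by a Friedrichs commutator argument, whose remainder is uniformly Lipschitz, and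
  by moving the mollification onto the distributional derivative \<open>X\<^sub>j (X\<^sub>k f\<^sub>w)\<close> in \<open>L\<^sup>\<infinity>\<close>.
\<close>

section \<open>Calculus with partial derivatives\<close>

text \<open>Every constant has to survive \<sigma> tending to 0. Three families of bounds do: the
  sup norms of the fields, their Lipschitz constants, and the sup norms of their commutators up to
  length \<open>s + 1\<close>; all quantitative estimates are arranged to use only these. The class
  of the fields is matched to the length \<open>s + 1\<close>. In [X_j, [X_k, X_w]] with |w| = s -
  1, the term X_j X_k f_w is the one controlled by hypothesis. The term X_j X_w f_k is harmless for
  \<open>s \<ge> 3\<close>, where f_k has one derivative to spare, and for \<open>s = 2\<close> it
  has the shape of the first one, since X_w is then one of the fields. The remaining term
  differentiates only f_j, once. Universality of the coefficients is forced by the quantifiers: one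
  choice of \<open>a\<close> serves all points and all \<sigma>. The weights come from the time
  change: an entry of size \<open>r ^ l\<close> for a word of length \<open>l\<close> is spent on
  flows of time at most \<open>r\<close>, so that each bracket gained in a Taylor expansion along a
  flow is worth one power of \<open>r\<close>.\<close>

lemma vector_mvt_linearization:
  fixes F :: "real \<Rightarrow> 'b::real_normed_vector"
  assumes der: "\<And>r. r \<in> closed_segment 0 t \<Longrightarrow>
      (F has_vector_derivative F' r) (at r within closed_segment 0 t)"
    and bnd: "\<And>r. r \<in> closed_segment 0 t \<Longrightarrow> norm (F' r - c) \<le> e"
  shows "norm (F t - F 0 - t *\<^sub>R c) \<le> e * \<bar>t\<bar>"
proof -
  have "norm ((F t - t *\<^sub>R c) - (F 0 - 0 *\<^sub>R c)) \<le> e * norm (t - 0)"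
  proof (rule differentiable_bound[where f = "\<lambda>r. F r - r *\<^sub>R c" and S = "closed_segment 0 t"
        and f' = "\<lambda>r h. h *\<^sub>R (F' r - c)"])
    fix r assume r: "r \<in> closed_segment 0 t"
    have "((\<lambda>r. F r - r *\<^sub>R c) has_vector_derivative (F' r - 1 *\<^sub>R c)) (at r within closed_segment 0 t)"
      by (intro has_vector_derivative_diff der r) (auto intro!: derivative_eq_intros simp: has_vector_derivative_def)
    then show "((\<lambda>r. F r - r *\<^sub>R c) has_derivative (\<lambda>h. h *\<^sub>R (F' r - c))) (at r within closed_segment 0 t)"
      by (simp add: has_vector_derivative_def)
    show "onorm (\<lambda>h. h *\<^sub>R (F' r - c)) \<le> e"
      using bnd[OF r] by (intro onorm_le) (simp add: mult.commute[of e] mult_left_mono)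
  qed auto
  then show ?thesis by (simp add: algebra_simps)
qed

lemma vector_mvt_bound:
  fixes F :: "real \<Rightarrow> 'b::real_normed_vector"
  assumes "\<And>r. r \<in> closed_segment 0 t \<Longrightarrow>
      (F has_vector_derivative F' r) (at r within closed_segment 0 t)"
    and "\<And>r. r \<in> closed_segment 0 t \<Longrightarrow> norm (F' r) \<le> e"
  shows "norm (F t - F 0) \<le> e * \<bar>t\<bar>"
  using vector_mvt_linearization[of t F F' 0 e] assms by simp

lemma has_vector_derivative_along:
  fixes g :: "'a::real_normed_vector \<Rightarrow> 'b::real_normed_vector"
  assumes "(g has_derivative g') (at x)"
  shows "((\<lambda>t. g (x + t *\<^sub>R v)) has_vector_derivative g' v) (at 0)"
proof -
  have 1: "((\<lambda>t. x + t *\<^sub>R v) has_derivative (\<lambda>t. t *\<^sub>R v)) (at 0)"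
    by (auto intro!: derivative_eq_intros)
  have "((\<lambda>t. g (x + t *\<^sub>R v)) has_derivative (\<lambda>t. g' (t *\<^sub>R v))) (at 0)"
    using has_derivative_compose[OF 1, of g g'] assms by simp
  moreover have "g' (t *\<^sub>R v) = t *\<^sub>R g' v" for t
    using has_derivative_linear[OF assms] by (simp add: linear_cmul)
  ultimately show ?thesis by (simp add: has_vector_derivative_def)
qed

lemma has_derivative_imp_pd:
  assumes "(g has_derivative g') (at x)"
  shows "pd_exists k g x" "pd k g x = g' (axis k 1)"
  using has_vector_derivative_along[OF assms, of "axis k 1"]
  unfolding pd_exists_def pd_def
  by (auto intro: differentiableI_vector vector_derivative_at)

lemma has_derivative_imp_Xop:
  assumes "(g has_derivative g') (at x)"
  shows "Xexists F g x" "Xop F g x = g' (F x)"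
  using has_vector_derivative_along[OF assms, of "F x"]
  unfolding Xexists_def Xop_def
  by (auto intro: differentiableI_vector vector_derivative_at)

lemma pd_exists_has_vector_derivative:
  assumes "pd_exists k g (y + t0 *\<^sub>R axis k 1)"
  shows "((\<lambda>t. g (y + t *\<^sub>R axis k 1)) has_vector_derivative pd k g (y + t0 *\<^sub>R axis k 1)) (at t0 within S)"
proof -
  let ?y = "y + t0 *\<^sub>R axis k 1"
  have 1: "((\<lambda>t. g (?y + t *\<^sub>R axis k 1)) has_vector_derivative pd k g ?y) (at (t0 - t0))"
    using assms unfolding pd_exists_def pd_def by (simp add: vector_derivative_works)
  have 2: "((\<lambda>t. t - t0) has_vector_derivative 1) (at t0)"
    by (auto intro!: derivative_eq_intros)
  have "(\<lambda>t. g (?y + (t - t0) *\<^sub>R axis k 1)) = (\<lambda>t. g (y + t *\<^sub>R axis k 1))"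
    by (simp add: algebra_simps)
  then show ?thesis
    using vector_diff_chain_at[OF 2 1] by (simp add: o_def has_vector_derivative_at_within)
qed

text \<open>The increment is split along the coordinate directions; on each piece the mean value
  inequality compares the partial derivative with its value at \<open>x\<close>, which is close by
  continuity.\<close>

lemma continuous_partials_imp_has_derivative:
  fixes g :: "real^'n \<Rightarrow> 'b::real_normed_vector"
  assumes ex: "\<And>k x. pd_exists k g x" and cont: "\<And>k. continuous_on UNIV (pd k g)"
  shows "(g has_derivative (\<lambda>h. \<Sum>k\<in>UNIV. h $ k *\<^sub>R pd k g x)) (at x)"
  unfolding has_derivative_at_alt
proof (intro conjI allI impI)
  show "bounded_linear (\<lambda>h. \<Sum>k\<in>UNIV. h $ k *\<^sub>R pd k g x)"
    by (intro bounded_linear_sum bounded_linear_scaleR_const bounded_linear_vec_nth)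
  fix e :: real assume e: "e > 0"
  define e' where "e' = e / CARD('n)"
  have e': "e' > 0" using e by (simp add: e'_def)
  have "\<forall>\<^sub>F y in nhds x. \<forall>k\<in>UNIV. dist (pd k g y) (pd k g x) < e'"
  proof (rule eventually_ball_finite, simp, rule ballI)
    fix k
    have "(pd k g \<longlongrightarrow> pd k g x) (at x)"
      using cont[of k] by (simp add: continuous_on_def)
    then show "\<forall>\<^sub>F y in nhds x. dist (pd k g y) (pd k g x) < e'"
      using e' by (auto simp: tendsto_iff eventually_at_filter elim!: eventually_mono)
  qed
  then obtain d where d: "d > 0" "\<And>y k. dist y x < d \<Longrightarrow> dist (pd k g y) (pd k g x) < e'"
    by (auto simp: eventually_nhds_metric)
  \<comment> \<open>The points \<open>x + pr S h\<close> form a staircase from \<open>x\<close> to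
    \<open>x + h\<close> that stays within distance \<open>norm h\<close> of
    \<open>x\<close>.\<close>
  define pr where "pr S h = (\<chi> i. if i \<in> S then h $ i else 0)" for S and h :: "real^'n"
  have npr: "norm (pr S h) \<le> norm h" for S h
    by (intro norm_le_componentwise_cart) (simp add: pr_def)
  have step: "norm (g (x + pr S h) - g x - (\<Sum>k\<in>S. h $ k *\<^sub>R pd k g x)) \<le> card S * e' * norm h"
    if "finite S" and h: "norm h < d" for S h
    using that(1)
  proof induction
    case empty
    have "pr {} h = 0" by (simp add: pr_def vec_eq_iff)
    then show ?case by simp
  next
    case (insert k S)
    let ?y = "x + pr S h" and ?F = "\<lambda>t. g (x + pr S h + t *\<^sub>R axis k 1)"
    have pri: "pr (insert k S) h = pr S h + h $ k *\<^sub>R axis k 1"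
      using insert.hyps by (auto simp: pr_def vec_eq_iff axis_def)
    have seg: "dist (?y + r *\<^sub>R axis k 1) x < d" if "r \<in> closed_segment 0 (h $ k)" for r
    proof -
      have "\<bar>r\<bar> \<le> \<bar>h $ k\<bar>" using that by (auto simp: closed_segment_eq_real_ivl split: if_splits)
      then have "norm (pr S h + r *\<^sub>R axis k 1) \<le> norm h"
        using insert.hyps by (intro norm_le_componentwise_cart) (auto simp: pr_def axis_def)
      then show ?thesis using h by (simp add: dist_norm add.assoc)
    qed
    have "norm (?F (h $ k) - ?F 0 - h $ k *\<^sub>R pd k g x) \<le> e' * \<bar>h $ k\<bar>"
    proof (rule vector_mvt_linearization)
      fix r assume r: "r \<in> closed_segment 0 (h $ k)"
      show "(?F has_vector_derivative pd k g (?y + r *\<^sub>R axis k 1)) (at r within closed_segment 0 (h $ k))"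
        by (rule pd_exists_has_vector_derivative[OF ex])
      show "norm (pd k g (?y + r *\<^sub>R axis k 1) - pd k g x) \<le> e'"
        using d(2)[OF seg[OF r], of k] by (simp add: dist_norm)
    qed
    also have "\<dots> \<le> e' * norm h" using e' component_le_norm_cart[of h k] by (intro mult_left_mono) auto
    finally have 1: "norm (?F (h $ k) - ?F 0 - h $ k *\<^sub>R pd k g x) \<le> e' * norm h" .
    have "g (x + pr (insert k S) h) - g x - (\<Sum>k\<in>insert k S. h $ k *\<^sub>R pd k g x) =
      (?F (h $ k) - ?F 0 - h $ k *\<^sub>R pd k g x) + (g (x + pr S h) - g x - (\<Sum>k\<in>S. h $ k *\<^sub>R pd k g x))"
      using insert.hyps by (simp add: pri algebra_simps)
    then have "norm (g (x + pr (insert k S) h) - g x - (\<Sum>k\<in>insert k S. h $ k *\<^sub>R pd k g x)) \<le>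
       e' * norm h + card S * e' * norm h"
      using norm_triangle_mono[OF 1 insert.IH] by metis
    then show ?case using insert.hyps by (simp add: algebra_simps)
  qed
  show "\<exists>d>0. \<forall>y. norm (y - x) < d \<longrightarrow>
     norm (g y - g x - (\<Sum>k\<in>UNIV. (y - x) $ k *\<^sub>R pd k g x)) \<le> e * norm (y - x)"
  proof (intro exI[of _ d] conjI allI impI d(1))
    fix y assume "norm (y - x) < d"
    moreover have "pr UNIV (y - x) = y - x" by (simp add: pr_def vec_eq_iff)
    ultimately show "norm (g y - g x - (\<Sum>k\<in>UNIV. (y - x) $ k *\<^sub>R pd k g x)) \<le> e * norm (y - x)"
      using step[of UNIV "y - x"] by (simp add: e'_def)
  qed
qed

section \<open>Functions of class C^r through iterated partial derivatives\<close>

fun Ck :: "nat \<Rightarrow> (real^'n \<Rightarrow> 'b::real_normed_vector) \<Rightarrow> bool" where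
  "Ck 0 g = continuous_on UNIV g"
| "Ck (Suc r) g = (continuous_on UNIV g \<and> (\<forall>k x. pd_exists k g x) \<and> (\<forall>k. Ck r (pd k g)))"

declare Ck.simps(2) [simp del]

lemma Ck_Suc_pd_exists: "Ck (Suc r) g \<Longrightarrow> pd_exists k g x"
  and Ck_pd: "Ck (Suc r) g \<Longrightarrow> Ck r (pd k g)"
  by (auto simp: Ck.simps(2))

lemma Ck_cont: "Ck r g \<Longrightarrow> continuous_on UNIV g"
  by (cases r) (auto simp: Ck.simps(2))

lemma Ck_Suc_imp: "Ck (Suc r) g \<Longrightarrow> Ck r g"
proof (induction r arbitrary: g)
  case (Suc r)
  then have "Ck r (pd k g)" for k by (auto dest: Ck_pd)
  with Suc.prems show ?case unfolding Ck.simps(2) by blast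
qed (simp add: Ck.simps(2))

lemma Ck_le: "Ck r g \<Longrightarrow> q \<le> r \<Longrightarrow> Ck q g"
  by (induction r) (auto simp: le_Suc_eq dest: Ck_Suc_imp)

lemma Ck_has_derivative:
  "Ck (Suc r) g \<Longrightarrow> (g has_derivative (\<lambda>h. \<Sum>k\<in>UNIV. h $ k *\<^sub>R pd k g x)) (at x)"
  by (rule continuous_partials_imp_has_derivative) (auto intro: Ck_cont Ck_pd Ck_Suc_pd_exists)

lemma Ck_Xop_eq: "Ck (Suc r) g \<Longrightarrow> Xop F g x = (\<Sum>k\<in>UNIV. F x $ k *\<^sub>R pd k g x)"
  using has_derivative_imp_Xop(2)[OF Ck_has_derivative] .

text \<open>Like the notions of the statement, \<open>Ck\<close> rests on bare partial derivatives,
  while closure rules are known for total derivatives. This rule passes from the latter to the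
  former, so that each closure property becomes an induction on \<open>r\<close>.\<close>

lemma Ck_SucI:
  assumes "\<And>x. (g has_derivative g' x) (at x)" "\<And>k. Ck r (\<lambda>x. g' x (axis k 1))"
  shows "Ck (Suc r) g"
proof -
  have "pd k g = (\<lambda>x. g' x (axis k 1))" for k
    using has_derivative_imp_pd(2)[OF assms(1)] by auto
  moreover have "continuous_on UNIV g"
    using assms(1) by (auto intro!: continuous_at_imp_continuous_on has_derivative_continuous)
  ultimately show ?thesis
    using has_derivative_imp_pd(1)[OF assms(1)] assms(2) unfolding Ck.simps(2) by auto
qed

lemma Ck_const: "Ck r (\<lambda>x. c)"
  by (induction r arbitrary: c) (auto intro!: Ck_SucI[where g' = "\<lambda>x h. 0"])

lemma sum_axis_scaleR: "(\<Sum>i\<in>UNIV. axis k (1::real) $ i *\<^sub>R c i) = (c k :: 'b::real_normed_vector)"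
  by (subst sum.cong[OF refl, of _ _ "\<lambda>i. if i = k then c i else 0"]) (auto simp: axis_def)

lemma Ck_add: "Ck r u \<Longrightarrow> Ck r v \<Longrightarrow> Ck r (\<lambda>x. u x + v x)"
proof (induction r arbitrary: u v)
  case 0 then show ?case by (auto intro: continuous_intros)
next
  case (Suc r)
  show ?case
    by (rule Ck_SucI[OF has_derivative_add[OF Ck_has_derivative[OF Suc.prems(1)]
        Ck_has_derivative[OF Suc.prems(2)]]])
      (use Suc in \<open>simp add: sum_axis_scaleR Ck_pd\<close>)
qed

lemma Ck_bounded_linear:
  "bounded_linear h \<Longrightarrow> Ck r u \<Longrightarrow> Ck r (\<lambda>x. h (u x))"
proof (induction r arbitrary: u)
  case 0 then show ?case by (auto intro: bounded_linear.continuous_on)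
next
  case (Suc r)
  show ?case
    by (rule Ck_SucI[OF bounded_linear.has_derivative[OF Suc.prems(1) Ck_has_derivative[OF Suc.prems(2)]]])
      (use Suc in \<open>simp add: sum_axis_scaleR Ck_pd\<close>)
qed

lemma (in bounded_bilinear) Ck_bilinear:
  "Ck r u \<Longrightarrow> Ck r v \<Longrightarrow> Ck r (\<lambda>x. prod (u x) (v x))"
proof (induction r arbitrary: u v)
  case 0 then show ?case by (auto intro: continuous_on)
next
  case (Suc r)
  show ?case
    by (rule Ck_SucI[OF FDERIV[OF Ck_has_derivative[OF Suc.prems(1)] Ck_has_derivative[OF Suc.prems(2)]]])
      (use Suc.prems in \<open>auto simp add: sum_axis_scaleR intro!: Ck_add Suc.IH intro: Ck_Suc_imp Ck_pd\<close>)
qed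

lemmas Ck_scaleR = bounded_bilinear.Ck_bilinear[OF bounded_bilinear_scaleR]
lemmas Ck_vec_nth = Ck_bounded_linear[OF bounded_linear_vec_nth]

lemma Ck_diff: "Ck r u \<Longrightarrow> Ck r v \<Longrightarrow> Ck r (\<lambda>x. u x - v x)"
  using Ck_add[of r u "\<lambda>x. - v x"] Ck_bounded_linear[OF bounded_linear_minus[OF bounded_linear_ident], of r v]
  by simp

lemma Ck_sum: "(\<And>i. i \<in> S \<Longrightarrow> Ck r (u i)) \<Longrightarrow> Ck r (\<lambda>x. \<Sum>i\<in>S. u i x)"
  by (induction S rule: infinite_finite_induct) (auto intro: Ck_const Ck_add)

lemma Ck_ident: "Ck r (\<lambda>x. x)"
  by (cases r) (auto intro!: Ck_SucI[where g' = "\<lambda>x h. h"] Ck_const)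

lemma Ck_Xop: "Ck r F \<Longrightarrow> Ck (Suc r) g \<Longrightarrow> Ck r (Xop F g)"
proof -
  assume "Ck r F" and g: "Ck (Suc r) g"
  moreover have "Xop F g = (\<lambda>x. \<Sum>k\<in>UNIV. F x $ k *\<^sub>R pd k g x)"
    using Ck_Xop_eq[OF g] by auto
  ultimately show ?thesis by (auto intro!: Ck_sum Ck_scaleR Ck_vec_nth intro: Ck_pd)
qed

lemma Ck_fw:
  assumes "\<And>j. j \<in> set w \<Longrightarrow> Ck (r + length w - 1) (f j)"
  shows "Ck r (fw f w)"
  using assms
proof (induction f w arbitrary: r rule: fw.induct)
  case (1 f) then show ?case by (simp add: Ck_const)
next
  case (2 f j) then show ?case by simp
next
  case (3 f j k w)
  have a: "Ck (Suc r) (fw f (k # w))" by (rule 3(1)) (use 3(3) in simp)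
  have b: "Ck (Suc r) (f j)" by (rule Ck_le[OF 3(3)]) auto
  show ?case
    using a b by (auto intro!: Ck_diff Ck_Xop intro: Ck_Suc_imp)
qed

lemma pds_append: "pds (ks @ js) g = pds ks (pds js g)"
  by (induction ks) auto

lemma smooth_fn_pd: "smooth_fn g \<Longrightarrow> smooth_fn (pd k g)"
  unfolding smooth_fn_def using pds_append[of _ "[k]" g]
  by (metis pds.simps)

lemma smooth_fn_imp_Ck: "smooth_fn g \<Longrightarrow> Ck r g"
proof (induction r arbitrary: g)
  case 0 then show ?case unfolding smooth_fn_def by (metis Ck.simps(1) pds.simps(1))
next
  case (Suc r)
  then show ?case using smooth_fn_pd[OF Suc.prems]
    unfolding Ck.simps(2) using Suc.prems pds.simps(1) unfolding smooth_fn_def by (metis (no_types, lifting))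
qed

lemma Ck_pds: "Ck (r + length ks) g \<Longrightarrow> Ck r (pds ks g)"
proof (induction ks arbitrary: r)
  case (Cons k ks)
  then have "Ck (Suc r) (pds ks g)" by simp
  then show ?case by (simp add: Ck_pd)
qed simp

lemma Ck_imp_smooth_fn:
  assumes "\<And>r. Ck r g" shows "smooth_fn g"
proof -
  have "Ck (Suc 0) (pds ks g)" for ks by (rule Ck_pds) (rule assms)
  then show ?thesis unfolding smooth_fn_def by (auto intro: Ck_cont Ck_Suc_pd_exists)
qed

lemma pd_sum: "(\<And>i. i \<in> S \<Longrightarrow> Ck (Suc 0) (u i)) \<Longrightarrow> pd k (\<lambda>x. \<Sum>i\<in>S. u i x) y = (\<Sum>i\<in>S. pd k (u i) y)"
  by (subst has_derivative_imp_pd(2)[OF has_derivative_sum[OF Ck_has_derivative]]) (auto simp: sum_axis_scaleR)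

lemma pd_add: "Ck (Suc 0) u \<Longrightarrow> Ck (Suc 0) v \<Longrightarrow> pd k (\<lambda>x. u x + v x) y = pd k u y + pd k v y"
  using has_derivative_imp_pd(2)[OF has_derivative_add[OF Ck_has_derivative[of 0 u] Ck_has_derivative[of 0 v]], of k y]
  by (simp add: sum_axis_scaleR)

lemma pd_diff: "Ck (Suc 0) u \<Longrightarrow> Ck (Suc 0) v \<Longrightarrow> pd k (\<lambda>x. u x - v x) y = pd k u y - pd k v y"
  using has_derivative_imp_pd(2)[OF has_derivative_diff[OF Ck_has_derivative[of 0 u] Ck_has_derivative[of 0 v]], of k y]
  by (simp add: sum_axis_scaleR)

lemma pd_bounded_linear: "bounded_linear h \<Longrightarrow> Ck (Suc 0) u \<Longrightarrow> pd k (\<lambda>x. h (u x)) y = h (pd k u y)"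
  using has_derivative_imp_pd(2)[OF bounded_linear.has_derivative[OF _ Ck_has_derivative[of 0 u]], of h k y]
  by (simp add: sum_axis_scaleR)

lemmas pd_vec_nth = pd_bounded_linear[OF bounded_linear_vec_nth]

lemma (in bounded_bilinear) pd_bilinear:
  "Ck (Suc 0) u \<Longrightarrow> Ck (Suc 0) v \<Longrightarrow> pd k (\<lambda>x. prod (u x) (v x)) y = prod (u y) (pd k v y) + prod (pd k u y) (v y)"
  using has_derivative_imp_pd(2)[OF FDERIV[OF Ck_has_derivative[of 0 u] Ck_has_derivative[of 0 v]], of k y]
  by (simp add: sum_axis_scaleR)

lemmas pd_scaleR = bounded_bilinear.pd_bilinear[OF bounded_bilinear_scaleR]

section \<open>Locality of derivatives and commutators, symmetry of second derivatives\<close>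

lemma vector_derivative_cong_eventually:
  assumes "\<forall>\<^sub>F t in nhds a. g t = h t"
  shows "vector_derivative g (at a) = vector_derivative h (at a)"
    and "g differentiable at a \<longleftrightarrow> h differentiable at a"
proof -
  have e: "g a = h a" using assms by (rule eventually_nhds_x_imp_x)
  have "\<forall>\<^sub>F t in at a. g t = h t" using assms by (rule filter_leD[rotated]) (simp add: at_within_def)
  then have "(g has_derivative D) (at a) \<longleftrightarrow> (h has_derivative D) (at a)" for D
    using e by (metis (mono_tags, lifting) UNIV_I eventually_mono has_derivative_transform_eventually)
  then show "vector_derivative g (at a) = vector_derivative h (at a)"
    and "g differentiable at a \<longleftrightarrow> h differentiable at a"
    by (simp_all add: vector_derivative_def has_vector_derivative_def differentiable_def)
qed

lemma eventually_line_in_open: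
  fixes x :: "'a::real_normed_vector"
  assumes "open S" "x \<in> S"
  shows "\<forall>\<^sub>F t::real in nhds 0. x + t *\<^sub>R v \<in> S"
proof -
  have "((\<lambda>t. x + t *\<^sub>R v) \<longlongrightarrow> x + 0 *\<^sub>R v) (nhds 0)"
    by (intro tendsto_intros filterlim_ident)
  then show ?thesis using assms by (auto dest: topological_tendstoD)
qed

lemma Xop_cong_open:
  assumes "open S" "x \<in> S" "\<And>y. y \<in> S \<Longrightarrow> g y = h y" "F x = G x"
  shows "Xop F g x = Xop G h x"
  unfolding Xop_def assms(4)
  by (rule vector_derivative_cong_eventually(1), rule eventually_mono[OF eventually_line_in_open[OF assms(1,2)]])
    (rule assms(3))

lemma pd_cong_open:
  assumes "open S" "x \<in> S" "\<And>y. y \<in> S \<Longrightarrow> g y = h y"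
  shows "pd k g x = pd k h x"
  unfolding pd_def
  by (rule vector_derivative_cong_eventually(1), rule eventually_mono[OF eventually_line_in_open[OF assms(1,2)]])
    (rule assms(3))

text \<open>Commutators only see the fields near the point. This allows the mollified fields to be
  exchanged for mollifications of bounded, globally Lipschitz ones that agree with them on a large
  ball.\<close>

lemma fw_cong_open:
  assumes "open S" "\<And>j y. j \<in> set w \<Longrightarrow> y \<in> S \<Longrightarrow> f j y = g j y" "x \<in> S"
  shows "fw f w x = fw g w x"
  using assms
proof (induction f w arbitrary: x rule: fw.induct)
  case (3 f j k w)
  have e: "\<And>y. y \<in> S \<Longrightarrow> fw f (k # w) y = fw g (k # w) y" using 3 by simp
  have e2: "\<And>y. y \<in> S \<Longrightarrow> f j y = g j y" using 3 by simp
  show ?case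
    using Xop_cong_open[OF 3(3,5) e, where F = "f j" and G = "g j"]
      Xop_cong_open[OF 3(3,5) e2, where F = "fw f (k # w)" and G = "fw g (k # w)"] e e2 3(5)
    by simp
qed auto

text \<open>The second difference over a small square is symmetric in the two directions and,
  divided by \<open>t * t\<close>, is close to either mixed derivative.\<close>

lemma pd_commute:
  fixes g :: "real^'n \<Rightarrow> 'b::real_normed_vector"
  assumes g: "Ck 2 g"
  shows "pd i (pd j g) x = pd j (pd i g) x"
proof -
  have g1: "Ck (Suc 0) g" "\<And>k. Ck (Suc 0) (pd k g)" "\<And>k l. Ck 0 (pd k (pd l g))"
    using g by (auto simp: numeral_2_eq_2 intro: Ck_pd Ck_Suc_imp simp del: Ck.simps)
  define \<Delta> where "\<Delta> t = g (x + t *\<^sub>R axis i 1 + t *\<^sub>R axis j 1) - g (x + t *\<^sub>R axis i 1) - g (x + t *\<^sub>R axis j 1) + g x" for t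
  \<comment> \<open>General in both directions, so that one estimate yields both orders of
    differentiation.\<close>
  have key: "\<exists>d>0. \<forall>t. 0 < t \<and> t < d \<longrightarrow> norm ((g (x + t *\<^sub>R axis i 1 + t *\<^sub>R axis j 1) - g (x + t *\<^sub>R axis i 1) - g (x + t *\<^sub>R axis j 1) + g x) - (t * t) *\<^sub>R pd j (pd i g) x) \<le> e * (t * t)"
    if e: "e > 0" for e i j
  proof -
    have "continuous_on UNIV (pd j (pd i g))" using g1(3) by simp
    then obtain d where d: "d > 0" "\<And>y. dist y x < d \<Longrightarrow> dist (pd j (pd i g) y) (pd j (pd i g) x) < e"
      unfolding continuous_on_iff using e by (metis UNIV_I)
    show ?thesis
    proof (intro exI[of _ "d/2"] conjI allI impI)
      fix t assume t: "0 < t \<and> t < d / 2"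
      let ?ei = "axis i (1::real)" and ?ej = "axis j (1::real)"
      let ?F = "\<lambda>r. g (x + t *\<^sub>R ?ej + r *\<^sub>R ?ei) - g (x + r *\<^sub>R ?ei)"
      have "norm (?F t - ?F 0 - t *\<^sub>R (t *\<^sub>R pd j (pd i g) x)) \<le> (e * t) * \<bar>t\<bar>"
      proof (rule vector_mvt_linearization)
        fix r assume r: "r \<in> closed_segment 0 t"
        then have r': "0 \<le> r" "r \<le> t" using t by (auto simp: closed_segment_eq_real_ivl)
        show "(?F has_vector_derivative (pd i g (x + t *\<^sub>R ?ej + r *\<^sub>R ?ei) - pd i g (x + r *\<^sub>R ?ei))) (at r within closed_segment 0 t)"
          using g1(1) by (intro has_vector_derivative_diff pd_exists_has_vector_derivative Ck_Suc_pd_exists)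
        let ?H = "\<lambda>q. pd i g (x + r *\<^sub>R ?ei + q *\<^sub>R ?ej)"
        have "norm (?H t - ?H 0 - t *\<^sub>R pd j (pd i g) x) \<le> e * \<bar>t\<bar>"
        proof (rule vector_mvt_linearization)
          fix q assume q: "q \<in> closed_segment 0 t"
          then have q': "0 \<le> q" "q \<le> t" using t by (auto simp: closed_segment_eq_real_ivl)
          show "(?H has_vector_derivative pd j (pd i g) (x + r *\<^sub>R ?ei + q *\<^sub>R ?ej)) (at q within closed_segment 0 t)"
            using g1(2) by (intro pd_exists_has_vector_derivative Ck_Suc_pd_exists)
          have "norm (r *\<^sub>R ?ei + q *\<^sub>R ?ej) \<le> r + q"
            using norm_triangle_ineq[of "r *\<^sub>R ?ei" "q *\<^sub>R ?ej"] r' q' by (simp add: norm_axis_1)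
          then have "dist (x + r *\<^sub>R ?ei + q *\<^sub>R ?ej) x < d"
            using r' q' t by (simp add: dist_norm add.assoc)
          from d(2)[OF this] show "norm (pd j (pd i g) (x + r *\<^sub>R ?ei + q *\<^sub>R ?ej) - pd j (pd i g) x) \<le> e"
            by (simp add: dist_norm)
        qed
        then show "norm (pd i g (x + t *\<^sub>R ?ej + r *\<^sub>R ?ei) - pd i g (x + r *\<^sub>R ?ei) - t *\<^sub>R pd j (pd i g) x) \<le> e * t"
          using t by (simp add: add.commute add.left_commute)
      qed
      then show "norm ((g (x + t *\<^sub>R ?ei + t *\<^sub>R ?ej) - g (x + t *\<^sub>R ?ei) - g (x + t *\<^sub>R ?ej) + g x) - (t * t) *\<^sub>R pd j (pd i g) x) \<le> e * (t * t)"
        using t by (simp add: algebra_simps)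
    qed (use d in auto)
  qed
  have "norm (pd i (pd j g) x - pd j (pd i g) x) \<le> 0 + e" if e: "e > 0" for e
  proof -
    obtain d where d: "d > 0" "\<And>t. 0 < t \<and> t < d \<Longrightarrow> norm (\<Delta> t - (t * t) *\<^sub>R pd j (pd i g) x) \<le> e/2 * (t * t)"
      using key[of "e/2" i j] e unfolding \<Delta>_def by auto
    obtain d' where d': "d' > 0" "\<And>t. 0 < t \<and> t < d' \<Longrightarrow> norm (\<Delta> t - (t * t) *\<^sub>R pd i (pd j g) x) \<le> e/2 * (t * t)"
      using key[of "e/2" j i] e unfolding \<Delta>_def by (auto simp: algebra_simps)
    define t where "t = min d d' / 2"
    have t: "0 < t" "t < d" "t < d'" using d d' by (auto simp: t_def)
    have "norm ((\<Delta> t - (t * t) *\<^sub>R pd j (pd i g) x) - (\<Delta> t - (t * t) *\<^sub>R pd i (pd j g) x)) \<le> e/2 * (t * t) + e/2 * (t * t)"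
      using d(2)[of t] d'(2)[of t] t by (intro norm_triangle_le_diff) auto
    also have "(\<Delta> t - (t * t) *\<^sub>R pd j (pd i g) x) - (\<Delta> t - (t * t) *\<^sub>R pd i (pd j g) x) = (t * t) *\<^sub>R (pd i (pd j g) x - pd j (pd i g) x)"
      by (simp add: algebra_simps)
    finally have "(t * t) * norm (pd i (pd j g) x - pd j (pd i g) x) \<le> (t * t) * e" by (simp add: mult.commute[of e])
    then show ?thesis using t by simp
  qed
  then have "norm (pd i (pd j g) x - pd j (pd i g) x) \<le> 0" by (rule field_le_epsilon)
  then show ?thesis by simp
qed

section \<open>Flows of Lipschitz fields and their Jacobians\<close>

text \<open>With the derivative written as a limit of quotients, a Jacobian whose arguments vary
  with the increment can be applied to the quotient and controlled by joint continuity
  alone.\<close>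

lemma has_vector_derivative_iff_quotient:
  fixes f :: "real \<Rightarrow> 'b::real_normed_vector"
  shows "(f has_vector_derivative v) (at x) \<longleftrightarrow> ((\<lambda>h. (1/h) *\<^sub>R (f (x + h) - f x)) \<longlongrightarrow> v) (at 0)"
proof -
  have "(f has_vector_derivative v) (at x) \<longleftrightarrow> (\<lambda>h. norm (f (x + h) - f x - h *\<^sub>R v) / norm h) \<midarrow>0\<rightarrow> 0"
    by (simp add: has_vector_derivative_def has_derivative_at bounded_linear_scaleR_left)
  also have "\<dots> \<longleftrightarrow> ((\<lambda>h. norm ((1/h) *\<^sub>R (f (x + h) - f x) - v)) \<longlongrightarrow> 0) (at 0)"
  proof (rule tendsto_cong)
    have "norm (f (x + h) - f x - h *\<^sub>R v) / norm h = norm ((1/h) *\<^sub>R (f (x + h) - f x) - v)" if "h \<noteq> 0" for h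
    proof -
      have "f (x + h) - f x - h *\<^sub>R v = h *\<^sub>R ((1/h) *\<^sub>R (f (x + h) - f x) - v)"
        using that by (simp add: algebra_simps)
      then show ?thesis using that by (metis nonzero_mult_div_cancel_left norm_eq_zero norm_scaleR real_norm_def)
    qed
    then show "\<forall>\<^sub>F h in at 0. norm (f (x + h) - f x - h *\<^sub>R v) / norm h = norm ((1/h) *\<^sub>R (f (x + h) - f x) - v)"
      by (auto simp: eventually_at_filter)
  qed
  also have "\<dots> \<longleftrightarrow> ((\<lambda>h. (1/h) *\<^sub>R (f (x + h) - f x)) \<longlongrightarrow> v) (at 0)"
    by (simp add: tendsto_norm_zero_iff LIM_zero_iff)
  finally show ?thesis .
qed

section \<open>Gronwall estimates\<close>

lemma closed_segment_0_abs_le: "r \<in> closed_segment 0 t \<Longrightarrow> \<bar>r\<bar> \<le> \<bar>t::real\<bar>"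
  by (auto simp: closed_segment_eq_real_ivl split: if_splits)

lemma closed_segment_0_subset: "\<bar>t::real\<bar> \<le> T \<Longrightarrow> closed_segment 0 t \<subseteq> {-T..T}"
  by (auto simp: closed_segment_eq_real_ivl split: if_splits)

lemma closed_segment_0_mono: "r \<in> closed_segment 0 (t::real) \<Longrightarrow> closed_segment 0 r \<subseteq> closed_segment 0 t"
  by (simp add: subset_closed_segment)

text \<open>At the point of maximal norm the mean value inequality reproduces at most half of that
  maximum, because \<open>L * \<bar>t\<bar> \<le> 1/2\<close>, and this half is absorbed. The
  factors 2 in the bounds for flows and Jacobians come from here.\<close>

lemma gronwall_short:
  fixes w :: "real \<Rightarrow> 'a::real_normed_vector"
  assumes der: "\<And>r. r \<in> closed_segment 0 t \<Longrightarrow> (w has_vector_derivative w' r) (at r within closed_segment 0 t)"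
    and bnd: "\<And>r. r \<in> closed_segment 0 t \<Longrightarrow> norm (w' r) \<le> L * norm (w r) + e"
    and L: "0 \<le> L" "L * \<bar>t\<bar> \<le> 1/2" and e: "0 \<le> e"
  shows "norm (w t) \<le> 2 * norm (w 0) + 2 * \<bar>t\<bar> * e"
proof -
  have cont: "continuous_on (closed_segment 0 t) (\<lambda>r. norm (w r))"
    using der by (intro continuous_on_norm) (auto simp: continuous_on_eq_continuous_within intro: has_vector_derivative_continuous)
  obtain q where q: "q \<in> closed_segment 0 t" and mx: "\<And>r. r \<in> closed_segment 0 t \<Longrightarrow> norm (w r) \<le> norm (w q)"
    using continuous_attains_sup[OF compact_segment _ cont] by auto
  let ?N = "norm (w q)"
  have "norm (w q - w 0) \<le> (L * ?N + e) * \<bar>q\<bar>"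
  proof (rule vector_mvt_bound)
    fix r assume "r \<in> closed_segment 0 q"
    then have r: "r \<in> closed_segment 0 t" using closed_segment_0_mono[OF q] by blast
    show "(w has_vector_derivative w' r) (at r within closed_segment 0 q)"
      by (rule has_vector_derivative_within_subset[OF der[OF r] closed_segment_0_mono[OF q]])
    show "norm (w' r) \<le> L * ?N + e"
      using bnd[OF r] mult_left_mono[OF mx[OF r] L(1)] by linarith
  qed
  also have "\<dots> \<le> (L * ?N + e) * \<bar>t\<bar>"
    using closed_segment_0_abs_le[OF q] L e by (intro mult_left_mono) auto
  also have "\<dots> = (L * \<bar>t\<bar>) * ?N + e * \<bar>t\<bar>" by (simp add: algebra_simps)
  also have "\<dots> \<le> 1/2 * ?N + e * \<bar>t\<bar>" using mult_right_mono[OF L(2), of ?N] by simp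
  finally have "norm (w q - w 0) \<le> 1/2 * ?N + e * \<bar>t\<bar>" .
  moreover have "?N \<le> norm (w 0) + norm (w q - w 0)" by (metis add_diff_cancel_left' add_diff_eq diff_add_cancel norm_triangle_ineq)
  ultimately have "?N \<le> 2 * norm (w 0) + 2 * \<bar>t\<bar> * e" by (simp add: algebra_simps)
  then show ?thesis using mx[of t] by simp
qed

text \<open>The squared norm times \<open>exp (- 2 * L * r)\<close> is nonincreasing for every size
  of \<open>L * t\<close>. Uniqueness of integral curves needs this form, since there the Lipschitz
  constant depends on the competing curve and cannot be balanced against the time.\<close>

lemma gronwall_zero_pos:
  fixes w :: "real \<Rightarrow> 'a::real_inner"
  assumes t: "0 \<le> t"
    and der: "\<And>r. r \<in> {0..t} \<Longrightarrow> (w has_vector_derivative w' r) (at r within {0..t})"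
    and bnd: "\<And>r. r \<in> {0..t} \<Longrightarrow> norm (w' r) \<le> L * norm (w r)"
    and w0: "w 0 = 0"
  shows "w t = 0"
proof (cases "t = 0")
  case False
  with t have t: "0 < t" by simp
  define q where "q r = (w r \<bullet> w r) * exp (- 2 * L * r)" for r
  have cont: "continuous_on {0..t} w"
    unfolding continuous_on_eq_continuous_within using der has_vector_derivative_continuous by blast
  have "q t \<le> q 0"
  proof (rule DERIV_nonpos_imp_decreasing_open[where f = q and a = 0 and b = t])
    fix r assume r: "0 < r" "r < t"
    have "(w has_vector_derivative w' r) (at r)"
      using der[of r] r by (metis at_within_Icc_at atLeastAtMost_iff less_imp_le)
    then have wd: "(w has_derivative (\<lambda>h. h *\<^sub>R w' r)) (at r)" by (simp add: has_vector_derivative_def)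
    have "(q has_derivative (\<lambda>h. (w r \<bullet> w r) * (exp (- 2 * L * r) * (- 2 * L * h)) + (w r \<bullet> (h *\<^sub>R w' r) + (h *\<^sub>R w' r) \<bullet> w r) * exp (- 2 * L * r))) (at r)"
      unfolding q_def by (rule has_derivative_mult[OF has_derivative_inner[OF wd wd]]) (auto intro!: derivative_eq_intros)
    moreover have "(\<lambda>h. (w r \<bullet> w r) * (exp (- 2 * L * r) * (- 2 * L * h)) + (w r \<bullet> (h *\<^sub>R w' r) + (h *\<^sub>R w' r) \<bullet> w r) * exp (- 2 * L * r))
      = (*) (2 * exp (- 2 * L * r) * (w r \<bullet> w' r - L * (w r \<bullet> w r)))"
      by (auto simp: fun_eq_iff inner_commute algebra_simps)
    ultimately have "DERIV q r :> 2 * exp (- 2 * L * r) * (w r \<bullet> w' r - L * (w r \<bullet> w r))"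
      by (simp add: has_field_derivative_def)
    moreover have "w r \<bullet> w' r \<le> L * (w r \<bullet> w r)"
    proof -
      have "w r \<bullet> w' r \<le> norm (w r) * norm (w' r)" by (rule norm_cauchy_schwarz)
      also have "\<dots> \<le> norm (w r) * (L * norm (w r))" using bnd[of r] r by (intro mult_left_mono) auto
      also have "\<dots> = L * (w r \<bullet> w r)" by (simp add: dot_square_norm power2_eq_square)
      finally show ?thesis .
    qed
    ultimately show "\<exists>y. DERIV q r :> y \<and> y \<le> 0"
      by (intro exI conjI) (auto simp: mult_nonneg_nonpos)
  qed (use t cont in \<open>auto simp: q_def intro!: continuous_intros\<close>)
  then have "w t \<bullet> w t \<le> 0" by (simp add: q_def w0 mult_le_0_iff)
  then show ?thesis by (metis inner_gt_zero_iff not_le)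
qed (use w0 in simp)

text \<open>Negative times follow by time reversal.\<close>

lemma gronwall_zero:
  fixes w :: "real \<Rightarrow> 'a::real_inner"
  assumes der: "\<And>r. r \<in> closed_segment 0 t \<Longrightarrow> (w has_vector_derivative w' r) (at r within closed_segment 0 t)"
    and bnd: "\<And>r. r \<in> closed_segment 0 t \<Longrightarrow> norm (w' r) \<le> L * norm (w r)"
    and w0: "w 0 = 0"
  shows "w t = 0"
proof (cases "0 \<le> t")
  case True
  then show ?thesis using gronwall_zero_pos[of t w w' L] assms by (simp add: closed_segment_eq_real_ivl)
next
  case False
  have "(\<lambda>r. w (- r)) (- t) = 0"
  proof (rule gronwall_zero_pos[where w = "\<lambda>r. w (- r)" and w' = "\<lambda>r. - w' (- r)" and L = L])
    fix r assume r: "r \<in> {0..- t}"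
    then have mr: "- r \<in> closed_segment 0 t" using False by (auto simp: closed_segment_eq_real_ivl)
    have 1: "((\<lambda>r. - r) has_vector_derivative -1) (at r within {0..- t})" by (auto intro!: derivative_eq_intros)
    have 2: "(w has_vector_derivative w' (- r)) (at (- r) within (\<lambda>r. - r) ` {0..- t})"
      using der[OF mr] False by (simp add: closed_segment_eq_real_ivl)
    show "((\<lambda>r. w (- r)) has_vector_derivative - w' (- r)) (at r within {0..- t})"
      using vector_diff_chain_within[OF 1 2] by (simp add: o_def)
    show "norm (- w' (- r)) \<le> L * norm (w (- r))" using bnd[OF mr] by simp
  qed (use False w0 in auto)
  then show ?thesis by simp
qed

section \<open>Existence of solutions on a short time interval\<close>

definition clamp :: "real \<Rightarrow> real \<Rightarrow> real" where "clamp T t = max (-T) (min T t)"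

lemma clamp_mem: "0 < T \<Longrightarrow> clamp T t \<in> {-T..T}" by (auto simp: clamp_def)
lemma clamp_id: "t \<in> {-T..T} \<Longrightarrow> clamp T t = t" by (auto simp: clamp_def)
lemma clamp_lip: "\<bar>clamp T t - clamp T t'\<bar> \<le> \<bar>t - t'\<bar>" by (auto simp: clamp_def)
lemma continuous_on_clamp: "continuous_on S (clamp T)" unfolding clamp_def by (intro continuous_intros)

text \<open>Solutions live on \<open>[-T, T]\<close> and are extended by constants, so that flows are total in time.\<close>

definition is_sol :: "real \<Rightarrow> (real \<Rightarrow> 'a \<Rightarrow> 'a) \<Rightarrow> 'a \<Rightarrow> (real \<Rightarrow> 'a::real_normed_vector) \<Rightarrow> bool" where
  "is_sol T F x y \<longleftrightarrow> y 0 = x \<and> (\<forall>t. y t = y (clamp T t)) \<and>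
     (\<forall>t\<in>{-T..T}. (y has_vector_derivative F t (y t)) (at t within {-T..T}))"

text \<open>The integral operator contracts by \<open>L * T \<le> 1/2\<close> on the bounded
  continuous functions of the whole line; clamping the time is what makes every iterate
  bounded.\<close>

lemma picard:
  fixes F :: "real \<Rightarrow> 'a::banach \<Rightarrow> 'a"
  assumes T: "0 < T" "0 \<le> L" "L * T \<le> 1/2"
    and cont: "continuous_on ({-T..T} \<times> UNIV) (\<lambda>(t, y). F t y)"
    and lip: "\<And>t y z. t \<in> {-T..T} \<Longrightarrow> norm (F t y - F t z) \<le> L * norm (y - z)"
  shows "\<exists>y. is_sol T F x y"
proof -
  \<comment> \<open>Integrating from \<open>-T\<close> and subtracting the value at 0 afterwards
    treats positive and negative times by a single formula.\<close>
  define G where "G y t = integral {-T..t} (\<lambda>s. F s (y s))" for y t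
  define P where "P y t = x + (G y (clamp T t) - G y 0)" for y t
  have contF: "continuous_on {-T..T} (\<lambda>s. F s (y s))" if "continuous_on UNIV y" for y
  proof -
    have "continuous_on {-T..T} (\<lambda>s. (s, y s))"
      by (intro continuous_intros continuous_on_subset[OF that]) auto
    then show ?thesis using continuous_on_compose2[OF cont, of "{-T..T}" "\<lambda>s. (s, y s)"] by auto
  qed
  have derG: "(G y has_vector_derivative F t (y t)) (at t within {-T..T})"
    if "continuous_on UNIV y" "t \<in> {-T..T}" for y t
    unfolding G_def by (rule integral_has_vector_derivative[OF contF]) (use that in auto)
  have contG: "continuous_on {-T..T} (G y)" if "continuous_on UNIV y" for y
    unfolding continuous_on_eq_continuous_within using derG[OF that] has_vector_derivative_continuous by blast
  have contP: "continuous_on UNIV (P y)" if "continuous_on UNIV y" for y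
    unfolding P_def
    by (intro continuous_intros continuous_on_compose2[OF contG[OF that] continuous_on_clamp]) (use clamp_mem[OF T(1)] in auto)
  have bP: "bounded (range (P y))" if "continuous_on UNIV y" for y
  proof -
    have "compact (P y ` {-T..T})"
      by (intro compact_continuous_image continuous_on_subset[OF contP[OF that]]) auto
    moreover have "P y t = P y (clamp T t)" for t unfolding P_def using clamp_id[OF clamp_mem[OF T(1)], of t] by simp
    then have "range (P y) \<subseteq> P y ` {-T..T}" using clamp_mem[OF T(1)] by blast
    ultimately show ?thesis using compact_imp_bounded bounded_subset by blast
  qed
  define Q where "Q y = Bcontfun (P (apply_bcontfun y))" for y :: "real \<Rightarrow>\<^sub>C 'a"
  have cb: "continuous_on UNIV (apply_bcontfun y)" for y :: "real \<Rightarrow>\<^sub>C 'a"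
    using apply_bcontfun[of y] by (auto simp: bcontfun_def)
  have Q: "apply_bcontfun (Q y) = P (apply_bcontfun y)" for y
    unfolding Q_def using contP[OF cb] bP[OF cb] by (intro Bcontfun_inverse) (auto simp: bcontfun_def)
  have "\<exists>!y. Q y = y"
  proof (rule banach_fix_type)
    show "\<forall>y z. dist (Q y) (Q z) \<le> 1/2 * dist y z"
    proof (intro allI)
      fix y z
      show "dist (Q y) (Q z) \<le> 1/2 * dist y z"
      proof (rule dist_bound)
        fix t
        let ?y = "apply_bcontfun y" and ?z = "apply_bcontfun z" and ?c = "clamp T t"
        have c: "\<bar>?c\<bar> \<le> T" using clamp_mem[OF T(1), of t] by auto
        have "norm ((G ?y ?c - G ?z ?c) - (G ?y 0 - G ?z 0)) \<le> (L * dist y z) * \<bar>?c\<bar>"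
        proof (rule vector_mvt_bound[where F = "\<lambda>t. G ?y t - G ?z t" and F' = "\<lambda>t. F t (?y t) - F t (?z t)"])
          fix r assume "r \<in> closed_segment 0 ?c"
          then have r: "r \<in> {-T..T}" using closed_segment_0_subset[OF c] by blast
          show "((\<lambda>t. G ?y t - G ?z t) has_vector_derivative F r (?y r) - F r (?z r)) (at r within closed_segment 0 ?c)"
            by (rule has_vector_derivative_within_subset[OF _ closed_segment_0_subset[OF c]])
              (intro has_vector_derivative_diff derG cb r)
          have "norm (F r (?y r) - F r (?z r)) \<le> L * norm (?y r - ?z r)" by (rule lip[OF r])
          also have "\<dots> \<le> L * dist y z" using dist_bounded[of y r z] T by (intro mult_left_mono) (auto simp: dist_norm)
          finally show "norm (F r (?y r) - F r (?z r)) \<le> L * dist y z" .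
        qed
        also have "\<dots> \<le> (L * dist y z) * T" using c T by (intro mult_left_mono) auto
        also have "\<dots> = (L * T) * dist y z" by simp
        also have "\<dots> \<le> 1/2 * dist y z" using T by (intro mult_right_mono) auto
        finally show "dist (apply_bcontfun (Q y) t) (apply_bcontfun (Q z) t) \<le> 1/2 * dist y z"
          by (simp add: Q P_def dist_norm algebra_simps)
      qed
    qed
  qed auto
  then obtain y where y: "Q y = y" by blast
  let ?y = "apply_bcontfun y"
  have yP: "?y = P ?y" using Q[of y] y by simp
  have "is_sol T F x ?y"
    unfolding is_sol_def
  proof (intro conjI allI ballI)
    have "P ?y 0 = x" using T clamp_id[of 0 T] by (simp add: P_def)
    then show "?y 0 = x" using yP by metis
    fix t
    have "P ?y t = P ?y (clamp T t)" unfolding P_def using clamp_id[OF clamp_mem[OF T(1)], of t] by simp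
    then show "?y t = ?y (clamp T t)" using yP by metis
  next
    fix t assume t: "t \<in> {-T..T}"
    have "((\<lambda>t. x + (G ?y t - G ?y 0)) has_vector_derivative F t (?y t)) (at t within {-T..T})"
      using derG[OF cb t] by (auto intro!: derivative_eq_intros)
    then have "(P ?y has_vector_derivative F t (?y t)) (at t within {-T..T})"
      by (rule has_vector_derivative_transform[OF t, rotated]) (auto simp: P_def clamp_id)
    then show "(?y has_vector_derivative F t (?y t)) (at t within {-T..T})"
      using yP by simp
  qed
  then show ?thesis by blast
qed

section \<open>Flow and variational equation\<close>

definition ode_sol :: "real \<Rightarrow> (real \<Rightarrow> 'a \<Rightarrow> 'a) \<Rightarrow> 'a \<Rightarrow> real \<Rightarrow> 'a::real_normed_vector" where
  "ode_sol T F x = (SOME y. is_sol T F x y)"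

lemma is_sol_seg:
  assumes "is_sol T F x y" "\<bar>t\<bar> \<le> T" "r \<in> closed_segment 0 t"
  shows "(y has_vector_derivative F r (y r)) (at r within closed_segment 0 t)"
  using assms closed_segment_0_subset[OF assms(2)] unfolding is_sol_def
  by (blast intro: has_vector_derivative_within_subset)

definition fl :: "real \<Rightarrow> (real^'n \<Rightarrow> real^'n) \<Rightarrow> real \<Rightarrow> real^'n \<Rightarrow> real^'n" where
  "fl T Z t x = ode_sol T (\<lambda>_. Z) x t"

definition dir :: "(real^'n \<Rightarrow> 'b::real_normed_vector) \<Rightarrow> real^'n \<Rightarrow> real^'n \<Rightarrow> 'b" where
  "dir g x h = (\<Sum>k\<in>UNIV. h $ k *\<^sub>R pd k g x)"

text \<open>Introduced through the variational equation along the orbit, so that its existence and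
  bounds precede the differentiability of the flow; \<open>fl_has_derivative\<close> later
  identifies it as the derivative in the initial point.\<close>

definition jac :: "real \<Rightarrow> (real^'n \<Rightarrow> real^'n) \<Rightarrow> real \<Rightarrow> real^'n \<Rightarrow> real^'n \<Rightarrow> real^'n" where
  "jac T Z t x v = ode_sol T (\<lambda>t u. dir Z (fl T Z t x) u) v t"

lemma bounded_linear_dir: "bounded_linear (dir g x)"
  unfolding dir_def by (intro bounded_linear_sum bounded_linear_scaleR_const bounded_linear_vec_nth)

lemma Ck_has_derivative_dir: "Ck (Suc r) g \<Longrightarrow> (g has_derivative dir g x) (at x)"
  using Ck_has_derivative[of r g x] by (simp add: dir_def[abs_def])

text \<open>Comparison is only with the base point and only at distance below \<open>e\<close>. In
  this form the Lipschitz estimate for a mollification remainder, available at distances up to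
  \<sigma>, still bounds its derivative.\<close>

lemma lipschitz_imp_derivative_bound:
  fixes g :: "'a::real_normed_vector \<Rightarrow> 'b::real_normed_vector"
  assumes d: "(g has_derivative D) (at x)" and e: "e > 0"
    and lip: "\<And>y. norm (y - x) < e \<Longrightarrow> norm (g y - g x) \<le> L * norm (y - x)"
  shows "norm (D v) \<le> L * norm v"
proof -
  have lim: "((\<lambda>h. (1/h) *\<^sub>R (g (x + h *\<^sub>R v) - g x)) \<longlongrightarrow> D v) (at 0)"
    using has_vector_derivative_along[OF d, of v] unfolding has_vector_derivative_iff_quotient by simp
  have ev: "\<forall>\<^sub>F h in at 0. norm ((1/h) *\<^sub>R (g (x + h *\<^sub>R v) - g x)) \<le> L * norm v"
    unfolding eventually_at
  proof (intro exI[of _ "e / (norm v + 1)"] conjI ballI impI)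
    show "e / (norm v + 1) > 0" using e by (simp add: add_nonneg_pos)
    fix h :: real assume h: "h \<noteq> 0 \<and> dist h 0 < e / (norm v + 1)"
    then have "\<bar>h\<bar> * (norm v + 1) < e" by (simp add: pos_less_divide_eq add_nonneg_pos)
    moreover have "\<bar>h\<bar> * norm v \<le> \<bar>h\<bar> * (norm v + 1)" by (intro mult_left_mono) auto
    ultimately have "norm ((x + h *\<^sub>R v) - x) < e" by simp
    from lip[OF this] have "norm (g (x + h *\<^sub>R v) - g x) \<le> \<bar>h\<bar> * (L * norm v)" by (simp add: ac_simps)
    then show "norm ((1/h) *\<^sub>R (g (x + h *\<^sub>R v) - g x)) \<le> L * norm v"
      using h by (simp add: divide_le_eq ac_simps)
  qed
  show ?thesis by (rule tendsto_upperbound[OF tendsto_norm[OF lim] ev]) simp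
qed

text \<open>The bounds are global because the fields will be cut off outside a large ball. The
  smallness of \<open>L * T\<close> serves twice: as the contraction factor in \<open>picard\<close>
  and for the absorption in \<open>gronwall_short\<close>.\<close>

locale smooth_field =
  fixes Z :: "real^'n \<Rightarrow> real^'n" and L M M2 T :: real
  assumes C1: "Ck (Suc 0) Z"
    and lip: "norm (Z x - Z y) \<le> L * norm (x - y)"
    and bnd: "norm (Z x) \<le> M"
    and dlip: "norm (dir Z x u - dir Z y u) \<le> M2 * norm (x - y) * norm u"
    and L0: "0 \<le> L" and M20: "0 \<le> M2" and T0: "0 < T" and LT: "L * T \<le> 1/2"
begin

abbreviation "\<Phi> \<equiv> fl T Z"
abbreviation "J \<equiv> jac T Z"

lemma LT': "\<bar>t\<bar> \<le> T \<Longrightarrow> L * \<bar>t\<bar> \<le> 1/2"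
  using mult_left_mono[of "\<bar>t\<bar>" T L] L0 LT by linarith

lemma Z_deriv: "(Z has_derivative dir Z x) (at x)"
  by (rule Ck_has_derivative_dir[OF C1])

lemma dir_bound: "norm (dir Z x u) \<le> L * norm u"
  by (rule lipschitz_imp_derivative_bound[OF Z_deriv, of 1]) (auto intro: lip)

lemma Z_cont: "continuous_on S Z"
  using Ck_cont[OF C1] continuous_on_subset by blast

lemma fl_sol: "is_sol T (\<lambda>_. Z) x (\<lambda>t. \<Phi> t x)"
proof -
  have "\<exists>y. is_sol T (\<lambda>_. Z) x y"
  proof (rule picard[OF T0 L0 LT])
    show "continuous_on ({- T..T} \<times> UNIV) (\<lambda>(t, y). Z y)"
      using continuous_on_compose2[OF Z_cont[of UNIV] continuous_on_snd[OF continuous_on_id]] by (simp add: split_beta)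
  qed (rule lip)
  then have "is_sol T (\<lambda>_. Z) x (ode_sol T (\<lambda>_. Z) x)" unfolding ode_sol_def by (rule someI_ex)
  then show ?thesis by (simp add: fl_def)
qed

lemma fl_0 [simp]: "\<Phi> 0 x = x" and fl_clamp: "\<Phi> t x = \<Phi> (clamp T t) x"
  using fl_sol[of x] unfolding is_sol_def by auto

lemma fl_deriv_within: "t \<in> {-T..T} \<Longrightarrow> ((\<lambda>t. \<Phi> t x) has_vector_derivative Z (\<Phi> t x)) (at t within {-T..T})"
  using fl_sol[of x] unfolding is_sol_def by auto

lemma fl_deriv: "\<bar>t\<bar> < T \<Longrightarrow> ((\<lambda>t. \<Phi> t x) has_vector_derivative Z (\<Phi> t x)) (at t)"
  using fl_deriv_within[of t x] at_within_interior[of t "{-T..T}"] by (simp add: abs_less_iff)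

lemmas fl_deriv_seg = is_sol_seg[OF fl_sol]

lemma fl_unique:
  assumes t: "\<bar>t\<bar> \<le> T" and "\<gamma> 0 = x"
    and g: "\<And>r. r \<in> closed_segment 0 t \<Longrightarrow> (\<gamma> has_vector_derivative Z (\<gamma> r)) (at r within closed_segment 0 t)"
  shows "\<gamma> t = \<Phi> t x"
proof -
  have "norm (\<gamma> t - \<Phi> t x) \<le> 2 * norm (\<gamma> 0 - \<Phi> 0 x) + 2 * \<bar>t\<bar> * 0"
    by (rule gronwall_short[where w' = "\<lambda>r. Z (\<gamma> r) - Z (\<Phi> r x)" and L = L])
      (use lip L0 LT'[OF t] in \<open>auto intro!: has_vector_derivative_diff g fl_deriv_seg[OF t]\<close>)
  then show ?thesis using assms(2) by simp
qed

lemma fl_lip: "norm (\<Phi> t x - \<Phi> t y) \<le> 2 * norm (x - y)"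
proof -
  let ?t = "clamp T t"
  have t: "\<bar>?t\<bar> \<le> T" using clamp_mem[OF T0, of t] by auto
  have "norm (\<Phi> ?t x - \<Phi> ?t y) \<le> 2 * norm (\<Phi> 0 x - \<Phi> 0 y) + 2 * \<bar>?t\<bar> * 0"
    by (rule gronwall_short[where w' = "\<lambda>r. Z (\<Phi> r x) - Z (\<Phi> r y)" and L = L])
      (use lip L0 LT'[OF t] in \<open>auto intro!: has_vector_derivative_diff fl_deriv_seg[OF t]\<close>)
  then show ?thesis using fl_clamp[of t] by simp
qed

lemma within_T_lip:
  fixes y :: "real \<Rightarrow> 'a::real_normed_vector"
  assumes der: "\<And>t. t \<in> {-T..T} \<Longrightarrow> (y has_vector_derivative y' t) (at t within {-T..T})"
    and b: "\<And>t. t \<in> {-T..T} \<Longrightarrow> norm (y' t) \<le> B" and c: "\<And>t. y t = y (clamp T t)"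
  shows "norm (y t - y t') \<le> B * \<bar>t - t'\<bar>"
proof -
  have "0 \<le> B" by (rule order_trans[OF norm_ge_zero b[of 0]]) (use T0 in auto)
  have "norm (y (clamp T t) - y (clamp T t')) \<le> B * norm (clamp T t - clamp T t')"
  proof (rule differentiable_bound[where f' = "\<lambda>t h. h *\<^sub>R y' t"])
    fix r assume r: "r \<in> {-T..T}"
    show "(y has_derivative (\<lambda>h. h *\<^sub>R y' r)) (at r within {-T..T})"
      using der[OF r] by (simp add: has_vector_derivative_def)
    show "onorm (\<lambda>h. h *\<^sub>R y' r) \<le> B"
      using b[OF r] by (intro onorm_le) (simp add: mult.commute[of B] mult_left_mono)
  qed (use clamp_mem[OF T0] in auto)
  also have "\<dots> \<le> B * \<bar>t - t'\<bar>" using clamp_lip[of T t t'] \<open>0 \<le> B\<close> by (intro mult_left_mono) auto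
  finally show ?thesis by (simp only: c[of t, symmetric] c[of t', symmetric])
qed

lemma fl_lip_time: "norm (\<Phi> t x - \<Phi> t' x) \<le> M * \<bar>t - t'\<bar>"
  by (rule within_T_lip[OF fl_deriv_within bnd fl_clamp])

lemma fl_lip_joint: "norm (\<Phi> t x - \<Phi> t' x') \<le> 2 * norm (x - x') + M * \<bar>t - t'\<bar>"
  using norm_triangle_mono[OF fl_lip[of t x x'] fl_lip_time[of t x' t']] by simp

lemma fl_displacement: "norm (\<Phi> t x - x) \<le> M * \<bar>t\<bar>"
  using fl_lip_time[of t x 0] by simp

lemma fl_inverse:
  assumes t: "\<bar>t\<bar> \<le> T" shows "\<Phi> (- t) (\<Phi> t x) = x"
proof -
  have "(\<lambda>r. \<Phi> (t + r) x) (- t) = \<Phi> (- t) (\<Phi> t x)"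
  proof (rule fl_unique)
    fix r assume r: "r \<in> closed_segment 0 (- t)"
    have sub: "(\<lambda>r. t + r) ` closed_segment 0 (- t) \<subseteq> {-T..T}"
      using t by (auto simp: closed_segment_eq_real_ivl split: if_splits)
    have 1: "((\<lambda>r. t + r) has_vector_derivative 1) (at r within closed_segment 0 (- t))"
      by (auto intro!: derivative_eq_intros)
    have 2: "((\<lambda>t. \<Phi> t x) has_vector_derivative Z (\<Phi> (t + r) x)) (at (t + r) within (\<lambda>r. t + r) ` closed_segment 0 (- t))"
      by (rule has_vector_derivative_within_subset[OF fl_deriv_within sub]) (use r sub in auto)
    show "((\<lambda>r. \<Phi> (t + r) x) has_vector_derivative Z (\<Phi> (t + r) x)) (at r within closed_segment 0 (- t))"
      using vector_diff_chain_within[OF 1 2] by (simp add: o_def)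
  qed (use t in auto)
  then show ?thesis by simp
qed

lemma dir_cont: "continuous_on UNIV (\<lambda>(x, u). dir Z x u)"
proof -
  have "continuous_on UNIV (\<lambda>p. pd k Z (fst p))" for k
    by (rule continuous_on_compose2[OF Ck_cont[OF Ck_pd[OF C1]]]) (auto intro: continuous_intros)
  then show ?thesis unfolding dir_def split_beta by (intro continuous_intros) auto
qed

lemma fl_cont: "continuous_on UNIV (\<lambda>(t, x). \<Phi> t x)"
proof (rule lipschitz_on_continuous_on)
  have M0: "0 \<le> M" using bnd[of 0] norm_ge_zero order_trans by blast
  show "(2 + M)-lipschitz_on UNIV (\<lambda>(t, x). \<Phi> t x)"
  proof (rule lipschitz_onI)
    fix p q :: "real \<times> (real^'n)"
    have a: "norm (snd p - snd q) \<le> norm (p - q)" by (metis norm_snd_le prod.collapse snd_diff)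
    have b: "\<bar>fst p - fst q\<bar> \<le> norm (p - q)" by (metis norm_fst_le prod.collapse fst_diff real_norm_def)
    show "dist (case p of (t, x) \<Rightarrow> \<Phi> t x) (case q of (t, x) \<Rightarrow> \<Phi> t x) \<le> (2 + M) * dist p q"
      using fl_lip_joint[of "fst p" "snd p" "fst q" "snd q"] a mult_left_mono[OF b M0]
      by (simp add: split_beta dist_norm algebra_simps)
  qed (use M0 in auto)
qed

lemma jac_sol: "is_sol T (\<lambda>t u. dir Z (\<Phi> t x) u) v (\<lambda>t. J t x v)"
proof -
  have "\<exists>y. is_sol T (\<lambda>t u. dir Z (\<Phi> t x) u) v y"
  proof (rule picard[OF T0 L0 LT])
    have "continuous_on ({- T..T} \<times> UNIV) (\<lambda>p. (\<Phi> (fst p) x, snd p))"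
      using continuous_on_compose2[OF fl_cont, of "{- T..T} \<times> UNIV" "\<lambda>p. (fst p, x)"]
      by (intro continuous_on_Pair continuous_on_snd continuous_on_id)
        (simp add: continuous_on_Pair continuous_on_fst continuous_on_const continuous_on_id)
    from continuous_on_compose2[OF dir_cont this]
    show "continuous_on ({- T..T} \<times> UNIV) (\<lambda>(t, u). dir Z (\<Phi> t x) u)"
      by (simp add: split_beta)
    fix t y z
    show "norm (dir Z (\<Phi> t x) y - dir Z (\<Phi> t x) z) \<le> L * norm (y - z)"
      using dir_bound[of "\<Phi> t x" "y - z"] linear_diff[OF bounded_linear.linear[OF bounded_linear_dir], of Z "\<Phi> t x" y z] by simp
  qed
  then have "is_sol T (\<lambda>t u. dir Z (\<Phi> t x) u) v (ode_sol T (\<lambda>t u. dir Z (\<Phi> t x) u) v)"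
    unfolding ode_sol_def by (rule someI_ex)
  then show ?thesis by (simp add: jac_def)
qed

lemma jac_0 [simp]: "J 0 x v = v" and jac_clamp: "J t x v = J (clamp T t) x v"
  using jac_sol[of x v] unfolding is_sol_def by auto

lemma jac_deriv_within: "t \<in> {-T..T} \<Longrightarrow> ((\<lambda>t. J t x v) has_vector_derivative dir Z (\<Phi> t x) (J t x v)) (at t within {-T..T})"
  using jac_sol[of x v] unfolding is_sol_def by auto

lemma jac_deriv: "\<bar>t\<bar> < T \<Longrightarrow> ((\<lambda>t. J t x v) has_vector_derivative dir Z (\<Phi> t x) (J t x v)) (at t)"
  using jac_deriv_within[of t x v] at_within_interior[of t "{-T..T}"] by (simp add: abs_less_iff)

lemmas jac_deriv_seg = is_sol_seg[OF jac_sol]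

lemma dir_diff: "dir Z x (u - v) = dir Z x u - dir Z x v"
  by (rule linear_diff[OF bounded_linear.linear[OF bounded_linear_dir]])

lemma jac_bound: "norm (J t x v) \<le> 2 * norm v"
proof -
  let ?t = "clamp T t"
  have t: "\<bar>?t\<bar> \<le> T" using clamp_mem[OF T0, of t] by auto
  have "norm (J ?t x v) \<le> 2 * norm (J 0 x v) + 2 * \<bar>?t\<bar> * 0"
    by (rule gronwall_short[OF jac_deriv_seg[OF t], where L = L])
      (use dir_bound L0 LT'[OF t] in auto)
  then show ?thesis using jac_clamp[of t] by simp
qed

text \<open>The second-order constant \<open>M2\<close> enters only qualitative facts, differentiability of the flow and continuity of its
  Jacobian. It may therefore blow up as the mollification parameter tends to 0.\<close>

lemma fl_quadratic: "norm (\<Phi> t (x + v) - \<Phi> t x - J t x v) \<le> 8 * T * M2 * (norm v)\<^sup>2"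
proof -
  \<comment> \<open>\<open>?e\<close> is \<open>M2\<close> times the square of
    \<open>2 * norm v\<close>, the bound of \<open>fl_lip\<close> for the distance between the two
    orbits.\<close>
  let ?t = "clamp T t" and ?e = "4 * M2 * (norm v)\<^sup>2"
  have t: "\<bar>?t\<bar> \<le> T" using clamp_mem[OF T0, of t] by auto
  have taylor: "norm (Z a - Z b - dir Z b (a - b)) \<le> M2 * (norm (a - b))\<^sup>2" for a b
  proof -
    let ?F = "\<lambda>t. Z (b + t *\<^sub>R (a - b))"
    have "norm (?F 1 - ?F 0 - 1 *\<^sub>R dir Z b (a - b)) \<le> (M2 * (norm (a - b))\<^sup>2) * \<bar>1\<bar>"
    proof (rule vector_mvt_linearization)
      fix r assume r: "r \<in> closed_segment 0 (1::real)"
      have 1: "((\<lambda>t. b + t *\<^sub>R (a - b)) has_derivative (\<lambda>h. h *\<^sub>R (a - b))) (at r within closed_segment 0 1)"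
        by (auto intro!: derivative_eq_intros)
      have "(?F has_derivative (\<lambda>h. dir Z (b + r *\<^sub>R (a - b)) (h *\<^sub>R (a - b)))) (at r within closed_segment 0 1)"
        by (rule has_derivative_compose[OF 1 Z_deriv])
      then show "(?F has_vector_derivative dir Z (b + r *\<^sub>R (a - b)) (a - b)) (at r within closed_segment 0 1)"
        by (simp add: has_vector_derivative_def linear_cmul[OF bounded_linear.linear[OF bounded_linear_dir]])
      have "norm (dir Z (b + r *\<^sub>R (a - b)) (a - b) - dir Z b (a - b)) \<le> M2 * norm (r *\<^sub>R (a - b)) * norm (a - b)"
        using dlip[of "b + r *\<^sub>R (a - b)" "a - b" b] by simp
      also have "\<dots> = M2 * \<bar>r\<bar> * (norm (a - b))\<^sup>2" by (simp add: power2_eq_square)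
      also have "\<dots> \<le> M2 * 1 * (norm (a - b))\<^sup>2"
        using r M20 by (intro mult_right_mono mult_left_mono) (auto simp: closed_segment_eq_real_ivl)
      finally show "norm (dir Z (b + r *\<^sub>R (a - b)) (a - b) - dir Z b (a - b)) \<le> M2 * (norm (a - b))\<^sup>2" by simp
    qed
    then show ?thesis by simp
  qed
  have "norm (\<Phi> ?t (x + v) - \<Phi> ?t x - J ?t x v) \<le> 2 * norm (\<Phi> 0 (x + v) - \<Phi> 0 x - J 0 x v) + 2 * \<bar>?t\<bar> * ?e"
  proof (rule gronwall_short[where w' = "\<lambda>r. Z (\<Phi> r (x + v)) - Z (\<Phi> r x) - dir Z (\<Phi> r x) (J r x v)" and L = L])
    fix r assume r: "r \<in> closed_segment 0 ?t"
    let ?a = "\<Phi> r (x + v)" and ?b = "\<Phi> r x" and ?u = "J r x v"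
    show "((\<lambda>r. \<Phi> r (x + v) - \<Phi> r x - J r x v) has_vector_derivative (Z ?a - Z ?b - dir Z ?b ?u)) (at r within closed_segment 0 ?t)"
      by (intro has_vector_derivative_diff fl_deriv_seg[OF t r] jac_deriv_seg[OF t r])
    \<comment> \<open>The defect splits into the linearized field applied to the error itself, which
      Gronwall absorbs, and the Taylor remainder, which is quadratic in the distance of the
      orbits.\<close>
    have "norm (Z ?a - Z ?b - dir Z ?b ?u) \<le> norm (dir Z ?b (?a - ?b - ?u)) + norm (Z ?a - Z ?b - dir Z ?b (?a - ?b))"
    proof -
      have "Z ?a - Z ?b - dir Z ?b ?u = dir Z ?b (?a - ?b - ?u) + (Z ?a - Z ?b - dir Z ?b (?a - ?b))"
        by (simp add: dir_diff)
      then show ?thesis by (metis norm_triangle_ineq)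
    qed
    also have "\<dots> \<le> L * norm (?a - ?b - ?u) + M2 * (norm (?a - ?b))\<^sup>2"
      by (intro add_mono dir_bound taylor)
    also have "\<dots> \<le> L * norm (?a - ?b - ?u) + M2 * (2 * norm v)\<^sup>2"
      using fl_lip[of r "x + v" x] M20 by (intro order_refl add_left_mono mult_left_mono power_mono) auto
    finally show "norm (Z ?a - Z ?b - dir Z ?b ?u) \<le> L * norm (?a - ?b - ?u) + ?e"
      by (simp add: power_mult_distrib)
  qed (use M20 L0 LT'[OF t] in auto)
  also have "\<dots> \<le> 2 * T * ?e" using t M20 by (simp add: mult_right_mono)
  finally have "norm (\<Phi> ?t (x + v) - \<Phi> ?t x - J ?t x v) \<le> 8 * T * M2 * (norm v)\<^sup>2" by simp
  then show ?thesis by (simp only: fl_clamp[of t, symmetric] jac_clamp[of t, symmetric])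
qed

lemma jac_unique:
  assumes t: "\<bar>t\<bar> \<le> T" and "u 0 = v"
    and g: "\<And>r. r \<in> closed_segment 0 t \<Longrightarrow> (u has_vector_derivative dir Z (\<Phi> r x) (u r)) (at r within closed_segment 0 t)"
  shows "u t = J t x v"
proof -
  have "norm (u t - J t x v) \<le> 2 * norm (u 0 - J 0 x v) + 2 * \<bar>t\<bar> * 0"
  proof (rule gronwall_short[where w' = "\<lambda>r. dir Z (\<Phi> r x) (u r) - dir Z (\<Phi> r x) (J r x v)" and L = L])
    fix r assume r: "r \<in> closed_segment 0 t"
    show "((\<lambda>r. u r - J r x v) has_vector_derivative dir Z (\<Phi> r x) (u r) - dir Z (\<Phi> r x) (J r x v)) (at r within closed_segment 0 t)"
      by (rule has_vector_derivative_diff[OF g[OF r] jac_deriv_seg[OF t r]])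
    show "norm (dir Z (\<Phi> r x) (u r) - dir Z (\<Phi> r x) (J r x v)) \<le> L * norm (u r - J r x v) + 0"
      unfolding dir_diff[symmetric] using dir_bound by simp
  qed (use L0 LT'[OF t] in auto)
  then show ?thesis using assms(2) by simp
qed

lemma jac_linear: "bounded_linear (J t x)"
proof -
  let ?t = "clamp T t"
  have t: "\<bar>?t\<bar> \<le> T" using clamp_mem[OF T0, of t] by auto
  have dl: "linear (dir Z y)" for y by (rule bounded_linear.linear[OF bounded_linear_dir])
  have add: "J t x (u + v) = J t x u + J t x v" for u v
    using jac_unique[OF t, of "\<lambda>t. J t x u + J t x v" "u + v" x] jac_clamp[of t]
    by (simp add: linear_add[OF dl] has_vector_derivative_add jac_deriv_seg[OF t])
  have scale: "J t x (c *\<^sub>R v) = c *\<^sub>R J t x v" for c v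
  proof -
    have "(\<lambda>t. c *\<^sub>R J t x v) ?t = J ?t x (c *\<^sub>R v)"
    proof (rule jac_unique[OF t])
      fix r assume r: "r \<in> closed_segment 0 ?t"
      show "((\<lambda>t. c *\<^sub>R J t x v) has_vector_derivative dir Z (\<Phi> r x) (c *\<^sub>R J r x v)) (at r within closed_segment 0 ?t)"
        using bounded_linear.has_vector_derivative[OF bounded_linear_scaleR_right jac_deriv_seg[OF t r], of c]
        by (simp add: linear_cmul[OF dl])
    qed simp
    then show ?thesis by (simp only: jac_clamp[of t, symmetric])
  qed
  show ?thesis
    by (rule bounded_linear_intro[where K = 2]) (use add scale jac_bound in \<open>auto simp: mult.commute\<close>)
qed

lemma fl_has_derivative: "(\<Phi> t has_derivative J t x) (at x)"
  unfolding has_derivative_at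
proof (intro conjI jac_linear)
  have "((\<lambda>v::real^'n. 8 * T * M2 * norm v) \<longlongrightarrow> 8 * T * M2 * norm (0::real^'n)) (at 0)"
    by (rule tendsto_mult[OF tendsto_const tendsto_norm[OF tendsto_ident_at]])
  then have lim: "((\<lambda>v::real^'n. 8 * T * M2 * norm v) \<longlongrightarrow> 0) (at 0)" by simp
  show "(\<lambda>v. norm (\<Phi> t (x + v) - \<Phi> t x - J t x v) / norm v) \<midarrow>0\<rightarrow> 0"
  proof (rule Lim_null_comparison[OF _ lim], rule eventuallyI)
    fix v
    show "norm (norm (\<Phi> t (x + v) - \<Phi> t x - J t x v) / norm v) \<le> 8 * T * M2 * norm v"
      using fl_quadratic[of t x v] by (cases "v = 0") (auto simp: divide_le_eq power2_eq_square mult.assoc)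
  qed
qed

text \<open>The chain rule applied to \<open>fl_inverse\<close>.\<close>

lemma jac_inverse: "\<bar>t\<bar> \<le> T \<Longrightarrow> J (- t) (\<Phi> t x) (J t x v) = v"
proof -
  assume t: "\<bar>t\<bar> \<le> T"
  have "((\<lambda>x. \<Phi> (- t) (\<Phi> t x)) has_derivative (\<lambda>v. J (- t) (\<Phi> t x) (J t x v))) (at x)"
    by (rule has_derivative_compose[OF fl_has_derivative fl_has_derivative])
  then have "((\<lambda>x. x) has_derivative (\<lambda>v. J (- t) (\<Phi> t x) (J t x v))) (at x)"
    using fl_inverse[OF t] by simp
  from has_derivative_unique[OF this has_derivative_ident] show ?thesis by metis
qed

lemma jac_lip_x: "norm (J t x v - J t x' v') \<le> 2 * norm (v - v') + 8 * T * M2 * norm (x - x') * norm v'"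
proof -
  let ?t = "clamp T t" and ?e = "4 * M2 * norm (x - x') * norm v'"
  have t: "\<bar>?t\<bar> \<le> T" using clamp_mem[OF T0, of t] by auto
  have "norm (J ?t x v - J ?t x' v') \<le> 2 * norm (J 0 x v - J 0 x' v') + 2 * \<bar>?t\<bar> * ?e"
  proof (rule gronwall_short[where w' = "\<lambda>r. dir Z (\<Phi> r x) (J r x v) - dir Z (\<Phi> r x') (J r x' v')" and L = L])
    fix r assume r: "r \<in> closed_segment 0 ?t"
    show "((\<lambda>r. J r x v - J r x' v') has_vector_derivative dir Z (\<Phi> r x) (J r x v) - dir Z (\<Phi> r x') (J r x' v')) (at r within closed_segment 0 ?t)"
      by (intro has_vector_derivative_diff jac_deriv_seg[OF t r])
    have "norm (dir Z (\<Phi> r x) (J r x v) - dir Z (\<Phi> r x') (J r x' v')) \<le>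
      norm (dir Z (\<Phi> r x) (J r x v - J r x' v')) + norm (dir Z (\<Phi> r x) (J r x' v') - dir Z (\<Phi> r x') (J r x' v'))"
    proof -
      have "dir Z (\<Phi> r x) (J r x v) - dir Z (\<Phi> r x') (J r x' v') =
        dir Z (\<Phi> r x) (J r x v - J r x' v') + (dir Z (\<Phi> r x) (J r x' v') - dir Z (\<Phi> r x') (J r x' v'))"
        by (simp add: dir_diff)
      then show ?thesis by (metis norm_triangle_ineq)
    qed
    also have "\<dots> \<le> L * norm (J r x v - J r x' v') + M2 * norm (\<Phi> r x - \<Phi> r x') * norm (J r x' v')"
      by (intro add_mono dir_bound dlip)
    also have "\<dots> \<le> L * norm (J r x v - J r x' v') + M2 * (2 * norm (x - x')) * (2 * norm v')"
      using M20 by (intro add_left_mono mult_mono fl_lip jac_bound order_refl) auto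
    finally show "norm (dir Z (\<Phi> r x) (J r x v) - dir Z (\<Phi> r x') (J r x' v')) \<le> L * norm (J r x v - J r x' v') + ?e"
      by simp
  qed (use M20 L0 LT'[OF t] in auto)
  also have "\<dots> \<le> 2 * norm (v - v') + 2 * T * ?e"
    using t M20 by (intro add_mono mult_right_mono) auto
  finally have "norm (J ?t x v - J ?t x' v') \<le> 2 * norm (v - v') + 8 * T * M2 * norm (x - x') * norm v'" by simp
  then show ?thesis by (simp only: jac_clamp[of t, symmetric])
qed

lemma jac_lip_time: "norm (J t x v - J t' x v) \<le> (L * (2 * norm v)) * \<bar>t - t'\<bar>"
proof (rule within_T_lip[OF jac_deriv_within])
  fix t show "norm (dir Z (\<Phi> t x) (J t x v)) \<le> L * (2 * norm v)"
    using dir_bound[of "\<Phi> t x" "J t x v"] mult_left_mono[OF jac_bound[of t x v] L0] by linarith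
qed (auto intro: jac_clamp)

text \<open>Along an arbitrary filter, so that time, base point and vector can move together, as
  they do inside difference quotients.\<close>

lemma jac_tendsto:
  assumes "(t \<longlongrightarrow> t0) A" "(x \<longlongrightarrow> x0) A" "(v \<longlongrightarrow> v0) A"
  shows "((\<lambda>a. J (t a) (x a) (v a)) \<longlongrightarrow> J t0 x0 v0) A"
proof -
  let ?b = "\<lambda>a. (2 * norm (v a - v0) + 8 * T * M2 * norm (x a - x0) * norm v0) + (L * (2 * norm v0)) * \<bar>t a - t0\<bar>"
  have "norm (J (t a) (x a) (v a) - J t0 x0 v0) \<le> ?b a" for a
    using norm_triangle_mono[OF jac_lip_x[of "t a" "x a" "v a" x0 v0] jac_lip_time[of "t a" x0 v0 t0]] by simp
  moreover have "(?b \<longlongrightarrow> (2 * norm (v0 - v0) + 8 * T * M2 * norm (x0 - x0) * norm v0) + (L * (2 * norm v0)) * \<bar>t0 - t0\<bar>) A"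
    by (intro tendsto_intros assms)
  ultimately have b: "norm (J (t a) (x a) (v a) - J t0 x0 v0) \<le> ?b a" and l: "(?b \<longlongrightarrow> 0) A" for a by simp_all
  show ?thesis by (rule LIM_zero_cancel, rule Lim_null_comparison[OF _ l]) (simp add: b)
qed

lemma fl_tendsto:
  assumes "(t \<longlongrightarrow> t0) A" "(x \<longlongrightarrow> x0) A"
  shows "((\<lambda>a. \<Phi> (t a) (x a)) \<longlongrightarrow> \<Phi> t0 x0) A"
proof -
  let ?b = "\<lambda>a. 2 * norm (x a - x0) + M * \<bar>t a - t0\<bar>"
  have b: "norm (\<Phi> (t a) (x a) - \<Phi> t0 x0) \<le> ?b a" for a by (rule fl_lip_joint)
  have "(?b \<longlongrightarrow> 2 * norm (x0 - x0) + M * \<bar>t0 - t0\<bar>) A" by (intro tendsto_intros assms)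
  then have l: "(?b \<longlongrightarrow> 0) A" by simp
  show ?thesis by (rule LIM_zero_cancel, rule Lim_null_comparison[OF _ l]) (simp add: b)
qed

text \<open>Time and initial point move simultaneously. The quotient separates into the flow's own
  motion at the fixed point \<open>y a\<close>, the Jacobian applied to the quotient of
  \<open>y\<close>, and the second-order error of \<open>fl_quadratic\<close>.\<close>

lemma fl_curve:
  assumes y: "(y has_vector_derivative v) (at a)" and a: "\<bar>c * a\<bar> < T"
  shows "((\<lambda>\<tau>. \<Phi> (c * \<tau>) (y \<tau>)) has_vector_derivative
      J (c * a) (y a) v + c *\<^sub>R Z (\<Phi> (c * a) (y a))) (at a)"
proof -
  let ?q = "\<lambda>h. (1/h) *\<^sub>R (y (a + h) - y a)"
  have q: "(?q \<longlongrightarrow> v) (at 0)" using y by (simp add: has_vector_derivative_iff_quotient)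
  have yc: "((\<lambda>h. y (a + h)) \<longlongrightarrow> y a) (at 0)"
    using has_vector_derivative_continuous[OF y] by (simp add: continuous_within LIM_offset_zero_iff[symmetric])
  have ct: "((\<lambda>h. c * (a + h)) \<longlongrightarrow> c * a) (at 0)"
    using tendsto_mult[OF tendsto_const[of c] tendsto_add[OF tendsto_const[of a] tendsto_ident_at[of 0 UNIV]]] by simp
  have 1: "((\<lambda>h. J (c * (a + h)) (y a) (?q h)) \<longlongrightarrow> J (c * a) (y a) v) (at 0)"
    by (rule jac_tendsto[OF ct tendsto_const q])
  have 2: "((\<lambda>h. (1/h) *\<^sub>R (\<Phi> (c * (a + h)) (y a) - \<Phi> (c * a) (y a))) \<longlongrightarrow> c *\<^sub>R Z (\<Phi> (c * a) (y a))) (at 0)"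
  proof -
    have "((\<lambda>t. c * t) has_vector_derivative c) (at a)" by (auto intro!: derivative_eq_intros)
    from vector_diff_chain_at[OF this fl_deriv[OF a, of "y a"]]
    show ?thesis by (simp add: has_vector_derivative_iff_quotient o_def)
  qed
  \<comment> \<open>By \<open>fl_quadratic\<close> this term is bounded by a quotient of
    \<open>y\<close> times an increment of \<open>y\<close>; the first converges and the second
    tends to 0.\<close>
  let ?r = "\<lambda>h. (1/h) *\<^sub>R (\<Phi> (c * (a + h)) (y (a + h)) - \<Phi> (c * (a + h)) (y a) - J (c * (a + h)) (y a) (y (a + h) - y a))"
  have 3: "(?r \<longlongrightarrow> 0) (at 0)"
  proof (rule Lim_null_comparison)
    have "((\<lambda>h. 8 * T * M2 * norm (?q h) * norm (y (a + h) - y a)) \<longlongrightarrow> 8 * T * M2 * norm v * norm (y a - y a)) (at 0)"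
      by (intro tendsto_intros q yc)
    then show "((\<lambda>h. 8 * T * M2 * norm (?q h) * norm (y (a + h) - y a)) \<longlongrightarrow> 0) (at 0)" by simp
    have "norm (?r h) \<le> 8 * T * M2 * norm (?q h) * norm (y (a + h) - y a)" for h
    proof -
      have "norm (\<Phi> (c * (a + h)) (y (a + h)) - \<Phi> (c * (a + h)) (y a) - J (c * (a + h)) (y a) (y (a + h) - y a))
         \<le> 8 * T * M2 * (norm (y (a + h) - y a))\<^sup>2"
        using fl_quadratic[of "c * (a + h)" "y a" "y (a + h) - y a"] by simp
      from mult_left_mono[OF this, of "1 / \<bar>h\<bar>"] show ?thesis by (simp add: power2_eq_square ac_simps)
    qed
    then show "\<forall>\<^sub>F h in at 0. norm (?r h) \<le> 8 * T * M2 * norm (?q h) * norm (y (a + h) - y a)" by simp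
  qed
  have "((\<lambda>h. ?r h + J (c * (a + h)) (y a) (?q h) + (1/h) *\<^sub>R (\<Phi> (c * (a + h)) (y a) - \<Phi> (c * a) (y a)))
     \<longlongrightarrow> 0 + J (c * a) (y a) v + c *\<^sub>R Z (\<Phi> (c * a) (y a))) (at 0)"
    by (intro tendsto_add 1 2 3)
  moreover have "?r h + J (c * (a + h)) (y a) (?q h) + (1/h) *\<^sub>R (\<Phi> (c * (a + h)) (y a) - \<Phi> (c * a) (y a))
     = (1/h) *\<^sub>R (\<Phi> (c * (a + h)) (y (a + h)) - \<Phi> (c * a) (y a))" for h
    by (simp add: linear_cmul[OF bounded_linear.linear[OF jac_linear]] scaleR_diff_right[symmetric] scaleR_add_right[symmetric])
  ultimately show ?thesis by (simp add: has_vector_derivative_iff_quotient)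
qed

text \<open>The derivative of a pulled-back field along the flow is the pulled-back Lie bracket.
  Differentiating the outer Jacobian in its base point would require second derivatives of the flow;
  freezing the pulled-back vector avoids this.\<close>

lemma pullback_deriv:
  assumes W: "Ck (Suc 0) W" and r: "\<bar>r\<bar> < T"
  shows "((\<lambda>r. J (- r) (\<Phi> r p) (W (\<Phi> r p))) has_vector_derivative
     J (- r) (\<Phi> r p) (Xop Z W (\<Phi> r p) - Xop W Z (\<Phi> r p))) (at r)"
proof -
  let ?g = "J (- r) (\<Phi> r p) (W (\<Phi> r p))"
  \<comment> \<open>\<open>?g\<close> is frozen at time \<open>r\<close>, so \<open>?k\<close>
    vanishes there. Near \<open>r\<close> the increment of the pullback is \<open>J\<close> applied
    to \<open>?k\<close>, and only continuity of that outer \<open>J\<close> is used.\<close>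
  let ?k = "\<lambda>r. W (\<Phi> r p) - J r p ?g"
  have inv: "J (- q) (\<Phi> q p) (J q p v) = v" if "\<bar>q\<bar> < T" for q v using jac_inverse[of q p v] that by simp
  have inv': "J r p ?g = W (\<Phi> r p)"
    using jac_inverse[of "- r" "\<Phi> r p" "W (\<Phi> r p)"] fl_inverse[of r p] r by simp
  have kd: "(?k has_vector_derivative (dir W (\<Phi> r p) (Z (\<Phi> r p)) - dir Z (\<Phi> r p) (J r p ?g))) (at r)"
  proof (rule has_vector_derivative_diff)
    have "((\<lambda>r. W (\<Phi> r p)) has_derivative (\<lambda>h. dir W (\<Phi> r p) (h *\<^sub>R Z (\<Phi> r p)))) (at r)"
      using fl_deriv[OF r, of p] unfolding has_vector_derivative_def
      by (rule has_derivative_compose[OF _ Ck_has_derivative_dir[OF W]])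
    then show "((\<lambda>r. W (\<Phi> r p)) has_vector_derivative dir W (\<Phi> r p) (Z (\<Phi> r p))) (at r)"
      by (simp add: has_vector_derivative_def linear_cmul[OF bounded_linear.linear[OF bounded_linear_dir]])
  qed (rule jac_deriv[OF r])
  have XZ: "Xop Z W (\<Phi> r p) - Xop W Z (\<Phi> r p) = dir W (\<Phi> r p) (Z (\<Phi> r p)) - dir Z (\<Phi> r p) (J r p ?g)"
    using has_derivative_imp_Xop(2)[OF Ck_has_derivative_dir[OF W]] has_derivative_imp_Xop(2)[OF Z_deriv] inv' by simp
  have k0: "?k r = 0" using inv' by simp
  have kq: "((\<lambda>h. (1/h) *\<^sub>R ?k (r + h)) \<longlongrightarrow> Xop Z W (\<Phi> r p) - Xop W Z (\<Phi> r p)) (at 0)"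
    using kd k0 XZ unfolding has_vector_derivative_iff_quotient by simp
  have rh: "((\<lambda>h::real. r + h) \<longlongrightarrow> r) (at 0)"
    using tendsto_add[OF tendsto_const[of r] tendsto_ident_at[of 0 UNIV]] by simp
  have lim: "((\<lambda>h. J (- (r + h)) (\<Phi> (r + h) p) ((1/h) *\<^sub>R ?k (r + h))) \<longlongrightarrow>
     J (- r) (\<Phi> r p) (Xop Z W (\<Phi> r p) - Xop W Z (\<Phi> r p))) (at 0)"
    by (rule jac_tendsto[OF tendsto_minus[OF rh] fl_tendsto[OF rh tendsto_const] kq])
  have ev: "\<forall>\<^sub>F h in at 0. J (- (r + h)) (\<Phi> (r + h) p) ((1/h) *\<^sub>R ?k (r + h)) =
     (1/h) *\<^sub>R (J (- (r + h)) (\<Phi> (r + h) p) (W (\<Phi> (r + h) p)) - ?g)"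
    unfolding eventually_at
  proof (intro exI[of _ "T - \<bar>r\<bar>"] conjI ballI impI)
    fix h :: real assume "h \<noteq> 0 \<and> dist h 0 < T - \<bar>r\<bar>"
    then have "\<bar>r + h\<bar> < T" using abs_triangle_ineq[of r h] by simp
    then show "J (- (r + h)) (\<Phi> (r + h) p) ((1/h) *\<^sub>R ?k (r + h)) =
     (1/h) *\<^sub>R (J (- (r + h)) (\<Phi> (r + h) p) (W (\<Phi> (r + h) p)) - ?g)"
      using inv[of "r + h" ?g]
      by (simp add: linear_cmul[OF bounded_linear.linear[OF jac_linear]] linear_diff[OF bounded_linear.linear[OF jac_linear]])
  qed (use r in auto)
  show ?thesis unfolding has_vector_derivative_iff_quotient by (rule Lim_transform_eventually[OF lim ev])
qed

end

section \<open>Noncommutative power series\<close>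

text \<open>Arbitrary coefficient functions on words: no convergence is involved, since a word has
  finitely many splittings and every coefficient of a product is a finite sum. A type of its own
  carries the instance of \<open>ring_1\<close>.\<close>

datatype ncs = NC (cf: "nat list \<Rightarrow> real")

lemma ncs_eqI: "(\<And>w. cf a w = cf b w) \<Longrightarrow> a = b"
  by (cases a; cases b) auto

definition splits :: "nat list \<Rightarrow> (nat list \<times> nat list) set" where
  "splits w = {(x, y). x @ y = w}"

lemma splits_image: "splits w = (\<lambda>i. (take i w, drop i w)) ` {..length w}"
proof -
  have "(x, y) \<in> (\<lambda>i. (take i w, drop i w)) ` {..length w}" if "x @ y = w" for x y
    using that by (intro image_eqI[of _ _ "length x"]) auto
  then show ?thesis by (auto simp: splits_def)
qed

lemma mem_splits: "(x, y) \<in> splits w \<longleftrightarrow> x @ y = w"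
  by (simp add: splits_def)

lemma finite_splits [simp]: "finite (splits w)"
  by (simp add: splits_image)

instantiation ncs :: ring_1
begin

definition "0 = NC (\<lambda>_. 0)"
definition "1 = NC (\<lambda>w. if w = [] then 1 else 0)"
definition "a + b = NC (\<lambda>w. cf a w + cf b w)"
definition "a - b = NC (\<lambda>w. cf a w - cf b w)"
definition "- a = NC (\<lambda>w. - cf a w)"
definition "a * b = NC (\<lambda>w. \<Sum>(x, y)\<in>splits w. cf a x * cf b y)"

lemma cf_simps [simp]:
  "cf 0 w = 0" "cf 1 w = (if w = [] then 1 else 0)" "cf (a + b) w = cf a w + cf b w"
  "cf (a - b) w = cf a w - cf b w" "cf (- a) w = - cf a w"
  by (simp_all add: zero_ncs_def one_ncs_def plus_ncs_def minus_ncs_def uminus_ncs_def)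

lemma cf_mult: "cf (a * b) w = (\<Sum>(x, y)\<in>splits w. cf a x * cf b y)"
  by (simp add: times_ncs_def)

lemma ncs_mult_assoc: "(a * b) * c = a * (b * (c::ncs))"
proof (rule ncs_eqI)
  fix w
  have "cf (a * b * c) w = (\<Sum>p\<in>splits w. \<Sum>q\<in>splits (fst p). cf a (fst q) * cf b (snd q) * cf c (snd p))"
    by (simp add: cf_mult split_beta sum_distrib_right)
  also have "\<dots> = (\<Sum>(p, q)\<in>Sigma (splits w) (\<lambda>p. splits (fst p)). cf a (fst q) * cf b (snd q) * cf c (snd p))"
    by (rule sum.Sigma) auto
  also have "\<dots> = (\<Sum>(p, q)\<in>Sigma (splits w) (\<lambda>p. splits (snd p)). cf a (fst p) * cf b (fst q) * cf c (snd q))"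
    by (rule sum.reindex_bij_witness[where i = "\<lambda>((x, u), (y, z)). ((x @ y, z), (x, y))"
          and j = "\<lambda>((u, z), (x, y)). ((x, y @ z), (y, z))"]) (auto simp: splits_def)
  also have "\<dots> = (\<Sum>p\<in>splits w. \<Sum>q\<in>splits (snd p). cf a (fst p) * cf b (fst q) * cf c (snd q))"
    by (rule sum.Sigma[symmetric]) auto
  also have "\<dots> = cf (a * (b * c)) w"
    by (simp add: cf_mult split_beta sum_distrib_left mult.assoc)
  finally show "cf (a * b * c) w = cf (a * (b * c)) w" .
qed

lemma ncs_mult_1: "1 * a = (a::ncs)" and ncs_mult_1_right: "a * 1 = (a::ncs)"
proof -
  show "1 * a = a"
  proof (rule ncs_eqI)
    fix w
    have "cf (1 * a) w = (\<Sum>p\<in>splits w. if p = ([], w) then cf a w else 0)"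
      unfolding cf_mult by (rule sum.cong) (auto simp: splits_def split: if_splits)
    then show "cf (1 * a) w = cf a w" by (simp add: mem_splits)
  qed
  show "a * 1 = a"
  proof (rule ncs_eqI)
    fix w
    have "cf (a * 1) w = (\<Sum>p\<in>splits w. if p = (w, []) then cf a w else 0)"
      unfolding cf_mult by (rule sum.cong) (auto simp: splits_def split: if_splits)
    then show "cf (a * 1) w = cf a w" by (simp add: mem_splits)
  qed
qed

instance
proof
  fix a b c :: ncs
  show "a * b * c = a * (b * c)" by (rule ncs_mult_assoc)
  show "1 * a = a" "a * 1 = a" by (rule ncs_mult_1 ncs_mult_1_right)+
  show "(a + b) * c = a * c + b * c" "a * (b + c) = a * b + a * c"
    by (auto intro!: ncs_eqI simp: cf_mult split_beta algebra_simps sum.distrib)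
  show "(0::ncs) \<noteq> 1"
  proof
    assume "(0::ncs) = 1"
    then have "cf 0 [] = cf 1 []" by simp
    then show False by simp
  qed
qed (auto intro!: ncs_eqI)

end

lemma cf_sum: "cf (\<Sum>i\<in>S. a i) w = (\<Sum>i\<in>S. cf (a i) w)"
  by (induction S rule: infinite_finite_induct) auto

definition scal :: "real \<Rightarrow> ncs \<Rightarrow> ncs" where "scal r a = NC (\<lambda>w. r * cf a w)"

lemma cf_scal [simp]: "cf (scal r a) w = r * cf a w" by (simp add: scal_def)

lemma scal_mult: "scal r a * b = scal r (a * b)" "a * scal r b = scal r (a * b)"
  by (auto intro!: ncs_eqI simp: cf_mult split_beta sum_distrib_left mult_ac)

definition letter :: "nat \<Rightarrow> ncs" where "letter k = NC (\<lambda>w. if w = [k] then 1 else 0)"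

lemma cf_letter [simp]: "cf (letter k) w = (if w = [k] then 1 else 0)" by (simp add: letter_def)

lemma cf_letter_mult: "cf (letter k * a) w = (if w \<noteq> [] \<and> hd w = k then cf a (tl w) else 0)"
proof -
  have "cf (letter k * a) w = (\<Sum>p\<in>splits w. if p = ([k], tl w) then (if w \<noteq> [] \<and> hd w = k then cf a (tl w) else 0) else 0)"
    unfolding cf_mult by (rule sum.cong) (auto simp: splits_def split: if_splits, (metis list.sel(3) append_Cons append_Nil butlast_snoc)+)
  also have "\<dots> = (if w \<noteq> [] \<and> hd w = k then cf a (tl w) else 0)"
    by (auto simp: mem_splits)
  finally show ?thesis .
qed

lemma cf_mult_letter: "cf (a * letter k) w = (if w \<noteq> [] \<and> last w = k then cf a (butlast w) else 0)"
proof -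
  have "cf (a * letter k) w = (\<Sum>p\<in>splits w. if p = (butlast w, [k]) then (if w \<noteq> [] \<and> last w = k then cf a (butlast w) else 0) else 0)"
    unfolding cf_mult by (rule sum.cong) (auto simp: splits_def split: if_splits, (metis list.sel(3) append_Cons append_Nil butlast_snoc)+)
  also have "\<dots> = (if w \<noteq> [] \<and> last w = k then cf a (butlast w) else 0)"
    by (auto simp: mem_splits)
  finally show ?thesis .
qed

text \<open>The Euler derivation. It is the formal counterpart of differentiating in \<tau> at
  \<tau> = 1 after every letter has been multiplied by \<tau>.\<close>

definition deg :: "ncs \<Rightarrow> ncs" where "deg a = NC (\<lambda>w. real (length w) * cf a w)"

lemma cf_deg [simp]: "cf (deg a) w = real (length w) * cf a w" by (simp add: deg_def)

lemma deg_mult: "deg (a * b) = deg a * b + a * deg b"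
proof (rule ncs_eqI)
  fix w
  show "cf (deg (a * b)) w = cf (deg a * b + a * deg b) w"
    unfolding cf_deg cf_simps cf_mult sum_distrib_left sum.distrib[symmetric]
    by (rule sum.cong) (auto simp: splits_def algebra_simps)
qed

definition exp_letter :: "nat \<Rightarrow> real \<Rightarrow> ncs" where
  "exp_letter k e = NC (\<lambda>w. if set w \<subseteq> {k} then e ^ length w / fact (length w) else 0)"

lemma cf_exp_letter: "cf (exp_letter k e) w = (if set w \<subseteq> {k} then e ^ length w / fact (length w) else 0)"
  by (simp add: exp_letter_def)

text \<open>A letter commutes with its own exponential, hence both sides: conjugation uses the left
  form together with the right one, the product recursion only the right one.\<close>

lemma deg_exp_letter: "deg (exp_letter k e) = scal e (letter k) * exp_letter k e" "deg (exp_letter k e) = exp_letter k e * scal e (letter k)"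
proof -
  have eq: "real (Suc n) * (e ^ Suc n / fact (Suc n)) = e * (e ^ n / fact n)" for n
    by (simp add: field_simps del: of_nat_Suc)
  show "deg (exp_letter k e) = scal e (letter k) * exp_letter k e"
  proof (rule ncs_eqI)
    fix w
    show "cf (deg (exp_letter k e)) w = cf (scal e (letter k) * exp_letter k e) w"
      unfolding scal_mult cf_scal cf_letter_mult cf_deg
      by (cases w) (use eq in \<open>auto simp: cf_exp_letter simp del: power_Suc fact_Suc\<close>)
  qed
  show "deg (exp_letter k e) = exp_letter k e * scal e (letter k)"
  proof (rule ncs_eqI)
    fix w
    show "cf (deg (exp_letter k e)) w = cf (exp_letter k e * scal e (letter k)) w"
      unfolding scal_mult cf_scal cf_mult_letter cf_deg
      by (cases w rule: rev_cases)
        (use eq in \<open>auto simp: cf_exp_letter simp del: power_Suc fact_Suc\<close>)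
  qed
qed

definition low :: "nat \<Rightarrow> ncs \<Rightarrow> bool" where "low p a \<longleftrightarrow> (\<forall>w. length w < p \<longrightarrow> cf a w = 0)"

text \<open>In the lowest possible degree only the splitting after \<open>p\<close> letters
  contributes, so the leading part of a product is the product of the leading parts.\<close>

lemma low_mult:
  assumes "low p a" "low q b"
  shows "low (p + q) (a * b)"
    and "length w = p + q \<Longrightarrow> cf (a * b) w = cf a (take p w) * cf b (drop p w)"
proof -
  have z: "cf a x * cf b y = 0" if "length x < p \<or> length y < q" for x y
    using assms that by (auto simp: low_def)
  show "low (p + q) (a * b)"
    unfolding low_def cf_mult
  proof (intro allI impI sum.neutral ballI)
    fix w r assume "length w < p + q" "r \<in> splits w"
    then have "length (fst r) < p \<or> length (snd r) < q" by (auto simp: splits_def)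
    then show "(case r of (x, y) \<Rightarrow> cf a x * cf b y) = 0" using z by (simp add: split_beta)
  qed
  assume w: "length w = p + q"
  have "cf (a * b) w = (\<Sum>r\<in>splits w. if r = (take p w, drop p w) then cf a (take p w) * cf b (drop p w) else 0)"
    unfolding cf_mult
  proof (rule sum.cong[OF refl])
    fix r assume r: "r \<in> splits w"
    obtain x y where xy: "r = (x, y)" by (cases r)
    have xw: "x @ y = w" using r by (simp add: xy splits_def)
    show "(case r of (x, y) \<Rightarrow> cf a x * cf b y) = (if r = (take p w, drop p w) then cf a (take p w) * cf b (drop p w) else 0)"
    proof (cases "length x = p")
      case True then show ?thesis using xw xy by auto
    next
      case False
      then have "length x < p \<or> length y < q" using xw w by auto
      moreover have "r \<noteq> (take p w, drop p w)" using False xy w by auto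
      ultimately show ?thesis using z xy by simp
    qed
  qed
  then show "cf (a * b) w = cf a (take p w) * cf b (drop p w)" by (simp add: mem_splits)
qed

lemma low_0: "low 0 a" by (simp add: low_def)

definition homog :: "nat \<Rightarrow> ncs \<Rightarrow> bool" where "homog p a \<longleftrightarrow> (\<forall>w. length w \<noteq> p \<longrightarrow> cf a w = 0)"

definition ad_letter :: "nat \<Rightarrow> ncs \<Rightarrow> ncs" where "ad_letter k a = letter k * a - a * letter k"

lemma cf_ad_letter: "cf (ad_letter k a) w = (if w \<noteq> [] \<and> hd w = k then cf a (tl w) else 0)
   - (if w \<noteq> [] \<and> last w = k then cf a (butlast w) else 0)"
  by (simp add: ad_letter_def cf_letter_mult cf_mult_letter)

lemma ad_letter_cong: "(\<And>u. Suc (length u) = length w \<Longrightarrow> cf a u = cf b u) \<Longrightarrow> cf (ad_letter k a) w = cf (ad_letter k b) w"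
  unfolding cf_ad_letter by (cases w) auto

lemma ad_letter_scal: "ad_letter k (scal r a) = scal r (ad_letter k a)"
  by (rule ncs_eqI) (simp add: cf_ad_letter algebra_simps)

text \<open>The formal identity e^(-eX) Y e^(eX) = e^(-e ad X) Y. Applying \<open>deg\<close> gives
  a recursion in the word length whose solution is the exponential series, term by term.\<close>

lemma cf_conj_exp_letter:
  assumes Y: "homog d Y"
  shows "cf (exp_letter k (- e) * Y * exp_letter k e) u =
     (if d \<le> length u then (- e) ^ (length u - d) / fact (length u - d) * cf ((ad_letter k ^^ (length u - d)) Y) u else 0)"
proof -
  define P where "P = exp_letter k (- e) * Y * exp_letter k e"
  have dY: "deg Y = scal (real d) Y" by (rule ncs_eqI) (use Y in \<open>auto simp: homog_def\<close>)
  have lowY: "low d Y" using Y by (auto simp: low_def homog_def)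
  have e0: "cf (exp_letter k e) [] = 1" for e by (simp add: cf_exp_letter)
  have dP: "deg P = scal (- e) (letter k * P) + scal (real d) P + scal e (P * letter k)"
  proof -
    have "deg P = deg (exp_letter k (- e)) * Y * exp_letter k e + exp_letter k (- e) * deg Y * exp_letter k e + exp_letter k (- e) * Y * deg (exp_letter k e)"
      by (simp add: P_def deg_mult algebra_simps)
    also have "deg (exp_letter k (- e)) = scal (- e) (letter k) * exp_letter k (- e)" by (rule deg_exp_letter)
    also have "deg (exp_letter k e) = exp_letter k e * scal e (letter k)" by (rule deg_exp_letter)
    finally show ?thesis by (simp add: P_def dY scal_mult mult.assoc)
  qed
  \<comment> \<open>The left factor is \<open>length u - d\<close>: it determines the coefficients
    above degree \<open>d\<close> from shorter words and says nothing in degree \<open>d\<close>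
    itself, where the coefficient is computed directly.\<close>
  have ode: "(real (length u) - real d) * cf P u = - e * cf (ad_letter k P) u" for u
  proof -
    have "cf (deg P) u = cf (scal (- e) (letter k * P) + scal (real d) P + scal e (P * letter k)) u"
      by (simp only: dP)
    then show ?thesis by (simp add: ad_letter_def algebra_simps)
  qed
  have "cf P u = (if d \<le> length u then (- e) ^ (length u - d) / fact (length u - d) * cf ((ad_letter k ^^ (length u - d)) Y) u else 0)"
    (is "_ = ?R u")
  proof (induction "length u" arbitrary: u rule: less_induct)
    case less
    show ?case
    proof (cases "length u = d")
      case True
      have l: "low (0 + d) (exp_letter k (- e) * Y)" by (rule low_mult[OF low_0 lowY])
      have "cf P u = cf (exp_letter k (- e) * Y) (take (0 + d) u) * cf (exp_letter k e) (drop (0 + d) u)"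
        unfolding P_def using True by (intro low_mult(2)[OF l low_0]) simp
      also have "\<dots> = cf (exp_letter k (- e) * Y) u" using True by (simp add: e0)
      also have "\<dots> = cf (exp_letter k (- e)) (take 0 u) * cf Y (drop 0 u)"
        using True by (intro low_mult(2)[OF low_0 lowY]) simp
      finally show ?thesis using True by (simp add: e0)
    next
      case ne: False
      show ?thesis
      proof (cases "d < length u")
        case False
        then have lt: "length u < d" using ne by simp
        have "cf (ad_letter k P) u = cf (ad_letter k 0) u"
          by (rule ad_letter_cong) (use less lt in auto)
        then have "cf (ad_letter k P) u = 0" by (simp add: cf_ad_letter)
        then show ?thesis using ode[of u] lt by simp
      next
        case True
        define i where "i = length u - d - 1"
        have i: "length u = d + Suc i" using True by (simp add: i_def)
        have "cf (ad_letter k P) u = cf (ad_letter k (scal ((- e) ^ i / fact i) ((ad_letter k ^^ i) Y))) u"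
          by (rule ad_letter_cong) (use less i in auto)
        then have "cf (ad_letter k P) u = (- e) ^ i / fact i * cf ((ad_letter k ^^ Suc i) Y) u"
          by (simp add: ad_letter_scal)
        then have "real (Suc i) * cf P u = - e * ((- e) ^ i / fact i * cf ((ad_letter k ^^ Suc i) Y) u)"
          using ode[of u] i by simp
        then have "cf P u = (- e) ^ Suc i / fact (Suc i) * cf ((ad_letter k ^^ Suc i) Y) u"
          by (simp add: field_simps del: of_nat_Suc funpow.simps)
        then show ?thesis using i by simp
      qed
    qed
  qed
  then show ?thesis by (simp add: P_def)
qed

text \<open>Conjugation of the unit, which has degree 0 and commutes with every letter.\<close>

lemma exp_letter_inverse: "exp_letter k e * exp_letter k (- e) = 1"
proof -
  have a: "ad_letter k 1 = 0" by (simp add: ad_letter_def)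
  have a0: "ad_letter k 0 = 0" by (simp add: ad_letter_def)
  have z: "(ad_letter k ^^ Suc i) 1 = 0" for i by (induction i) (use a a0 in auto)
  have h: "homog 0 1" by (simp add: homog_def)
  have "exp_letter k (- (- e)) * 1 * exp_letter k (- e) = 1"
  proof (rule ncs_eqI)
    fix w show "cf (exp_letter k (- (- e)) * 1 * exp_letter k (- e)) w = cf 1 w"
      unfolding cf_conj_exp_letter[OF h] using z[of "length w - 1"] by (cases w) auto
  qed
  then show ?thesis by simp
qed

section \<open>Lie words, pushed coefficients and the formal logarithmic derivative\<close>

fun lie_word :: "nat list \<Rightarrow> ncs" where
  "lie_word [] = 0"
| "lie_word [k] = letter k"
| "lie_word (k # l # w) = ad_letter k (lie_word (l # w))"

lemma lie_word_Cons: "v \<noteq> [] \<Longrightarrow> lie_word (k # v) = ad_letter k (lie_word v)" by (cases v) auto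

lemma lie_word_replicate: "v \<noteq> [] \<Longrightarrow> lie_word (replicate i k @ v) = (ad_letter k ^^ i) (lie_word v)"
  by (induction i) (auto simp: lie_word_Cons)

lemma homog_lie_word: "homog (length v) (lie_word v)"
proof (induction v rule: lie_word.induct)
  case (3 k l w)
  then show ?case unfolding homog_def lie_word.simps(3) cf_ad_letter by auto
qed (auto simp: homog_def)

lemma cf_lie_word_length: "length u \<noteq> length v \<Longrightarrow> cf (lie_word v) u = 0"
  using homog_lie_word[of v] by (simp add: homog_def)

lemma finite_words: "finite (words s m)"
proof -
  have "words s m \<subseteq> {w. set w \<subseteq> {1..m} \<and> length w \<le> s}" by (auto simp: words_def)
  then show ?thesis using finite_lists_length_le[of "{1..m}" s] finite_subset by blast
qed

text \<open>The coefficients of \<open>e\<^bsup>-t ad X\<^sub>k\<^esup> (\<Sum>v. a v X\<^sub>v)\<close>, truncated at length \<open>s\<close>.\<close>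

definition push :: "nat \<Rightarrow> nat \<Rightarrow> nat \<Rightarrow> real \<Rightarrow> (nat list \<Rightarrow> real) \<Rightarrow> nat list \<Rightarrow> real" where
  "push s m k t a u = (if u \<in> words s m then
     \<Sum>i\<in>{i. i < length u \<and> take i u = replicate i k}. (- t) ^ i / fact i * a (drop i u) else 0)"

text \<open>Reindexing by the pair of the stripped word and the number of stripped letters: a word
  may arise from several shorter ones by prepending copies of \<open>k\<close>. The values
  \<open>g\<close> are arbitrary, so the same identity serves power series and vector
  fields.\<close>

lemma sum_push:
  fixes g :: "nat list \<Rightarrow> 'b::real_vector"
  assumes k: "k \<in> {1..m}"
  shows "(\<Sum>u\<in>words s m. push s m k t a u *\<^sub>R g u) =
     (\<Sum>v\<in>words s m. \<Sum>i\<in>{..s - length v}. (a v * ((- t) ^ i / fact i)) *\<^sub>R g (replicate i k @ v))"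
proof -
  have "(\<Sum>u\<in>words s m. push s m k t a u *\<^sub>R g u) =
    (\<Sum>u\<in>words s m. \<Sum>i\<in>{i. i < length u \<and> take i u = replicate i k}. ((- t) ^ i / fact i * a (drop i u)) *\<^sub>R g u)"
    by (rule sum.cong) (auto simp: push_def scaleR_sum_left)
  also have "\<dots> = (\<Sum>(u, i)\<in>Sigma (words s m) (\<lambda>u. {i. i < length u \<and> take i u = replicate i k}). ((- t) ^ i / fact i * a (drop i u)) *\<^sub>R g u)"
    by (rule sum.Sigma) (auto simp: finite_words)
  also have "\<dots> = (\<Sum>(v, i)\<in>Sigma (words s m) (\<lambda>v. {..s - length v}). (a v * ((- t) ^ i / fact i)) *\<^sub>R g (replicate i k @ v))"
  proof (rule sum.reindex_bij_witness[where i = "\<lambda>(v, i). (replicate i k @ v, i)" and j = "\<lambda>(u, i). (drop i u, i)"])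
    fix p assume "p \<in> Sigma (words s m) (\<lambda>u. {i. i < length u \<and> take i u = replicate i k})"
    then obtain u i where p: "p = (u, i)" "u \<in> words s m" "i < length u" "take i u = replicate i k" by auto
    have u: "replicate i k @ drop i u = u" using p(4) append_take_drop_id[of i u] by simp
    then show "(case case p of (u, i) \<Rightarrow> (drop i u, i) of (v, i) \<Rightarrow> (replicate i k @ v, i)) = p" by (simp add: p)
    show "(case p of (u, i) \<Rightarrow> (drop i u, i)) \<in> Sigma (words s m) (\<lambda>v. {..s - length v})"
      using p set_drop_subset[of i u] by (auto simp: words_def)
    show "(case case p of (u, i) \<Rightarrow> (drop i u, i) of (v, i) \<Rightarrow> (a v * ((- t) ^ i / fact i)) *\<^sub>R g (replicate i k @ v)) =
       (case p of (u, i) \<Rightarrow> ((- t) ^ i / fact i * a (drop i u)) *\<^sub>R g u)"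
      using u by (simp add: p mult.commute)
  next
    fix p assume "p \<in> Sigma (words s m) (\<lambda>v. {..s - length v})"
    then obtain v i where p: "p = (v, i)" "v \<in> words s m" "i \<le> s - length v" by auto
    then show "(case case p of (v, i) \<Rightarrow> (replicate i k @ v, i) of (u, i) \<Rightarrow> (drop i u, i)) = p" by simp
    show "(case p of (v, i) \<Rightarrow> (replicate i k @ v, i)) \<in> Sigma (words s m) (\<lambda>u. {i. i < length u \<and> take i u = replicate i k})"
      using p k by (auto simp: words_def)
  qed
  also have "\<dots> = (\<Sum>v\<in>words s m. \<Sum>i\<in>{..s - length v}. (a v * ((- t) ^ i / fact i)) *\<^sub>R g (replicate i k @ v))"
    by (rule sum.Sigma[symmetric]) (auto simp: finite_words)
  finally show ?thesis .
qed

definition lie_sum :: "nat \<Rightarrow> nat \<Rightarrow> (nat list \<Rightarrow> real) \<Rightarrow> ncs" where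
  "lie_sum s m b = (\<Sum>v\<in>words s m. scal (b v) (lie_word v))"

lemma cf_lie_sum: "cf (lie_sum s m b) u = (\<Sum>v\<in>words s m. b v * cf (lie_word v) u)"
  by (simp add: lie_sum_def cf_sum)

definition eq_upto :: "nat \<Rightarrow> ncs \<Rightarrow> ncs \<Rightarrow> bool" where
  "eq_upto s a b \<longleftrightarrow> (\<forall>u. length u \<le> s \<longrightarrow> cf a u = cf b u)"

lemma eq_upto_refl: "eq_upto s a a" by (simp add: eq_upto_def)
lemma eq_upto_trans: "eq_upto s a b \<Longrightarrow> eq_upto s b c \<Longrightarrow> eq_upto s a c" by (simp add: eq_upto_def)
lemma eq_upto_add: "eq_upto s a b \<Longrightarrow> eq_upto s c d \<Longrightarrow> eq_upto s (a + c) (b + d)" by (simp add: eq_upto_def)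
lemma eq_upto_mult: assumes "eq_upto s a b" "eq_upto s c d" shows "eq_upto s (a * c) (b * d)"
  unfolding eq_upto_def
proof (intro allI impI)
  fix u :: "nat list" assume u: "length u \<le> s"
  show "cf (a * c) u = cf (b * d) u"
    unfolding cf_mult by (rule sum.cong) (use assms u in \<open>auto simp: splits_def eq_upto_def\<close>)
qed

lemma sum_mult_ncs: "x * (\<Sum>v\<in>S. a v) * y = (\<Sum>v\<in>S. x * a v * (y::ncs))"
  by (simp add: sum_distrib_left sum_distrib_right)

text \<open>By homogeneity a word \<open>u\<close> receives a contribution from \<open>v\<close>
  only for the power \<open>length u - length v\<close>, and this power lies within the truncation
  because \<open>length u \<le> s\<close>.\<close>

lemma lie_sum_push:
  assumes k: "k \<in> {1..m}"
  shows "eq_upto s (lie_sum s m (push s m k e b)) (exp_letter k (- e) * lie_sum s m b * exp_letter k e)"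
  unfolding eq_upto_def
proof (intro allI impI)
  fix u :: "nat list" assume u: "length u \<le> s"
  have "cf (lie_sum s m (push s m k e b)) u =
     (\<Sum>v\<in>words s m. \<Sum>i\<in>{..s - length v}. (b v * ((- e) ^ i / fact i)) * cf (lie_word (replicate i k @ v)) u)"
    using sum_push[OF k, of s e b "\<lambda>v. cf (lie_word v) u"] by (simp add: cf_lie_sum)
  also have "\<dots> = (\<Sum>v\<in>words s m. b v * cf (exp_letter k (- e) * lie_word v * exp_letter k e) u)"
  proof (rule sum.cong[OF refl])
    fix v assume v: "v \<in> words s m"
    then have v0: "v \<noteq> []" by (auto simp: words_def)
    let ?i = "length u - length v"
    have "(\<Sum>i\<in>{..s - length v}. (b v * ((- e) ^ i / fact i)) * cf (lie_word (replicate i k @ v)) u) =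
      (\<Sum>i\<in>{..s - length v}. if i = ?i then (if length v \<le> length u then (b v * ((- e) ^ ?i / fact ?i)) * cf (lie_word (replicate ?i k @ v)) u else 0) else 0)"
      by (rule sum.cong) (auto simp: cf_lie_word_length)
    also have "\<dots> = (if length v \<le> length u then (b v * ((- e) ^ ?i / fact ?i)) * cf (lie_word (replicate ?i k @ v)) u else 0)"
      using u by auto
    also have "\<dots> = b v * cf (exp_letter k (- e) * lie_word v * exp_letter k e) u"
      unfolding cf_conj_exp_letter[OF homog_lie_word] lie_word_replicate[OF v0] by auto
    finally show "(\<Sum>i\<in>{..s - length v}. (b v * ((- e) ^ i / fact i)) * cf (lie_word (replicate i k @ v)) u) = b v * cf (exp_letter k (- e) * lie_word v * exp_letter k e) u" .
  qed
  also have "\<dots> = cf (exp_letter k (- e) * lie_sum s m b * exp_letter k e) u"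
    by (simp add: lie_sum_def sum_mult_ncs cf_sum scal_mult)
  finally show "cf (lie_sum s m (push s m k e b)) u = cf (exp_letter k (- e) * lie_sum s m b * exp_letter k e) u" .
qed

text \<open>The commutator coefficients of the \<open>\<tau>\<close>-derivative of the product of the flows \<open>e\<^bsup>e \<tau> X\<^sub>k\<^esup>\<close> along \<open>es\<close>: each new
  factor pushes the previous velocity forward and adds its own.\<close>

definition run_coeff :: "nat \<Rightarrow> nat \<Rightarrow> real \<Rightarrow> (nat \<times> real) list \<Rightarrow> nat list \<Rightarrow> real" where
  "run_coeff s m \<tau> es = foldl (\<lambda>a (k, e) u. push s m k (e * \<tau>) a u + (if u = [k] then e else 0)) (\<lambda>_. 0) es"

lemma run_coeff_Nil: "run_coeff s m \<tau> [] = (\<lambda>_. 0)" by (simp add: run_coeff_def)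
lemma run_coeff_snoc: "run_coeff s m \<tau> (es @ [(k, e)]) = (\<lambda>u. push s m k (e * \<tau>) (run_coeff s m \<tau> es) u + (if u = [k] then e else 0))"
  by (simp add: run_coeff_def)

text \<open>Flows act on functions by composition, which reverses their order: the flow that is run
  earliest becomes the leftmost factor, the outermost operator.\<close>

definition exp_prod :: "(nat \<times> real) list \<Rightarrow> ncs" where
  "exp_prod es = prod_list (map (\<lambda>(k, e). exp_letter k e) es)"

lemma exp_prod_append: "exp_prod (es @ fs) = exp_prod es * exp_prod fs" by (simp add: exp_prod_def)
lemma exp_prod_single: "exp_prod [(k, e)] = exp_letter k e" by (simp add: exp_prod_def)

text \<open>Both sides solve the same recursion, since \<open>deg\<close> is a derivation and \<open>deg e\<^bsup>X\<^esup> = e\<^bsup>X\<^esup> X\<close>.\<close>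

lemma exp_prod_lie_sum_run_coeff:
  assumes "\<And>k e. (k, e) \<in> set es \<Longrightarrow> k \<in> {1..m}" and s: "1 \<le> s"
  shows "eq_upto s (exp_prod es * lie_sum s m (run_coeff s m 1 es)) (deg (exp_prod es))"
  using assms(1)
proof (induction es rule: rev_induct)
  case Nil
  show ?case by (auto simp: eq_upto_def run_coeff_Nil lie_sum_def exp_prod_def cf_sum)
next
  case (snoc p es)
  obtain k e where p: "p = (k, e)" by (cases p)
  have k: "k \<in> {1..m}" using snoc.prems[of k e] by (simp add: p)
  have IH: "eq_upto s (exp_prod es * lie_sum s m (run_coeff s m 1 es)) (deg (exp_prod es))" using snoc by auto
  let ?D = "run_coeff s m 1 es" and ?G = "exp_prod es"
  have kw: "[k] \<in> words s m" using k s by (auto simp: words_def)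
  have L: "lie_sum s m (run_coeff s m 1 (es @ [(k, e)])) = lie_sum s m (push s m k e ?D) + scal e (letter k)"
  proof (rule ncs_eqI)
    fix u
    have "(\<Sum>v\<in>words s m. (if v = [k] then e else 0) * cf (lie_word v) u) = (\<Sum>v\<in>words s m. if v = [k] then e * cf (lie_word [k]) u else 0)"
      by (rule sum.cong) auto
    then show "cf (lie_sum s m (run_coeff s m 1 (es @ [(k, e)]))) u = cf (lie_sum s m (push s m k e ?D) + scal e (letter k)) u"
      using kw by (simp add: cf_lie_sum run_coeff_snoc distrib_right sum.distrib finite_words)
  qed
  have "eq_upto s (?G * exp_letter k e * (lie_sum s m (push s m k e ?D) + scal e (letter k)))
     (?G * exp_letter k e * (exp_letter k (- e) * lie_sum s m ?D * exp_letter k e + scal e (letter k)))"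
    by (intro eq_upto_mult eq_upto_add eq_upto_refl lie_sum_push k)
  \<comment> \<open>The exponential of the new letter meets the inverse produced by the conjugation,
    which leaves the induction hypothesis times the last exponential.\<close>
  also have "?G * exp_letter k e * (exp_letter k (- e) * lie_sum s m ?D * exp_letter k e + scal e (letter k))
     = ?G * (exp_letter k e * exp_letter k (- e)) * lie_sum s m ?D * exp_letter k e + ?G * (exp_letter k e * scal e (letter k))"
    by (simp add: algebra_simps)
  also have "\<dots> = (?G * lie_sum s m ?D) * exp_letter k e + ?G * deg (exp_letter k e)"
    by (simp add: exp_letter_inverse deg_exp_letter(2))
  finally have 1: "eq_upto s (?G * exp_letter k e * (lie_sum s m (push s m k e ?D) + scal e (letter k)))
     ((?G * lie_sum s m ?D) * exp_letter k e + ?G * deg (exp_letter k e))" .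
  have 2: "eq_upto s ((?G * lie_sum s m ?D) * exp_letter k e + ?G * deg (exp_letter k e)) (deg ?G * exp_letter k e + ?G * deg (exp_letter k e))"
    by (intro eq_upto_mult eq_upto_add eq_upto_refl IH)
  show ?case unfolding p L exp_prod_append exp_prod_single deg_mult by (rule eq_upto_trans[OF 1 2])
qed

section \<open>Leading terms of formal group commutators\<close>

lemma exp_prod_invseq: "exp_prod es * exp_prod (invseq es) = 1"
proof (induction es rule: rev_induct)
  case Nil show ?case by (simp add: exp_prod_def invseq_def)
next
  case (snoc p es)
  obtain k e where p: "p = (k, e)" by (cases p)
  have i: "invseq (es @ [(k, e)]) = [(k, - e)] @ invseq es" by (simp add: invseq_def)
  have "exp_prod (es @ [p]) * exp_prod (invseq (es @ [p])) = exp_prod es * (exp_letter k e * exp_letter k (- e)) * exp_prod (invseq es)"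
    unfolding p i exp_prod_append exp_prod_single by (simp add: mult.assoc)
  then show ?case using snoc by (simp add: exp_letter_inverse)
qed

lemma exp_prod_cf_Nil: "cf (exp_prod es) [] = 1"
proof (induction es rule: rev_induct)
  case Nil show ?case by (simp add: exp_prod_def)
next
  case (snoc p es)
  have "cf (exp_prod es * exp_letter (fst p) (snd p)) [] = cf (exp_prod es) [] * cf (exp_letter (fst p) (snd p)) []"
    using low_mult(2)[OF low_0 low_0, of "[]"] by simp
  then show ?case using snoc exp_prod_append[of es "[p]"] exp_prod_single[of "fst p" "snd p"] by (simp add: cf_exp_letter)
qed

lemma low_diff_1: "cf a [] = 1 \<Longrightarrow> low 1 (a - 1)" by (simp add: low_def)

text \<open>A group commutator satisfies A C A' C' - 1 = (A C - C A) A' C', where A' and C' invert A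
  and C. The trailing factor has constant term 1, so the leading part is the commutator of the
  leading parts of A - 1 and C - 1.\<close>

lemma exp_prod_cseq:
  assumes "w \<noteq> []"
  shows "length u \<le> length w \<Longrightarrow> cf (exp_prod (cseq 1 w) - 1) u = cf (lie_word w) u"
  using assms
proof (induction w arbitrary: u rule: lie_word.induct)
  case (2 k)
  then show ?case by (cases u) (auto simp: exp_prod_def cf_exp_letter)
next
  case (3 k l w)
  let ?A = "exp_letter k 1" and ?A' = "exp_letter k (- 1)" and ?C = "exp_prod (cseq 1 (l # w))" and ?C' = "exp_prod (invseq (cseq 1 (l # w)))"
  let ?p = "length (l # w)"
  have G: "exp_prod (cseq 1 (k # l # w)) = ?A * ?C * ?A' * ?C'"
    by (simp add: exp_prod_append[symmetric] exp_prod_single[symmetric] del: cseq.simps(1,2))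
  have "(?A * ?C - ?C * ?A) * (?A' * ?C') = ?A * ?C * ?A' * ?C' - ?C * (?A * ?A') * ?C'"
    by (simp add: algebra_simps)
  then have G1: "exp_prod (cseq 1 (k # l # w)) - 1 = (?A * ?C - ?C * ?A) * (?A' * ?C')"
    unfolding G by (simp add: exp_letter_inverse exp_prod_invseq)
  \<comment> \<open>Subtracting 1 from each factor leaves the commutator unchanged and makes visible
    that its order is at least \<open>1 + ?p\<close>.\<close>
  have AC: "?A * ?C - ?C * ?A = (?A - 1) * (?C - 1) - (?C - 1) * (?A - 1)" by (simp add: algebra_simps)
  have IH: "\<And>u. length u \<le> ?p \<Longrightarrow> cf (?C - 1) u = cf (lie_word (l # w)) u" using 3 by simp
  have lA: "low 1 (?A - 1)" by (rule low_diff_1) (simp add: cf_exp_letter)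
  have lC: "low ?p (?C - 1)" unfolding low_def using IH cf_lie_word_length by (metis less_imp_le nat_neq_iff)
  have l1: "low (1 + ?p) ((?A - 1) * (?C - 1))" by (rule low_mult[OF lA lC])
  have l2: "low (1 + ?p) ((?C - 1) * (?A - 1))" using low_mult(1)[OF lC lA] by (simp add: add.commute)
  have lB: "low (1 + ?p) (?A * ?C - ?C * ?A)" unfolding AC using l1 l2 by (simp add: low_def)
  have c1: "cf (?A' * ?C') [] = 1"
    using low_mult(2)[OF low_0 low_0, of "[]" ?A' ?C'] by (simp add: exp_prod_cf_Nil cf_exp_letter)
  have A1: "cf (?A - 1) [a] = cf (letter k) [a]" for a by (simp add: cf_exp_letter)
  show ?case
  proof (cases "length u = 1 + ?p")
    case False
    then have "length u < 1 + ?p" using 3(2) by simp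
    moreover have "low (1 + ?p + 0) ((?A * ?C - ?C * ?A) * (?A' * ?C'))" by (rule low_mult[OF lB low_0])
    ultimately have "cf (exp_prod (cseq 1 (k # l # w)) - 1) u = 0" unfolding G1 by (simp add: low_def)
    then show ?thesis using False cf_lie_word_length[of u "k # l # w"] by (metis length_Cons plus_1_eq_Suc)
  next
    case True
    have "cf (exp_prod (cseq 1 (k # l # w)) - 1) u = cf (?A * ?C - ?C * ?A) (take (1 + ?p) u) * cf (?A' * ?C') (drop (1 + ?p) u)"
      unfolding G1 using True by (intro low_mult(2)[OF lB low_0]) simp
    also have "\<dots> = cf ((?A - 1) * (?C - 1)) u - cf ((?C - 1) * (?A - 1)) u"
      using True c1 AC by simp
    also have "cf ((?A - 1) * (?C - 1)) u = cf (?A - 1) (take 1 u) * cf (?C - 1) (drop 1 u)"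
      using True by (intro low_mult(2)[OF lA lC]) simp
    also have "\<dots> = (if u \<noteq> [] \<and> hd u = k then cf (lie_word (l # w)) (tl u) else 0)"
    proof (cases u)
      case (Cons a u')
      then have "cf (?C - 1) u' = cf (lie_word (l # w)) u'" using True IH by simp
      then show ?thesis using Cons A1[of a] by simp
    qed (use True in simp)
    also have "cf ((?C - 1) * (?A - 1)) u = cf (?C - 1) (take ?p u) * cf (?A - 1) (drop ?p u)"
      using True by (intro low_mult(2)[OF lC lA]) simp
    also have "\<dots> = (if u \<noteq> [] \<and> last u = k then cf (lie_word (l # w)) (butlast u) else 0)"
    proof (cases u rule: rev_cases)
      case (snoc u' a)
      then have "cf (?C - 1) u' = cf (lie_word (l # w)) u'" using True IH by simp
      then show ?thesis using snoc A1[of a] True by simp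
    qed (use True in simp)
    finally show ?thesis by (simp add: cf_ad_letter)
  qed
qed simp

text \<open>If (1 + a)(1 + b) = 1 then b = - a - a b, and the product a b starts beyond degree
  \<open>length w\<close>.\<close>

lemma exp_prod_invseq_cseq:
  assumes "w \<noteq> []" "length u \<le> length w"
  shows "cf (exp_prod (invseq (cseq 1 w)) - 1) u = - cf (lie_word w) u"
proof -
  let ?G = "exp_prod (cseq 1 w)" and ?H = "exp_prod (invseq (cseq 1 w))"
  have "(?G - 1) + (?H - 1) + (?G - 1) * (?H - 1) = 0" using exp_prod_invseq[of "cseq 1 w"] by (simp add: algebra_simps)
  then have "cf ((?G - 1) + (?H - 1) + (?G - 1) * (?H - 1)) u = 0" by simp
  moreover have "cf ((?G - 1) * (?H - 1)) u = 0"
  proof -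
    have "low (length w) (?G - 1)" unfolding low_def using exp_prod_cseq[OF assms(1)] cf_lie_word_length by (metis less_imp_le nat_neq_iff)
    from low_mult(1)[OF this low_diff_1[OF exp_prod_cf_Nil]] show ?thesis using assms(2) by (simp add: low_def)
  qed
  ultimately show ?thesis using exp_prod_cseq[OF assms] by simp
qed

text \<open>Since the product G differs from 1 only from degree \<open>length w\<close> on and the
  Lie sum L has no constant term, G L = \<open>deg\<close> G forces L and \<open>deg\<close> G to
  agree up to that degree. The factor \<open>real (length w)\<close> is produced by
  \<open>deg\<close>.\<close>

lemma lie_sum_run_coeff_low:
  assumes es: "\<And>k e. (k, e) \<in> set es \<Longrightarrow> k \<in> {1..m}" and w: "w \<in> words s m"
    and G: "\<And>u. length u \<le> length w \<Longrightarrow> cf (exp_prod es - 1) u = c * cf (lie_word w) u"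
    and u: "length u \<le> length w"
  shows "cf (lie_sum s m (run_coeff s m 1 es)) u = c * real (length w) * cf (lie_word w) u"
proof -
  let ?L = "lie_sum s m (run_coeff s m 1 es)"
  have ws: "length w \<le> s" "1 \<le> length w" using w by (auto simp: words_def)
  have "eq_upto s (exp_prod es * ?L) (deg (exp_prod es))" using exp_prod_lie_sum_run_coeff[OF es] ws by auto
  then have e: "cf (exp_prod es * ?L) u = real (length u) * cf (exp_prod es) u" using u ws by (simp add: eq_upto_def)
  have lL: "low 1 ?L"
  proof -
    have "cf (lie_word v) [] = 0" if "v \<in> words s m" for v using that cf_lie_word_length[of "[]" v] by (cases v) (auto simp: words_def)
    then show ?thesis by (auto simp: low_def cf_lie_sum)
  qed
  have lG: "low (length w) (exp_prod es - 1)" unfolding low_def using G cf_lie_word_length by (metis less_imp_le mult_zero_right nat_neq_iff)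
  have "cf ((exp_prod es - 1) * ?L) u = 0" using low_mult(1)[OF lG lL] u by (simp add: low_def)
  moreover have "exp_prod es * ?L = ?L + (exp_prod es - 1) * ?L" by (simp add: algebra_simps)
  ultimately have "cf (exp_prod es * ?L) u = cf ?L u" by simp
  with e have 1: "cf ?L u = real (length u) * cf (exp_prod es) u" by simp
  have "real (length u) * cf (exp_prod es) u = real (length u) * cf (exp_prod es - 1) u" by auto
  also have "\<dots> = c * real (length w) * cf (lie_word w) u"
    using G[OF u] cf_lie_word_length[of u w] by (cases "length u = length w") auto
  finally show ?thesis using 1 by simp
qed

section \<open>Pushing commutators forward along flows\<close>

lemma Xop_Xop_expand:
  fixes g :: "real^'n \<Rightarrow> 'b::real_normed_vector"
  assumes F: "\<And>r. Ck r F" and H: "\<And>r. Ck r H" and g: "\<And>r. Ck r g"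
  shows "Xop F (Xop H g) x = (\<Sum>i\<in>UNIV. \<Sum>j\<in>UNIV. (F x $ i * H x $ j) *\<^sub>R pd i (pd j g) x)
     + (\<Sum>j\<in>UNIV. Xop F H x $ j *\<^sub>R pd j g x)"
proof -
  have Hg: "Xop H g = (\<lambda>x. \<Sum>j\<in>UNIV. H x $ j *\<^sub>R pd j g x)" using Ck_Xop_eq[OF g] by auto
  have c: "Ck r (\<lambda>x. H x $ j)" "Ck r (pd j g)" for r j using Ck_vec_nth[OF H] Ck_pd[OF g] by auto
  have "Xop F (Xop H g) x = (\<Sum>i\<in>UNIV. F x $ i *\<^sub>R pd i (Xop H g) x)"
    by (rule Ck_Xop_eq[OF Ck_Xop[OF H g]])
  also have "\<dots> = (\<Sum>i\<in>UNIV. F x $ i *\<^sub>R (\<Sum>j\<in>UNIV. H x $ j *\<^sub>R pd i (pd j g) x + pd i H x $ j *\<^sub>R pd j g x))"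
    unfolding Hg using c by (simp add: pd_sum Ck_scaleR pd_scaleR pd_vec_nth[OF H])
  also have "\<dots> = (\<Sum>i\<in>UNIV. \<Sum>j\<in>UNIV. (F x $ i * H x $ j) *\<^sub>R pd i (pd j g) x)
     + (\<Sum>i\<in>UNIV. \<Sum>j\<in>UNIV. (F x $ i * pd i H x $ j) *\<^sub>R pd j g x)"
    by (simp add: scaleR_sum_right scaleR_add_right sum.distrib)
  also have "(\<Sum>i\<in>UNIV. \<Sum>j\<in>UNIV. (F x $ i * pd i H x $ j) *\<^sub>R pd j g x) =
      (\<Sum>j\<in>UNIV. Xop F H x $ j *\<^sub>R pd j g x)"
    unfolding Ck_Xop_eq[OF H] by (subst sum.swap) (simp add: scaleR_sum_left)
  finally show ?thesis .
qed

text \<open>The second-order parts of both compositions coincide by symmetry of second derivatives,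
  so their difference is a first-order operator.\<close>

lemma Xop_commutator:
  fixes g :: "real^'n \<Rightarrow> 'b::real_normed_vector"
  assumes F: "\<And>r. Ck r F" and H: "\<And>r. Ck r H" and g: "\<And>r. Ck r g"
  shows "Xop (\<lambda>x. Xop F H x - Xop H F x) g x = Xop F (Xop H g) x - Xop H (Xop F g) x"
proof -
  have "(\<Sum>i\<in>UNIV. \<Sum>j\<in>UNIV. (F x $ i * H x $ j) *\<^sub>R pd i (pd j g) x) =
    (\<Sum>i\<in>UNIV. \<Sum>j\<in>UNIV. (H x $ i * F x $ j) *\<^sub>R pd i (pd j g) x)"
    by (subst sum.swap) (simp add: pd_commute[OF g] mult.commute)
  then show ?thesis
    unfolding Xop_Xop_expand[OF F H g] Xop_Xop_expand[OF H F g] Ck_Xop_eq[OF g]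
    by (simp add: scaleR_diff_left sum_subtractf)
qed

lemma Xop_sum_right:
  assumes "\<And>i. i \<in> S \<Longrightarrow> Ck (Suc 0) (g i)"
  shows "Xop F (\<lambda>x. \<Sum>i\<in>S. c i *\<^sub>R g i x) x = (\<Sum>i\<in>S. c i *\<^sub>R Xop F (g i) x)"
proof -
  have "((\<lambda>x. \<Sum>i\<in>S. c i *\<^sub>R g i x) has_derivative (\<lambda>h. \<Sum>i\<in>S. c i *\<^sub>R dir (g i) x h)) (at x)"
    by (intro has_derivative_sum has_derivative_scaleR_right Ck_has_derivative_dir[of 0] assms)
  from has_derivative_imp_Xop(2)[OF this] have "Xop F (\<lambda>x. \<Sum>i\<in>S. c i *\<^sub>R g i x) x = (\<Sum>i\<in>S. c i *\<^sub>R dir (g i) x (F x))" .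
  also have "\<dots> = (\<Sum>i\<in>S. c i *\<^sub>R Xop F (g i) x)"
    by (rule sum.cong[OF refl]) (simp add: has_derivative_imp_Xop(2)[OF Ck_has_derivative_dir[OF assms]])
  finally show ?thesis .
qed

section \<open>Substitution of differential operators for letters\<close>

definition words_of_length :: "nat \<Rightarrow> nat \<Rightarrow> nat list set" where
  "words_of_length m p = {u. set u \<subseteq> {1..m} \<and> length u = p}"

lemma finite_words_of_length: "finite (words_of_length m p)"
  unfolding words_of_length_def using finite_lists_length_eq[of "{1..m}" p] by simp

definition word_op :: "(nat \<Rightarrow> real^'n \<Rightarrow> real^'n) \<Rightarrow> nat list \<Rightarrow> (real^'n \<Rightarrow> 'b::real_normed_vector) \<Rightarrow> real^'n \<Rightarrow> 'b" where
  "word_op Z u g = foldr (\<lambda>k. Xop (Z k)) u g"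

lemma Ck_word_op: "(\<And>k r. Ck r (Z k)) \<Longrightarrow> (\<And>r. Ck r g) \<Longrightarrow> Ck r (word_op Z u g)"
  by (induction u arbitrary: r) (auto simp: word_op_def intro: Ck_Xop)

lemma fw_Cons: "v \<noteq> [] \<Longrightarrow> fw f (k # v) = (\<lambda>x. Xop (f k) (fw f v) x - Xop (fw f v) (f k) x)"
  by (cases v) auto

text \<open>Substituting the operators of the fields for the letters turns formal commutators into
  commutators of operators, and those are the iterated vector fields.\<close>

lemma Xop_fw:
  fixes Z :: "nat \<Rightarrow> real^'n \<Rightarrow> real^'n" and g :: "real^'n \<Rightarrow> 'b::real_normed_vector"
  assumes Z: "\<And>k r. Ck r (Z k)" and v: "v \<noteq> []" "set v \<subseteq> {1..m}" and g: "\<And>r. Ck r g"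
  shows "Xop (fw Z v) g x = (\<Sum>u\<in>words_of_length m (length v). cf (lie_word v) u *\<^sub>R word_op Z u g x)"
  using v g
proof (induction v arbitrary: g x rule: lie_word.induct)
  case (2 k)
  have "(\<Sum>u\<in>words_of_length m (length [k]). cf (lie_word [k]) u *\<^sub>R word_op Z u g x) = (\<Sum>u\<in>words_of_length m 1. if u = [k] then word_op Z [k] g x else 0)"
    by (rule sum.cong) auto
  then show ?case using 2 by (simp add: finite_words_of_length) (simp add: words_of_length_def word_op_def)
next
  case (3 k l w)
  let ?v = "l # w" and ?n = "length (l # w)"
  have k: "k \<in> {1..m}" using 3 by simp
  have IH: "Xop (fw Z ?v) g x = (\<Sum>u\<in>words_of_length m ?n. cf (lie_word ?v) u *\<^sub>R word_op Z u g x)"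
    if "\<And>r. Ck r g" for g :: "real^'n \<Rightarrow> 'b" and x using 3 that by simp
  have Cv: "Ck r (fw Z ?v)" for r by (rule Ck_fw) (rule Z)
  have Ckg: "Ck r (Xop (Z k) g)" for r by (rule Ck_Xop[OF Z 3(4)])
  have "Xop (fw Z (k # ?v)) g x = Xop (Z k) (Xop (fw Z ?v) g) x - Xop (fw Z ?v) (Xop (Z k) g) x"
    using Xop_commutator[OF Z Cv 3(4)] by simp
  also have "Xop (fw Z ?v) g = (\<lambda>x. \<Sum>u\<in>words_of_length m ?n. cf (lie_word ?v) u *\<^sub>R word_op Z u g x)"
    using IH[OF 3(4)] by auto
  also have "Xop (Z k) (\<lambda>x. \<Sum>u\<in>words_of_length m ?n. cf (lie_word ?v) u *\<^sub>R word_op Z u g x) x = (\<Sum>u\<in>words_of_length m ?n. cf (lie_word ?v) u *\<^sub>R word_op Z (k # u) g x)"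
    by (subst Xop_sum_right) (auto simp: word_op_def intro: Ck_word_op[OF Z 3(4), unfolded word_op_def])
  also have "Xop (fw Z ?v) (Xop (Z k) g) x = (\<Sum>u\<in>words_of_length m ?n. cf (lie_word ?v) u *\<^sub>R word_op Z (u @ [k]) g x)"
    unfolding IH[OF Ckg] by (simp add: word_op_def)
  \<comment> \<open>The sum over words beginning with \<open>k\<close> is extended by zero to all
    words of the new length; the sum over words ending in \<open>k\<close> is treated likewise, and
    the two together match \<open>cf_ad_letter\<close>.\<close>
  also have "(\<Sum>u\<in>words_of_length m ?n. cf (lie_word ?v) u *\<^sub>R word_op Z (k # u) g x) =
     (\<Sum>u\<in>words_of_length m (Suc ?n). (if u \<noteq> [] \<and> hd u = k then cf (lie_word ?v) (tl u) else 0) *\<^sub>R word_op Z u g x)"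
  proof (rule sum.mono_neutral_cong_left[OF finite_words_of_length, of "(#) k ` words_of_length m ?n", THEN trans[rotated]])
    show "(\<Sum>u\<in>words_of_length m ?n. cf (lie_word ?v) u *\<^sub>R word_op Z (k # u) g x) =
       (\<Sum>u\<in>(#) k ` words_of_length m ?n. cf (lie_word ?v) (tl u) *\<^sub>R word_op Z u g x)"
      by (subst sum.reindex) (auto simp: inj_on_def)
    show "\<forall>i\<in>words_of_length m (Suc ?n) - (#) k ` words_of_length m ?n. (if i \<noteq> [] \<and> hd i = k then cf (lie_word ?v) (tl i) else 0) *\<^sub>R word_op Z i g x = 0"
    proof
      fix i assume i: "i \<in> words_of_length m (Suc ?n) - (#) k ` words_of_length m ?n"
      then have "\<not> (i \<noteq> [] \<and> hd i = k)" by (cases i) (auto simp: words_of_length_def)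
      then show "(if i \<noteq> [] \<and> hd i = k then cf (lie_word ?v) (tl i) else 0) *\<^sub>R word_op Z i g x = 0" by auto
    qed
  qed (use k in \<open>auto simp: words_of_length_def\<close>)
  also have "(\<Sum>u\<in>words_of_length m ?n. cf (lie_word ?v) u *\<^sub>R word_op Z (u @ [k]) g x) =
     (\<Sum>u\<in>words_of_length m (Suc ?n). (if u \<noteq> [] \<and> last u = k then cf (lie_word ?v) (butlast u) else 0) *\<^sub>R word_op Z u g x)"
  proof (rule sum.mono_neutral_cong_left[OF finite_words_of_length, of "(\<lambda>u. u @ [k]) ` words_of_length m ?n", THEN trans[rotated]])
    show "(\<Sum>u\<in>words_of_length m ?n. cf (lie_word ?v) u *\<^sub>R word_op Z (u @ [k]) g x) =
       (\<Sum>u\<in>(\<lambda>u. u @ [k]) ` words_of_length m ?n. cf (lie_word ?v) (butlast u) *\<^sub>R word_op Z u g x)"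
      by (subst sum.reindex) (auto simp: inj_on_def)
    show "\<forall>i\<in>words_of_length m (Suc ?n) - (\<lambda>u. u @ [k]) ` words_of_length m ?n. (if i \<noteq> [] \<and> last i = k then cf (lie_word ?v) (butlast i) else 0) *\<^sub>R word_op Z i g x = 0"
    proof
      fix i assume i: "i \<in> words_of_length m (Suc ?n) - (\<lambda>u. u @ [k]) ` words_of_length m ?n"
      then have "\<not> (i \<noteq> [] \<and> last i = k)" by (cases i rule: rev_cases) (auto simp: words_of_length_def)
      then show "(if i \<noteq> [] \<and> last i = k then cf (lie_word ?v) (butlast i) else 0) *\<^sub>R word_op Z i g x = 0" by auto
    qed
  qed (use k in \<open>auto simp: words_of_length_def\<close>)
  finally show ?case by (simp add: cf_ad_letter scaleR_diff_left sum_subtractf)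
qed simp

text \<open>Applied to the identity map, a field returns its own coefficients.\<close>

lemma fw_expand:
  fixes Z :: "nat \<Rightarrow> real^'n \<Rightarrow> real^'n"
  assumes Z: "\<And>k r. Ck r (Z k)" and v: "v \<noteq> []" "set v \<subseteq> {1..m}"
  shows "fw Z v y = (\<Sum>u\<in>words_of_length m (length v). cf (lie_word v) u *\<^sub>R word_op Z u (\<lambda>x. x) y)"
proof -
  have "Xop (fw Z v) (\<lambda>x. x) y = fw Z v y"
    by (rule has_derivative_imp_Xop(2)) (rule has_derivative_ident)
  then show ?thesis using Xop_fw[OF Z v Ck_ident, where x = y] by simp
qed

text \<open>The family \<open>lie_word v\<close> is linearly dependent, so coefficients cannot be compared directly. The identity of power
  series is transported to vector fields by substituting differential operators for the letters.\<close>

lemma run_coeff_cancel: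
  fixes Z :: "nat \<Rightarrow> real^'n \<Rightarrow> real^'n"
  assumes Z: "\<And>k r. Ck r (Z k)"
    and es: "\<And>k e. (k, e) \<in> set es \<Longrightarrow> k \<in> {1..m}" and w: "w \<in> words s m"
    and G: "\<And>u. length u \<le> length w \<Longrightarrow> cf (exp_prod es - 1) u = c * cf (lie_word w) u"
    and p: "p \<le> length w"
  shows "(\<Sum>v\<in>{v\<in>words s m. length v = p}. run_coeff s m 1 es v *\<^sub>R fw Z v y) =
    (if p = length w then (c * real (length w)) *\<^sub>R fw Z w y else 0)"
proof -
  let ?D = "run_coeff s m 1 es" and ?W = "{v\<in>words s m. length v = p}" and ?o = "\<lambda>u. word_op Z u (\<lambda>x. x) y"
  have "(\<Sum>v\<in>?W. ?D v *\<^sub>R fw Z v y) = (\<Sum>v\<in>?W. ?D v *\<^sub>R (\<Sum>u\<in>words_of_length m p. cf (lie_word v) u *\<^sub>R ?o u))"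
  proof (rule sum.cong[OF refl])
    fix v assume "v \<in> ?W"
    then have "v \<noteq> []" "set v \<subseteq> {1..m}" "length v = p" by (auto simp: words_def)
    then show "?D v *\<^sub>R fw Z v y = ?D v *\<^sub>R (\<Sum>u\<in>words_of_length m p. cf (lie_word v) u *\<^sub>R ?o u)"
      using fw_expand[of Z, OF Z, of v m y] by simp
  qed
  also have "\<dots> = (\<Sum>u\<in>words_of_length m p. (\<Sum>v\<in>?W. ?D v * cf (lie_word v) u) *\<^sub>R ?o u)"
    unfolding scaleR_sum_right scaleR_sum_left by (subst sum.swap) simp
  also have "\<dots> = (\<Sum>u\<in>words_of_length m p. (c * real (length w) * cf (lie_word w) u) *\<^sub>R ?o u)"
  proof (rule sum.cong[OF refl])
    fix u assume u: "u \<in> words_of_length m p"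
    \<comment> \<open>Lie words of other lengths have no coefficient at \<open>u\<close>, so the
      part of degree \<open>p\<close> can be read off the full Lie sum.\<close>
    have "(\<Sum>v\<in>?W. ?D v * cf (lie_word v) u) = cf (lie_sum s m ?D) u"
      unfolding cf_lie_sum by (rule sum.mono_neutral_left) (use u in \<open>auto simp: finite_words words_of_length_def intro: cf_lie_word_length\<close>)
    also have "\<dots> = c * real (length w) * cf (lie_word w) u"
      by (rule lie_sum_run_coeff_low[OF es w G]) (use u p in \<open>auto simp: words_of_length_def\<close>)
    finally show "(\<Sum>v\<in>?W. ?D v * cf (lie_word v) u) *\<^sub>R ?o u = (c * real (length w) * cf (lie_word w) u) *\<^sub>R ?o u" by simp
  qed
  also have "\<dots> = (if p = length w then (c * real (length w)) *\<^sub>R fw Z w y else 0)"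
  proof (cases "p = length w")
    case True
    have "w \<noteq> []" "set w \<subseteq> {1..m}" using w by (auto simp: words_def)
    then show ?thesis using fw_expand[of Z, OF Z, of w m y] True by (simp add: scaleR_sum_right)
  next
    case False
    then show ?thesis by (auto intro!: sum.neutral simp: words_of_length_def cf_lie_word_length)
  qed
  finally show ?thesis .
qed

text \<open>The remainder is not divided by a factorial; its order is all that matters. In the
  induction the derivative of the remainder is the remainder of the shifted family
  \<open>g (Suc i)\<close>.\<close>

lemma vector_taylor:
  fixes g :: "nat \<Rightarrow> real \<Rightarrow> 'b::real_normed_vector"
  assumes "\<And>i r. i \<le> N \<Longrightarrow> r \<in> closed_segment 0 t \<Longrightarrow>
      (g i has_vector_derivative g (Suc i) r) (at r within closed_segment 0 t)"
    and "\<And>r. r \<in> closed_segment 0 t \<Longrightarrow> norm (g (Suc N) r) \<le> B"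
  shows "norm (g 0 t - (\<Sum>i\<le>N. (t ^ i / fact i) *\<^sub>R g i 0)) \<le> B * \<bar>t\<bar> ^ Suc N"
  using assms
proof (induction N arbitrary: g t)
  case 0
  then show ?case using vector_mvt_bound[of t "g 0" "g (Suc 0)" B] by simp
next
  case (Suc N)
  have B: "0 \<le> B" using Suc.prems(2)[of 0] norm_ge_zero[of "g (Suc (Suc N)) 0"] by (auto simp del: norm_ge_zero)
  define F where "F r = g 0 r - (g 0 0 + (\<Sum>i\<le>N. (r ^ Suc i / fact (Suc i)) *\<^sub>R g (Suc i) 0))" for r
  have F: "F r = g 0 r - (\<Sum>i\<le>Suc N. (r ^ i / fact i) *\<^sub>R g i 0)" for r
    unfolding F_def by (subst sum.atMost_Suc_shift) simp
  have "norm (F t - F 0) \<le> (B * \<bar>t\<bar> ^ Suc N) * \<bar>t\<bar>"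
  proof (rule vector_mvt_bound)
    fix r assume r: "r \<in> closed_segment 0 t"
    have pd: "((\<lambda>r. (r ^ Suc i / fact (Suc i)) *\<^sub>R c) has_vector_derivative (r ^ i / fact i) *\<^sub>R c) (at r within S)" for i S and c :: 'b
    proof -
      have "((\<lambda>r. r ^ Suc i / fact (Suc i)) has_real_derivative (r ^ i / fact i)) (at r within S)"
        using DERIV_cdivide[OF DERIV_pow[of "Suc i" r S], of "fact (Suc i)"] by (simp add: field_simps del: of_nat_Suc)
      from has_vector_derivative_scaleR[OF this has_vector_derivative_const[of c]] show ?thesis by simp
    qed
    show "(F has_vector_derivative (g (Suc 0) r - (0 + (\<Sum>i\<le>N. (r ^ i / fact i) *\<^sub>R g (Suc i) 0)))) (at r within closed_segment 0 t)"
      unfolding F_def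
      by (intro has_vector_derivative_diff has_vector_derivative_add has_vector_derivative_const has_vector_derivative_sum pd)
        (use Suc.prems(1)[of 0] r in simp)
    have sub: "closed_segment 0 r \<subseteq> closed_segment 0 t" by (rule closed_segment_0_mono[OF r])
    have "norm (g (Suc 0) r - (\<Sum>i\<le>N. (r ^ i / fact i) *\<^sub>R g (Suc i) 0)) \<le> B * \<bar>r\<bar> ^ Suc N"
    proof (rule Suc.IH[of r "\<lambda>i. g (Suc i)"])
      fix i q assume "i \<le> N" "q \<in> closed_segment 0 r"
      then show "(g (Suc i) has_vector_derivative g (Suc (Suc i)) q) (at q within closed_segment 0 r)"
        using Suc.prems(1)[of "Suc i" q] sub by (blast intro: has_vector_derivative_within_subset Suc_le_mono[THEN iffD2])
    qed (use Suc.prems(2) sub in blast)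
    also have "\<dots> \<le> B * \<bar>t\<bar> ^ Suc N"
      using closed_segment_0_abs_le[OF r] B by (intro mult_left_mono power_mono) auto
    finally show "norm (g (Suc 0) r - (0 + (\<Sum>i\<le>N. (r ^ i / fact i) *\<^sub>R g (Suc i) 0))) \<le> B * \<bar>t\<bar> ^ Suc N" by simp
  qed
  moreover have "F 0 = 0" by (simp add: F_def)
  ultimately show ?case by (simp add: F mult.assoc mult.commute mult.left_commute)
qed

text \<open>The commutator bound reaches length \<open>Suc s\<close>, one more than the expansion
  keeps, and is required only on the ball of radius \<open>R\<close>. Points must therefore be kept
  in that ball, which the margins with \<open>M\<close> in the lemmas below provide.\<close>

locale vflows =
  fixes Z :: "nat \<Rightarrow> real^'n \<Rightarrow> real^'n" and L M M2 T B R :: real and s m :: nat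
  assumes Zsm: "Ck r (Z k)" and field: "smooth_field (Z k) L M M2 T"
    and fwB: "set v \<subseteq> {1..m} \<Longrightarrow> 1 \<le> length v \<Longrightarrow> length v \<le> Suc s \<Longrightarrow> norm y < R \<Longrightarrow> norm (fw Z v y) \<le> B"
    and B0: "0 \<le> B" and s1: "1 \<le> s"
begin

abbreviation "\<Phi> k \<equiv> fl T (Z k)"
abbreviation "J k \<equiv> jac T (Z k)"

lemma M0: "0 \<le> M" using smooth_field.bnd[OF field, of 0 0] norm_ge_zero order_trans by blast
lemma T0: "0 < T" using smooth_field.T0[OF field] .

lemma Ck_fwZ: "Ck r (fw Z v)" by (rule Ck_fw) (rule Zsm)

lemma norm_fl: "norm (\<Phi> k t x) \<le> norm x + M * \<bar>t\<bar>"
  using smooth_field.fl_displacement[OF field, of k t x] norm_triangle_sub[of "\<Phi> k t x" x] by simp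

text \<open>Taylor expansion in \<open>r\<close> of the pullback of X_v along the orbit through the
  endpoint, taken at \<open>r = - t\<close>. By \<open>pullback_deriv\<close> each derivative
  prepends a letter \<open>k\<close>, and starting from the endpoint places all commutators there.
  The remainder involves a commutator of length exactly \<open>s + 1\<close>.\<close>

lemma jac_fw:
  assumes v: "v \<in> words s m" and k: "k \<in> {1..m}" and t: "\<bar>t\<bar> < T" and y: "norm (\<Phi> k t x) + M * \<bar>t\<bar> < R"
  shows "norm (J k t x (fw Z v x) - (\<Sum>i\<le>s - length v. ((- t) ^ i / fact i) *\<^sub>R fw Z (replicate i k @ v) (\<Phi> k t x)))
     \<le> 2 * B * \<bar>t\<bar> ^ (s + 1 - length v)"
proof -
  let ?y = "\<Phi> k t x" and ?N = "s - length v"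
  define g where "g i r = J k (- r) (\<Phi> k r ?y) (fw Z (replicate i k @ v) (\<Phi> k r ?y))" for i r
  have v0: "v \<noteq> []" "length v \<le> s" "set v \<subseteq> {1..m}" using v by (auto simp: words_def)
  have "norm (g 0 (- t) - (\<Sum>i\<le>?N. ((- t) ^ i / fact i) *\<^sub>R g i 0)) \<le> (2 * B) * \<bar>- t\<bar> ^ Suc ?N"
  proof (rule vector_taylor)
    fix i r assume r: "r \<in> closed_segment 0 (- t)"
    then have rT: "\<bar>r\<bar> < T" using closed_segment_0_abs_le[OF r] t by simp
    have ne: "replicate i k @ v \<noteq> []" using v0 by simp
    have "(g i has_vector_derivative g (Suc i) r) (at r)"
      unfolding g_def using smooth_field.pullback_deriv[OF field Ck_fwZ rT, of k ?y "replicate i k @ v"] ne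
      by (simp add: fw_Cons)
    then show "(g i has_vector_derivative g (Suc i) r) (at r within closed_segment 0 (- t))"
      by (rule has_vector_derivative_at_within)
  next
    fix r assume r: "r \<in> closed_segment 0 (- t)"
    then have rt: "\<bar>r\<bar> \<le> \<bar>t\<bar>" using closed_segment_0_abs_le[OF r] by simp
    let ?u = "replicate (Suc ?N) k @ v"
    have "norm (\<Phi> k r ?y) \<le> norm ?y + M * \<bar>t\<bar>"
      using norm_fl[of k r ?y] mult_left_mono[OF rt M0] by linarith
    then have "norm (fw Z ?u (\<Phi> k r ?y)) \<le> B"
      using y v0 k by (intro fwB) auto
    then show "norm (g (Suc ?N) r) \<le> 2 * B"
      unfolding g_def using smooth_field.jac_bound[OF field, of k "- r" "\<Phi> k r ?y" "fw Z ?u (\<Phi> k r ?y)"] by linarith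
  qed
  moreover have "g i 0 = fw Z (replicate i k @ v) ?y" for i
    unfolding g_def by (simp add: smooth_field.fl_0[OF field] smooth_field.jac_0[OF field])
  moreover have "g 0 (- t) = J k t x (fw Z v x)"
    unfolding g_def using smooth_field.fl_inverse[OF field, of t k x] t by simp
  moreover have "Suc ?N = s + 1 - length v" using v0 by simp
  ultimately show ?thesis by simp
qed

text \<open>The shape of the claim: \<open>V\<close> is a combination of commutators at \<open>x\<close> of length at least \<open>d\<close>, with coefficients and
  error of the weighted orders in \<open>r\<close> that the theorem asks for.\<close>

definition comm_expansion :: "nat \<Rightarrow> real \<Rightarrow> real \<Rightarrow> (nat list \<Rightarrow> real) \<Rightarrow> real^'n \<Rightarrow> real^'n \<Rightarrow> bool" where
  "comm_expansion d r A a x V \<longleftrightarrow> (\<forall>v. \<bar>a v\<bar> \<le> A * r ^ (length v - d)) \<and> (\<forall>v. v \<notin> words s m \<or> length v < d \<longrightarrow> a v = 0) \<and>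
     norm (V - (\<Sum>v\<in>words s m. a v *\<^sub>R fw Z v x)) \<le> A * r ^ (s + 1 - d)"

text \<open>The loss in one push: \<open>s\<close> bounds the number of terms feeding one
  coefficient, 2 the Jacobian acting on the old error, and \<open>2 * B\<close> per word the
  truncation error of \<open>jac_fw\<close>.\<close>

definition "KK = 2 + real s + 2 * B * card (words s m)"

lemma KK1: "1 \<le> KK" using B0 by (simp add: KK_def add_increasing2)

text \<open>Stripping \<open>i\<close> letters costs \<open>i\<close> powers of \<open>r\<close> in
  the coefficient and the factor \<open>t ^ i\<close> restores them. In the lowest length
  \<open>d\<close> only \<open>i = 0\<close> survives, because shorter words carry no
  coefficient.\<close>

lemma push_bound:
  assumes a: "\<And>v. \<bar>a v\<bar> \<le> A * r ^ (length v - d)" and sup: "\<And>v. v \<notin> words s m \<or> length v < d \<Longrightarrow> a v = 0"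
    and t: "\<bar>t\<bar> \<le> r" and A: "0 \<le> A"
  shows "\<bar>push s m k t a u\<bar> \<le> real s * (A * r ^ (length u - d))"
    and "u \<notin> words s m \<or> length u < d \<Longrightarrow> push s m k t a u = 0"
    and "u \<in> words s m \<Longrightarrow> length u = d \<Longrightarrow> push s m k t a u = a u"
proof -
  have r: "0 \<le> r" using t by simp
  let ?S = "{i. i < length u \<and> take i u = replicate i k}"
  have tm: "\<bar>(- t) ^ i / fact i * a (drop i u)\<bar> \<le> A * r ^ (length u - d)" if "i \<in> ?S" for i
  proof (cases "length (drop i u) < d")
    case True
    then show ?thesis using sup[of "drop i u"] A r by simp
  next
    case False
    have "\<bar>(- t) ^ i / fact i * a (drop i u)\<bar> = \<bar>t\<bar> ^ i / fact i * \<bar>a (drop i u)\<bar>"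
      by (simp add: abs_mult power_abs)
    also have "\<dots> \<le> r ^ i * (A * r ^ (length u - i - d))"
    proof (intro mult_mono)
      have "\<bar>t\<bar> ^ i / fact i \<le> \<bar>t\<bar> ^ i" using fact_ge_1[of i, where 'a = real] by (simp add: divide_le_eq mult_le_cancel_left1)
      also have "\<dots> \<le> r ^ i" using t by (intro power_mono) auto
      finally show "\<bar>t\<bar> ^ i / fact i \<le> r ^ i" .
    qed (use a[of "drop i u"] r in auto)
    also have "\<dots> = A * r ^ (i + (length u - i - d))" by (simp add: power_add)
    \<comment> \<open>Exact for natural numbers, because the stripped word still has length at least
      \<open>d\<close>.\<close>
    also have "i + (length u - i - d) = length u - d" using False that by auto
    finally show ?thesis .
  qed
  have nn: "0 \<le> A * r ^ (length u - d)" using A r by simp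
  have z: "a (drop i u) = 0" if "length u - i < d" for i using sup[of "drop i u"] that by simp
  show "\<bar>push s m k t a u\<bar> \<le> real s * (A * r ^ (length u - d))"
  proof (cases "u \<in> words s m")
    case True
    have "\<bar>push s m k t a u\<bar> \<le> (\<Sum>i\<in>?S. \<bar>(- t) ^ i / fact i * a (drop i u)\<bar>)"
      unfolding push_def if_P[OF True] by (rule sum_abs)
    also have "\<dots> \<le> (\<Sum>i\<in>?S. A * r ^ (length u - d))" by (rule sum_mono) (rule tm)
    also have "\<dots> = real (card ?S) * (A * r ^ (length u - d))" by simp
    also have "\<dots> \<le> real s * (A * r ^ (length u - d))"
    proof (rule mult_right_mono[OF _ nn])
      have "card ?S \<le> card {..<length u}" by (rule card_mono) auto
      then show "real (card ?S) \<le> real s" using True by (auto simp: words_def)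
    qed
    finally show ?thesis .
  qed (use nn in \<open>simp add: push_def\<close>)
  show "push s m k t a u = 0" if u: "u \<notin> words s m \<or> length u < d"
    unfolding push_def using u by (auto intro!: sum.neutral z)
  show "push s m k t a u = a u" if u: "u \<in> words s m" "length u = d"
  proof -
    have "u \<noteq> []" using u by (auto simp: words_def)
    have "push s m k t a u = (\<Sum>i\<in>?S. if i = 0 then a u else 0)"
      unfolding push_def if_P[OF u(1)] by (rule sum.cong) (auto intro!: z simp: u(2)[symmetric])
    then show ?thesis using \<open>u \<noteq> []\<close> by simp
  qed
qed

text \<open>A word of length |v| has coefficient of order |v| - d and truncation error of order s +
  1 - |v|, so every word contributes an error of the same order s + 1 - d.\<close>

lemma comm_expansion_push:
  assumes E: "comm_expansion d r A a x V" and k: "k \<in> {1..m}" and t: "\<bar>t\<bar> \<le> r" "r < T"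
    and y: "norm (\<Phi> k t x) + M * r < R" and A: "0 \<le> A" and d: "d \<le> s"
  shows "comm_expansion d r (KK * A) (push s m k t a) (\<Phi> k t x) (J k t x V)"
proof -
  have r: "0 \<le> r" using t by simp
  have a: "\<And>v. \<bar>a v\<bar> \<le> A * r ^ (length v - d)" and sup: "\<And>v. v \<notin> words s m \<or> length v < d \<Longrightarrow> a v = 0"
    and er: "norm (V - (\<Sum>v\<in>words s m. a v *\<^sub>R fw Z v x)) \<le> A * r ^ (s + 1 - d)"
    using E unfolding comm_expansion_def by auto
  let ?y = "\<Phi> k t x" and ?W = "words s m" and ?S = "\<Sum>v\<in>words s m. a v *\<^sub>R fw Z v x"
  let ?T = "\<lambda>v. \<Sum>i\<le>s - length v. ((- t) ^ i / fact i) *\<^sub>R fw Z (replicate i k @ v) ?y"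
  have lin: "linear (J k t x)" by (rule bounded_linear.linear[OF smooth_field.jac_linear[OF field]])
  have "(\<Sum>u\<in>?W. push s m k t a u *\<^sub>R fw Z u ?y) = (\<Sum>v\<in>?W. a v *\<^sub>R ?T v)"
    unfolding sum_push[OF k] scaleR_sum_right by simp
  then have eq: "J k t x V - (\<Sum>u\<in>?W. push s m k t a u *\<^sub>R fw Z u ?y) =
     J k t x (V - ?S) + (\<Sum>v\<in>?W. a v *\<^sub>R (J k t x (fw Z v x) - ?T v))"
    by (simp add: linear_diff[OF lin] linear_sum[OF lin] linear_cmul[OF lin] scaleR_diff_right sum_subtractf)
  have 1: "norm (J k t x (V - ?S)) \<le> 2 * (A * r ^ (s + 1 - d))"
    using smooth_field.jac_bound[OF field, of k t x "V - ?S"] er by linarith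
  have "norm (\<Sum>v\<in>?W. a v *\<^sub>R (J k t x (fw Z v x) - ?T v)) \<le> (\<Sum>v\<in>?W. 2 * B * (A * r ^ (s + 1 - d)))"
  proof (rule sum_norm_le)
    fix v assume v: "v \<in> ?W"
    show "norm (a v *\<^sub>R (J k t x (fw Z v x) - ?T v)) \<le> 2 * B * (A * r ^ (s + 1 - d))"
    proof (cases "length v < d")
      case True then show ?thesis using sup[of v] A B0 r by simp
    next
      case False
      have vs: "length v \<le> s" using v by (auto simp: words_def)
      have "M * \<bar>t\<bar> \<le> M * r" using t M0 by (intro mult_left_mono) auto
      then have "norm (J k t x (fw Z v x) - ?T v) \<le> 2 * B * \<bar>t\<bar> ^ (s + 1 - length v)"
        using y t by (intro jac_fw[OF v k]) auto
      also have "\<dots> \<le> 2 * B * r ^ (s + 1 - length v)" using t B0 by (intro mult_left_mono power_mono) auto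
      finally have "norm (a v *\<^sub>R (J k t x (fw Z v x) - ?T v)) \<le> (A * r ^ (length v - d)) * (2 * B * r ^ (s + 1 - length v))"
        using a[of v] A r by (simp add: mult_mono)
      also have "\<dots> = 2 * B * (A * r ^ ((length v - d) + (s + 1 - length v)))" by (simp add: power_add)
      also have "(length v - d) + (s + 1 - length v) = s + 1 - d" using False vs by simp
      finally show ?thesis .
    qed
  qed
  then have 2: "norm (\<Sum>v\<in>?W. a v *\<^sub>R (J k t x (fw Z v x) - ?T v)) \<le> (2 * B * card ?W) * (A * r ^ (s + 1 - d))"
    by (simp add: algebra_simps)
  have nn: "0 \<le> A * r ^ q" for q using A r by simp
  have K1: "real s * (A * r ^ q) \<le> KK * A * r ^ q" for q
    using mult_right_mono[OF _ nn[of q], of "real s" KK] B0 by (simp add: KK_def mult.assoc)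
  show ?thesis
    unfolding comm_expansion_def
  proof (intro conjI allI impI)
    fix u
    show "\<bar>push s m k t a u\<bar> \<le> KK * A * r ^ (length u - d)"
      using push_bound(1)[OF a sup t(1) A, of k u] K1[of "length u - d"] by linarith
    show "push s m k t a u = 0" if "u \<notin> words s m \<or> length u < d"
      by (rule push_bound(2)[OF a sup t(1) A that])
  next
    have "norm (J k t x V - (\<Sum>u\<in>?W. push s m k t a u *\<^sub>R fw Z u ?y)) \<le>
       2 * (A * r ^ (s + 1 - d)) + (2 * B * card ?W) * (A * r ^ (s + 1 - d))"
      unfolding eq by (rule norm_triangle_mono[OF 1 2])
    also have "\<dots> = (2 + 2 * B * card ?W) * (A * r ^ (s + 1 - d))" by (simp add: algebra_simps)
    also have "\<dots> \<le> KK * (A * r ^ (s + 1 - d))" by (intro mult_right_mono nn) (simp add: KK_def)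
    finally show "norm (J k t x V - (\<Sum>u\<in>?W. push s m k t a u *\<^sub>R fw Z u ?y)) \<le> KK * A * r ^ (s + 1 - d)"
      by (simp add: mult.assoc)
  qed
qed

lemma push_lowest:
  assumes "comm_expansion d r A a x V" "\<bar>t\<bar> \<le> r" "0 \<le> A" "u \<in> words s m" "length u = d"
  shows "push s m k t a u = a u"
  using push_bound(3)[of a A r d t u k] assms unfolding comm_expansion_def by blast

end

section \<open>Approximate exponentials\<close>

text \<open>The sequence at parameter 1 records only the order of the flows and the signs; \<tau> is
  multiplied in when the flows are run. The flag stands for \<open>0 \<le> t\<close>.\<close>

definition word_seq :: "nat list \<Rightarrow> bool \<Rightarrow> (nat \<times> real) list" where
  "word_seq w b = (if b then cseq 1 w else invseq (cseq 1 w))"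

lemma cseq_mem: "(k, e) \<in> set (cseq 1 w) \<Longrightarrow> k \<in> set w \<and> \<bar>e\<bar> = 1"
proof (induction "1::real" w arbitrary: k e rule: cseq.induct)
  case (3 Z Z' Zs)
  then show ?case by (auto simp: invseq_def)
qed auto

lemma word_seq_mem: "(k, e) \<in> set (word_seq w b) \<Longrightarrow> k \<in> set w" "(k, e) \<in> set (word_seq w b) \<Longrightarrow> \<bar>e\<bar> = 1"
  using cseq_mem by (auto simp: word_seq_def invseq_def split: if_splits) fastforce+

text \<open>Each further letter doubles the length and adds two, so a factor 4 per letter is
  ample.\<close>

lemma length_cseq: "length (cseq \<tau> w) \<le> 4 ^ length w"
proof (induction \<tau> w rule: cseq.induct)
  case (3 \<tau> Z Z' Zs)
  have a: "length (cseq \<tau> (Z' # Zs)) \<le> 4 * 4 ^ length Zs" using 3 by simp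
  have b: "(1::nat) \<le> 4 ^ length Zs" by simp
  have "length (cseq \<tau> (Z # Z' # Zs)) = 2 + 2 * length (cseq \<tau> (Z' # Zs))" by (simp add: invseq_def)
  also have "\<dots> \<le> 16 * 4 ^ length Zs" using a b by linarith
  finally show ?case by simp
qed auto

lemma length_word_seq: "length (word_seq w b) \<le> 4 ^ length w"
  using length_cseq[of 1 w] by (simp add: word_seq_def invseq_def)

section \<open>The time change and the universal coefficients\<close>

definition tau :: "nat list \<Rightarrow> real \<Rightarrow> real" where
  "tau w t = \<bar>t\<bar> powr (1 / real (length w))"

lemma tau_nonneg: "0 \<le> tau w t" by (simp add: tau_def)
lemma tau_0 [simp]: "tau w 0 = 0" by (simp add: tau_def)
lemma tau_pos: "t \<noteq> 0 \<Longrightarrow> 0 < tau w t" by (simp add: tau_def)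

lemma tau_tendsto: "w \<noteq> [] \<Longrightarrow> (t \<longlongrightarrow> t0) A \<Longrightarrow> ((\<lambda>a. tau w (t a)) \<longlongrightarrow> tau w t0) A"
  unfolding tau_def by (rule tendsto_powr'[OF tendsto_rabs tendsto_const]) auto

lemma tau_deriv:
  assumes w: "w \<noteq> []" and t: "t \<noteq> 0"
  shows "(tau w has_real_derivative sgn t / (real (length w) * tau w t ^ (length w - 1))) (at t)"
proof -
  let ?l = "real (length w)"
  have l: "?l > 0" using w by simp
  have pw: "\<bar>t\<bar> powr (1 / ?l - 1) = 1 / tau w t ^ (length w - 1)"
  proof -
    have "tau w t ^ (length w - 1) = \<bar>t\<bar> powr (1 - 1 / ?l)"
      using t l w by (simp add: tau_def powr_realpow[symmetric] powr_powr of_nat_diff Suc_leI diff_divide_distrib)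
    then show ?thesis using t by (simp add: powr_minus[symmetric] divide_inverse)
  qed
  have d: "((\<lambda>x. x powr (1 / ?l)) has_real_derivative (1 / ?l) * x powr (1 / ?l - 1)) (at x)" if "x > 0" for x
    using has_real_derivative_powr[OF that, of "1 / ?l"] by simp
  consider "t > 0" | "t < 0" using t by linarith
  then show ?thesis
  proof cases
    case 1
    have "((\<lambda>x. x powr (1 / ?l)) has_real_derivative sgn t / (?l * tau w t ^ (length w - 1))) (at t)"
      using d[OF 1] 1 pw by (simp add: mult.commute)
    then show ?thesis
      by (rule has_field_derivative_transform_within_open[where S = "{0<..}"]) (use 1 in \<open>auto simp: tau_def\<close>)
  next
    case 2
    have "((\<lambda>x. (- x) powr (1 / ?l)) has_real_derivative ((1 / ?l) * (- t) powr (1 / ?l - 1)) * (- 1)) (at t)"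
      by (rule DERIV_chain2[OF d]) (use 2 in \<open>auto intro!: derivative_eq_intros\<close>)
    then have "((\<lambda>x. (- x) powr (1 / ?l)) has_real_derivative sgn t / (?l * tau w t ^ (length w - 1))) (at t)"
      using 2 pw by (simp add: mult.commute)
    then show ?thesis
      by (rule has_field_derivative_transform_within_open[where S = "{..<0}"]) (use 2 in \<open>auto simp: tau_def\<close>)
  qed
qed

text \<open>For longer words this is \<open>run_coeff\<close> multiplied by the derivative of
  \<open>tau\<close>. Up to length \<open>length w\<close> the values are prescribed instead: 1 at
  \<open>w\<close> and 0 elsewhere. The corresponding values of \<open>run_coeff\<close> may differ;
  only the vector fields they produce in each length agree, by
  \<open>run_coeff_cancel\<close>.\<close>

definition exp_coeff :: "nat \<Rightarrow> nat \<Rightarrow> nat list \<Rightarrow> real \<Rightarrow> nat list \<Rightarrow> real" where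
  "exp_coeff s m w t v = (if v = w then 1 else if v \<in> words s m \<and> length w < length v
     then sgn t / real (length w) * tau w t ^ (length v - length w) * run_coeff s m 1 (word_seq w (0 \<le> t)) v else 0)"

definition push_list :: "nat \<Rightarrow> nat \<Rightarrow> real \<Rightarrow> (nat \<times> real) list \<Rightarrow> (nat list \<Rightarrow> real) \<Rightarrow> nat list \<Rightarrow> real" where
  "push_list s m \<tau> es a = foldl (\<lambda>a (k, e). push s m k (e * \<tau>) a) a es"

text \<open>A commutator of length l carries \<tau>^l in the product of flows, and differentiation
  in \<tau> lowers this power by one.\<close>

lemma run_coeff_homog: "run_coeff s m \<tau> es v = \<tau> ^ (length v - 1) * run_coeff s m 1 es v"
proof (induction es arbitrary: v rule: rev_induct)
  case Nil then show ?case by (simp add: run_coeff_Nil)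
next
  case (snoc p es)
  obtain k e where p: "p = (k, e)" by (cases p)
  have "push s m k (e * \<tau>) (run_coeff s m \<tau> es) v = \<tau> ^ (length v - 1) * push s m k e (run_coeff s m 1 es) v"
  proof (cases "v \<in> words s m")
    case True
    show ?thesis unfolding push_def if_P[OF True] sum_distrib_left
    proof (rule sum.cong[OF refl])
      fix i assume i: "i \<in> {i. i < length v \<and> take i v = replicate i k}"
      have 1: "(- (e * \<tau>)) ^ i = (- e) ^ i * \<tau> ^ i" by (metis mult_minus_left power_mult_distrib)
      have 2: "\<tau> ^ i * \<tau> ^ (length v - i - 1) = \<tau> ^ (length v - 1)"
        unfolding power_add[symmetric] using i by (auto intro!: arg_cong[where f = "power \<tau>"])
      show "(- (e * \<tau>)) ^ i / fact i * run_coeff s m \<tau> es (drop i v) = \<tau> ^ (length v - 1) * ((- e) ^ i / fact i * run_coeff s m 1 es (drop i v))"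
        unfolding snoc[of "drop i v"] 1 length_drop 2[symmetric] by (simp add: mult_ac)
    qed
  qed (simp add: push_def)
  then show ?case unfolding p run_coeff_snoc by (simp add: algebra_simps)
qed

lemma exp_prod_word_seq:
  assumes "w \<noteq> []" "length u \<le> length w"
  shows "cf (exp_prod (word_seq w b) - 1) u = (if b then 1 else - 1) * cf (lie_word w) u"
  using exp_prod_cseq[of w u] exp_prod_invseq_cseq[OF assms] assms by (simp add: word_seq_def)

section \<open>Running a sequence of flows\<close>

context vflows
begin

definition run_fl :: "real \<Rightarrow> (nat \<times> real) list \<Rightarrow> real^'n \<Rightarrow> real^'n" where
  "run_fl \<tau> es x = foldl (\<lambda>y (k, e). \<Phi> k (e * \<tau>) y) x es"

definition run_tangent :: "real \<Rightarrow> (nat \<times> real) list \<Rightarrow> (real^'n) \<times> (real^'n) \<Rightarrow> (real^'n) \<times> (real^'n)" where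
  "run_tangent \<tau> es p = foldl (\<lambda>(y, V) (k, e). (\<Phi> k (e * \<tau>) y, J k (e * \<tau>) y V)) p es"

text \<open>Recursion on the reversed list, because the flow run last is the outer one: it
  transports the velocity accumulated so far and adds its own.\<close>

fun velocity_rev :: "real \<Rightarrow> real^'n \<Rightarrow> (nat \<times> real) list \<Rightarrow> real^'n" where
  "velocity_rev \<tau> x [] = 0"
| "velocity_rev \<tau> x ((k, e) # es) = J k (e * \<tau>) (run_fl \<tau> (rev es) x) (velocity_rev \<tau> x es) + e *\<^sub>R Z k (\<Phi> k (e * \<tau>) (run_fl \<tau> (rev es) x))"

definition run_velocity :: "real \<Rightarrow> (nat \<times> real) list \<Rightarrow> real^'n \<Rightarrow> real^'n" where
  "run_velocity \<tau> es x = velocity_rev \<tau> x (rev es)"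

lemma run_fl_Nil [simp]: "run_fl \<tau> [] x = x" by (simp add: run_fl_def)
lemma run_fl_snoc: "run_fl \<tau> (es @ [(k, e)]) x = \<Phi> k (e * \<tau>) (run_fl \<tau> es x)" by (simp add: run_fl_def)
lemma run_velocity_Nil [simp]: "run_velocity \<tau> [] x = 0" by (simp add: run_velocity_def)
lemma run_velocity_snoc: "run_velocity \<tau> (es @ [(k, e)]) x = J k (e * \<tau>) (run_fl \<tau> es x) (run_velocity \<tau> es x) + e *\<^sub>R Z k (\<Phi> k (e * \<tau>) (run_fl \<tau> es x))"
  by (simp add: run_velocity_def)
lemma run_tangent_Nil [simp]: "run_tangent \<tau> [] p = p" by (simp add: run_tangent_def)
lemma run_tangent_snoc: "run_tangent \<tau> (es @ [(k, e)]) p = (\<Phi> k (e * \<tau>) (fst (run_tangent \<tau> es p)), J k (e * \<tau>) (fst (run_tangent \<tau> es p)) (snd (run_tangent \<tau> es p)))"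
  by (simp add: run_tangent_def split_beta)

lemma fst_run_tangent [simp]: "fst (run_tangent \<tau> es p) = run_fl \<tau> es (fst p)"
  by (induction es rule: rev_induct) (auto simp: run_tangent_snoc run_fl_snoc split_paired_all)

lemma run_fl_0 [simp]: "run_fl 0 es x = x"
  by (induction es rule: rev_induct) (auto simp: run_fl_snoc smooth_field.fl_0[OF field] split_paired_all)

lemma run_tangent_0 [simp]: "run_tangent 0 es p = p"
  by (induction es rule: rev_induct) (auto simp: run_tangent_snoc smooth_field.fl_0[OF field] smooth_field.jac_0[OF field] split_paired_all)

lemma run_fl_norm:
  assumes "\<And>k e. (k, e) \<in> set es \<Longrightarrow> \<bar>e\<bar> = 1" and t: "\<bar>\<tau>\<bar> \<le> r"
  shows "norm (run_fl \<tau> es x) \<le> norm x + M * r * length es"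
  using assms(1)
proof (induction es rule: rev_induct)
  case (snoc p es)
  obtain k e where p: "p = (k, e)" by (cases p)
  have e: "\<bar>e\<bar> = 1" using snoc.prems[of k e] by (simp add: p)
  have "norm (\<Phi> k (e * \<tau>) (run_fl \<tau> es x)) \<le> norm (run_fl \<tau> es x) + M * \<bar>e * \<tau>\<bar>" by (rule norm_fl)
  also have "\<dots> \<le> (norm x + M * r * length es) + M * r"
    using snoc e t M0 by (intro add_mono mult_left_mono) (auto simp: abs_mult)
  finally show ?case by (simp add: p run_fl_snoc algebra_simps)
qed simp

lemma run_fl_tendsto:
  assumes "(\<tau> \<longlongrightarrow> \<tau>0) A" "(x \<longlongrightarrow> x0) A"
  shows "((\<lambda>a. run_fl (\<tau> a) es (x a)) \<longlongrightarrow> run_fl \<tau>0 es x0) A"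
proof (induction es rule: rev_induct)
  case (snoc p es)
  obtain k e where p: "p = (k, e)" by (cases p)
  show ?case unfolding p run_fl_snoc
    by (intro smooth_field.fl_tendsto[OF field] snoc tendsto_mult tendsto_const assms)
qed (use assms in simp)

lemma run_tangent_tendsto:
  assumes "(\<tau> \<longlongrightarrow> \<tau>0) A" "(q \<longlongrightarrow> q0) A"
  shows "((\<lambda>a. run_tangent (\<tau> a) es (q a)) \<longlongrightarrow> run_tangent \<tau>0 es q0) A"
proof (induction es rule: rev_induct)
  case (snoc p es)
  obtain k e where p: "p = (k, e)" by (cases p)
  show ?case unfolding p run_tangent_snoc fst_run_tangent
    by (intro tendsto_Pair smooth_field.fl_tendsto[OF field] smooth_field.jac_tendsto[OF field] tendsto_snd[OF snoc]
        run_fl_tendsto tendsto_fst tendsto_mult tendsto_const assms)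
qed (use assms in simp)

lemma run_velocity_tendsto:
  assumes "(\<tau> \<longlongrightarrow> \<tau>0) A" "(x \<longlongrightarrow> x0) A"
  shows "((\<lambda>a. run_velocity (\<tau> a) es (x a)) \<longlongrightarrow> run_velocity \<tau>0 es x0) A"
proof (induction es rule: rev_induct)
  case (snoc p es)
  obtain k e where p: "p = (k, e)" by (cases p)
  have et: "((\<lambda>a. e * \<tau> a) \<longlongrightarrow> e * \<tau>0) A" by (intro tendsto_mult tendsto_const assms)
  have rt: "((\<lambda>a. run_fl (\<tau> a) es (x a)) \<longlongrightarrow> run_fl \<tau>0 es x0) A" by (rule run_fl_tendsto[OF assms])
  have "isCont (Z k) y" for y using Ck_cont[OF Zsm[of 0 k]] by (simp add: continuous_on_eq_continuous_at)
  then have "((\<lambda>a. Z k (\<Phi> k (e * \<tau> a) (run_fl (\<tau> a) es (x a)))) \<longlongrightarrow> Z k (\<Phi> k (e * \<tau>0) (run_fl \<tau>0 es x0))) A"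
    by (rule isCont_tendsto_compose) (rule smooth_field.fl_tendsto[OF field et rt])
  then show ?case unfolding p run_velocity_snoc
    by (intro tendsto_add tendsto_scaleR tendsto_const smooth_field.jac_tendsto[OF field et rt snoc])
qed simp

lemma run_velocity_deriv:
  assumes "\<And>k e. (k, e) \<in> set es \<Longrightarrow> \<bar>e\<bar> = 1" and t: "\<bar>\<tau>\<bar> < T"
  shows "((\<lambda>\<tau>. run_fl \<tau> es x) has_vector_derivative run_velocity \<tau> es x) (at \<tau>)"
  using assms(1)
proof (induction es rule: rev_induct)
  case (snoc p es)
  obtain k e where p: "p = (k, e)" by (cases p)
  have e: "\<bar>e\<bar> = 1" using snoc.prems[of k e] by (simp add: p)
  show ?case unfolding p run_fl_snoc run_velocity_snoc
    by (rule smooth_field.fl_curve[OF field]) (use snoc t e in \<open>auto simp: abs_mult\<close>)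
qed simp

lemma run_fl_curve:
  assumes "(y has_vector_derivative V) (at a)"
  shows "((\<lambda>r. run_fl \<tau> es (y r)) has_vector_derivative snd (run_tangent \<tau> es (y a, V))) (at a)"
proof (induction es rule: rev_induct)
  case (snoc p es)
  obtain k e where p: "p = (k, e)" by (cases p)
  have lin: "linear (J k (e * \<tau>) z)" for z by (rule bounded_linear.linear[OF smooth_field.jac_linear[OF field]])
  have "((\<lambda>r. \<Phi> k (e * \<tau>) (run_fl \<tau> es (y r))) has_derivative
      (\<lambda>h. J k (e * \<tau>) (run_fl \<tau> es (y a)) (h *\<^sub>R snd (run_tangent \<tau> es (y a, V))))) (at a)"
    by (rule has_derivative_compose[OF _ smooth_field.fl_has_derivative[OF field]])
      (use snoc in \<open>simp add: has_vector_derivative_def\<close>)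
  then show ?case unfolding p run_fl_snoc run_tangent_snoc by (simp add: has_vector_derivative_def linear_cmul[OF lin])
qed (use assms in simp)

lemma comm_expansion_mono: "comm_expansion d r A a x V \<Longrightarrow> A \<le> A' \<Longrightarrow> 0 \<le> r \<Longrightarrow> comm_expansion d r A' a x V"
  unfolding comm_expansion_def by (meson mult_right_mono order_trans zero_le_power)

lemma comm_expansion_add_letter:
  assumes E: "comm_expansion 1 r A a y V" and e: "\<bar>e\<bar> = 1" and r: "0 \<le> r" and k: "k \<in> {1..m}" and A: "0 \<le> A"
  shows "comm_expansion 1 r (A + 1) (\<lambda>u. a u + (if u = [k] then e else 0)) y (V + e *\<^sub>R Z k y)"
proof -
  have kw: "[k] \<in> words s m" using k s1 by (auto simp: words_def)
  have "(\<Sum>v\<in>words s m. (if v = [k] then e else 0) *\<^sub>R fw Z v y) = (\<Sum>v\<in>words s m. if v = [k] then e *\<^sub>R Z k y else 0)"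
    by (rule sum.cong) auto
  then have S: "(\<Sum>v\<in>words s m. (a v + (if v = [k] then e else 0)) *\<^sub>R fw Z v y) = (\<Sum>v\<in>words s m. a v *\<^sub>R fw Z v y) + e *\<^sub>R Z k y"
    using kw by (simp add: scaleR_add_left sum.distrib finite_words)
  show ?thesis unfolding comm_expansion_def S
  proof (intro conjI allI impI)
    fix v
    have av: "\<bar>a v\<bar> \<le> A * r ^ (length v - 1)" using E unfolding comm_expansion_def by blast
    have "\<bar>if v = [k] then e else 0\<bar> \<le> r ^ (length v - 1)" using e r by auto
    then show "\<bar>a v + (if v = [k] then e else 0)\<bar> \<le> (A + 1) * r ^ (length v - 1)"
      using av by (simp add: distrib_right)
    assume "v \<notin> words s m \<or> length v < 1"
    moreover from this have "v \<noteq> [k]" using kw by auto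
    ultimately show "a v + (if v = [k] then e else 0) = 0" using E unfolding comm_expansion_def by simp
  next
    have "norm (V - (\<Sum>v\<in>words s m. a v *\<^sub>R fw Z v y)) \<le> A * r ^ (s + 1 - 1)" using E unfolding comm_expansion_def by blast
    also have "\<dots> \<le> (A + 1) * r ^ (s + 1 - 1)" using r by (intro mult_right_mono) auto
    finally show "norm (V + e *\<^sub>R Z k y - ((\<Sum>v\<in>words s m. a v *\<^sub>R fw Z v y) + e *\<^sub>R Z k y)) \<le> (A + 1) * r ^ (s + 1 - 1)"
      by simp
  qed
qed

text \<open>The base length is 1, since each flow contributes its own field. One step multiplies the
  constant by \<open>KK\<close> and adds 1 for the new letter, which \<open>KK + 1\<close> per flow
  dominates.\<close>

lemma comm_expansion_run_velocity:
  assumes "\<And>k e. (k, e) \<in> set es \<Longrightarrow> k \<in> {1..m} \<and> \<bar>e\<bar> = 1" and t: "0 \<le> \<tau>" "\<tau> < T"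
    and x: "norm x + M * \<tau> * real (length es + 1) < R"
  shows "comm_expansion 1 \<tau> ((KK + 1) ^ length es) (run_coeff s m \<tau> es) (run_fl \<tau> es x) (run_velocity \<tau> es x)"
  using assms(1) x
proof (induction es rule: rev_induct)
  case Nil
  then show ?case using t by (simp add: comm_expansion_def run_coeff_Nil)
next
  case (snoc p es)
  obtain k e where p: "p = (k, e)" by (cases p)
  have e: "\<bar>e\<bar> = 1" and k: "k \<in> {1..m}" using snoc.prems(1)[of k e] by (auto simp: p)
  let ?A = "(KK + 1) ^ length es"
  have A: "1 \<le> ?A" using KK1 by (intro one_le_power) simp
  have "M * \<tau> * real (length es + 1) \<le> M * \<tau> * real (length (es @ [p]) + 1)"
    using M0 t by (intro mult_left_mono) auto
  then have E: "comm_expansion 1 \<tau> ?A (run_coeff s m \<tau> es) (run_fl \<tau> es x) (run_velocity \<tau> es x)"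
    using snoc by (intro snoc.IH) auto
  have "norm (run_fl \<tau> (es @ [(k, e)]) x) \<le> norm x + M * \<tau> * length (es @ [p])"
    using run_fl_norm[of "es @ [(k, e)]" \<tau> \<tau> x] snoc.prems(1) t by (auto simp: p)
  then have y: "norm (\<Phi> k (e * \<tau>) (run_fl \<tau> es x)) + M * \<tau> < R"
    using snoc.prems(2) by (simp add: run_fl_snoc algebra_simps)
  have "comm_expansion 1 \<tau> (KK * ?A) (push s m k (e * \<tau>) (run_coeff s m \<tau> es)) (\<Phi> k (e * \<tau>) (run_fl \<tau> es x)) (J k (e * \<tau>) (run_fl \<tau> es x) (run_velocity \<tau> es x))"
    by (rule comm_expansion_push[OF E k _ t(2) y]) (use e t A s1 in \<open>auto simp: abs_mult\<close>)
  then have "comm_expansion 1 \<tau> (KK * ?A + 1) (run_coeff s m \<tau> (es @ [(k, e)])) (run_fl \<tau> (es @ [(k, e)]) x) (run_velocity \<tau> (es @ [(k, e)]) x)"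
    unfolding run_coeff_snoc run_fl_snoc run_velocity_snoc
    by (rule comm_expansion_add_letter) (use e t k A KK1 in auto)
  then show ?case unfolding p
    by (rule comm_expansion_mono) (use A t in \<open>auto simp: algebra_simps\<close>)
qed

text \<open>No letter is added here, so the coefficients in the lowest length are preserved. This is
  why the partial derivative begins with exactly one copy of the j-th commutator.\<close>

lemma comm_expansion_run_tangent:
  assumes E: "comm_expansion d r A a x V" and es: "\<And>k e. (k, e) \<in> set es \<Longrightarrow> k \<in> {1..m} \<and> \<bar>e\<bar> = 1"
    and t: "\<bar>\<tau>\<bar> \<le> r" "r < T" and x: "norm x + M * r * real (length es + 1) < R" and A: "0 \<le> A" and d: "d \<le> s"
  shows "comm_expansion d r (KK ^ length es * A) (push_list s m \<tau> es a) (run_fl \<tau> es x) (snd (run_tangent \<tau> es (x, V))) \<and>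
    (\<forall>u\<in>words s m. length u = d \<longrightarrow> push_list s m \<tau> es a u = a u)"
  using es x
proof (induction es rule: rev_induct)
  case Nil
  then show ?case using E by (simp add: push_list_def)
next
  case (snoc p es)
  have r: "0 \<le> r" using t by simp
  obtain k e where p: "p = (k, e)" by (cases p)
  have e: "\<bar>e\<bar> = 1" and k: "k \<in> {1..m}" using snoc.prems(1)[of k e] by (auto simp: p)
  let ?A = "KK ^ length es * A"
  have A': "0 \<le> ?A" using KK1 A by simp
  have "M * r * real (length es + 1) \<le> M * r * real (length (es @ [p]) + 1)"
    using M0 r by (intro mult_left_mono) auto
  then have IH: "comm_expansion d r ?A (push_list s m \<tau> es a) (run_fl \<tau> es x) (snd (run_tangent \<tau> es (x, V)))"
    "\<forall>u\<in>words s m. length u = d \<longrightarrow> push_list s m \<tau> es a u = a u"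
    using snoc.IH snoc.prems by auto
  have "norm (run_fl \<tau> (es @ [(k, e)]) x) \<le> norm x + M * r * length (es @ [p])"
    using run_fl_norm[of "es @ [(k, e)]" \<tau> r x] snoc.prems(1) t by (auto simp: p)
  then have y: "norm (\<Phi> k (e * \<tau>) (run_fl \<tau> es x)) + M * r < R"
    using snoc.prems(2) by (simp add: run_fl_snoc algebra_simps)
  have et: "\<bar>e * \<tau>\<bar> \<le> r" using e t by (simp add: abs_mult)
  have ps: "push_list s m \<tau> (es @ [(k, e)]) a = push s m k (e * \<tau>) (push_list s m \<tau> es a)" by (simp add: push_list_def)
  have "comm_expansion d r (KK * ?A) (push_list s m \<tau> (es @ [(k, e)]) a) (run_fl \<tau> (es @ [(k, e)]) x) (snd (run_tangent \<tau> (es @ [(k, e)]) (x, V)))"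
    unfolding ps run_fl_snoc run_tangent_snoc using comm_expansion_push[OF IH(1) k et t(2) y A' d] by simp
  moreover have "push_list s m \<tau> (es @ [(k, e)]) a u = a u" if "u \<in> words s m" "length u = d" for u
    unfolding ps using push_lowest[OF IH(1) et A' that] IH(2) that by simp
  ultimately show ?case unfolding p by (simp add: mult.assoc)
qed

end

text \<open>The two sequences attached to the two signs of \<open>t\<close> are glued at
  \<open>t0 = 0\<close>. Both runs are the identity there, since \<open>tau\<close> vanishes, so the
  limits agree.\<close>

lemma sign_tendsto:
  fixes t :: "'a \<Rightarrow> real"
  assumes t: "(t \<longlongrightarrow> t0) A" and F: "\<And>b. (F b \<longlongrightarrow> l b) A" and l: "t0 = 0 \<Longrightarrow> l True = l False"
  shows "((\<lambda>a. F (0 \<le> t a) a) \<longlongrightarrow> l (0 \<le> t0)) A"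
proof -
  consider "t0 > 0" | "t0 < 0" | "t0 = 0" by linarith
  then show ?thesis
  proof cases
    case 1
    have "\<forall>\<^sub>F a in A. F True a = F (0 \<le> t a) a"
      using order_tendstoD(1)[OF t 1] by eventually_elim simp
    from Lim_transform_eventually[OF F[of True] this] show ?thesis using 1 by simp
  next
    case 2
    have "\<forall>\<^sub>F a in A. F False a = F (0 \<le> t a) a"
      using order_tendstoD(2)[OF t 2] by eventually_elim (simp add: not_le)
    from Lim_transform_eventually[OF F[of False] this] show ?thesis using 2 by simp
  next
    case 3
    have "((\<lambda>a. if 0 \<le> t a then F True a else F False a) \<longlongrightarrow> l True) A"
      by (rule filterlim_If) (use F[of True] F[of False] l[OF 3] in \<open>auto intro: tendsto_mono[OF inf_le1]\<close>)
    moreover have "(\<lambda>a. if 0 \<le> t a then F True a else F False a) = (\<lambda>a. F (0 \<le> t a) a)" by auto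
    ultimately show ?thesis using 3 by simp
  qed
qed

text \<open>Neither the fields nor the point nor \<sigma> appears: the coefficients of the theorem
  are built from words and \<open>h\<close> alone.\<close>

definition E_coeff :: "nat \<Rightarrow> nat \<Rightarrow> (nat \<Rightarrow> nat list) \<Rightarrow> (nat \<Rightarrow> real) \<Rightarrow> nat list \<Rightarrow> (nat list \<Rightarrow> real) \<Rightarrow> nat list \<Rightarrow> real" where
  "E_coeff s m ws h js a = foldr (\<lambda>j a. push_list s m (tau (ws j) (h j)) (word_seq (ws j) (0 \<le> h j)) a) js a"

section \<open>A single approximate exponential\<close>

context vflows
begin

definition exp_approx :: "nat list \<Rightarrow> real \<Rightarrow> real^'n \<Rightarrow> real^'n" where
  "exp_approx w t x = run_fl (tau w t) (word_seq w (0 \<le> t)) x"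

definition exp_tangent :: "nat list \<Rightarrow> real \<Rightarrow> (real^'n) \<times> (real^'n) \<Rightarrow> (real^'n) \<times> (real^'n)" where
  "exp_tangent w t p = run_tangent (tau w t) (word_seq w (0 \<le> t)) p"

text \<open>The chain rule for \<open>\<tau> = |t|\<^bsup>1/\<ell>\<^esup>\<close> is singular at \<open>t = 0\<close>. By the cancellation of the lower-order terms the
  derivative extends continuously by \<open>f\<^sub>w\<close>.\<close>

definition exp_velocity :: "nat list \<Rightarrow> real \<Rightarrow> real^'n \<Rightarrow> real^'n" where
  "exp_velocity w t x = (if t = 0 then fw Z w x else
     (sgn t / (real (length w) * tau w t ^ (length w - 1))) *\<^sub>R run_velocity (tau w t) (word_seq w (0 \<le> t)) x)"

text \<open>\<open>NN\<close> bounds the number of flows in one approximate exponential and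
  \<open>AA\<close> the constant of its velocity. They depend on \<open>s\<close>, \<open>m\<close>
  and \<open>B\<close> only, hence neither on \<sigma> nor on the point.\<close>

definition NN :: nat where "NN = 4 ^ s"
definition AA :: real where "AA = (KK + 1) ^ NN"

lemma AA1: "1 \<le> AA" unfolding AA_def using KK1 by (intro one_le_power) simp

lemma word_facts: "w \<in> words s m \<Longrightarrow> w \<noteq> [] \<and> set w \<subseteq> {1..m} \<and> length w \<le> s \<and> 1 \<le> length w"
  by (auto simp: words_def)

lemma len_word_seq: "w \<in> words s m \<Longrightarrow> length (word_seq w b) \<le> NN"
proof -
  assume "w \<in> words s m"
  then have "(4::nat) ^ length w \<le> 4 ^ s" using word_facts by (intro power_increasing) auto
  then show ?thesis using length_word_seq[of w b] unfolding NN_def by (rule order_trans[rotated])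
qed

lemma word_seq_ok: "w \<in> words s m \<Longrightarrow> (k, e) \<in> set (word_seq w b) \<Longrightarrow> k \<in> {1..m} \<and> \<bar>e\<bar> = 1"
  using word_seq_mem[of k e w b] word_facts[of w] by blast

lemma Mr_mono: "0 \<le> r \<Longrightarrow> (p::nat) \<le> q \<Longrightarrow> M * r * real p \<le> M * r * real q"
  using M0 by (intro mult_left_mono) auto

lemma exp_approx_norm: "w \<in> words s m \<Longrightarrow> tau w t \<le> r \<Longrightarrow> norm (exp_approx w t x) \<le> norm x + M * r * NN"
proof -
  assume w: "w \<in> words s m" and r: "tau w t \<le> r"
  have r0: "0 \<le> r" using r tau_nonneg[of w t] by simp
  have "norm (exp_approx w t x) \<le> norm x + M * r * length (word_seq w (0 \<le> t))"
    unfolding exp_approx_def by (rule run_fl_norm) (use word_seq_ok[OF w] r tau_nonneg[of w t] in auto)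
  also have "\<dots> \<le> norm x + M * r * NN" using Mr_mono[OF r0 len_word_seq[OF w]] by simp
  finally show ?thesis .
qed

lemma exp_approx_0 [simp]: "exp_approx w 0 x = x" by (simp add: exp_approx_def)

lemma exp_approx_tendsto:
  assumes w: "w \<noteq> []" and t: "(t \<longlongrightarrow> t0) A" and x: "(x \<longlongrightarrow> x0) A"
  shows "((\<lambda>a. exp_approx w (t a) (x a)) \<longlongrightarrow> exp_approx w t0 x0) A"
  unfolding exp_approx_def by (rule sign_tendsto[OF t run_fl_tendsto[OF tau_tendsto[OF w t] x]]) simp

lemma exp_tangent_tendsto:
  assumes w: "w \<noteq> []" and t: "(t \<longlongrightarrow> t0) A" and x: "(q \<longlongrightarrow> q0) A"
  shows "((\<lambda>a. exp_tangent w (t a) (q a)) \<longlongrightarrow> exp_tangent w t0 q0) A"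
  unfolding exp_tangent_def by (rule sign_tendsto[OF t run_tangent_tendsto[OF tau_tendsto[OF w t] x]]) simp

text \<open>The expansion in \<tau> is divided by l \<tau>^(l-1), where l = |w|. Terms of length
  below l would blow up, but they cancel as vector fields; the error \<tau>^s becomes
  \<tau>^(s+1-l), the order required.\<close>

lemma comm_expansion_exp_velocity:
  assumes w: "w \<in> words s m" and t: "tau w t \<le> r" "r < T" and x: "norm x + M * r * real (NN + 1) < R"
  shows "comm_expansion (length w) r AA (exp_coeff s m w t) (exp_approx w t x) (exp_velocity w t x)"
proof (cases "t = 0")
  case True
  have r: "0 \<le> r" using t tau_nonneg[of w t] by simp
  have b: "exp_coeff s m w 0 v = (if v = w then 1 else 0)" for v by (auto simp: exp_coeff_def)
  have "(\<Sum>v\<in>words s m. exp_coeff s m w 0 v *\<^sub>R fw Z v x) = (\<Sum>v\<in>words s m. if v = w then fw Z w x else 0)"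
    by (rule sum.cong) (auto simp: b)
  then have "(\<Sum>v\<in>words s m. exp_coeff s m w 0 v *\<^sub>R fw Z v x) = fw Z w x" using w by (simp add: finite_words)
  then show ?thesis using True AA1 r w by (auto simp: comm_expansion_def exp_velocity_def b)
next
  case False
  let ?\<tau> = "tau w t" and ?es = "word_seq w (0 \<le> t)" and ?l = "length w" and ?c = "sgn t" and ?y = "exp_approx w t x"
  have tp: "0 < ?\<tau>" by (rule tau_pos[OF False])
  have r: "0 \<le> r" using t tp by simp
  have w': "w \<noteq> []" "?l \<le> s" "1 \<le> ?l" using word_facts[OF w] by auto
  have l1: "1 / real ?l \<le> 1" using w'(1,3) by (auto simp: divide_le_eq Suc_leI)
  have cc: "?c * ?c = 1" using False by (simp add: sgn_if)
  have len: "length ?es \<le> NN" by (rule len_word_seq[OF w])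
  have "M * ?\<tau> * real (length ?es + 1) \<le> M * r * real (NN + 1)"
    using M0 t tp len by (intro mult_mono) auto
  then have E: "comm_expansion 1 ?\<tau> ((KK + 1) ^ length ?es) (run_coeff s m ?\<tau> ?es) ?y (run_velocity ?\<tau> ?es x)"
    unfolding exp_approx_def using word_seq_ok[OF w] tp t x by (intro comm_expansion_run_velocity) auto
  have "(KK + 1) ^ length ?es \<le> AA" unfolding AA_def using KK1 len by (intro power_increasing) auto
  then have E: "comm_expansion 1 ?\<tau> AA (run_coeff s m ?\<tau> ?es) ?y (run_velocity ?\<tau> ?es x)" using comm_expansion_mono[OF E] tp by simp
  \<comment> \<open>The bound at \<tau>, divided by the power from \<open>run_coeff_homog\<close>,
    leaves a bound independent of \<tau>.\<close>
  have D1: "\<bar>run_coeff s m 1 ?es v\<bar> \<le> AA" for v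
  proof -
    have "\<bar>run_coeff s m ?\<tau> ?es v\<bar> \<le> AA * ?\<tau> ^ (length v - 1)" using E unfolding comm_expansion_def by blast
    then have "\<bar>run_coeff s m 1 ?es v\<bar> * ?\<tau> ^ (length v - 1) \<le> AA * ?\<tau> ^ (length v - 1)"
      unfolding run_coeff_homog[of s m ?\<tau>] using tp by (simp add: abs_mult mult.commute)
    then show ?thesis using tp by simp
  qed
  \<comment> \<open>The discrepancy between the velocity in \<tau> and the prescribed velocity in
    \<open>t\<close>. It vanishes after summation over each single length: by
    \<open>run_coeff_cancel\<close> up to \<open>?l\<close>, and term by term beyond.\<close>
  define g where "g v = (run_coeff s m ?\<tau> ?es v - ?c * ?l * ?\<tau> ^ (?l - 1) * exp_coeff s m w t v) *\<^sub>R fw Z v ?y" for v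
  have g0: "(\<Sum>v\<in>{v\<in>words s m. length v = p}. g v) = 0" for p
  proof (cases "p \<le> ?l")
    case True
    let ?W = "{v\<in>words s m. length v = p}"
    have "(\<Sum>v\<in>?W. run_coeff s m ?\<tau> ?es v *\<^sub>R fw Z v ?y) = ?\<tau> ^ (p - 1) *\<^sub>R (\<Sum>v\<in>?W. run_coeff s m 1 ?es v *\<^sub>R fw Z v ?y)"
      unfolding scaleR_sum_right by (rule sum.cong[OF refl]) (simp add: run_coeff_homog[of s m ?\<tau>])
    also have "(\<Sum>v\<in>?W. run_coeff s m 1 ?es v *\<^sub>R fw Z v ?y) = (if p = ?l then (?c * real ?l) *\<^sub>R fw Z w ?y else 0)"
      by (rule run_coeff_cancel[OF Zsm _ w _ True]) (use word_seq_ok[OF w] exp_prod_word_seq[OF w'(1)] False in \<open>auto simp: sgn_if\<close>)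
    finally have 1: "(\<Sum>v\<in>?W. run_coeff s m ?\<tau> ?es v *\<^sub>R fw Z v ?y) = (if p = ?l then (?\<tau> ^ (?l - 1) * (?c * real ?l)) *\<^sub>R fw Z w ?y else 0)"
      by simp
    have "(\<Sum>v\<in>?W. exp_coeff s m w t v *\<^sub>R fw Z v ?y) = (\<Sum>v\<in>?W. if v = w then fw Z w ?y else 0)"
      by (rule sum.cong) (use True in \<open>auto simp: exp_coeff_def\<close>)
    then have 2: "(\<Sum>v\<in>?W. exp_coeff s m w t v *\<^sub>R fw Z v ?y) = (if p = ?l then fw Z w ?y else 0)"
      using w by (simp add: finite_words)
    have "(\<Sum>v\<in>?W. g v) = (\<Sum>v\<in>?W. run_coeff s m ?\<tau> ?es v *\<^sub>R fw Z v ?y) - (?c * ?l * ?\<tau> ^ (?l - 1)) *\<^sub>R (\<Sum>v\<in>?W. exp_coeff s m w t v *\<^sub>R fw Z v ?y)"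
      by (simp add: g_def scaleR_diff_left sum_subtractf scaleR_sum_right)
    also have "\<dots> = 0" unfolding 1 2 by (simp add: mult_ac)
    finally show ?thesis .
  next
    case gt: False
    show ?thesis
    proof (rule sum.neutral, rule ballI)
      fix v assume v: "v \<in> {v\<in>words s m. length v = p}"
      then have vl: "length w < length v" "v \<noteq> w" "v \<in> words s m" using gt by auto
      have pw: "?\<tau> ^ (?l - 1) * ?\<tau> ^ (length v - ?l) = ?\<tau> ^ (length v - 1)"
        unfolding power_add[symmetric] using vl(1) w'(3) by (intro arg_cong[where f = "power ?\<tau>"]) simp
      have "?c * ?l * ?\<tau> ^ (?l - 1) * exp_coeff s m w t v = (?c * ?c) * (?\<tau> ^ (?l - 1) * ?\<tau> ^ (length v - ?l)) * run_coeff s m 1 ?es v"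
        using vl w'(1,3) by (simp add: exp_coeff_def field_simps)
      also have "\<dots> = run_coeff s m ?\<tau> ?es v" unfolding cc pw run_coeff_homog[of s m ?\<tau>] by simp
      finally show "g v = 0" by (simp add: g_def)
    qed
  qed
  have "(\<Sum>v\<in>words s m. g v) = (\<Sum>p\<in>{..s}. \<Sum>v\<in>{v\<in>words s m. length v = p}. g v)"
    by (rule sum.group[symmetric, OF finite_words]) (use word_facts in auto)
  then have "(\<Sum>v\<in>words s m. g v) = 0" by (simp add: g0)
  then have S: "(\<Sum>v\<in>words s m. run_coeff s m ?\<tau> ?es v *\<^sub>R fw Z v ?y) = (?c * ?l * ?\<tau> ^ (?l - 1)) *\<^sub>R (\<Sum>v\<in>words s m. exp_coeff s m w t v *\<^sub>R fw Z v ?y)"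
    by (simp add: g_def scaleR_diff_left sum_subtractf scaleR_sum_right)
  \<comment> \<open>The derivative of \<open>tau\<close>. Since \<open>?c * ?c = 1\<close>, it
    inverts the factor \<open>?c * ?l * ?\<tau> ^ (?l - 1)\<close>.\<close>
  define q where "q = ?c / (?l * ?\<tau> ^ (?l - 1))"
  have qq: "q * (?c * ?l * ?\<tau> ^ (?l - 1)) = 1" unfolding q_def using tp w'(1,3) cc by (simp add: field_simps)
  have "exp_velocity w t x - (\<Sum>v\<in>words s m. exp_coeff s m w t v *\<^sub>R fw Z v ?y) = q *\<^sub>R (run_velocity ?\<tau> ?es x - (\<Sum>v\<in>words s m. run_coeff s m ?\<tau> ?es v *\<^sub>R fw Z v ?y))"
    unfolding S scaleR_diff_right scaleR_scaleR qq using False by (simp add: exp_velocity_def q_def)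
  then have "norm (exp_velocity w t x - (\<Sum>v\<in>words s m. exp_coeff s m w t v *\<^sub>R fw Z v ?y)) = \<bar>q\<bar> * norm (run_velocity ?\<tau> ?es x - (\<Sum>v\<in>words s m. run_coeff s m ?\<tau> ?es v *\<^sub>R fw Z v ?y))"
    by simp
  also have "\<dots> \<le> \<bar>q\<bar> * (AA * ?\<tau> ^ (s + 1 - 1))"
    using E unfolding comm_expansion_def by (intro mult_left_mono) auto
  also have "\<dots> \<le> AA * ?\<tau> ^ (s + 1 - ?l)"
  proof -
    have "\<bar>q\<bar> \<le> 1 / ?\<tau> ^ (?l - 1)"
      unfolding q_def using tp w'(1,3) False by (simp add: abs_mult abs_sgn_eq frac_le mult_le_cancel_right1 Suc_leI)
    then have "\<bar>q\<bar> * (AA * ?\<tau> ^ (s + 1 - 1)) \<le> 1 / ?\<tau> ^ (?l - 1) * (AA * ?\<tau> ^ (s + 1 - 1))"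
      using AA1 tp by (intro mult_right_mono) auto
    also have "\<dots> = AA * ?\<tau> ^ (s + 1 - ?l)"
    proof -
      have "?\<tau> ^ (s + 1 - 1) = ?\<tau> ^ (s + 1 - ?l) * ?\<tau> ^ (?l - 1)"
        unfolding power_add[symmetric] using w' by (intro arg_cong[where f = "power ?\<tau>"]) simp
      then show ?thesis using tp by simp
    qed
    finally show ?thesis .
  qed
  also have "\<dots> \<le> AA * r ^ (s + 1 - ?l)" using t tp AA1 by (intro mult_left_mono power_mono) auto
  finally have err: "norm (exp_velocity w t x - (\<Sum>v\<in>words s m. exp_coeff s m w t v *\<^sub>R fw Z v ?y)) \<le> AA * r ^ (s + 1 - ?l)" .
  show ?thesis unfolding comm_expansion_def
  proof (intro conjI allI impI err)
    fix v
    show "\<bar>exp_coeff s m w t v\<bar> \<le> AA * r ^ (length v - ?l)"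
    proof (cases "v \<noteq> w \<and> v \<in> words s m \<and> ?l < length v")
      case True
      have "\<bar>exp_coeff s m w t v\<bar> = (1 / ?l) * (?\<tau> ^ (length v - ?l) * \<bar>run_coeff s m 1 ?es v\<bar>)"
        using True False tp by (simp add: exp_coeff_def abs_mult abs_sgn_eq)
      also have "\<dots> \<le> 1 * (r ^ (length v - ?l) * AA)"
        using l1 tp t D1[of v] AA1 r by (intro mult_mono power_mono) auto
      finally show ?thesis by (simp add: mult.commute)
    next
      case F: False
      then show ?thesis using AA1 r by (auto simp: exp_coeff_def)
    qed
    show "exp_coeff s m w t v = 0" if "v \<notin> words s m \<or> length v < ?l" using that w by (auto simp: exp_coeff_def)
  qed
qed

text \<open>Apart from the leading commutator every term of the expansion carries at least one
  factor \<tau>. This is the continuity of the velocity at \<open>t = 0\<close>.\<close>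

lemma exp_velocity_near:
  assumes w: "w \<in> words s m" and t: "tau w t \<le> 1" "tau w t < T" and x: "norm x + M * tau w t * real (NN + 1) < R"
  shows "norm (exp_velocity w t x - fw Z w (exp_approx w t x)) \<le> (AA + card (words s m) * (AA * B)) * tau w t"
proof -
  let ?\<tau> = "tau w t" and ?y = "exp_approx w t x" and ?l = "length w"
  have t0: "0 \<le> ?\<tau>" by (rule tau_nonneg)
  have E: "comm_expansion ?l ?\<tau> AA (exp_coeff s m w t) ?y (exp_velocity w t x)" by (rule comm_expansion_exp_velocity[OF w order_refl t(2) x])
  have w': "?l \<le> s" using word_facts[OF w] by auto
  have pw: "?\<tau> ^ k \<le> ?\<tau>" if "1 \<le> k" for k
    using power_decreasing[OF that t0 t(1)] by simp
  have "norm ?y \<le> norm x + M * ?\<tau> * NN" by (rule exp_approx_norm[OF w order_refl])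
  moreover have "M * ?\<tau> * NN \<le> M * ?\<tau> * real (NN + 1)" by (rule Mr_mono[OF t0]) simp
  ultimately have y: "norm ?y < R" using x by linarith
  have 1: "norm (exp_velocity w t x - (\<Sum>v\<in>words s m. exp_coeff s m w t v *\<^sub>R fw Z v ?y)) \<le> AA * ?\<tau>"
  proof -
    have "norm (exp_velocity w t x - (\<Sum>v\<in>words s m. exp_coeff s m w t v *\<^sub>R fw Z v ?y)) \<le> AA * ?\<tau> ^ (s + 1 - ?l)"
      using E unfolding comm_expansion_def by blast
    also have "\<dots> \<le> AA * ?\<tau>" using pw[of "s + 1 - ?l"] w' AA1 by (intro mult_left_mono) auto
    finally show ?thesis .
  qed
  have S: "(\<Sum>v\<in>words s m. exp_coeff s m w t v *\<^sub>R fw Z v ?y) = fw Z w ?y + (\<Sum>v\<in>words s m - {w}. exp_coeff s m w t v *\<^sub>R fw Z v ?y)"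
    using w by (simp add: sum.remove[OF finite_words w] exp_coeff_def)
  have "norm (\<Sum>v\<in>words s m - {w}. exp_coeff s m w t v *\<^sub>R fw Z v ?y) \<le> (\<Sum>v\<in>words s m - {w}. (AA * B) * ?\<tau>)"
  proof (rule sum_norm_le)
    fix v assume v: "v \<in> words s m - {w}"
    show "norm (exp_coeff s m w t v *\<^sub>R fw Z v ?y) \<le> (AA * B) * ?\<tau>"
    proof (cases "?l < length v")
      case True
      have "\<bar>exp_coeff s m w t v\<bar> \<le> AA * ?\<tau> ^ (length v - ?l)" using E unfolding comm_expansion_def by blast
      also have "\<dots> \<le> AA * ?\<tau>" using pw[of "length v - ?l"] True AA1 by (intro mult_left_mono) auto
      finally have b: "\<bar>exp_coeff s m w t v\<bar> \<le> AA * ?\<tau>" .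
      have "norm (fw Z v ?y) \<le> B" using v y by (intro fwB) (auto simp: words_def)
      then have "\<bar>exp_coeff s m w t v\<bar> * norm (fw Z v ?y) \<le> (AA * ?\<tau>) * B" using b AA1 t0 by (intro mult_mono) auto
      then show ?thesis by (simp add: mult_ac)
    next
      case False
      then show ?thesis using v AA1 B0 t0 by (auto simp: exp_coeff_def)
    qed
  qed
  also have "\<dots> = real (card (words s m - {w})) * ((AA * B) * ?\<tau>)" by simp
  also have "\<dots> \<le> real (card (words s m)) * ((AA * B) * ?\<tau>)"
    using AA1 B0 t0 by (intro mult_right_mono) (auto intro: card_mono simp: finite_words)
  finally have 2: "norm (\<Sum>v\<in>words s m - {w}. exp_coeff s m w t v *\<^sub>R fw Z v ?y) \<le> real (card (words s m)) * ((AA * B) * ?\<tau>)" .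
  have "exp_velocity w t x - fw Z w ?y = (exp_velocity w t x - (\<Sum>v\<in>words s m. exp_coeff s m w t v *\<^sub>R fw Z v ?y)) + (\<Sum>v\<in>words s m - {w}. exp_coeff s m w t v *\<^sub>R fw Z v ?y)"
    by (simp add: S)
  then have "norm (exp_velocity w t x - fw Z w ?y) \<le> AA * ?\<tau> + real (card (words s m)) * ((AA * B) * ?\<tau>)"
    using norm_triangle_mono[OF 1 2] by metis
  then show ?thesis by (simp add: algebra_simps)
qed

text \<open>For \<open>t0 \<noteq> 0\<close> all ingredients are continuous; for
  \<open>t0 = 0\<close> the velocity is compared with the commutator at the endpoint, which tends to
  the base point.\<close>

lemma exp_velocity_tendsto:
  assumes w: "w \<in> words s m" and t: "(t \<longlongrightarrow> t0) A" and x: "(x \<longlongrightarrow> x0) A" and R: "norm x0 < R"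
  shows "((\<lambda>a. exp_velocity w (t a) (x a)) \<longlongrightarrow> exp_velocity w t0 x0) A"
proof (cases "t0 = 0")
  case False
  have w': "w \<noteq> []" "1 \<le> length w" using word_facts[OF w] by auto
  have tt: "((\<lambda>a. tau w (t a)) \<longlongrightarrow> tau w t0) A" by (rule tau_tendsto[OF w'(1) t])
  have "((\<lambda>a. (sgn (t a) / (real (length w) * tau w (t a) ^ (length w - 1))) *\<^sub>R run_velocity (tau w (t a)) (word_seq w (0 \<le> t a)) (x a)) \<longlongrightarrow>
      (sgn t0 / (real (length w) * tau w t0 ^ (length w - 1))) *\<^sub>R run_velocity (tau w t0) (word_seq w (0 \<le> t0)) x0) A"
    using tau_pos[OF False, of w] w' False
    by (intro tendsto_scaleR tendsto_divide tendsto_sgn tendsto_mult tendsto_const tendsto_power tt t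
        sign_tendsto[OF t run_velocity_tendsto[OF tt x]]) auto
  moreover have "\<forall>\<^sub>F a in A. (sgn (t a) / (real (length w) * tau w (t a) ^ (length w - 1))) *\<^sub>R run_velocity (tau w (t a)) (word_seq w (0 \<le> t a)) (x a) = exp_velocity w (t a) (x a)"
    using tendsto_imp_eventually_ne[OF t False] by eventually_elim (simp add: exp_velocity_def)
  ultimately show ?thesis using False by (simp add: exp_velocity_def Lim_transform_eventually)
next
  case True
  have w': "w \<noteq> []" using word_facts[OF w] by auto
  have tt: "((\<lambda>a. tau w (t a)) \<longlongrightarrow> 0) A" using tau_tendsto[OF w' t] True by simp
  let ?C = "AA + card (words s m) * (AA * B)"
  have ph: "((\<lambda>a. exp_approx w (t a) (x a)) \<longlongrightarrow> x0) A" using exp_approx_tendsto[OF w' t x] True by simp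
  have "isCont (fw Z w) x0" using Ck_cont[OF Ck_fwZ[of 0 w]] by (simp add: continuous_on_eq_continuous_at)
  then have 1: "((\<lambda>a. fw Z w (exp_approx w (t a) (x a))) \<longlongrightarrow> fw Z w x0) A" by (rule isCont_tendsto_compose[OF _ ph])
  have "((\<lambda>a. norm (x a) + M * tau w (t a) * real (NN + 1)) \<longlongrightarrow> norm x0 + M * 0 * real (NN + 1)) A"
    by (intro tendsto_add tendsto_mult tendsto_const tendsto_norm x tt)
  then have e1: "\<forall>\<^sub>F a in A. norm (x a) + M * tau w (t a) * real (NN + 1) < R"
    using order_tendstoD(2)[of _ _ A R] R by simp
  have "\<forall>\<^sub>F a in A. norm (exp_velocity w (t a) (x a) - fw Z w (exp_approx w (t a) (x a))) \<le> ?C * tau w (t a)"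
    using e1 order_tendstoD(2)[OF tt T0] order_tendstoD(2)[OF tt zero_less_one]
    by eventually_elim (rule exp_velocity_near[OF w], auto)
  moreover have "((\<lambda>a. ?C * tau w (t a)) \<longlongrightarrow> 0) A" using tendsto_mult[OF tendsto_const[of ?C] tt] by simp
  ultimately have "((\<lambda>a. exp_velocity w (t a) (x a) - fw Z w (exp_approx w (t a) (x a))) \<longlongrightarrow> 0) A" by (rule Lim_null_comparison)
  from tendsto_add[OF this 1] show ?thesis using True by (simp add: exp_velocity_def)
qed

text \<open>At \<open>t = 0\<close> the chain rule fails because \<open>tau\<close> is not
  differentiable there for words longer than one letter. The derivative is obtained instead from its
  limit along \<open>t \<noteq> 0\<close> by the mean value inequality.\<close>

lemma exp_velocity_deriv:
  assumes w: "w \<in> words s m" and t: "tau w t < T" and R: "norm x < R"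
  shows "((\<lambda>t. exp_approx w t x) has_vector_derivative exp_velocity w t x) (at t)"
proof -
  have w': "w \<noteq> []" "1 \<le> length w" using word_facts[OF w] by auto
  have sok: "\<And>k e b. (k, e) \<in> set (word_seq w b) \<Longrightarrow> \<bar>e\<bar> = 1" using word_seq_ok[OF w] by blast
  have nz: "((\<lambda>t. exp_approx w t x) has_vector_derivative exp_velocity w t x) (at t)" if t: "tau w t < T" and t0: "t \<noteq> 0" for t
  proof -
    let ?b = "0 \<le> t"
    have "((\<lambda>t. run_fl (tau w t) (word_seq w ?b) x) has_vector_derivative
       (sgn t / (real (length w) * tau w t ^ (length w - 1))) *\<^sub>R run_velocity (tau w t) (word_seq w ?b) x) (at t)"
      using vector_diff_chain_at[OF tau_deriv[OF w'(1) t0, unfolded has_real_derivative_iff_has_vector_derivative]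
          run_velocity_deriv[of "word_seq w ?b" "tau w t" x]] sok t tau_nonneg[of w t] by (simp add: o_def)
    then have d: "((\<lambda>t. run_fl (tau w t) (word_seq w ?b) x) has_vector_derivative exp_velocity w t x) (at t)" using t0 by (simp add: exp_velocity_def)
    show ?thesis
    proof (rule has_vector_derivative_transform_within_open[OF d, of "if 0 < t then {0<..} else {..<0}"])
      fix q :: real assume "q \<in> (if 0 < t then {0<..} else {..<0})"
      then show "run_fl (tau w q) (word_seq w ?b) x = exp_approx w q x" using t0 by (auto simp: exp_approx_def split: if_splits)
    qed (use t0 in auto)
  qed
  show ?thesis
  proof (cases "t = 0")
    case False then show ?thesis using nz t by simp
  next
    case True
    let ?l = "exp_velocity w 0 x"
    have "((\<lambda>q. exp_velocity w q x) \<longlongrightarrow> ?l) (at 0)" by (rule exp_velocity_tendsto[OF w tendsto_ident_at tendsto_const R])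
    moreover have "\<forall>\<^sub>F q in at (0::real). tau w q < T"
      using order_tendstoD(2)[OF tau_tendsto[OF w'(1) tendsto_ident_at[of 0 UNIV]], of T] T0 by simp
    ultimately have ev: "\<forall>\<^sub>F q in at (0::real). dist (exp_velocity w q x) ?l < e \<and> tau w q < T" if "e > 0" for e
      using that by (auto simp: tendsto_iff intro: eventually_conj)
    have cont: "continuous_on S (\<lambda>q. exp_approx w q x - q *\<^sub>R ?l)" for S
      unfolding continuous_on_def
      by (intro ballI tendsto_diff exp_approx_tendsto[OF w'(1)] tendsto_scaleR tendsto_const tendsto_ident_at)
    have der: "((\<lambda>q. exp_approx w q x - q *\<^sub>R ?l) has_derivative (\<lambda>h. h *\<^sub>R (exp_velocity w q x - ?l))) (at q)" if "tau w q < T" "q \<noteq> 0" for q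
      using has_vector_derivative_diff[OF nz[OF that] has_vector_derivative_scaleR[OF DERIV_ident has_vector_derivative_const[of ?l]]]
      by (simp add: has_vector_derivative_def)
    have "((\<lambda>h. (1/h) *\<^sub>R (exp_approx w (0 + h) x - exp_approx w 0 x)) \<longlongrightarrow> ?l) (at 0)"
    proof (rule tendstoI)
      fix e :: real assume e: "e > 0"
      obtain d where d: "d > 0" "\<And>q. q \<noteq> 0 \<Longrightarrow> \<bar>q\<bar> < d \<Longrightarrow> dist (exp_velocity w q x) ?l < e \<and> tau w q < T"
        using ev[OF e] unfolding eventually_at by (auto simp: dist_norm)
      show "\<forall>\<^sub>F h in at 0. dist ((1/h) *\<^sub>R (exp_approx w (0 + h) x - exp_approx w 0 x)) ?l < e"
        unfolding eventually_at
      proof (intro exI[of _ d] conjI ballI impI d(1))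
        fix h :: real assume "h \<noteq> 0 \<and> dist h 0 < d"
        then have h: "h \<noteq> 0" "\<bar>h\<bar> < d" by auto
        let ?p = "\<lambda>q. exp_approx w q x - q *\<^sub>R ?l"
        have "norm (?p h - ?p 0) < \<bar>h\<bar> * e"
        proof (cases "h > 0")
          case True
          obtain q where q: "q \<in> {0<..<h}" "norm (?p h - ?p 0) \<le> norm ((h - 0) *\<^sub>R (exp_velocity w q x - ?l))"
            using mvt_general[of 0 h ?p "\<lambda>q h. h *\<^sub>R (exp_velocity w q x - ?l)", OF True cont] der d(2) h by fastforce
          then have "norm (exp_velocity w q x - ?l) < e" using d(2)[of q] h by (auto simp: dist_norm)
          then have "norm ((h - 0) *\<^sub>R (exp_velocity w q x - ?l)) < \<bar>h\<bar> * e" using h by simp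
          with q(2) show ?thesis by linarith
        next
          case False
          then have hn: "h < 0" using h by simp
          obtain q where q: "q \<in> {h<..<0}" "norm (?p 0 - ?p h) \<le> norm ((0 - h) *\<^sub>R (exp_velocity w q x - ?l))"
            using mvt_general[of h 0 ?p "\<lambda>q h. h *\<^sub>R (exp_velocity w q x - ?l)", OF hn cont] der d(2) h by fastforce
          then have "norm (exp_velocity w q x - ?l) < e" using d(2)[of q] h by (auto simp: dist_norm)
          then have "norm ((0 - h) *\<^sub>R (exp_velocity w q x - ?l)) < \<bar>h\<bar> * e" using h by simp
          with q(2) show ?thesis using norm_minus_commute[of "?p h" "?p 0"] by linarith
        qed
        moreover have "?p h - ?p 0 = h *\<^sub>R ((1/h) *\<^sub>R (exp_approx w (0 + h) x - exp_approx w 0 x) - ?l)"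
          using h by (simp add: algebra_simps)
        ultimately show "dist ((1/h) *\<^sub>R (exp_approx w (0 + h) x - exp_approx w 0 x)) ?l < e"
          using h by (simp add: dist_norm)
      qed
    qed
    then show ?thesis using True by (simp add: has_vector_derivative_iff_quotient)
  qed
qed

section \<open>Products of approximate exponentials and their partial derivatives\<close>

definition E_approx :: "(nat \<Rightarrow> nat list) \<Rightarrow> (nat \<Rightarrow> real) \<Rightarrow> nat list \<Rightarrow> real^'n \<Rightarrow> real^'n" where
  "E_approx ws h js x = foldr (\<lambda>j y. exp_approx (ws j) (h j) y) js x"

definition E_tangent :: "(nat \<Rightarrow> nat list) \<Rightarrow> (nat \<Rightarrow> real) \<Rightarrow> nat list \<Rightarrow> (real^'n) \<times> (real^'n) \<Rightarrow> (real^'n) \<times> (real^'n)" where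
  "E_tangent ws h js p = foldr (\<lambda>j p. exp_tangent (ws j) (h j) p) js p"

lemma fst_exp_tangent [simp]: "fst (exp_tangent w t p) = exp_approx w t (fst p)" by (simp add: exp_tangent_def exp_approx_def)

lemma fst_E_tangent [simp]: "fst (E_tangent ws h js p) = E_approx ws h js (fst p)"
  by (induction js) (auto simp: E_tangent_def E_approx_def)

lemma E_approx_curve:
  assumes "(y has_vector_derivative V) (at a)"
  shows "((\<lambda>r. E_approx ws h js (y r)) has_vector_derivative snd (E_tangent ws h js (y a, V))) (at a)"
proof (induction js)
  case Nil then show ?case using assms by (simp add: E_approx_def E_tangent_def)
next
  case (Cons j js)
  have "(E_approx ws h js (y a), snd (E_tangent ws h js (y a, V))) = E_tangent ws h js (y a, V)"
    by (metis fst_E_tangent fst_conv prod.collapse)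
  then show ?case
    using run_fl_curve[OF Cons, of "tau (ws j) (h j)" "word_seq (ws j) (0 \<le> h j)"]
    by (simp add: E_approx_def E_tangent_def exp_tangent_def exp_approx_def)
qed

lemma E_approx_norm:
  assumes "\<And>j. j \<in> set js \<Longrightarrow> ws j \<in> words s m \<and> tau (ws j) (h j) \<le> r"
  shows "norm (E_approx ws h js x) \<le> norm x + M * r * real (NN * length js)"
  using assms
proof (induction js)
  case Nil then show ?case by (simp add: E_approx_def)
next
  case (Cons j js)
  have "norm (E_approx ws h (j # js) x) \<le> norm (E_approx ws h js x) + M * r * NN"
    using exp_approx_norm[of "ws j" "h j" r "E_approx ws h js x"] Cons.prems[of j] by (simp add: E_approx_def)
  also have "norm (E_approx ws h js x) \<le> norm x + M * r * real (NN * length js)" using Cons by simp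
  finally show ?case by (simp add: algebra_simps)
qed

lemma E_approx_tendsto:
  assumes "\<And>j. j \<in> set js \<Longrightarrow> ws j \<noteq> [] \<and> ((\<lambda>a. h a j) \<longlongrightarrow> h0 j) A" "(x \<longlongrightarrow> x0) A"
  shows "((\<lambda>a. E_approx ws (h a) js (x a)) \<longlongrightarrow> E_approx ws h0 js x0) A"
  using assms
proof (induction js)
  case (Cons j js)
  have "((\<lambda>a. exp_approx (ws j) (h a j) (E_approx ws (h a) js (x a))) \<longlongrightarrow> exp_approx (ws j) (h0 j) (E_approx ws h0 js x0)) A"
    using Cons by (intro exp_approx_tendsto) auto
  then show ?case by (simp add: E_approx_def)
qed (simp add: E_approx_def)

lemma E_tangent_tendsto:
  assumes "\<And>j. j \<in> set js \<Longrightarrow> ws j \<noteq> [] \<and> ((\<lambda>a. h a j) \<longlongrightarrow> h0 j) A" "(q \<longlongrightarrow> q0) A"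
  shows "((\<lambda>a. E_tangent ws (h a) js (q a)) \<longlongrightarrow> E_tangent ws h0 js q0) A"
  using assms
proof (induction js)
  case (Cons j js)
  have "((\<lambda>a. exp_tangent (ws j) (h a j) (E_tangent ws (h a) js (q a))) \<longlongrightarrow> exp_tangent (ws j) (h0 j) (E_tangent ws h0 js q0)) A"
    using Cons by (intro exp_tangent_tendsto) auto
  then show ?case by (simp add: E_tangent_def)
qed (simp add: E_tangent_def)

lemma comm_expansion_E_tangent:
  assumes E: "comm_expansion d r A a x V" and js: "\<And>j. j \<in> set js \<Longrightarrow> ws j \<in> words s m \<and> tau (ws j) (h j) \<le> r"
    and r: "0 \<le> r" "r < T" and x: "norm x + M * r * real (NN * length js + 1) < R" and A: "0 \<le> A" and d: "d \<le> s"
  shows "comm_expansion d r (KK ^ (NN * length js) * A) (E_coeff s m ws h js a) (E_approx ws h js x) (snd (E_tangent ws h js (x, V))) \<and>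
    (\<forall>u\<in>words s m. length u = d \<longrightarrow> E_coeff s m ws h js a u = a u)"
  using js x
proof (induction js)
  case Nil
  then show ?case using E by (simp add: E_coeff_def E_approx_def E_tangent_def)
next
  case (Cons j js)
  let ?A = "KK ^ (NN * length js) * A" and ?es = "word_seq (ws j) (0 \<le> h j)" and ?a = "E_coeff s m ws h js a"
    and ?x = "E_approx ws h js x" and ?V = "snd (E_tangent ws h js (x, V))"
  have w: "ws j \<in> words s m" "tau (ws j) (h j) \<le> r" using Cons.prems(1)[of j] by auto
  have "M * r * real (NN * length js + 1) \<le> M * r * real (NN * length (j # js) + 1)" by (rule Mr_mono[OF r(1)]) simp
  then have IH: "comm_expansion d r ?A ?a ?x ?V" "\<forall>u\<in>words s m. length u = d \<longrightarrow> ?a u = a u"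
    using Cons.IH Cons.prems by auto
  have "norm ?x \<le> norm x + M * r * real (NN * length js)" using Cons.prems by (intro E_approx_norm) auto
  moreover have "M * r * real (length ?es + 1) \<le> M * r * real (NN + 1)" using len_word_seq[OF w(1)] by (intro Mr_mono[OF r(1)]) simp
  moreover have "M * r * real (NN * length (j # js) + 1) = M * r * real (NN * length js) + M * r * real (NN + 1)"
    by (simp add: algebra_simps)
  ultimately have x': "norm ?x + M * r * real (length ?es + 1) < R" using Cons.prems(2) by linarith
  have A': "0 \<le> ?A" using KK1 A by simp
  have run_tangent: "comm_expansion d r (KK ^ length ?es * ?A) (push_list s m (tau (ws j) (h j)) ?es ?a) (run_fl (tau (ws j) (h j)) ?es ?x) (snd (run_tangent (tau (ws j) (h j)) ?es (?x, ?V))) \<and>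
    (\<forall>u\<in>words s m. length u = d \<longrightarrow> push_list s m (tau (ws j) (h j)) ?es ?a u = ?a u)"
    by (rule comm_expansion_run_tangent[OF IH(1) _ _ r(2) x' A' d]) (use word_seq_ok[OF w(1)] w(2) tau_nonneg[of "ws j" "h j"] in auto)
  have eq: "(?x, ?V) = E_tangent ws h js (x, V)" by (metis fst_E_tangent fst_conv prod.collapse)
  have "KK ^ length ?es * ?A \<le> KK ^ NN * ?A"
    using A' KK1 len_word_seq[OF w(1)] by (intro mult_right_mono power_increasing) auto
  also have "KK ^ NN * ?A = KK ^ (NN * length (j # js)) * A" by (simp add: power_add)
  finally have K: "KK ^ length ?es * ?A \<le> KK ^ (NN * length (j # js)) * A" .
  have "comm_expansion d r (KK ^ (NN * length (j # js)) * A) (E_coeff s m ws h (j # js) a) (E_approx ws h (j # js) x) (snd (E_tangent ws h (j # js) (x, V)))"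
    using comm_expansion_mono[OF conjunct1[OF run_tangent] K r(1)] unfolding eq by (simp add: E_coeff_def E_approx_def E_tangent_def exp_tangent_def exp_approx_def)
  moreover have "\<forall>u\<in>words s m. length u = d \<longrightarrow> E_coeff s m ws h (j # js) a u = a u"
    using run_tangent IH(2) by (simp add: E_coeff_def)
  ultimately show ?case by blast
qed

text \<open>Factors of index above \<open>j\<close> act before the j-th one and only move its base
  point; factors below \<open>j\<close> act after it and transport its velocity.\<close>

definition E_partial :: "(nat \<Rightarrow> nat list) \<Rightarrow> nat \<Rightarrow> nat \<Rightarrow> real^'n \<Rightarrow> (nat \<Rightarrow> real) \<Rightarrow> real^'n" where
  "E_partial ws n j x h = snd (E_tangent ws h [1..<j] (exp_approx (ws j) (h j) (E_approx ws h [Suc j..<n + 1] x),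
      exp_velocity (ws j) (h j) (E_approx ws h [Suc j..<n + 1] x)))"

context
  fixes ws :: "nat \<Rightarrow> nat list" and n j :: nat and r0 :: real and x :: "real^'n"
  assumes ws: "\<And>i. i \<in> {1..n} \<Longrightarrow> ws i \<in> words s m" and j: "j \<in> {1..n}" and r0: "0 < r0" "r0 < T"
    and xR: "norm x + M * r0 * real (NN * (n + 2) + 1) < R"
begin

lemma split_list: "[1..<n + 1] = [1..<j] @ [j] @ [Suc j..<n + 1]"
proof -
  have "[1..<n + 1] = [1..<j] @ [j..<n + 1]" using j upt_add_eq_append[of 1 j "n + 1 - j"] by auto
  then show ?thesis using j upt_conv_Cons[of j "n + 1"] by auto
qed

lemma xR': "0 \<le> r \<Longrightarrow> r \<le> r0 \<Longrightarrow> (q::nat) \<le> NN * (n + 2) + 1 \<Longrightarrow> norm x + M * r * real q < R"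
proof -
  assume "0 \<le> r" "r \<le> r0" "q \<le> NN * (n + 2) + 1"
  then have "M * r * real q \<le> M * r0 * real (NN * (n + 2) + 1)"
    using M0 by (intro mult_mono of_nat_mono) auto
  then show ?thesis using xR by linarith
qed

lemma E_approx_update: "E_approx ws (h(j := t)) [1..<n + 1] x = E_approx ws h [1..<j] (exp_approx (ws j) t (E_approx ws h [Suc j..<n + 1] x))"
proof -
  have "foldr (\<lambda>i y. exp_approx (ws i) ((h(j := t)) i) y) js y = foldr (\<lambda>i y. exp_approx (ws i) (h i) y) js y" if "j \<notin> set js" for js y
    using that by (induction js) auto
  then show ?thesis unfolding E_approx_def split_list by simp
qed

lemma E_approx_split: "E_approx ws h [1..<n + 1] x = E_approx ws h [1..<j] (exp_approx (ws j) (h j) (E_approx ws h [Suc j..<n + 1] x))"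
  using E_approx_update[of h "h j"] by simp

lemma tail_norm:
  assumes "\<And>i. i \<in> {1..n} \<Longrightarrow> tau (ws i) (h i) \<le> r" and r: "0 \<le> r" "r \<le> r0"
  shows "norm (E_approx ws h [Suc j..<n + 1] x) \<le> norm x + M * r * real (NN * n)"
proof -
  have "norm (E_approx ws h [Suc j..<n + 1] x) \<le> norm x + M * r * real (NN * length [Suc j..<n + 1])"
    using assms(1) ws j by (intro E_approx_norm) auto
  also have "\<dots> \<le> norm x + M * r * real (NN * n)" using Mr_mono[OF r(1), of "NN * length [Suc j..<n + 1]" "NN * n"] by (simp del: upt_Suc)
  finally show ?thesis .
qed

text \<open>The tail is charged with all \<open>n\<close> factors, each displacing a point by at
  most \<open>M * r * NN\<close>. The budget \<open>NN * (n + 2) + 1\<close> then leaves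
  \<open>NN * 2 + 1\<close>, enough for the j-th factor and the unit margin of the expansion
  lemmas.\<close>

lemma tail_R:
  assumes "\<And>i. i \<in> {1..n} \<Longrightarrow> tau (ws i) (h i) \<le> r" and r: "0 \<le> r" "r \<le> r0" and q: "q \<le> NN * 2 + 1"
  shows "norm (E_approx ws h [Suc j..<n + 1] x) + M * r * real q < R"
proof -
  have "norm (E_approx ws h [Suc j..<n + 1] x) + M * r * real q \<le> norm x + M * r * real (NN * n + q)"
    using tail_norm[OF assms(1-3)] by (simp add: algebra_simps)
  also have "\<dots> < R" using q by (intro xR'[OF r]) (simp add: algebra_simps)
  finally show ?thesis .
qed

lemma E_partial_deriv:
  assumes h: "\<And>i. i \<in> {1..n} \<Longrightarrow> tau (ws i) (h i) \<le> r" and r: "0 \<le> r" "r \<le> r0"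
  shows "((\<lambda>t. E_approx ws (h(j := t)) [1..<n + 1] x) has_vector_derivative E_partial ws n j x h) (at (h j))"
  unfolding E_approx_update E_partial_def
  by (rule E_approx_curve, rule exp_velocity_deriv) (use h[OF j] ws[OF j] r r0 tail_R[OF h r, of 0] in auto)

lemma E_partial_tendsto:
  assumes h: "\<And>i. i \<in> {1..n} \<Longrightarrow> tau (ws i) (h0 i) \<le> r" and r: "0 \<le> r" "r \<le> r0"
    and t: "\<And>i. ((\<lambda>a. h a i) \<longlongrightarrow> h0 i) A"
  shows "((\<lambda>a. E_partial ws n j x (h a)) \<longlongrightarrow> E_partial ws n j x h0) A"
proof -
  have ne: "ws i \<noteq> []" if "i \<in> {1..n}" for i using word_facts[OF ws[OF that]] by simp
  have tl: "((\<lambda>a. E_approx ws (h a) [Suc j..<n + 1] x) \<longlongrightarrow> E_approx ws h0 [Suc j..<n + 1] x) A"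
    by (intro E_approx_tendsto tendsto_const conjI t ne) (use j in auto)
  show ?thesis unfolding E_partial_def
    by (intro tendsto_snd E_tangent_tendsto tendsto_Pair conjI ne t exp_approx_tendsto exp_velocity_tendsto tl)
      (use j ws tail_R[OF h r, of 0] in auto)
qed

text \<open>The velocity of the j-th factor is expanded in the base length \<open>d\<close> and then
  transported. Transport preserves coefficients of length \<open>d\<close>, so the only commutator
  of that length present is the j-th one, with coefficient 1.\<close>

lemma E_partial_comm_expansion:
  assumes h: "\<And>i. i \<in> {1..n} \<Longrightarrow> tau (ws i) (h i) \<le> r" and r: "0 \<le> r" "r \<le> r0"
  defines "a \<equiv> E_coeff s m ws h [1..<j] (exp_coeff s m (ws j) (h j))" and "d \<equiv> length (ws j)"
    and "C \<equiv> KK ^ (NN * n) * AA" and "E \<equiv> E_approx ws h [1..<n + 1] x"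
  shows "\<bar>a v\<bar> \<le> C * r ^ (length v - d)"
    and "norm (E_partial ws n j x h - fw Z (ws j) E - (\<Sum>v\<in>{v\<in>words s m. d + 1 \<le> length v}. a v *\<^sub>R fw Z v E)) \<le> C * r ^ (s + 1 - d)"
proof -
  let ?z = "E_approx ws h [Suc j..<n + 1] x"
  have w: "ws j \<in> words s m" by (rule ws[OF j])
  have E0: "comm_expansion d r AA (exp_coeff s m (ws j) (h j)) (exp_approx (ws j) (h j) ?z) (exp_velocity (ws j) (h j) ?z)"
    unfolding d_def by (rule comm_expansion_exp_velocity[OF w h[OF j]]) (use r r0 tail_R[OF h r, of "NN + 1"] in auto)
  have le: "NN * length [1..<j] + 1 + NN \<le> NN * n + 1"
  proof -
    have "NN * Suc (j - 1) \<le> NN * n" using j by (intro mult_le_mono2) auto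
    then show ?thesis by simp
  qed
  have y: "norm (exp_approx (ws j) (h j) ?z) + M * r * real (NN * length [1..<j] + 1) < R"
  proof -
    have "norm (exp_approx (ws j) (h j) ?z) \<le> norm ?z + M * r * NN" by (rule exp_approx_norm[OF w h[OF j]])
    also have "norm ?z \<le> norm x + M * r * real (NN * length [Suc j..<n + 1])"
      using h ws j by (intro E_approx_norm) auto
    finally have "norm (exp_approx (ws j) (h j) ?z) + M * r * real (NN * length [1..<j] + 1) \<le>
       norm x + M * r * real (NN * length [Suc j..<n + 1] + NN + (NN * length [1..<j] + 1))"
      by (simp add: algebra_simps)
    also have "\<dots> < R"
    proof (rule xR'[OF r])
      have "NN * length [Suc j..<n + 1] \<le> NN * n" by (simp del: upt_Suc)
      moreover have "NN * length [1..<j] \<le> NN * n" using j by (intro mult_le_mono2) auto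
      ultimately show "NN * length [Suc j..<n + 1] + NN + (NN * length [1..<j] + 1) \<le> NN * (n + 2) + 1"
        using j le by (simp add: algebra_simps diff_mult_distrib2 del: upt_Suc)
    qed
    finally show ?thesis .
  qed
  have F: "comm_expansion d r (KK ^ (NN * length [1..<j]) * AA) a E (E_partial ws n j x h)"
    and low: "\<forall>u\<in>words s m. length u = d \<longrightarrow> a u = exp_coeff s m (ws j) (h j) u"
    using comm_expansion_E_tangent[OF E0, of "[1..<j]" ws h, OF _ r(1) _ y] h ws j r r0 AA1 word_facts[OF w]
    unfolding a_def E_def E_approx_split E_partial_def d_def by auto
  have "KK ^ (NN * length [1..<j]) * AA \<le> C"
    unfolding C_def using KK1 AA1 j by (intro mult_right_mono power_increasing) auto
  then have F: "comm_expansion d r C a E (E_partial ws n j x h)" using comm_expansion_mono[OF F] r by simp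
  then show "\<bar>a v\<bar> \<le> C * r ^ (length v - d)" unfolding comm_expansion_def by blast
  have "(\<Sum>v\<in>words s m. a v *\<^sub>R fw Z v E) = a (ws j) *\<^sub>R fw Z (ws j) E + (\<Sum>v\<in>words s m - {ws j}. a v *\<^sub>R fw Z v E)"
    by (rule sum.remove[OF finite_words w])
  \<comment> \<open>The unit coefficient is prescribed by \<open>exp_coeff\<close> and unaffected by
    the pushes.\<close>
  also have "a (ws j) = 1" using low w by (simp add: d_def exp_coeff_def)
  also have "(\<Sum>v\<in>words s m - {ws j}. a v *\<^sub>R fw Z v E) = (\<Sum>v\<in>{v\<in>words s m. d + 1 \<le> length v}. a v *\<^sub>R fw Z v E)"
  proof (rule sum.mono_neutral_right)
    show "\<forall>v\<in>words s m - {ws j} - {v\<in>words s m. d + 1 \<le> length v}. a v *\<^sub>R fw Z v E = 0"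
    proof
      fix v assume v: "v \<in> words s m - {ws j} - {v\<in>words s m. d + 1 \<le> length v}"
      then consider "length v < d" | "length v = d" by fastforce
      then have "a v = 0"
      proof cases
        case 1 then show ?thesis using F unfolding comm_expansion_def by blast
      next
        case 2 then show ?thesis using v low by (auto simp: exp_coeff_def d_def)
      qed
      then show "a v *\<^sub>R fw Z v E = 0" by simp
    qed
  qed (auto simp: finite_words d_def)
  finally show "norm (E_partial ws n j x h - fw Z (ws j) E - (\<Sum>v\<in>{v\<in>words s m. d + 1 \<le> length v}. a v *\<^sub>R fw Z v E)) \<le> C * r ^ (s + 1 - d)"
    using F unfolding comm_expansion_def by (simp add: algebra_simps)
qed

end

end

section \<open>Mollification\<close>

lemma integral_bounded_support:
  fixes f :: "'a::euclidean_space \<Rightarrow> 'b::euclidean_space"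
  assumes m: "f \<in> borel_measurable lborel" and C: "0 \<le> C" and r: "0 \<le> \<rho>"
    and b: "\<And>z. norm (z - x) \<le> \<rho> \<Longrightarrow> norm (f z) \<le> C" and z: "\<And>z. \<rho> < norm (z - x) \<Longrightarrow> f z = 0"
  shows "integrable lborel f"
    and "norm (integral\<^sup>L lborel f) \<le> C * (unit_ball_vol (real DIM('a)) * \<rho> ^ DIM('a))"
proof -
  let ?g = "\<lambda>z. C * indicator (cball x \<rho>) z"
  have g: "integrable lborel ?g"
    by (intro integrable_mult_right integrable_real_indicator) (auto simp: emeasure_bounded_finite[unfolded infinity_ennreal_def])
  have le: "norm (f y) \<le> ?g y" for y
    using b[of y] z[of y] C by (cases "norm (y - x) \<le> \<rho>") (auto simp: indicator_def dist_norm norm_minus_commute)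
  show i: "integrable lborel f"
    by (rule Bochner_Integration.integrable_bound[OF g m]) (use le C in \<open>auto intro!: AE_I2 order_trans[OF le]\<close>)
  have "norm (integral\<^sup>L lborel f) \<le> integral\<^sup>L lborel ?g"
    by (rule order_trans[OF integral_norm_bound integral_mono[OF integrable_norm[OF i] g le]])
  also have "\<dots> = C * (unit_ball_vol (real DIM('a)) * \<rho> ^ DIM('a))"
    using content_cball[OF r, of x] by simp
  finally show "norm (integral\<^sup>L lborel f) \<le> C * (unit_ball_vol (real DIM('a)) * \<rho> ^ DIM('a))" .
qed

lemma integral_affine_lborel:
  fixes f :: "'a::euclidean_space \<Rightarrow> 'b::euclidean_space"
  assumes f: "f \<in> borel_measurable borel" and c: "c \<noteq> 0"
  shows "integral\<^sup>L lborel f = (\<bar>c\<bar> ^ DIM('a)) *\<^sub>R (\<integral>y. f (t + c *\<^sub>R y) \<partial>lborel)"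
proof -
  have "integral\<^sup>L lborel f = integral\<^sup>L (density (distr lborel borel (\<lambda>x. t + c *\<^sub>R x)) (\<lambda>_. \<bar>c\<bar> ^ DIM('a))) f"
    using lborel_affine[OF c, of t] by simp
  also have "\<dots> = (\<integral>y. (\<bar>c\<bar> ^ DIM('a)) *\<^sub>R f y \<partial>distr lborel borel (\<lambda>x. t + c *\<^sub>R x))"
    using f by (subst integral_density) (auto simp: ennreal_power)
  also have "\<dots> = (\<integral>y. (\<bar>c\<bar> ^ DIM('a)) *\<^sub>R f (t + c *\<^sub>R y) \<partial>lborel)"
    using f by (subst integral_distr) auto
  finally show ?thesis by simp
qed

lemma integral_translation_lborel:
  fixes f :: "'a::euclidean_space \<Rightarrow> 'b::euclidean_space"
  assumes f: "f \<in> borel_measurable borel"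
  shows "integral\<^sup>L lborel f = (\<integral>y. f (y + t) \<partial>lborel)"
  using integral_affine_lborel[OF f, of 1 t] by (simp add: add.commute)

text \<open>In contrast to \<open>mollifier\<close>, this class is stable under \<open>pd\<close>,
  so that derivatives of a mollification are again mollifications, with differentiated
  kernels.\<close>

definition bump :: "(real^'n \<Rightarrow> real) \<Rightarrow> bool" where
  "bump \<psi> \<longleftrightarrow> (\<forall>r. Ck r \<psi>) \<and> (\<forall>z. 1 < norm z \<longrightarrow> \<psi> z = 0)"

lemma bump_Ck: "bump \<psi> \<Longrightarrow> Ck r \<psi>" and bump_0: "bump \<psi> \<Longrightarrow> 1 < norm z \<Longrightarrow> \<psi> z = 0"
  by (auto simp: bump_def)

lemma pd_const: "pd k (\<lambda>_. c) x = 0"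
  using has_derivative_imp_pd(2)[OF has_derivative_const[of c "at x"], of k] by simp

lemma bump_pd: "bump \<psi> \<Longrightarrow> bump (pd k \<psi>)"
proof -
  assume b: "bump \<psi>"
  have "pd k \<psi> z = 0" if z: "1 < norm z" for z
  proof -
    have "open {z :: real^'n. 1 < norm z}" by (intro open_Collect_less continuous_intros)
    then have "pd k \<psi> z = pd k (\<lambda>_. 0) z" by (rule pd_cong_open) (use b z in \<open>auto simp: bump_def\<close>)
    also have "\<dots> = 0" by (rule pd_const)
    finally show ?thesis .
  qed
  then show ?thesis using b by (auto simp: bump_def intro: Ck_pd)
qed

lemma bump_bounded: "bump \<psi> \<Longrightarrow> \<exists>C\<ge>0. \<forall>z. \<bar>\<psi> z\<bar> \<le> C"
proof -
  assume b: "bump \<psi>"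
  have "compact (\<psi> ` cball 0 1)"
    by (intro compact_continuous_image continuous_on_subset[OF Ck_cont[OF bump_Ck[OF b, of 0]]]) auto
  then obtain C where C: "\<And>z. z \<in> cball 0 1 \<Longrightarrow> norm (\<psi> z) \<le> C"
    by (meson compact_imp_bounded bounded_iff imageI)
  have "\<bar>\<psi> z\<bar> \<le> max C 0" for z
    using C[of z] bump_0[OF b, of z] by (cases "norm z \<le> 1") auto
  then show ?thesis by (intro exI[of _ "max C 0"]) auto
qed

lemma bump_lip: "bump \<psi> \<Longrightarrow> \<exists>C\<ge>0. \<forall>y z. \<bar>\<psi> y - \<psi> z\<bar> \<le> C * norm (y - z)"
proof -
  assume b: "bump \<psi>"
  have "\<forall>k. \<exists>C\<ge>0. \<forall>z. \<bar>pd k \<psi> z\<bar> \<le> C" using bump_bounded[OF bump_pd[OF b]] by blast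
  then obtain C where C: "\<And>k. C k \<ge> 0" "\<And>k z. \<bar>pd k \<psi> z\<bar> \<le> C k" by metis
  let ?L = "\<Sum>k\<in>UNIV. C k"
  have "norm (\<psi> y - \<psi> z) \<le> ?L * norm (y - z)" for y z
  proof (rule differentiable_bound[where f' = "dir \<psi>" and S = UNIV])
    fix x
    show "(\<psi> has_derivative dir \<psi> x) (at x within UNIV)"
      using Ck_has_derivative_dir[OF bump_Ck[OF b]] by simp
    show "onorm (dir \<psi> x) \<le> ?L"
    proof (rule onorm_le)
      fix h
      have "norm (dir \<psi> x h) \<le> (\<Sum>k\<in>UNIV. C k * norm h)"
        unfolding dir_def
      proof (rule sum_norm_le)
        fix k
        have "\<bar>pd k \<psi> x\<bar> * \<bar>h $ k\<bar> \<le> C k * norm h" using C component_le_norm_cart[of h k] by (intro mult_mono) auto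
        then show "norm (h $ k *\<^sub>R pd k \<psi> x) \<le> C k * norm h" by (simp add: abs_mult mult.commute)
      qed
      then show "norm (dir \<psi> x h) \<le> ?L * norm h" by (simp add: sum_distrib_right)
    qed
  qed auto
  moreover have "0 \<le> ?L" by (intro sum_nonneg C)
  ultimately show ?thesis by (intro exI[of _ ?L]) auto
qed

section \<open>The mollification operator and its derivatives\<close>

definition mollify :: "(real^'n \<Rightarrow> real) \<Rightarrow> real \<Rightarrow> (real^'n \<Rightarrow> 'b::euclidean_space) \<Rightarrow> real^'n \<Rightarrow> 'b" where
  "mollify \<psi> \<sigma> u x = (\<integral>y. \<psi> y *\<^sub>R u (x - \<sigma> *\<^sub>R y) \<partial>lborel)"

lemma borel_cont: "continuous_on UNIV g \<Longrightarrow> g \<in> borel_measurable lborel"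
  by (simp add: borel_measurable_continuous_onI)

lemma cont_mollify_arg:
  fixes u :: "'a::real_normed_vector \<Rightarrow> 'b::topological_space"
  shows "continuous_on UNIV u \<Longrightarrow> continuous_on UNIV (\<lambda>y. u (x - \<sigma> *\<^sub>R y))"
  by (rule continuous_on_compose2[of UNIV u]) (auto intro!: continuous_intros)

lemma kernel_bound:
  fixes u :: "real^'n \<Rightarrow> 'b::euclidean_space"
  assumes c: "continuous_on UNIV \<eta>" "continuous_on UNIV u" and s: "0 \<le> \<sigma>" and r: "0 \<le> \<rho>" and C: "0 \<le> C" and U: "0 \<le> U"
    and b: "\<And>y. \<bar>\<eta> y\<bar> \<le> C" and z: "\<And>y. \<rho> < norm y \<Longrightarrow> \<eta> y = 0"
    and u: "\<And>z. norm (z - x) \<le> \<sigma> * \<rho> \<Longrightarrow> norm (u z) \<le> U"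
  shows "integrable lborel (\<lambda>y. \<eta> y *\<^sub>R u (x - \<sigma> *\<^sub>R y))"
    and "norm (\<integral>y. \<eta> y *\<^sub>R u (x - \<sigma> *\<^sub>R y) \<partial>lborel) \<le> C * U * (unit_ball_vol (real DIM(real^'n)) * \<rho> ^ DIM(real^'n))"
proof -
  have m: "(\<lambda>y. \<eta> y *\<^sub>R u (x - \<sigma> *\<^sub>R y)) \<in> borel_measurable lborel"
    by (intro borel_cont continuous_on_scaleR c cont_mollify_arg)
  have n: "norm (\<eta> y *\<^sub>R u (x - \<sigma> *\<^sub>R y)) \<le> C * U" if "norm (y - 0) \<le> \<rho>" for y
  proof -
    have "norm (u (x - \<sigma> *\<^sub>R y)) \<le> U" using that s by (intro u) (auto intro: mult_left_mono)
    then show ?thesis using b[of y] C by (auto intro!: mult_mono)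
  qed
  show "integrable lborel (\<lambda>y. \<eta> y *\<^sub>R u (x - \<sigma> *\<^sub>R y))"
    and "norm (\<integral>y. \<eta> y *\<^sub>R u (x - \<sigma> *\<^sub>R y) \<partial>lborel) \<le> C * U * (unit_ball_vol (real DIM(real^'n)) * \<rho> ^ DIM(real^'n))"
    using integral_bounded_support[where x = 0, OF m _ r n] z C U by auto
qed

lemma cont_bounded_ball:
  fixes u :: "real^'n \<Rightarrow> 'b::real_normed_vector"
  assumes "continuous_on UNIV u"
  shows "\<exists>U\<ge>0. \<forall>z. norm z \<le> R \<longrightarrow> norm (u z) \<le> U"
proof -
  have "compact (u ` cball 0 R)" by (intro compact_continuous_image continuous_on_subset[OF assms]) auto
  then obtain C where C: "\<And>z. z \<in> cball 0 R \<Longrightarrow> norm (u z) \<le> C"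
    by (meson compact_imp_bounded bounded_iff imageI)
  then show ?thesis by (intro exI[of _ "max C 0"]) (auto simp: le_max_iff_disj)
qed

lemma cont_bounded_near:
  fixes u :: "real^'n \<Rightarrow> 'b::real_normed_vector"
  assumes "continuous_on UNIV u"
  shows "\<exists>U\<ge>0. \<forall>z. norm (z - x) \<le> R \<longrightarrow> norm (u z) \<le> U"
proof -
  obtain U where U: "U \<ge> 0" "\<And>z. norm z \<le> norm x + R \<Longrightarrow> norm (u z) \<le> U" using cont_bounded_ball[OF assms] by metis
  have "norm z \<le> norm x + R" if "norm (z - x) \<le> R" for z using that norm_triangle_sub[of z x] by simp
  then show ?thesis using U by blast
qed

lemma mollify_integrable:
  fixes u :: "real^'n \<Rightarrow> 'b::euclidean_space"
  assumes b: "bump \<psi>" and u: "continuous_on UNIV u" and s: "0 \<le> \<sigma>"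
  shows "integrable lborel (\<lambda>y. \<psi> y *\<^sub>R u (x - \<sigma> *\<^sub>R y))"
proof -
  obtain C where C: "C \<ge> 0" "\<And>z. \<bar>\<psi> z\<bar> \<le> C" using bump_bounded[OF b] by blast
  obtain U where U: "U \<ge> 0" "\<And>z. norm (z - x) \<le> \<sigma> * 1 \<Longrightarrow> norm (u z) \<le> U" using cont_bounded_near[OF u] by metis
  show ?thesis by (rule kernel_bound(1)[OF Ck_cont[OF bump_Ck[OF b, of 0]] u s _ C(1) U(1) C(2) bump_0[OF b] U(2)]) auto
qed

lemma mollify_bound:
  fixes u :: "real^'n \<Rightarrow> 'b::euclidean_space"
  assumes b: "bump \<psi>" and C: "0 \<le> C" "\<And>z. \<bar>\<psi> z\<bar> \<le> C" and u: "continuous_on UNIV u" and s: "0 \<le> \<sigma>"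
    and U: "0 \<le> U" "\<And>z. norm (z - x) \<le> \<sigma> \<Longrightarrow> norm (u z) \<le> U"
  shows "norm (mollify \<psi> \<sigma> u x) \<le> C * unit_ball_vol (real DIM(real^'n)) * U"
  using kernel_bound(2)[OF Ck_cont[OF bump_Ck[OF b, of 0]] u s zero_le_one C(1) U(1) C(2) bump_0[OF b], of x] U(2)
  by (simp add: mollify_def mult_ac)

lemma mollify_diff:
  assumes "bump \<psi>" "continuous_on UNIV u" "continuous_on UNIV v" "0 \<le> \<sigma>"
  shows "mollify \<psi> \<sigma> (\<lambda>x. u x - v x) x = mollify \<psi> \<sigma> u x - mollify \<psi> \<sigma> v x"
  unfolding mollify_def using mollify_integrable[OF assms(1,2,4)] mollify_integrable[OF assms(1,3,4)]
  by (simp add: scaleR_diff_right)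

lemma mollify_add:
  assumes "bump \<psi>" "continuous_on UNIV u" "continuous_on UNIV v" "0 \<le> \<sigma>"
  shows "mollify \<psi> \<sigma> (\<lambda>x. u x + v x) x = mollify \<psi> \<sigma> u x + mollify \<psi> \<sigma> v x"
  unfolding mollify_def using mollify_integrable[OF assms(1,2,4)] mollify_integrable[OF assms(1,3,4)]
  by (simp add: scaleR_add_right)

lemma mollify_linear:
  assumes h: "bounded_linear h" and "bump \<psi>" "continuous_on UNIV u" "0 \<le> \<sigma>"
  shows "mollify \<psi> \<sigma> (\<lambda>x. h (u x)) x = h (mollify \<psi> \<sigma> u x)"
proof -
  have "h (mollify \<psi> \<sigma> u x) = (\<integral>y. h (\<psi> y *\<^sub>R u (x - \<sigma> *\<^sub>R y)) \<partial>lborel)"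
    unfolding mollify_def by (rule integral_bounded_linear[OF h mollify_integrable[OF assms(2-4)], symmetric])
  then show ?thesis by (simp add: mollify_def linear_cmul[OF bounded_linear.linear[OF h]])
qed

lemma mollify_const: "mollify \<psi> \<sigma> (\<lambda>_. c) x = integral\<^sup>L lborel \<psi> *\<^sub>R c" if "bump \<psi>"
proof -
  have "integrable lborel (\<lambda>y. \<psi> y *\<^sub>R (1::real))" using mollify_integrable[OF that, of "\<lambda>_. 1::real" 0 0] by simp
  then show ?thesis by (simp add: mollify_def)
qed

text \<open>Translation moves the increment of the base point from \<open>u\<close>, which is merely
  continuous, onto the smooth kernel.\<close>

lemma mollify_shift:
  fixes u :: "real^'n \<Rightarrow> 'b::euclidean_space"
  assumes b: "bump \<psi>" and u: "continuous_on UNIV u" and s: "0 < \<sigma>"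
  shows "mollify \<psi> \<sigma> u (x + v) = (\<integral>y. \<psi> (y + (1/\<sigma>) *\<^sub>R v) *\<^sub>R u (x - \<sigma> *\<^sub>R y) \<partial>lborel)"
proof -
  have "(\<lambda>y. \<psi> y *\<^sub>R u (x + v - \<sigma> *\<^sub>R y)) \<in> borel_measurable borel"
    using borel_cont[OF continuous_on_scaleR[OF Ck_cont[OF bump_Ck[OF b, of 0]] cont_mollify_arg[OF u]]] by simp
  from integral_translation_lborel[OF this, of "(1/\<sigma>) *\<^sub>R v"] s show ?thesis
    by (simp add: mollify_def algebra_simps)
qed

lemma cont_shift: "continuous_on UNIV \<psi> \<Longrightarrow> continuous_on UNIV (\<lambda>y::'a::real_normed_vector. \<psi> (y + w))"
  by (rule continuous_on_compose2[of UNIV \<psi>]) (auto intro!: continuous_intros)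

lemma mollify_continuous:
  fixes u :: "real^'n \<Rightarrow> 'b::euclidean_space"
  assumes b: "bump \<psi>" and u: "continuous_on UNIV u" and s: "0 < \<sigma>"
  shows "continuous_on UNIV (mollify \<psi> \<sigma> u)"
  unfolding continuous_on_eq_continuous_at[OF open_UNIV] isCont_def
proof (rule ballI)
  fix x
  obtain L where L: "L \<ge> 0" "\<And>y z. \<bar>\<psi> y - \<psi> z\<bar> \<le> L * norm (y - z)" using bump_lip[OF b] by blast
  \<comment> \<open>Radius 2, because the kernel and its shift by a vector of length at most 1 both
    vanish outside that ball.\<close>
  obtain U where U: "U \<ge> 0" "\<And>z. norm (z - x) \<le> \<sigma> * 2 \<Longrightarrow> norm (u z) \<le> U" using cont_bounded_near[OF u] by metis
  let ?K = "L / \<sigma> * U * (unit_ball_vol (real DIM(real^'n)) * 2 ^ DIM(real^'n))"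
  have cp: "continuous_on UNIV \<psi>" by (rule Ck_cont[OF bump_Ck[OF b, of 0]])
  have bd: "norm (mollify \<psi> \<sigma> u (x + v) - mollify \<psi> \<sigma> u x) \<le> ?K * norm v" if v: "norm v \<le> \<sigma>" for v
  proof -
    let ?w = "(1/\<sigma>) *\<^sub>R v"
    have w: "norm ?w \<le> 1" "norm ?w = norm v / \<sigma>" using v s by (auto simp: divide_le_eq)
    have i: "integrable lborel (\<lambda>y. \<psi> (y + ?w) *\<^sub>R u (x - \<sigma> *\<^sub>R y))"
    proof -
      obtain C where C: "C \<ge> 0" "\<And>z. \<bar>\<psi> z\<bar> \<le> C" using bump_bounded[OF b] by blast
      show ?thesis
      proof (rule kernel_bound(1)[where \<eta> = "\<lambda>y. \<psi> (y + ?w)" and C = C and U = U and \<rho> = 2])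
        fix y :: "real^'n" assume "2 < norm y"
        then show "\<psi> (y + ?w) = 0" using w norm_triangle_sub[of y "- ?w"] by (intro bump_0[OF b]) simp
      qed (use s C U u cont_shift[OF cp] in auto)
    qed
    have "mollify \<psi> \<sigma> u (x + v) - mollify \<psi> \<sigma> u x = (\<integral>y. (\<psi> (y + ?w) - \<psi> y) *\<^sub>R u (x - \<sigma> *\<^sub>R y) \<partial>lborel)"
      unfolding mollify_shift[OF b u s] mollify_def[of \<psi> \<sigma> u x] using i mollify_integrable[OF b u, of \<sigma> x] s
      by (simp add: scaleR_diff_left)
    also have "norm \<dots> \<le> (L * norm ?w) * U * (unit_ball_vol (real DIM(real^'n)) * 2 ^ DIM(real^'n))"
    proof (rule kernel_bound(2)[OF _ u _ _ _ U(1) _ _ U(2)])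
      show "continuous_on UNIV (\<lambda>y. \<psi> (y + ?w) - \<psi> y)" by (intro continuous_on_diff cont_shift cp)
      fix y
      show "\<bar>\<psi> (y + ?w) - \<psi> y\<bar> \<le> L * norm ?w" using L(2)[of "y + ?w" y] by simp
      assume "2 < norm y"
      then show "\<psi> (y + ?w) - \<psi> y = 0" using w norm_triangle_sub[of y "- ?w"] bump_0[OF b] by simp
    qed (use s L in auto)
    finally show ?thesis using s by (simp add: w(2) mult_ac)
  qed
  have "((\<lambda>y. ?K * norm (y - x)) \<longlongrightarrow> ?K * norm (x - x)) (at x)"
    by (intro tendsto_mult tendsto_const tendsto_norm tendsto_diff tendsto_ident_at)
  then have 0: "((\<lambda>y. ?K * norm (y - x)) \<longlongrightarrow> 0) (at x)" by simp
  have "\<forall>\<^sub>F y in at x. norm (mollify \<psi> \<sigma> u y - mollify \<psi> \<sigma> u x) \<le> ?K * norm (y - x)"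
    unfolding eventually_at
  proof (intro exI[of _ \<sigma>] conjI ballI impI s)
    fix y assume "y \<noteq> x \<and> dist y x < \<sigma>"
    then show "norm (mollify \<psi> \<sigma> u y - mollify \<psi> \<sigma> u x) \<le> ?K * norm (y - x)" using bd[of "y - x"] by (simp add: dist_norm)
  qed
  then show "mollify \<psi> \<sigma> u \<midarrow>x\<rightarrow> mollify \<psi> \<sigma> u x" by (rule LIM_zero_cancel[OF Lim_null_comparison[OF _ 0]])
qed

lemma quotient_imp_pd:
  assumes K: "0 < \<delta>" "\<And>t. \<bar>t\<bar> \<le> \<delta> \<Longrightarrow> norm (g (x + t *\<^sub>R axis k 1) - g x - t *\<^sub>R D) \<le> K * t\<^sup>2"
  shows "pd_exists k g x" "pd k g x = D"
proof -
  have "((\<lambda>t. g (x + t *\<^sub>R axis k 1)) has_vector_derivative D) (at 0)"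
    unfolding has_vector_derivative_iff_quotient
  proof (rule LIM_zero_cancel, rule Lim_null_comparison)
    have "((\<lambda>t. K * \<bar>t\<bar>) \<longlongrightarrow> K * \<bar>0::real\<bar>) (at 0)"
      by (intro tendsto_mult tendsto_const tendsto_rabs tendsto_ident_at)
    then show "((\<lambda>t::real. K * \<bar>t\<bar>) \<longlongrightarrow> 0) (at 0)" by simp
    show "\<forall>\<^sub>F t in at 0. norm ((1/t) *\<^sub>R (g (x + (0 + t) *\<^sub>R axis k 1) - g (x + 0 *\<^sub>R axis k 1)) - D) \<le> K * \<bar>t\<bar>"
      unfolding eventually_at
    proof (intro exI[of _ \<delta>] conjI ballI impI K(1))
      fix t :: real assume "t \<noteq> 0 \<and> dist t 0 < \<delta>"
      then have t: "t \<noteq> 0" "\<bar>t\<bar> \<le> \<delta>" by auto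
      have "(1/t) *\<^sub>R (g (x + t *\<^sub>R axis k 1) - g x) - D = (1/t) *\<^sub>R (g (x + t *\<^sub>R axis k 1) - g x - t *\<^sub>R D)"
        using t by (simp add: scaleR_diff_right)
      also have "norm \<dots> \<le> 1 / \<bar>t\<bar> * (K * t\<^sup>2)"
        using K(2)[OF t(2)] by (simp add: divide_right_mono)
      also have "\<dots> = K * \<bar>t\<bar>" using t by (simp add: power2_eq_square field_simps)
      finally show "norm ((1/t) *\<^sub>R (g (x + (0 + t) *\<^sub>R axis k 1) - g (x + 0 *\<^sub>R axis k 1)) - D) \<le> K * \<bar>t\<bar>" by simp
    qed
  qed
  then show "pd_exists k g x" "pd k g x = D"
    unfolding pd_exists_def pd_def by (auto intro: differentiableI_vector vector_derivative_at)
qed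

text \<open>The derivative falls on the kernel and costs \<open>1/\<sigma>\<close>. The difference
  quotient is estimated by the Lipschitz bound on the kernel's own partial derivative, so
  \<open>u\<close> needs no regularity beyond continuity.\<close>

lemma pd_mollify:
  fixes u :: "real^'n \<Rightarrow> 'b::euclidean_space"
  assumes b: "bump \<psi>" and u: "continuous_on UNIV u" and s: "0 < \<sigma>"
  shows "pd_exists k (mollify \<psi> \<sigma> u) x" "pd k (mollify \<psi> \<sigma> u) x = (1/\<sigma>) *\<^sub>R mollify (pd k \<psi>) \<sigma> u x"
proof -
  obtain L where L: "L \<ge> 0" "\<And>y z. \<bar>pd k \<psi> y - pd k \<psi> z\<bar> \<le> L * norm (y - z)" using bump_lip[OF bump_pd[OF b]] by metis
  obtain U where U: "U \<ge> 0" "\<And>z. norm (z - x) \<le> \<sigma> * 2 \<Longrightarrow> norm (u z) \<le> U" using cont_bounded_near[OF u] by metis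
  obtain C where C: "C \<ge> 0" "\<And>z. \<bar>\<psi> z\<bar> \<le> C" using bump_bounded[OF b] by blast
  have cp: "continuous_on UNIV \<psi>" by (rule Ck_cont[OF bump_Ck[OF b, of 0]])
  have cp': "continuous_on UNIV (pd k \<psi>)" by (rule Ck_cont[OF bump_Ck[OF bump_pd[OF b], of 0]])
  let ?e = "axis k (1::real)"
  let ?K = "L / \<sigma>\<^sup>2 * U * (unit_ball_vol (real DIM(real^'n)) * 2 ^ DIM(real^'n))"
  have "norm (mollify \<psi> \<sigma> u (x + t *\<^sub>R ?e) - mollify \<psi> \<sigma> u x - t *\<^sub>R ((1/\<sigma>) *\<^sub>R mollify (pd k \<psi>) \<sigma> u x)) \<le> ?K * t\<^sup>2"
    if t: "\<bar>t\<bar> \<le> \<sigma>" for t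
  proof -
    let ?t = "t / \<sigma>"
    let ?w = "?t *\<^sub>R ?e"
    have w: "norm ?w \<le> 1" using t s by (simp add: divide_le_eq)
    have i: "integrable lborel (\<lambda>y. \<psi> (y + ?w) *\<^sub>R u (x - \<sigma> *\<^sub>R y))"
    proof (rule kernel_bound(1)[where \<eta> = "\<lambda>y. \<psi> (y + ?w)" and C = C and U = U and \<rho> = 2])
      fix y :: "real^'n" assume "2 < norm y"
      then show "\<psi> (y + ?w) = 0" using w norm_triangle_sub[of y "- ?w"] by (intro bump_0[OF b]) simp
    qed (use s C U u cont_shift[OF cp] in auto)
    have "mollify \<psi> \<sigma> u (x + t *\<^sub>R ?e) - mollify \<psi> \<sigma> u x - t *\<^sub>R ((1/\<sigma>) *\<^sub>R mollify (pd k \<psi>) \<sigma> u x) =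
      (\<integral>y. (\<psi> (y + ?w) - \<psi> y - ?t * pd k \<psi> y) *\<^sub>R u (x - \<sigma> *\<^sub>R y) \<partial>lborel)"
    proof -
      have I: "integrable lborel (\<lambda>y. pd k \<psi> y *\<^sub>R u (x - \<sigma> *\<^sub>R y))"
        using mollify_integrable[OF bump_pd[OF b] u, of \<sigma> k x] s by simp
      have I3: "integrable lborel (\<lambda>y. (?t * pd k \<psi> y) *\<^sub>R u (x - \<sigma> *\<^sub>R y))"
        using integrable_scaleR_right[OF I, of ?t] by (simp only: scaleR_scaleR)
      have "(\<integral>y. ?t *\<^sub>R (pd k \<psi> y *\<^sub>R u (x - \<sigma> *\<^sub>R y)) \<partial>lborel) = ?t *\<^sub>R mollify (pd k \<psi>) \<sigma> u x"
        unfolding mollify_def by (rule integral_scaleR_right)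
      then have e3: "t *\<^sub>R ((1/\<sigma>) *\<^sub>R mollify (pd k \<psi>) \<sigma> u x) = (\<integral>y. (?t * pd k \<psi> y) *\<^sub>R u (x - \<sigma> *\<^sub>R y) \<partial>lborel)"
        by (simp only: scaleR_scaleR) simp
      have I2: "integrable lborel (\<lambda>y. \<psi> y *\<^sub>R u (x - \<sigma> *\<^sub>R y))" using mollify_integrable[OF b u, of \<sigma> x] s by simp
      have i': "integrable lborel (\<lambda>y. \<psi> (y + (1/\<sigma>) *\<^sub>R (t *\<^sub>R ?e)) *\<^sub>R u (x - \<sigma> *\<^sub>R y))" using i by simp
      have "mollify \<psi> \<sigma> u (x + t *\<^sub>R ?e) - mollify \<psi> \<sigma> u x - t *\<^sub>R ((1/\<sigma>) *\<^sub>R mollify (pd k \<psi>) \<sigma> u x) =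
         (\<integral>y. \<psi> (y + (1/\<sigma>) *\<^sub>R (t *\<^sub>R ?e)) *\<^sub>R u (x - \<sigma> *\<^sub>R y) - \<psi> y *\<^sub>R u (x - \<sigma> *\<^sub>R y) - (?t * pd k \<psi> y) *\<^sub>R u (x - \<sigma> *\<^sub>R y) \<partial>lborel)"
        unfolding mollify_shift[OF b u s] mollify_def[of \<psi> \<sigma> u x] e3
        by (subst Bochner_Integration.integral_diff[OF Bochner_Integration.integrable_diff[OF i' I2] I3],
            subst Bochner_Integration.integral_diff[OF i' I2]) (rule refl)
      then show ?thesis by (simp add: scaleR_diff_left)
    qed
    also have "norm \<dots> \<le> (L * \<bar>?t\<bar> * \<bar>?t\<bar>) * U * (unit_ball_vol (real DIM(real^'n)) * 2 ^ DIM(real^'n))"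
    proof (rule kernel_bound(2)[OF _ u _ _ _ U(1) _ _ U(2)])
      show "continuous_on UNIV (\<lambda>y. \<psi> (y + ?w) - \<psi> y - ?t * pd k \<psi> y)" by (intro continuous_intros cont_shift cp cp')
      fix y
      have "norm ((\<lambda>r. \<psi> (y + r *\<^sub>R ?e)) ?t - (\<lambda>r. \<psi> (y + r *\<^sub>R ?e)) 0 - ?t *\<^sub>R pd k \<psi> y) \<le> (L * \<bar>?t\<bar>) * \<bar>?t\<bar>"
      proof (rule vector_mvt_linearization)
        fix r assume r: "r \<in> closed_segment 0 ?t"
        show "((\<lambda>r. \<psi> (y + r *\<^sub>R ?e)) has_vector_derivative pd k \<psi> (y + r *\<^sub>R ?e)) (at r within closed_segment 0 ?t)"
          by (rule pd_exists_has_vector_derivative[OF Ck_Suc_pd_exists[OF bump_Ck[OF b]]])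
        have "\<bar>pd k \<psi> (y + r *\<^sub>R ?e) - pd k \<psi> y\<bar> \<le> L * \<bar>r\<bar>" using L(2)[of "y + r *\<^sub>R ?e" y] by simp
        also have "\<dots> \<le> L * \<bar>?t\<bar>" using closed_segment_0_abs_le[OF r] L by (intro mult_left_mono) auto
        finally show "norm (pd k \<psi> (y + r *\<^sub>R ?e) - pd k \<psi> y) \<le> L * \<bar>?t\<bar>" by simp
      qed
      then show "\<bar>\<psi> (y + ?w) - \<psi> y - ?t * pd k \<psi> y\<bar> \<le> L * \<bar>?t\<bar> * \<bar>?t\<bar>" by simp
      assume "2 < norm y"
      then show "\<psi> (y + ?w) - \<psi> y - ?t * pd k \<psi> y = 0"
        using w norm_triangle_sub[of y "- ?w"] bump_0[OF b] bump_0[OF bump_pd[OF b]] by simp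
    qed (use s L in auto)
    also have "\<dots> = ?K * t\<^sup>2" by (simp add: power2_eq_square abs_if)
    finally show ?thesis .
  qed
  from quotient_imp_pd[OF s this] show "pd_exists k (mollify \<psi> \<sigma> u) x" "pd k (mollify \<psi> \<sigma> u) x = (1/\<sigma>) *\<^sub>R mollify (pd k \<psi>) \<sigma> u x" by auto
qed

lemma Ck_mollify:
  fixes u :: "real^'n \<Rightarrow> 'b::euclidean_space"
  assumes b: "bump \<psi>" and u: "continuous_on UNIV u" and s: "0 < \<sigma>"
  shows "Ck r (mollify \<psi> \<sigma> u)"
  using b
proof (induction r arbitrary: \<psi>)
  case 0 then show ?case using mollify_continuous[OF _ u s] by simp
next
  case (Suc r)
  have "pd k (mollify \<psi> \<sigma> u) = (\<lambda>x. (1/\<sigma>) *\<^sub>R mollify (pd k \<psi>) \<sigma> u x)" for k using pd_mollify[OF Suc.prems u s] by auto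
  then have "Ck r (pd k (mollify \<psi> \<sigma> u))" for k
    using Ck_bounded_linear[OF bounded_linear_scaleR_right Suc.IH[OF bump_pd[OF Suc.prems]]] by simp
  then show ?case unfolding Ck.simps(2) using mollify_continuous[OF Suc.prems u s] pd_mollify(1)[OF Suc.prems u s] by blast
qed

lemma pd_mollify_fun:
  assumes "bump \<psi>" "continuous_on UNIV u" "0 < \<sigma>"
  shows "pd k (mollify \<psi> \<sigma> u) = (\<lambda>x. (1/\<sigma>) *\<^sub>R mollify (pd k \<psi>) \<sigma> u x)"
    and "pd l (pd k (mollify \<psi> \<sigma> u)) = (\<lambda>x. (1/\<sigma>\<^sup>2) *\<^sub>R mollify (pd l (pd k \<psi>)) \<sigma> u x)"
proof -
  show 1: "pd k (mollify \<psi> \<sigma> u) = (\<lambda>x. (1/\<sigma>) *\<^sub>R mollify (pd k \<psi>) \<sigma> u x)" using pd_mollify(2)[OF assms] by auto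
  show "pd l (pd k (mollify \<psi> \<sigma> u)) = (\<lambda>x. (1/\<sigma>\<^sup>2) *\<^sub>R mollify (pd l (pd k \<psi>)) \<sigma> u x)"
    unfolding 1 using pd_bounded_linear[OF bounded_linear_scaleR_right Ck_mollify[OF bump_pd[OF assms(1)] assms(2,3)]]
      pd_mollify(2)[OF bump_pd[OF assms(1)] assms(2,3)] by (auto simp: power2_eq_square)
qed

section \<open>Functions that are Lipschitz on every ball\<close>

definition ball_lip :: "(real^'n \<Rightarrow> 'b::real_normed_vector) \<Rightarrow> bool" where
  "ball_lip u \<longleftrightarrow> (\<forall>R. \<exists>L\<ge>0. \<forall>x y. norm x \<le> R \<longrightarrow> norm y \<le> R \<longrightarrow> norm (u x - u y) \<le> L * norm (x - y))"

lemma loc_lip_imp_ball_lip: "loc_lip u \<Longrightarrow> ball_lip u"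
proof -
  assume l: "loc_lip u"
  \<comment> \<open>A constant dummy time brings in the compactness theorem for
    \<open>local_lipschitz\<close> families.\<close>
  have ll: "local_lipschitz {0::real} UNIV (\<lambda>_. u)"
  proof (rule local_lipschitzI)
    fix t :: real and x
    obtain e L where "e > 0" "L-lipschitz_on (ball x e) u" using l unfolding loc_lip_def by blast
    then have "L-lipschitz_on (cball x (e/2) \<inter> UNIV) u" by (auto intro: lipschitz_on_subset)
    then show "\<exists>u'>0. \<exists>L. \<forall>t\<in>cball t u' \<inter> {0}. L-lipschitz_on (cball x u' \<inter> UNIV) u"
      using \<open>e > 0\<close> by (intro exI[of _ "e/2"]) auto
  qed
  show ?thesis unfolding ball_lip_def
  proof
    fix R
    have "local_lipschitz {0::real} (cball 0 R) (\<lambda>_. u)" by (rule local_lipschitz_subset[OF ll]) auto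
    then obtain L where "L-lipschitz_on (cball 0 R) u"
      using local_lipschitz_compact_implies_lipschitz[where X = "cball 0 R" and T = "{0::real}" and f = "\<lambda>_. u"] by auto
    then show "\<exists>L\<ge>0. \<forall>x y. norm x \<le> R \<longrightarrow> norm y \<le> R \<longrightarrow> norm (u x - u y) \<le> L * norm (x - y)"
      by (auto simp: lipschitz_on_def dist_norm)
  qed
qed

lemma ball_lip_cont: "ball_lip u \<Longrightarrow> continuous_on UNIV u"
proof -
  assume l: "ball_lip u"
  have "continuous_on (ball 0 R) u" for R
  proof -
    obtain L where "L \<ge> 0" "\<forall>x y. norm x \<le> R \<longrightarrow> norm y \<le> R \<longrightarrow> norm (u x - u y) \<le> L * norm (x - y)"
      using l unfolding ball_lip_def by blast
    then have "L-lipschitz_on (ball 0 R) u" by (auto simp: lipschitz_on_def dist_norm)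
    then show ?thesis by (rule lipschitz_on_continuous_on)
  qed
  then have "isCont u x" for x using continuous_on_eq_continuous_at[of "ball 0 (norm x + 1)" u] by auto
  then show ?thesis by (simp add: continuous_on_eq_continuous_at)
qed

definition Cinf :: "(real^'n \<Rightarrow> 'b::real_normed_vector) \<Rightarrow> bool" where "Cinf g \<longleftrightarrow> (\<forall>r. Ck r g)"

lemma CinfD: "Cinf g \<Longrightarrow> Ck r g" by (simp add: Cinf_def)
lemma Cinf_add: "Cinf u \<Longrightarrow> Cinf v \<Longrightarrow> Cinf (\<lambda>x. u x + v x)" by (simp add: Cinf_def Ck_add)
lemma Cinf_diff: "Cinf u \<Longrightarrow> Cinf v \<Longrightarrow> Cinf (\<lambda>x. u x - v x)" by (simp add: Cinf_def Ck_diff)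
lemma Cinf_scaleR: "Cinf u \<Longrightarrow> Cinf v \<Longrightarrow> Cinf (\<lambda>x. u x *\<^sub>R v x)" by (simp add: Cinf_def Ck_scaleR)
lemma Cinf_pd: "Cinf u \<Longrightarrow> Cinf (pd k u)" by (auto simp: Cinf_def intro: Ck_pd)
lemma Cinf_linear: "bounded_linear h \<Longrightarrow> Cinf u \<Longrightarrow> Cinf (\<lambda>x. h (u x))" by (simp add: Cinf_def Ck_bounded_linear)
lemma Cinf_mollify: "bump \<psi> \<Longrightarrow> continuous_on UNIV u \<Longrightarrow> 0 < \<sigma> \<Longrightarrow> Cinf (mollify \<psi> \<sigma> u)" by (simp add: Cinf_def Ck_mollify)
lemma Cinf_Xop: "Cinf F \<Longrightarrow> Cinf g \<Longrightarrow> Cinf (Xop F g)" by (simp add: Cinf_def Ck_Xop)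

lemma ball_lip_bounded: "ball_lip u \<Longrightarrow> \<exists>U\<ge>0. \<forall>z. norm z \<le> R \<longrightarrow> norm (u z) \<le> U"
  by (rule cont_bounded_ball[OF ball_lip_cont])

lemma ball_lip_E:
  assumes "ball_lip u" obtains L where "L \<ge> 0" "\<And>x y. norm x \<le> R \<Longrightarrow> norm y \<le> R \<Longrightarrow> norm (u x - u y) \<le> L * norm (x - y)"
  using assms unfolding ball_lip_def by blast

lemma ball_lip_add: assumes "ball_lip u" "ball_lip v" shows "ball_lip (\<lambda>x. u x + v x)"
  unfolding ball_lip_def
proof
  fix R
  obtain L where L: "L \<ge> 0" "\<And>x y. norm x \<le> R \<Longrightarrow> norm y \<le> R \<Longrightarrow> norm (u x - u y) \<le> L * norm (x - y)" using ball_lip_E[OF assms(1)] by blast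
  obtain K where K: "K \<ge> 0" "\<And>x y. norm x \<le> R \<Longrightarrow> norm y \<le> R \<Longrightarrow> norm (v x - v y) \<le> K * norm (x - y)" using ball_lip_E[OF assms(2)] by blast
  have "norm ((u x + v x) - (u y + v y)) \<le> (L + K) * norm (x - y)" if "norm x \<le> R" "norm y \<le> R" for x y
    using norm_triangle_mono[OF L(2)[OF that] K(2)[OF that]] by (simp add: algebra_simps)
  then show "\<exists>L\<ge>0. \<forall>x y. norm x \<le> R \<longrightarrow> norm y \<le> R \<longrightarrow> norm ((u x + v x) - (u y + v y)) \<le> L * norm (x - y)"
    using L K by (intro exI[of _ "L + K"]) auto
qed

lemma ball_lip_linear: assumes h: "bounded_linear h" and "ball_lip u" shows "ball_lip (\<lambda>x. h (u x))"
  unfolding ball_lip_def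
proof
  fix R
  obtain L where L: "L \<ge> 0" "\<And>x y. norm x \<le> R \<Longrightarrow> norm y \<le> R \<Longrightarrow> norm (u x - u y) \<le> L * norm (x - y)" using ball_lip_E[OF assms(2)] by blast
  obtain K where K: "K > 0" "\<And>x. norm (h x) \<le> norm x * K" using bounded_linear.pos_bounded[OF h] by blast
  have "norm (h (u x) - h (u y)) \<le> (L * K) * norm (x - y)" if "norm x \<le> R" "norm y \<le> R" for x y
  proof -
    have "norm (h (u x) - h (u y)) \<le> norm (u x - u y) * K"
      using K(2)[of "u x - u y"] linear_diff[OF bounded_linear.linear[OF h]] by simp
    also have "\<dots> \<le> (L * norm (x - y)) * K" using L(2)[OF that] K by (intro mult_right_mono) auto
    finally show ?thesis by (simp add: mult_ac)
  qed
  then show "\<exists>L\<ge>0. \<forall>x y. norm x \<le> R \<longrightarrow> norm y \<le> R \<longrightarrow> norm (h (u x) - h (u y)) \<le> L * norm (x - y)"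
    using L K by (intro exI[of _ "L * K"]) auto
qed

lemma ball_lip_scaleR: assumes "ball_lip u" "ball_lip v" shows "ball_lip (\<lambda>x. u x *\<^sub>R v x)"
  unfolding ball_lip_def
proof
  fix R
  obtain L where L: "L \<ge> 0" "\<And>x y. norm x \<le> R \<Longrightarrow> norm y \<le> R \<Longrightarrow> norm (u x - u y) \<le> L * norm (x - y)" using ball_lip_E[OF assms(1)] by blast
  obtain K where K: "K \<ge> 0" "\<And>x y. norm x \<le> R \<Longrightarrow> norm y \<le> R \<Longrightarrow> norm (v x - v y) \<le> K * norm (x - y)" using ball_lip_E[OF assms(2)] by blast
  obtain U where U: "U \<ge> 0" "\<And>z. norm z \<le> R \<Longrightarrow> norm (u z) \<le> U" using ball_lip_bounded[OF assms(1)] by metis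
  obtain V where V: "V \<ge> 0" "\<And>z. norm z \<le> R \<Longrightarrow> norm (v z) \<le> V" using ball_lip_bounded[OF assms(2)] by metis
  have "norm (u x *\<^sub>R v x - u y *\<^sub>R v y) \<le> (L * V + U * K) * norm (x - y)" if xy: "norm x \<le> R" "norm y \<le> R" for x y
  proof -
    have "u x *\<^sub>R v x - u y *\<^sub>R v y = (u x - u y) *\<^sub>R v x + u y *\<^sub>R (v x - v y)" by (simp add: algebra_simps)
    also have "norm \<dots> \<le> norm (u x - u y) * norm (v x) + norm (u y) * norm (v x - v y)"
      by (rule order_trans[OF norm_triangle_ineq]) simp
    also have "\<dots> \<le> (L * norm (x - y)) * V + U * (K * norm (x - y))"
      using L(1) K(1) U(1) V(1) by (intro add_mono mult_mono L(2) K(2) U(2) V(2) xy) auto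
    finally show ?thesis by (simp add: algebra_simps)
  qed
  then show "\<exists>L\<ge>0. \<forall>x y. norm x \<le> R \<longrightarrow> norm y \<le> R \<longrightarrow> norm (u x *\<^sub>R v x - u y *\<^sub>R v y) \<le> L * norm (x - y)"
    using L K U V by (intro exI[of _ "L * V + U * K"]) auto
qed

section \<open>Pointwise bounds up to second order\<close>

definition C2_bound :: "real \<Rightarrow> real \<Rightarrow> real \<Rightarrow> (real^'n \<Rightarrow> 'b::real_normed_vector) \<Rightarrow> real^'n \<Rightarrow> bool" where
  "C2_bound a b d U x \<longleftrightarrow> norm (U x) \<le> a \<and> (\<forall>k. norm (pd k U x) \<le> b) \<and> (\<forall>k l. norm (pd k (pd l U) x) \<le> d)"

lemma C2_bound_mono: "C2_bound a b d U x \<Longrightarrow> a \<le> a' \<Longrightarrow> b \<le> b' \<Longrightarrow> d \<le> d' \<Longrightarrow> C2_bound a' b' d' U x"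
  unfolding C2_bound_def by (meson order_trans)

lemma C2_bound_nonneg: "C2_bound a b d U x \<Longrightarrow> 0 \<le> a \<and> 0 \<le> b \<and> 0 \<le> d"
  unfolding C2_bound_def by (meson norm_ge_zero order_trans)

lemma pd_add_fun: "Cinf u \<Longrightarrow> Cinf v \<Longrightarrow> pd k (\<lambda>x. u x + v x) = (\<lambda>x. pd k u x + pd k v x)"
  using pd_add[OF CinfD CinfD] by blast

lemma pd_diff_fun: "Cinf u \<Longrightarrow> Cinf v \<Longrightarrow> pd k (\<lambda>x. u x - v x) = (\<lambda>x. pd k u x - pd k v x)"
  using pd_diff[OF CinfD CinfD] by blast

lemma pd_scaleR_fun: "Cinf u \<Longrightarrow> Cinf v \<Longrightarrow> pd k (\<lambda>x. u x *\<^sub>R v x) = (\<lambda>x. u x *\<^sub>R pd k v x + pd k u x *\<^sub>R v x)"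
  using pd_scaleR[OF CinfD CinfD] by blast

lemma pd_linear_fun: "bounded_linear h \<Longrightarrow> Cinf u \<Longrightarrow> pd k (\<lambda>x. h (u x)) = (\<lambda>x. h (pd k u x))"
  using pd_bounded_linear[OF _ CinfD] by blast

lemma C2_bound_add:
  assumes "Cinf U" "Cinf V" "C2_bound a b d U x" "C2_bound a' b' d' V x"
  shows "C2_bound (a + a') (b + b') (d + d') (\<lambda>x. U x + V x) x"
  using assms unfolding C2_bound_def by (simp add: pd_add_fun Cinf_pd norm_triangle_mono)

lemma C2_bound_diff:
  assumes "Cinf U" "Cinf V" "C2_bound a b d U x" "C2_bound a' b' d' V x"
  shows "C2_bound (a + a') (b + b') (d + d') (\<lambda>x. U x - V x) x"
  using assms unfolding C2_bound_def by (auto simp: pd_diff_fun Cinf_pd intro!: order_trans[OF norm_triangle_ineq4] add_mono)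

lemma C2_bound_scaleR:
  assumes U: "Cinf U" and V: "Cinf V" and u: "C2_bound a b d U x" and v: "C2_bound a' b' d' V x"
  shows "C2_bound (a * a') (a * b' + b * a') (a * d' + 2 * (b * b') + d * a') (\<lambda>x. U x *\<^sub>R V x) x"
proof -
  have n: "0 \<le> a" "0 \<le> b" "0 \<le> d" "0 \<le> a'" "0 \<le> b'" "0 \<le> d'" using C2_bound_nonneg[OF u] C2_bound_nonneg[OF v] by auto
  have m: "norm (p *\<^sub>R q) \<le> \<alpha> * \<beta>" if "norm p \<le> \<alpha>" "norm q \<le> \<beta>" "0 \<le> \<alpha>" for p \<alpha> \<beta> and q :: 'b
    using that by (simp add: mult_mono)
  note u' = u[unfolded C2_bound_def] and v' = v[unfolded C2_bound_def]
  show ?thesis unfolding C2_bound_def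
  proof (intro conjI allI)
    show "norm (U x *\<^sub>R V x) \<le> a * a'" using u' v' n by (intro m) auto
    fix k
    show "norm (pd k (\<lambda>x. U x *\<^sub>R V x) x) \<le> a * b' + b * a'"
      unfolding pd_scaleR_fun[OF U V] using u' v' n by (intro order_trans[OF norm_triangle_ineq] add_mono m) auto
    fix l
    have "pd k (pd l (\<lambda>x. U x *\<^sub>R V x)) x = (U x *\<^sub>R pd k (pd l V) x + pd k U x *\<^sub>R pd l V x) + (pd l U x *\<^sub>R pd k V x + pd k (pd l U) x *\<^sub>R V x)"
      using U V by (simp add: pd_scaleR_fun pd_add_fun Cinf_scaleR Cinf_pd)
    also have "norm \<dots> \<le> (a * d' + b * b') + (b * b' + d * a')"
      using u' v' n by (intro order_trans[OF norm_triangle_ineq] add_mono m) auto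
    finally show "norm (pd k (pd l (\<lambda>x. U x *\<^sub>R V x)) x) \<le> a * d' + 2 * (b * b') + d * a'" by simp
  qed
qed

lemma C2_bound_linear:
  assumes h: "bounded_linear h" and K: "0 \<le> K" "\<And>y. norm (h y) \<le> K * norm y" and U: "Cinf U" and u: "C2_bound a b d U x"
  shows "C2_bound (K * a) (K * b) (K * d) (\<lambda>x. h (U x)) x"
proof -
  have n: "norm (h y) \<le> K * c" if "norm y \<le> c" for y c
    by (rule order_trans[OF K(2) mult_left_mono[OF that K(1)]])
  have p1: "pd k (\<lambda>x. h (U x)) = (\<lambda>x. h (pd k U x))" for k by (rule pd_linear_fun[OF h U])
  have p2: "pd k (\<lambda>x. h (pd l U x)) = (\<lambda>x. h (pd k (pd l U) x))" for k l by (rule pd_linear_fun[OF h Cinf_pd[OF U]])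
  show ?thesis unfolding C2_bound_def p1 p2
    by (intro conjI allI n) (use u in \<open>auto simp: C2_bound_def\<close>)
qed

lemma mollifier_facts:
  fixes \<phi> :: "real^'n \<Rightarrow> real"
  assumes "mollifier \<phi>" shows "bump \<phi>" "integral\<^sup>L lborel \<phi> = 1" "\<And>x. 0 \<le> \<phi> x"
proof -
  show b: "bump \<phi>"
    unfolding bump_def
  proof (intro conjI allI impI)
    fix r show "Ck r \<phi>" using assms smooth_fn_imp_Ck by (auto simp: mollifier_def)
  next
    fix z :: "real^'n" assume "1 < norm z"
    then have "z \<notin> closure {x. \<phi> x \<noteq> 0}" using assms by (auto simp: mollifier_def)
    then show "\<phi> z = 0" using closure_subset[of "{x. \<phi> x \<noteq> 0}"] by auto
  qed
  have "integrable lborel \<phi>" using mollify_integrable[OF b, of "\<lambda>_. 1::real" 0 0] by simp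
  then have "integral UNIV \<phi> = integral\<^sup>L lborel \<phi>" by (rule integral_lborel)
  moreover have "integral UNIV \<phi> = 1" using assms by (auto simp: mollifier_def intro: integral_unique)
  ultimately show "integral\<^sup>L lborel \<phi> = 1" by simp
  show "\<And>x. 0 \<le> \<phi> x" using assms by (auto simp: mollifier_def)
qed

lemma moll_eq_mollify: "bump \<phi> \<Longrightarrow> continuous_on UNIV F \<Longrightarrow> 0 \<le> \<sigma> \<Longrightarrow> moll \<phi> \<sigma> F = mollify \<phi> \<sigma> F"
  unfolding moll_def mollify_def using mollify_integrable integral_lborel by blast

text \<open>One constant dominates the kernel and its first and second derivatives, and each
  derivative costs \<open>1/\<sigma>\<close>. The size \<open>A\<close> of \<open>w\<close> matters
  only within distance \<sigma> of the point, so the bound gains when \<open>w\<close> is small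
  there.\<close>

lemma mollify_C2_bound:
  fixes \<phi> :: "real^'n \<Rightarrow> real"
  assumes b: "bump \<phi>"
  obtains B where "B \<ge> 0" "\<And>\<sigma> (w :: real^'n \<Rightarrow> 'b::euclidean_space) A x. 0 < \<sigma> \<Longrightarrow> continuous_on UNIV w \<Longrightarrow> 0 \<le> A \<Longrightarrow>
      (\<And>z. norm (z - x) \<le> \<sigma> \<Longrightarrow> norm (w z) \<le> A) \<Longrightarrow> C2_bound (B * A) (B * A / \<sigma>) (B * A / \<sigma>\<^sup>2) (mollify \<phi> \<sigma> w) x"
proof -
  obtain C0 where C0: "C0 \<ge> 0" "\<And>z. \<bar>\<phi> z\<bar> \<le> C0" using bump_bounded[OF b] by blast
  have "\<forall>k. \<exists>C\<ge>0. \<forall>z. \<bar>pd k \<phi> z\<bar> \<le> C" using bump_bounded[OF bump_pd[OF b]] by blast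
  then obtain C1 where C1: "\<And>k. C1 k \<ge> 0" "\<And>k z. \<bar>pd k \<phi> z\<bar> \<le> C1 k" by metis
  have "\<forall>p. \<exists>C\<ge>0. \<forall>z. \<bar>pd (fst p) (pd (snd p) \<phi>) z\<bar> \<le> C" using bump_bounded[OF bump_pd[OF bump_pd[OF b]]] by blast
  then obtain C2 where C2: "\<And>p. C2 p \<ge> 0" "\<And>p z. \<bar>pd (fst p) (pd (snd p) \<phi>) z\<bar> \<le> C2 p" by metis
  define C where "C = C0 + (\<Sum>k\<in>UNIV. C1 k) + (\<Sum>p\<in>UNIV. C2 p)"
  have c1: "C1 k \<le> (\<Sum>k\<in>UNIV. C1 k)" for k using C1 by (intro member_le_sum) auto
  have c2: "C2 p \<le> (\<Sum>p\<in>UNIV. C2 p)" for p using C2 by (intro member_le_sum) auto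
  have s1: "0 \<le> (\<Sum>k\<in>UNIV. C1 k)" "0 \<le> (\<Sum>p\<in>UNIV. C2 p)" using C1 C2 by (auto intro: sum_nonneg)
  have C: "0 \<le> C" "\<And>z. \<bar>\<phi> z\<bar> \<le> C" "\<And>k z. \<bar>pd k \<phi> z\<bar> \<le> C" "\<And>k l z. \<bar>pd k (pd l \<phi>) z\<bar> \<le> C"
  proof -
    show "0 \<le> C" "\<And>z. \<bar>\<phi> z\<bar> \<le> C" using C0 s1 by (auto simp: C_def intro: order_trans[OF C0(2)])
    show "\<bar>pd k \<phi> z\<bar> \<le> C" for k z using C1(2)[of k z] c1[of k] C0 s1 by (simp add: C_def)
    show "\<bar>pd k (pd l \<phi>) z\<bar> \<le> C" for k l z using C2(2)[of "(k, l)" z] c2[of "(k, l)"] C0 s1 by (simp add: C_def)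
  qed
  let ?B = "C * unit_ball_vol (real DIM(real^'n))"
  show thesis
  proof (rule that[of ?B])
    show "0 \<le> ?B" using C(1) by simp
    fix \<sigma> A :: real and w :: "real^'n \<Rightarrow> 'b" and x
    assume s: "0 < \<sigma>" and w: "continuous_on UNIV w" and A: "0 \<le> A" and bd: "\<And>z. norm (z - x) \<le> \<sigma> \<Longrightarrow> norm (w z) \<le> A"
    have m: "norm (mollify \<psi> \<sigma> w x) \<le> ?B * A" if "bump \<psi>" "\<And>z. \<bar>\<psi> z\<bar> \<le> C" for \<psi>
      by (rule mollify_bound[OF that(1) C(1) that(2) w _ A bd]) (use s in auto)
    show "C2_bound (?B * A) (?B * A / \<sigma>) (?B * A / \<sigma>\<^sup>2) (mollify \<phi> \<sigma> w) x"
      unfolding C2_bound_def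
    proof (intro conjI allI)
      show "norm (mollify \<phi> \<sigma> w x) \<le> ?B * A" by (rule m[OF b C(2)])
      fix k
      show "norm (pd k (mollify \<phi> \<sigma> w) x) \<le> ?B * A / \<sigma>"
        unfolding pd_mollify_fun(1)[OF b w s] using m[OF bump_pd[OF b] C(3), of k] s by (simp add: divide_right_mono)
      fix l
      show "norm (pd k (pd l (mollify \<phi> \<sigma> w)) x) \<le> ?B * A / \<sigma>\<^sup>2"
        unfolding pd_mollify_fun(2)[OF b w s] using m[OF bump_pd[OF bump_pd[OF b]] C(4), of k l] s by (simp add: divide_right_mono)
    qed
  qed
qed

lemma C2_bound_add_const:
  assumes "Cinf U" "C2_bound a b d U x"
  shows "C2_bound (a + norm c) b d (\<lambda>x. U x + c) x"
proof -
  have c: "Cinf (\<lambda>_. c)" by (simp add: Cinf_def Ck_const)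
  have "pd k (\<lambda>x. U x + c) = pd k U" for k using pd_add_fun[OF assms(1) c] by (simp add: pd_const)
  then show ?thesis using assms(2) unfolding C2_bound_def by (auto intro: norm_triangle_mono)
qed

lemma near_norm: "norm x \<le> R \<Longrightarrow> norm (z - x) \<le> \<sigma> \<Longrightarrow> \<sigma> \<le> 1 \<Longrightarrow> norm z \<le> R + (1::real)"
  using norm_triangle_sub[of z x] by simp

context
  fixes \<phi> :: "real^'n \<Rightarrow> real"
  assumes b: "bump \<phi>" and i1: "integral\<^sup>L lborel \<phi> = 1"
begin

lemma mollify_sub_const: "continuous_on UNIV u \<Longrightarrow> 0 \<le> \<sigma> \<Longrightarrow> mollify \<phi> \<sigma> (\<lambda>z. u z - c) x = mollify \<phi> \<sigma> u x - c"
  using mollify_diff[OF b _ continuous_on_const, of u \<sigma> c x] mollify_const[OF b] i1 by simp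

text \<open>Subtracting the constant \<open>u x\<close> makes the function of size \<sigma> near
  \<open>x\<close>, which pays for one derivative. The mollification itself differs only by that
  constant.\<close>

lemma mollify_ball_lip_C2_bound:
  fixes u :: "real^'n \<Rightarrow> 'b::euclidean_space"
  assumes u: "ball_lip u"
  shows "\<exists>C\<ge>0. \<forall>\<sigma>\<in>{0<..1}. \<forall>x. norm x \<le> R \<longrightarrow> C2_bound C C (C / \<sigma>) (mollify \<phi> \<sigma> u) x \<and>
     C2_bound (C * \<sigma>) C (C / \<sigma>) (mollify \<phi> \<sigma> (\<lambda>z. u z - u x)) x"
proof -
  obtain B where B: "B \<ge> 0" "\<And>\<sigma> (w :: real^'n \<Rightarrow> 'b) A x. 0 < \<sigma> \<Longrightarrow> continuous_on UNIV w \<Longrightarrow> 0 \<le> A \<Longrightarrow>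
      (\<And>z. norm (z - x) \<le> \<sigma> \<Longrightarrow> norm (w z) \<le> A) \<Longrightarrow> C2_bound (B * A) (B * A / \<sigma>) (B * A / \<sigma>\<^sup>2) (mollify \<phi> \<sigma> w) x"
    using mollify_C2_bound[OF b] by metis
  obtain L where L: "L \<ge> 0" "\<And>x y. norm x \<le> R + 1 \<Longrightarrow> norm y \<le> R + 1 \<Longrightarrow> norm (u x - u y) \<le> L * norm (x - y)" using ball_lip_E[OF u] by blast
  obtain U where U: "U \<ge> 0" "\<And>z. norm z \<le> R \<Longrightarrow> norm (u z) \<le> U" using ball_lip_bounded[OF u] by metis
  have cu: "continuous_on UNIV u" by (rule ball_lip_cont[OF u])
  let ?C = "B * L + U"
  have "C2_bound ?C ?C (?C / \<sigma>) (mollify \<phi> \<sigma> u) x \<and> C2_bound (?C * \<sigma>) ?C (?C / \<sigma>) (mollify \<phi> \<sigma> (\<lambda>z. u z - u x)) x"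
    if s: "\<sigma> \<in> {0<..1}" and x: "norm x \<le> R" for \<sigma> x
  proof -
    have s': "0 < \<sigma>" "\<sigma> \<le> 1" using s by auto
    have cw: "continuous_on UNIV (\<lambda>z. u z - u x)" by (intro continuous_intros cu)
    have "norm (u z - u x) \<le> L * \<sigma>" if "norm (z - x) \<le> \<sigma>" for z
      using L(2)[of z x] near_norm[OF x that s'(2)] x mult_left_mono[OF that L(1)] by simp
    then have nw: "C2_bound (B * (L * \<sigma>)) (B * (L * \<sigma>) / \<sigma>) (B * (L * \<sigma>) / \<sigma>\<^sup>2) (mollify \<phi> \<sigma> (\<lambda>z. u z - u x)) x"
      using s' L by (intro B(2) cw) auto
    have e: "B * (L * \<sigma>) / \<sigma> = B * L" "B * (L * \<sigma>) / \<sigma>\<^sup>2 = B * L / \<sigma>" using s' by (auto simp: power2_eq_square)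
    have BL: "0 \<le> B * L" using B L by simp
    have nw': "C2_bound (?C * \<sigma>) ?C (?C / \<sigma>) (mollify \<phi> \<sigma> (\<lambda>z. u z - u x)) x"
      using nw U(1) s' BL unfolding e by (rule_tac C2_bound_mono) (auto simp: divide_right_mono algebra_simps)
    have "(\<lambda>y. mollify \<phi> \<sigma> (\<lambda>z. u z - u x) y + u x) = mollify \<phi> \<sigma> u" using mollify_sub_const[OF cu] s' by auto
    then have "C2_bound (B * (L * \<sigma>) + norm (u x)) (B * L) (B * L / \<sigma>) (mollify \<phi> \<sigma> u) x"
      using C2_bound_add_const[OF Cinf_mollify[OF b cw s'(1)] nw, of "u x"] unfolding e by simp
    moreover have "B * (L * \<sigma>) \<le> B * L" using BL mult_left_mono[OF s'(2) BL] by (simp add: mult.assoc)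
    ultimately have "C2_bound ?C ?C (?C / \<sigma>) (mollify \<phi> \<sigma> u) x"
      using U(1) U(2)[OF x] s' by (rule_tac C2_bound_mono) (auto simp: divide_right_mono)
    then show ?thesis using nw' by blast
  qed
  then show ?thesis using B L U by (intro exI[of _ ?C]) auto
qed

text \<open>The difference between the mollified product and the product of mollifications is
  unchanged when constants are subtracted from both factors. Normalized to vanish at
  \<open>x0\<close>, the product is of size \<sigma>^2 nearby, which pays for two
  derivatives.\<close>

lemma mollify_product_C2_bound:
  fixes u :: "real^'n \<Rightarrow> real" and v :: "real^'n \<Rightarrow> 'b::euclidean_space"
  assumes u: "ball_lip u" and v: "ball_lip v"
  shows "\<exists>C\<ge>0. \<forall>\<sigma>\<in>{0<..1}. \<forall>x. norm x \<le> R \<longrightarrow>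
     C2_bound (C * \<sigma>) C C (\<lambda>x. mollify \<phi> \<sigma> (\<lambda>z. u z *\<^sub>R v z) x - mollify \<phi> \<sigma> u x *\<^sub>R mollify \<phi> \<sigma> v x) x"
proof -
  obtain B where B: "B \<ge> 0" "\<And>\<sigma> (w :: real^'n \<Rightarrow> 'b) A x. 0 < \<sigma> \<Longrightarrow> continuous_on UNIV w \<Longrightarrow> 0 \<le> A \<Longrightarrow>
      (\<And>z. norm (z - x) \<le> \<sigma> \<Longrightarrow> norm (w z) \<le> A) \<Longrightarrow> C2_bound (B * A) (B * A / \<sigma>) (B * A / \<sigma>\<^sup>2) (mollify \<phi> \<sigma> w) x"
    using mollify_C2_bound[OF b] by metis
  obtain L where L: "L \<ge> 0" "\<And>x y. norm x \<le> R + 1 \<Longrightarrow> norm y \<le> R + 1 \<Longrightarrow> norm (u x - u y) \<le> L * norm (x - y)" using ball_lip_E[OF u] by blast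
  obtain K where K: "K \<ge> 0" "\<And>x y. norm x \<le> R + 1 \<Longrightarrow> norm y \<le> R + 1 \<Longrightarrow> norm (v x - v y) \<le> K * norm (x - y)" using ball_lip_E[OF v] by blast
  obtain U where U: "U \<ge> 0" "\<And>\<sigma> x. \<sigma>\<in>{0<..1} \<Longrightarrow> norm x \<le> R \<Longrightarrow> C2_bound (U * \<sigma>) U (U / \<sigma>) (mollify \<phi> \<sigma> (\<lambda>z. u z - u x)) x"
    using mollify_ball_lip_C2_bound[OF u, of R] by blast
  obtain V where V: "V \<ge> 0" "\<And>\<sigma> x. \<sigma>\<in>{0<..1} \<Longrightarrow> norm x \<le> R \<Longrightarrow> C2_bound (V * \<sigma>) V (V / \<sigma>) (mollify \<phi> \<sigma> (\<lambda>z. v z - v x)) x"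
    using mollify_ball_lip_C2_bound[OF v, of R] by blast
  have cu: "continuous_on UNIV u" and cv: "continuous_on UNIV v" using ball_lip_cont u v by auto
  let ?C = "B * (L * K) + 4 * (U * V)"
  have "C2_bound (?C * \<sigma>) ?C ?C (\<lambda>x. mollify \<phi> \<sigma> (\<lambda>z. u z *\<^sub>R v z) x - mollify \<phi> \<sigma> u x *\<^sub>R mollify \<phi> \<sigma> v x) x0"
    if s: "\<sigma> \<in> {0<..1}" and x: "norm x0 \<le> R" for \<sigma> x0
  proof -
    have s': "0 < \<sigma>" "\<sigma> \<le> 1" using s by auto
    let ?u = "\<lambda>z. u z - u x0" and ?v = "\<lambda>z. v z - v x0"
    have cu': "continuous_on UNIV ?u" and cv': "continuous_on UNIV ?v" by (intro continuous_intros cu cv)+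
    have cw: "continuous_on UNIV (\<lambda>z. ?u z *\<^sub>R ?v z)" by (intro continuous_intros cu cv)
    have "norm (?u z *\<^sub>R ?v z) \<le> L * K * \<sigma>\<^sup>2" if z: "norm (z - x0) \<le> \<sigma>" for z
    proof -
      have "norm (?u z) \<le> L * \<sigma>" using L(2)[of z x0] near_norm[OF x z s'(2)] x mult_left_mono[OF z L(1)] by simp
      moreover have "norm (?v z) \<le> K * \<sigma>" using K(2)[of z x0] near_norm[OF x z s'(2)] x mult_left_mono[OF z K(1)] by simp
      ultimately have "norm (?u z) * norm (?v z) \<le> (L * \<sigma>) * (K * \<sigma>)" using L K s' by (intro mult_mono) auto
      then show ?thesis by (simp add: power2_eq_square mult_ac)
    qed
    then have "C2_bound (B * (L * K * \<sigma>\<^sup>2)) (B * (L * K * \<sigma>\<^sup>2) / \<sigma>) (B * (L * K * \<sigma>\<^sup>2) / \<sigma>\<^sup>2) (mollify \<phi> \<sigma> (\<lambda>z. ?u z *\<^sub>R ?v z)) x0"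
      using s' L K by (intro B(2) cw) auto
    moreover have "C2_bound ((U * \<sigma>) * (V * \<sigma>)) ((U * \<sigma>) * V + U * (V * \<sigma>)) ((U * \<sigma>) * (V / \<sigma>) + 2 * (U * V) + (U / \<sigma>) * (V * \<sigma>))
       (\<lambda>x. mollify \<phi> \<sigma> ?u x *\<^sub>R mollify \<phi> \<sigma> ?v x) x0"
      by (intro C2_bound_scaleR Cinf_mollify b cu' cv' s' U(2) V(2) s x)
    ultimately have n: "C2_bound (B * (L * K * \<sigma>\<^sup>2) + (U * \<sigma>) * (V * \<sigma>)) (B * (L * K * \<sigma>\<^sup>2) / \<sigma> + ((U * \<sigma>) * V + U * (V * \<sigma>)))
       (B * (L * K * \<sigma>\<^sup>2) / \<sigma>\<^sup>2 + ((U * \<sigma>) * (V / \<sigma>) + 2 * (U * V) + (U / \<sigma>) * (V * \<sigma>)))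
       (\<lambda>x. mollify \<phi> \<sigma> (\<lambda>z. ?u z *\<^sub>R ?v z) x - mollify \<phi> \<sigma> ?u x *\<^sub>R mollify \<phi> \<sigma> ?v x) x0"
      by (intro C2_bound_diff Cinf_scaleR Cinf_mollify b cu' cv' cw s')
    \<comment> \<open>This is the invariance under subtraction of constants. It holds at every
      \<open>x\<close>, so derivatives may be taken although the normalization is at
      \<open>x0\<close>.\<close>
    have eq: "mollify \<phi> \<sigma> (\<lambda>z. ?u z *\<^sub>R ?v z) x - mollify \<phi> \<sigma> ?u x *\<^sub>R mollify \<phi> \<sigma> ?v x = mollify \<phi> \<sigma> (\<lambda>z. u z *\<^sub>R v z) x - mollify \<phi> \<sigma> u x *\<^sub>R mollify \<phi> \<sigma> v x" for x
    proof -
      have s0: "0 \<le> \<sigma>" using s' by simp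
      have c1: "continuous_on UNIV (\<lambda>z. u z *\<^sub>R v z)" "continuous_on UNIV (\<lambda>z. u z *\<^sub>R v x0)"
        "continuous_on UNIV (\<lambda>z. u x0 *\<^sub>R ?v z)" "continuous_on UNIV (\<lambda>z. u z *\<^sub>R v z - u z *\<^sub>R v x0)" by (intro continuous_intros cu cv)+
      have "(\<lambda>z. ?u z *\<^sub>R ?v z) = (\<lambda>z. (u z *\<^sub>R v z - u z *\<^sub>R v x0) - u x0 *\<^sub>R ?v z)" by (simp add: fun_eq_iff algebra_simps)
      then have "mollify \<phi> \<sigma> (\<lambda>z. ?u z *\<^sub>R ?v z) x = mollify \<phi> \<sigma> (\<lambda>z. (u z *\<^sub>R v z - u z *\<^sub>R v x0) - u x0 *\<^sub>R ?v z) x" by simp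
      also have "\<dots> = (mollify \<phi> \<sigma> (\<lambda>z. u z *\<^sub>R v z) x - mollify \<phi> \<sigma> (\<lambda>z. u z *\<^sub>R v x0) x) - mollify \<phi> \<sigma> (\<lambda>z. u x0 *\<^sub>R ?v z) x"
        using mollify_diff[OF b c1(4,3) s0] mollify_diff[OF b c1(1,2) s0] by simp
      also have "mollify \<phi> \<sigma> (\<lambda>z. u z *\<^sub>R v x0) x = mollify \<phi> \<sigma> u x *\<^sub>R v x0"
        by (rule mollify_linear[OF bounded_linear_scaleR_left b cu s0])
      also have "mollify \<phi> \<sigma> (\<lambda>z. u x0 *\<^sub>R ?v z) x = u x0 *\<^sub>R mollify \<phi> \<sigma> ?v x"
        by (rule mollify_linear[OF bounded_linear_scaleR_right b cv' s0])
      finally have F: "mollify \<phi> \<sigma> (\<lambda>z. ?u z *\<^sub>R ?v z) x = mollify \<phi> \<sigma> (\<lambda>z. u z *\<^sub>R v z) x - mollify \<phi> \<sigma> u x *\<^sub>R v x0 - u x0 *\<^sub>R mollify \<phi> \<sigma> ?v x" .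
      show ?thesis unfolding F mollify_sub_const[OF cu s0] mollify_sub_const[OF cv s0] by (simp add: algebra_simps)
    qed
    have p: "0 \<le> B * (L * K)" "0 \<le> U * V" using B L K U V by auto
    have q: "B * (L * K) * \<sigma> \<le> B * (L * K)" "U * V * \<sigma> \<le> U * V"
      using mult_left_mono[OF s'(2) p(1)] mult_left_mono[OF s'(2) p(2)] by auto
    have q2: "B * (L * K) * \<sigma> * \<sigma> \<le> B * (L * K) * \<sigma>" "U * V * \<sigma> * \<sigma> \<le> U * V * \<sigma>"
      using mult_right_mono[OF q(1), of \<sigma>] mult_right_mono[OF q(2), of \<sigma>] s' by auto
    show ?thesis using n unfolding eq
    proof (rule C2_bound_mono)
      have "0 \<le> U * V * \<sigma>" using p s' by simp
      then show "B * (L * K * \<sigma>\<^sup>2) + (U * \<sigma>) * (V * \<sigma>) \<le> ?C * \<sigma>" using q2 by (simp add: power2_eq_square algebra_simps)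
      show "B * (L * K * \<sigma>\<^sup>2) / \<sigma> + ((U * \<sigma>) * V + U * (V * \<sigma>)) \<le> ?C"
        using q p s' by (simp add: power2_eq_square algebra_simps)
      show "B * (L * K * \<sigma>\<^sup>2) / \<sigma>\<^sup>2 + ((U * \<sigma>) * (V / \<sigma>) + 2 * (U * V) + (U / \<sigma>) * (V * \<sigma>)) \<le> ?C"
        using s' by (simp add: power2_eq_square)
    qed
  qed
  then show ?thesis using B L K U V by (intro exI[of _ ?C]) auto
qed

text \<open>\<open>U \<sigma>\<close> approximates the mollification of \<open>u\<close> with error \<open>O(\<sigma>)\<close> and, crucially, with second derivatives of the
  error bounded, one order better than for \<open>U \<sigma>\<close> itself. The class is closed under products.\<close>

definition moll_close :: "(real^'n \<Rightarrow> 'b::euclidean_space) \<Rightarrow> (real \<Rightarrow> real^'n \<Rightarrow> 'b) \<Rightarrow> bool" where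
  "moll_close u U \<longleftrightarrow> ball_lip u \<and> (\<forall>\<sigma>\<in>{0<..1}. Cinf (U \<sigma>)) \<and>
     (\<forall>R. \<exists>C\<ge>0. \<forall>\<sigma>\<in>{0<..1}. \<forall>x. norm x \<le> R \<longrightarrow> C2_bound (C * \<sigma>) C C (\<lambda>x. U \<sigma> x - mollify \<phi> \<sigma> u x) x)"

lemma moll_close_E:
  assumes "moll_close u U" obtains C where "C \<ge> 0" "\<And>\<sigma> x. \<sigma>\<in>{0<..1} \<Longrightarrow> norm x \<le> R \<Longrightarrow> C2_bound (C * \<sigma>) C C (\<lambda>x. U \<sigma> x - mollify \<phi> \<sigma> u x) x"
  using assms unfolding moll_close_def by blast

lemma moll_close_C2_bound:
  assumes g: "moll_close u U"
  shows "\<exists>C\<ge>0. \<forall>\<sigma>\<in>{0<..1}. \<forall>x. norm x \<le> R \<longrightarrow> C2_bound C C (C / \<sigma>) (U \<sigma>) x"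
proof -
  have u: "ball_lip u" using g by (simp add: moll_close_def)
  obtain C where C: "C \<ge> 0" "\<And>\<sigma> x. \<sigma>\<in>{0<..1} \<Longrightarrow> norm x \<le> R \<Longrightarrow> C2_bound (C * \<sigma>) C C (\<lambda>x. U \<sigma> x - mollify \<phi> \<sigma> u x) x" using moll_close_E[OF g] by blast
  obtain D where D: "D \<ge> 0" "\<And>\<sigma> x. \<sigma>\<in>{0<..1} \<Longrightarrow> norm x \<le> R \<Longrightarrow> C2_bound D D (D / \<sigma>) (mollify \<phi> \<sigma> u) x"
    using mollify_ball_lip_C2_bound[OF u, of R] by blast
  have "C2_bound (C + D) (C + D) ((C + D) / \<sigma>) (U \<sigma>) x" if s: "\<sigma> \<in> {0<..1}" and x: "norm x \<le> R" for \<sigma> x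
  proof -
    have s': "0 < \<sigma>" "\<sigma> \<le> 1" using s by auto
    have U: "Cinf (U \<sigma>)" and m: "Cinf (mollify \<phi> \<sigma> u)" using g s Cinf_mollify[OF b ball_lip_cont[OF u] s'(1)] by (auto simp: moll_close_def)
    have "C2_bound (C * \<sigma> + D) (C + D) (C + D / \<sigma>) (\<lambda>x. (U \<sigma> x - mollify \<phi> \<sigma> u x) + mollify \<phi> \<sigma> u x) x"
      by (rule C2_bound_add[OF Cinf_diff[OF U m] m C(2)[OF s x] D(2)[OF s x]])
    moreover have "C * \<sigma> \<le> C" using C s' mult_left_mono[of \<sigma> 1 C] by simp
    moreover have "C \<le> C / \<sigma>" using C s' mult_left_mono[of \<sigma> 1 C] by (simp add: le_divide_eq)
    ultimately show ?thesis by (rule_tac C2_bound_mono) (auto simp: add_divide_distrib)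
  qed
  then show ?thesis using C D by (intro exI[of _ "C + D"]) auto
qed

lemma moll_close_add:
  assumes g: "moll_close u U" "moll_close v V" shows "moll_close (\<lambda>x. u x + v x) (\<lambda>\<sigma> x. U \<sigma> x + V \<sigma> x)"
  unfolding moll_close_def
proof (intro conjI ballI allI)
  have u: "ball_lip u" "ball_lip v" using g by (auto simp: moll_close_def)
  then show "ball_lip (\<lambda>x. u x + v x)" by (rule ball_lip_add)
  show "Cinf (\<lambda>x. U \<sigma> x + V \<sigma> x)" if "\<sigma> \<in> {0<..1}" for \<sigma> using g that by (auto simp: moll_close_def intro: Cinf_add)
  fix R
  obtain C where C: "C \<ge> 0" "\<And>\<sigma> x. \<sigma>\<in>{0<..1} \<Longrightarrow> norm x \<le> R \<Longrightarrow> C2_bound (C * \<sigma>) C C (\<lambda>x. U \<sigma> x - mollify \<phi> \<sigma> u x) x" using moll_close_E[OF g(1)] by blast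
  obtain D where D: "D \<ge> 0" "\<And>\<sigma> x. \<sigma>\<in>{0<..1} \<Longrightarrow> norm x \<le> R \<Longrightarrow> C2_bound (D * \<sigma>) D D (\<lambda>x. V \<sigma> x - mollify \<phi> \<sigma> v x) x" using moll_close_E[OF g(2)] by blast
  have "C2_bound ((C + D) * \<sigma>) (C + D) (C + D) (\<lambda>x. U \<sigma> x + V \<sigma> x - mollify \<phi> \<sigma> (\<lambda>x. u x + v x) x) x" if s: "\<sigma> \<in> {0<..1}" and x: "norm x \<le> R" for \<sigma> x
  proof -
    have "C2_bound (C * \<sigma> + D * \<sigma>) (C + D) (C + D) (\<lambda>x. (U \<sigma> x - mollify \<phi> \<sigma> u x) + (V \<sigma> x - mollify \<phi> \<sigma> v x)) x"
      using g s by (intro C2_bound_add Cinf_diff Cinf_mollify b ball_lip_cont u C D x) (auto simp: moll_close_def)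
    moreover have "(\<lambda>x. (U \<sigma> x - mollify \<phi> \<sigma> u x) + (V \<sigma> x - mollify \<phi> \<sigma> v x)) = (\<lambda>x. U \<sigma> x + V \<sigma> x - mollify \<phi> \<sigma> (\<lambda>x. u x + v x) x)"
      using mollify_add[OF b ball_lip_cont[OF u(1)] ball_lip_cont[OF u(2)], of \<sigma>] s by (auto simp: fun_eq_iff)
    ultimately show ?thesis by (simp add: distrib_right)
  qed
  then show "\<exists>C\<ge>0. \<forall>\<sigma>\<in>{0<..1}. \<forall>x. norm x \<le> R \<longrightarrow> C2_bound (C * \<sigma>) C C (\<lambda>x. U \<sigma> x + V \<sigma> x - mollify \<phi> \<sigma> (\<lambda>x. u x + v x) x) x"
    using C D by (intro exI[of _ "C + D"]) auto
qed

lemma moll_close_linear: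
  fixes h :: "'b::euclidean_space \<Rightarrow> 'c::euclidean_space"
  assumes h: "bounded_linear h" and g: "moll_close u U" shows "moll_close (\<lambda>x. h (u x)) (\<lambda>\<sigma> x. h (U \<sigma> x))"
  unfolding moll_close_def
proof (intro conjI ballI allI)
  have u: "ball_lip u" using g by (auto simp: moll_close_def)
  then show "ball_lip (\<lambda>x. h (u x))" by (rule ball_lip_linear[OF h])
  show "Cinf (\<lambda>x. h (U \<sigma> x))" if "\<sigma> \<in> {0<..1}" for \<sigma> using g that by (auto simp: moll_close_def intro: Cinf_linear[OF h])
  fix R
  obtain C where C: "C \<ge> 0" "\<And>\<sigma> x. \<sigma>\<in>{0<..1} \<Longrightarrow> norm x \<le> R \<Longrightarrow> C2_bound (C * \<sigma>) C C (\<lambda>x. U \<sigma> x - mollify \<phi> \<sigma> u x) x" using moll_close_E[OF g] by blast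
  obtain K where K: "K > 0" "\<And>x. norm (h x) \<le> norm x * K" using bounded_linear.pos_bounded[OF h] by blast
  have "C2_bound ((K * C) * \<sigma>) (K * C) (K * C) (\<lambda>x. h (U \<sigma> x) - mollify \<phi> \<sigma> (\<lambda>x. h (u x)) x) x" if s: "\<sigma> \<in> {0<..1}" and x: "norm x \<le> R" for \<sigma> x
  proof -
    have "C2_bound (K * (C * \<sigma>)) (K * C) (K * C) (\<lambda>x. h (U \<sigma> x - mollify \<phi> \<sigma> u x)) x"
      using g s K by (intro C2_bound_linear[OF h] Cinf_diff Cinf_mollify b ball_lip_cont u C x) (auto simp: moll_close_def mult.commute)
    moreover have "(\<lambda>x. h (U \<sigma> x - mollify \<phi> \<sigma> u x)) = (\<lambda>x. h (U \<sigma> x) - mollify \<phi> \<sigma> (\<lambda>x. h (u x)) x)"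
      using mollify_linear[OF h b ball_lip_cont[OF u], of \<sigma>] s linear_diff[OF bounded_linear.linear[OF h]] by (auto simp: fun_eq_iff)
    ultimately show ?thesis by (simp add: mult.assoc)
  qed
  then show "\<exists>C\<ge>0. \<forall>\<sigma>\<in>{0<..1}. \<forall>x. norm x \<le> R \<longrightarrow> C2_bound (C * \<sigma>) C C (\<lambda>x. h (U \<sigma> x) - mollify \<phi> \<sigma> (\<lambda>x. h (u x)) x) x"
    using C K by (intro exI[of _ "K * C"]) auto
qed

text \<open>The error is the error of \<open>U\<close> times \<open>V\<close>, plus the mollified
  \<open>u\<close> times the error of \<open>V\<close>, minus the defect of
  \<open>mollify_product_C2_bound\<close>. A second derivative of \<open>V\<close> may be of order
  \<open>1/\<sigma>\<close>, but it meets the error of \<open>U\<close>, which is of order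
  \<sigma>.\<close>

lemma moll_close_scaleR:
  fixes u :: "real^'n \<Rightarrow> real" and v :: "real^'n \<Rightarrow> 'b::euclidean_space"
  assumes g: "moll_close u U" "moll_close v V" shows "moll_close (\<lambda>x. u x *\<^sub>R v x) (\<lambda>\<sigma> x. U \<sigma> x *\<^sub>R V \<sigma> x)"
  unfolding moll_close_def
proof (intro conjI ballI allI)
  have u: "ball_lip u" "ball_lip v" using g by (auto simp: moll_close_def)
  then show uv: "ball_lip (\<lambda>x. u x *\<^sub>R v x)" by (rule ball_lip_scaleR)
  show "Cinf (\<lambda>x. U \<sigma> x *\<^sub>R V \<sigma> x)" if "\<sigma> \<in> {0<..1}" for \<sigma> using g that by (auto simp: moll_close_def intro: Cinf_scaleR)
  fix R
  obtain C where C: "C \<ge> 0" "\<And>\<sigma> x. \<sigma>\<in>{0<..1} \<Longrightarrow> norm x \<le> R \<Longrightarrow> C2_bound (C * \<sigma>) C C (\<lambda>x. U \<sigma> x - mollify \<phi> \<sigma> u x) x" using moll_close_E[OF g(1)] by blast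
  obtain D where D: "D \<ge> 0" "\<And>\<sigma> x. \<sigma>\<in>{0<..1} \<Longrightarrow> norm x \<le> R \<Longrightarrow> C2_bound (D * \<sigma>) D D (\<lambda>x. V \<sigma> x - mollify \<phi> \<sigma> v x) x" using moll_close_E[OF g(2)] by blast
  obtain E where E: "E \<ge> 0" "\<And>\<sigma> x. \<sigma>\<in>{0<..1} \<Longrightarrow> norm x \<le> R \<Longrightarrow> C2_bound E E (E / \<sigma>) (V \<sigma>) x" using moll_close_C2_bound[OF g(2), of R] by blast
  obtain F where F: "F \<ge> 0" "\<And>\<sigma> x. \<sigma>\<in>{0<..1} \<Longrightarrow> norm x \<le> R \<Longrightarrow> C2_bound F F (F / \<sigma>) (mollify \<phi> \<sigma> u) x" using mollify_ball_lip_C2_bound[OF u(1), of R] by blast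
  obtain Q where Q: "Q \<ge> 0" "\<And>\<sigma> x. \<sigma>\<in>{0<..1} \<Longrightarrow> norm x \<le> R \<Longrightarrow>
     C2_bound (Q * \<sigma>) Q Q (\<lambda>x. mollify \<phi> \<sigma> (\<lambda>z. u z *\<^sub>R v z) x - mollify \<phi> \<sigma> u x *\<^sub>R mollify \<phi> \<sigma> v x) x"
    using mollify_product_C2_bound[OF u, of R] by blast
  let ?C = "4 * (C * E) + 4 * (F * D) + Q"
  have "C2_bound (?C * \<sigma>) ?C ?C (\<lambda>x. U \<sigma> x *\<^sub>R V \<sigma> x - mollify \<phi> \<sigma> (\<lambda>x. u x *\<^sub>R v x) x) x" if s: "\<sigma> \<in> {0<..1}" and x: "norm x \<le> R" for \<sigma> x
  proof -
    have s': "0 < \<sigma>" "\<sigma> \<le> 1" using s by auto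
    have sU: "Cinf (U \<sigma>)" "Cinf (V \<sigma>)" using g s by (auto simp: moll_close_def)
    have sM: "Cinf (mollify \<phi> \<sigma> u)" "Cinf (mollify \<phi> \<sigma> v)" "Cinf (mollify \<phi> \<sigma> (\<lambda>z. u z *\<^sub>R v z))"
      using Cinf_mollify[OF b ball_lip_cont s'(1)] u uv by auto
    have 1: "C2_bound (C * \<sigma> * E) (C * \<sigma> * E + C * E) (C * \<sigma> * (E / \<sigma>) + 2 * (C * E) + C * E) (\<lambda>x. (U \<sigma> x - mollify \<phi> \<sigma> u x) *\<^sub>R V \<sigma> x) x"
      by (rule C2_bound_scaleR[OF Cinf_diff[OF sU(1) sM(1)] sU(2) C(2)[OF s x] E(2)[OF s x]])
    have 2: "C2_bound (F * (D * \<sigma>)) (F * D + F * (D * \<sigma>)) (F * D + 2 * (F * D) + F / \<sigma> * (D * \<sigma>)) (\<lambda>x. mollify \<phi> \<sigma> u x *\<^sub>R (V \<sigma> x - mollify \<phi> \<sigma> v x)) x"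
      by (rule C2_bound_scaleR[OF sM(1) Cinf_diff[OF sU(2) sM(2)] F(2)[OF s x] D(2)[OF s x]])
    have n: "C2_bound (C * \<sigma> * E + F * (D * \<sigma>) + Q * \<sigma>) ((C * \<sigma> * E + C * E) + (F * D + F * (D * \<sigma>)) + Q)
       ((C * \<sigma> * (E / \<sigma>) + 2 * (C * E) + C * E) + (F * D + 2 * (F * D) + F / \<sigma> * (D * \<sigma>)) + Q)
       (\<lambda>x. ((U \<sigma> x - mollify \<phi> \<sigma> u x) *\<^sub>R V \<sigma> x + mollify \<phi> \<sigma> u x *\<^sub>R (V \<sigma> x - mollify \<phi> \<sigma> v x)) -
          (mollify \<phi> \<sigma> (\<lambda>z. u z *\<^sub>R v z) x - mollify \<phi> \<sigma> u x *\<^sub>R mollify \<phi> \<sigma> v x)) x"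
      by (intro C2_bound_diff C2_bound_add 1 2 Q(2)[OF s x] Cinf_add Cinf_diff Cinf_scaleR sU sM)
    have eq: "(\<lambda>x. ((U \<sigma> x - mollify \<phi> \<sigma> u x) *\<^sub>R V \<sigma> x + mollify \<phi> \<sigma> u x *\<^sub>R (V \<sigma> x - mollify \<phi> \<sigma> v x)) -
          (mollify \<phi> \<sigma> (\<lambda>z. u z *\<^sub>R v z) x - mollify \<phi> \<sigma> u x *\<^sub>R mollify \<phi> \<sigma> v x)) = (\<lambda>x. U \<sigma> x *\<^sub>R V \<sigma> x - mollify \<phi> \<sigma> (\<lambda>x. u x *\<^sub>R v x) x)"
      by (simp add: fun_eq_iff algebra_simps)
    have p: "0 \<le> C * E" "0 \<le> F * D" using C D E F by auto
    have q: "C * E * \<sigma> \<le> C * E" "F * D * \<sigma> \<le> F * D"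
      using mult_left_mono[OF s'(2) p(1)] mult_left_mono[OF s'(2) p(2)] by auto
    have p': "0 \<le> C * E * \<sigma>" "0 \<le> F * D * \<sigma>" using p s' by auto
    show ?thesis using n unfolding eq
    proof (rule C2_bound_mono)
      show "C * \<sigma> * E + F * (D * \<sigma>) + Q * \<sigma> \<le> ?C * \<sigma>" using p' by (simp add: algebra_simps)
      show "(C * \<sigma> * E + C * E) + (F * D + F * (D * \<sigma>)) + Q \<le> ?C" using p q by (simp add: algebra_simps)
      show "(C * \<sigma> * (E / \<sigma>) + 2 * (C * E) + C * E) + (F * D + 2 * (F * D) + F / \<sigma> * (D * \<sigma>)) + Q \<le> ?C" using s' by simp
    qed
  qed
  then show "\<exists>C\<ge>0. \<forall>\<sigma>\<in>{0<..1}. \<forall>x. norm x \<le> R \<longrightarrow> C2_bound (C * \<sigma>) C C (\<lambda>x. U \<sigma> x *\<^sub>R V \<sigma> x - mollify \<phi> \<sigma> (\<lambda>x. u x *\<^sub>R v x) x) x"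
    using C D E F Q by (intro exI[of _ ?C]) auto
qed

text \<open>\<open>r\<close> counts the derivatives still available: both the approximation and its
  derivatives up to that order stay close to the mollification of the respective derivative of
  \<open>u\<close>.\<close>

fun moll_close_upto :: "nat \<Rightarrow> (real^'n \<Rightarrow> 'b::euclidean_space) \<Rightarrow> (real \<Rightarrow> real^'n \<Rightarrow> 'b) \<Rightarrow> bool" where
  "moll_close_upto 0 u U = moll_close u U"
| "moll_close_upto (Suc r) u U = (moll_close u U \<and> (\<forall>k x. pd_exists k u x) \<and> (\<forall>k. moll_close_upto r (pd k u) (\<lambda>\<sigma>. pd k (U \<sigma>))))"

declare moll_close_upto.simps(2) [simp del]

lemma moll_close_upto_moll_close: "moll_close_upto r u U \<Longrightarrow> moll_close u U" by (cases r) (auto simp: moll_close_upto.simps(2))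

lemma moll_close_upto_Suc_D: "moll_close_upto (Suc r) u U \<Longrightarrow> moll_close_upto r (pd k u) (\<lambda>\<sigma>. pd k (U \<sigma>))" "moll_close_upto (Suc r) u U \<Longrightarrow> pd_exists k u x"
  by (auto simp: moll_close_upto.simps(2))

lemma moll_close_upto_Suc_imp: "moll_close_upto (Suc r) u U \<Longrightarrow> moll_close_upto r u U"
proof (induction r arbitrary: u U)
  case 0 then show ?case by (simp add: moll_close_upto.simps(2))
next
  case (Suc r)
  then have "moll_close_upto r (pd k u) (\<lambda>\<sigma>. pd k (U \<sigma>))" for k by (auto dest: moll_close_upto_Suc_D)
  with Suc.prems show ?case unfolding moll_close_upto.simps(2) by blast
qed

lemma moll_close_upto_Ck: "moll_close_upto (Suc r) u U \<Longrightarrow> Ck (Suc 0) u"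
proof -
  assume g: "moll_close_upto (Suc r) u U"
  have "ball_lip u" using moll_close_upto_moll_close[OF g] unfolding moll_close_def by blast
  then have "continuous_on UNIV u" by (rule ball_lip_cont)
  moreover have "ball_lip (pd k u)" for k using moll_close_upto_moll_close[OF moll_close_upto_Suc_D(1)[OF g]] unfolding moll_close_def by blast
  then have "Ck 0 (pd k u)" for k by (simp add: ball_lip_cont)
  ultimately show ?thesis using moll_close_upto_Suc_D(2)[OF g] unfolding Ck.simps(2) by blast
qed

lemma moll_close_upto_Cinf: "moll_close_upto r u U \<Longrightarrow> \<sigma> \<in> {0<..1} \<Longrightarrow> Cinf (U \<sigma>)"
  using moll_close_upto_moll_close unfolding moll_close_def by blast

lemma moll_close_upto_cong: "moll_close_upto r u U \<Longrightarrow> (\<And>\<sigma>. \<sigma> \<in> {0<..1} \<Longrightarrow> U \<sigma> = V \<sigma>) \<Longrightarrow> moll_close_upto r u V"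
proof (induction r arbitrary: u U V)
  case 0 then show ?case by (simp add: moll_close_def)
next
  case (Suc r)
  have "moll_close u V" using moll_close_upto_moll_close[OF Suc.prems(1)] Suc.prems(2) by (simp add: moll_close_def)
  moreover have "moll_close_upto r (pd k u) (\<lambda>\<sigma>. pd k (V \<sigma>))" for k
    by (rule Suc.IH[OF moll_close_upto_Suc_D(1)[OF Suc.prems(1)]]) (use Suc.prems(2) in simp)
  ultimately show ?case using Suc.prems(1) unfolding moll_close_upto.simps(2) by blast
qed

lemma moll_close_upto_add: "moll_close_upto r u U \<Longrightarrow> moll_close_upto r v V \<Longrightarrow> moll_close_upto r (\<lambda>x. u x + v x) (\<lambda>\<sigma> x. U \<sigma> x + V \<sigma> x)"
proof (induction r arbitrary: u U v V)
  case 0 then show ?case by (simp add: moll_close_add)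
next
  case (Suc r)
  note c = moll_close_upto_Ck[OF Suc.prems(1)] moll_close_upto_Ck[OF Suc.prems(2)]
  have "moll_close_upto r (\<lambda>x. pd k u x + pd k v x) (\<lambda>\<sigma> x. pd k (U \<sigma>) x + pd k (V \<sigma>) x)" for k
    by (rule Suc.IH[OF moll_close_upto_Suc_D(1)[OF Suc.prems(1)] moll_close_upto_Suc_D(1)[OF Suc.prems(2)]])
  then have "moll_close_upto r (\<lambda>x. pd k u x + pd k v x) (\<lambda>\<sigma>. pd k (\<lambda>x. U \<sigma> x + V \<sigma> x))" for k
    by (rule moll_close_upto_cong) (simp add: pd_add_fun[OF moll_close_upto_Cinf[OF Suc.prems(1)] moll_close_upto_Cinf[OF Suc.prems(2)]])
  moreover have "pd k (\<lambda>x. u x + v x) = (\<lambda>x. pd k u x + pd k v x)" for k using pd_add[OF c] by auto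
  ultimately show ?case unfolding moll_close_upto.simps(2)
    using moll_close_add[OF moll_close_upto_moll_close[OF Suc.prems(1)] moll_close_upto_moll_close[OF Suc.prems(2)]] Ck_Suc_pd_exists[OF Ck_add[OF c]] by (intro conjI allI) simp_all
qed

lemma moll_close_upto_linear: "bounded_linear h \<Longrightarrow> moll_close_upto r u U \<Longrightarrow> moll_close_upto r (\<lambda>x. h (u x)) (\<lambda>\<sigma> x. h (U \<sigma> x))"
proof (induction r arbitrary: u U)
  case 0 then show ?case by (simp add: moll_close_linear)
next
  case (Suc r)
  note c = moll_close_upto_Ck[OF Suc.prems(2)]
  have "moll_close_upto r (\<lambda>x. h (pd k u x)) (\<lambda>\<sigma> x. h (pd k (U \<sigma>) x))" for k
    by (rule Suc.IH[OF Suc.prems(1) moll_close_upto_Suc_D(1)[OF Suc.prems(2)]])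
  then have "moll_close_upto r (\<lambda>x. h (pd k u x)) (\<lambda>\<sigma>. pd k (\<lambda>x. h (U \<sigma> x)))" for k
    by (rule moll_close_upto_cong) (simp add: pd_linear_fun[OF Suc.prems(1) moll_close_upto_Cinf[OF Suc.prems(2)]])
  moreover have "pd k (\<lambda>x. h (u x)) = (\<lambda>x. h (pd k u x))" for k using pd_bounded_linear[OF Suc.prems(1) c] by auto
  ultimately show ?case unfolding moll_close_upto.simps(2)
    using moll_close_linear[OF Suc.prems(1) moll_close_upto_moll_close[OF Suc.prems(2)]] Ck_Suc_pd_exists[OF Ck_bounded_linear[OF Suc.prems(1) c]] by (intro conjI allI) simp_all
qed

lemma moll_close_upto_diff: "moll_close_upto r u U \<Longrightarrow> moll_close_upto r v V \<Longrightarrow> moll_close_upto r (\<lambda>x. u x - v x) (\<lambda>\<sigma> x. U \<sigma> x - V \<sigma> x)"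
  using moll_close_upto_add[of r u U "\<lambda>x. - v x" "\<lambda>\<sigma> x. - V \<sigma> x"] moll_close_upto_linear[OF bounded_linear_minus[OF bounded_linear_ident], of r v V] by simp

lemma moll_close_upto_scaleR:
  fixes v :: "real^'n \<Rightarrow> 'b::euclidean_space"
  shows "moll_close_upto r u U \<Longrightarrow> moll_close_upto r v V \<Longrightarrow> moll_close_upto r (\<lambda>x. u x *\<^sub>R v x) (\<lambda>\<sigma> x. U \<sigma> x *\<^sub>R V \<sigma> x)"
proof (induction r arbitrary: u U v V)
  case 0 then show ?case by (simp add: moll_close_scaleR)
next
  case (Suc r)
  note c = moll_close_upto_Ck[OF Suc.prems(1)] moll_close_upto_Ck[OF Suc.prems(2)]
  have "moll_close_upto r (\<lambda>x. u x *\<^sub>R pd k v x + pd k u x *\<^sub>R v x) (\<lambda>\<sigma> x. U \<sigma> x *\<^sub>R pd k (V \<sigma>) x + pd k (U \<sigma>) x *\<^sub>R V \<sigma> x)" for k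
    by (rule moll_close_upto_add[OF Suc.IH[OF moll_close_upto_Suc_imp[OF Suc.prems(1)] moll_close_upto_Suc_D(1)[OF Suc.prems(2)]]
          Suc.IH[OF moll_close_upto_Suc_D(1)[OF Suc.prems(1)] moll_close_upto_Suc_imp[OF Suc.prems(2)]]])
  then have "moll_close_upto r (\<lambda>x. u x *\<^sub>R pd k v x + pd k u x *\<^sub>R v x) (\<lambda>\<sigma>. pd k (\<lambda>x. U \<sigma> x *\<^sub>R V \<sigma> x))" for k
    by (rule moll_close_upto_cong) (simp add: pd_scaleR_fun[OF moll_close_upto_Cinf[OF Suc.prems(1)] moll_close_upto_Cinf[OF Suc.prems(2)]])
  moreover have "pd k (\<lambda>x. u x *\<^sub>R v x) = (\<lambda>x. u x *\<^sub>R pd k v x + pd k u x *\<^sub>R v x)" for k using pd_scaleR[OF c] by auto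
  ultimately show ?case unfolding moll_close_upto.simps(2)
    using moll_close_scaleR[OF moll_close_upto_moll_close[OF Suc.prems(1)] moll_close_upto_moll_close[OF Suc.prems(2)]] Ck_Suc_pd_exists[OF Ck_scaleR[OF c]] by (intro conjI allI) simp_all
qed

lemma moll_close_upto_sum:
  assumes "finite S" "S \<noteq> {}" "\<And>i. i \<in> S \<Longrightarrow> moll_close_upto r (u i) (U i)"
  shows "moll_close_upto r (\<lambda>x. \<Sum>i\<in>S. u i x) (\<lambda>\<sigma> x. \<Sum>i\<in>S. U i \<sigma> x)"
  using assms by (induction S rule: finite_ne_induct) (auto intro: moll_close_upto_add)

lemma moll_close_upto_Xop:
  fixes F :: "real^'n \<Rightarrow> real^'n" and v :: "real^'n \<Rightarrow> 'b::euclidean_space"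
  assumes F: "moll_close_upto r F FF" and v: "moll_close_upto (Suc r) v V"
  shows "moll_close_upto r (Xop F v) (\<lambda>\<sigma>. Xop (FF \<sigma>) (V \<sigma>))"
proof -
  have "moll_close_upto r (\<lambda>x. \<Sum>k\<in>UNIV. F x $ k *\<^sub>R pd k v x) (\<lambda>\<sigma> x. \<Sum>k\<in>UNIV. FF \<sigma> x $ k *\<^sub>R pd k (V \<sigma>) x)"
    by (intro moll_close_upto_sum moll_close_upto_scaleR moll_close_upto_linear[OF bounded_linear_vec_nth] F moll_close_upto_Suc_D(1)[OF v]) auto
  moreover have "Xop F v = (\<lambda>x. \<Sum>k\<in>UNIV. F x $ k *\<^sub>R pd k v x)" using Ck_Xop_eq[OF moll_close_upto_Ck[OF v]] by auto
  ultimately show ?thesis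
    by (rule_tac moll_close_upto_cong[where U = "\<lambda>\<sigma> x. \<Sum>k\<in>UNIV. FF \<sigma> x $ k *\<^sub>R pd k (V \<sigma>) x"]) (use Ck_Xop_eq[OF CinfD[OF moll_close_upto_Cinf[OF v]]] in auto)
qed

lemma moll_close_upto_le: "moll_close_upto r u U \<Longrightarrow> q \<le> r \<Longrightarrow> moll_close_upto q u U"
  by (induction r) (auto simp: le_Suc_eq dest: moll_close_upto_Suc_imp)

text \<open>Each bracket consumes one derivative. With \<open>r = s - 2\<close> the supply is used
  up exactly at words of length \<open>s - 1\<close>.\<close>

lemma moll_close_upto_fw:
  assumes "\<And>j. j \<in> set w \<Longrightarrow> moll_close_upto r (f j) (\<lambda>\<sigma>. F \<sigma> j)" "w \<noteq> []" "length w \<le> Suc r"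
  shows "moll_close_upto (Suc r - length w) (fw f w) (\<lambda>\<sigma>. fw (F \<sigma>) w)"
  using assms
proof (induction w rule: lie_word.induct)
  case (2 k) then show ?case by simp
next
  case (3 k l w)
  let ?q = "Suc r - length (k # l # w)"
  have e: "Suc ?q = Suc r - length (l # w)" using 3(4) by simp
  have v: "moll_close_upto (Suc ?q) (fw f (l # w)) (\<lambda>\<sigma>. fw (F \<sigma>) (l # w))" unfolding e using 3 by auto
  have k: "moll_close_upto (Suc ?q) (f k) (\<lambda>\<sigma>. F \<sigma> k)" by (rule moll_close_upto_le[OF 3(2)]) (use 3(4) in auto)
  have "moll_close_upto ?q (\<lambda>x. Xop (f k) (fw f (l # w)) x - Xop (fw f (l # w)) (f k) x)
     (\<lambda>\<sigma> x. Xop (F \<sigma> k) (fw (F \<sigma>) (l # w)) x - Xop (fw (F \<sigma>) (l # w)) (F \<sigma> k) x)"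
    by (intro moll_close_upto_diff moll_close_upto_Xop v k moll_close_upto_Suc_imp[OF v] moll_close_upto_Suc_imp[OF k])
  then show ?case by simp
qed simp

text \<open>Here the derivative falls on \<open>u\<close> instead of the kernel, so nothing is lost
  in \<sigma>. The Lipschitz partial derivative makes the first-order remainder quadratic, uniformly
  over the support of the kernel.\<close>

lemma mollify_pd_swap:
  fixes u :: "real^'n \<Rightarrow> 'b::euclidean_space"
  assumes u: "continuous_on UNIV u" and ex: "\<And>x. pd_exists k u x" and l: "ball_lip (pd k u)" and s: "0 < \<sigma>"
  shows "pd k (mollify \<phi> \<sigma> u) x = mollify \<phi> \<sigma> (pd k u) x"
proof -
  obtain L where L: "L \<ge> 0" "\<And>y z. norm y \<le> norm x + \<sigma> + 1 \<Longrightarrow> norm z \<le> norm x + \<sigma> + 1 \<Longrightarrow> norm (pd k u y - pd k u z) \<le> L * norm (y - z)"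
    using ball_lip_E[OF l] by blast
  obtain C where C: "C \<ge> 0" "\<And>z. \<bar>\<phi> z\<bar> \<le> C" using bump_bounded[OF b] by blast
  let ?e = "axis k (1::real)"
  have clamp: "continuous_on UNIV (pd k u)" by (rule ball_lip_cont[OF l])
  have s0: "0 \<le> \<sigma>" using s by simp
  show ?thesis
  proof (rule quotient_imp_pd(2)[of 1 _ _ _ _ "C * unit_ball_vol (real DIM(real^'n)) * L"])
    fix t :: real assume t: "\<bar>t\<bar> \<le> 1"
    let ?w = "\<lambda>z. u (z + t *\<^sub>R ?e) - u z - t *\<^sub>R pd k u z"
    have c1: "continuous_on UNIV (\<lambda>z. u (z + t *\<^sub>R ?e))" by (rule cont_shift[OF u])
    have c2: "continuous_on UNIV (\<lambda>z. u (z + t *\<^sub>R ?e) - u z)" "continuous_on UNIV (\<lambda>z. t *\<^sub>R pd k u z)" by (intro continuous_intros c1 u clamp)+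
    have e: "mollify \<phi> \<sigma> ?w x = mollify \<phi> \<sigma> u (x + t *\<^sub>R ?e) - mollify \<phi> \<sigma> u x - t *\<^sub>R mollify \<phi> \<sigma> (pd k u) x"
    proof -
      have "mollify \<phi> \<sigma> (\<lambda>z. u (z + t *\<^sub>R ?e)) x = mollify \<phi> \<sigma> u (x + t *\<^sub>R ?e)" by (simp add: mollify_def algebra_simps)
      then show ?thesis
        using mollify_diff[OF b c2 s0] mollify_diff[OF b c1 u s0] mollify_linear[OF bounded_linear_scaleR_right b clamp s0] by simp
    qed
    have "norm (mollify \<phi> \<sigma> ?w x) \<le> C * unit_ball_vol (real DIM(real^'n)) * (L * t\<^sup>2)"
    proof (rule mollify_bound[OF b C _ s0])
      show "continuous_on UNIV ?w" by (rule continuous_on_diff[OF c2])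
      fix z assume z: "norm (z - x) \<le> \<sigma>"
      have nz: "norm z \<le> norm x + \<sigma>" using z norm_triangle_sub[of z x] by simp
      have "norm ((\<lambda>r. u (z + r *\<^sub>R ?e)) t - (\<lambda>r. u (z + r *\<^sub>R ?e)) 0 - t *\<^sub>R pd k u z) \<le> (L * \<bar>t\<bar>) * \<bar>t\<bar>"
      proof (rule vector_mvt_linearization)
        fix r assume r: "r \<in> closed_segment 0 t"
        show "((\<lambda>r. u (z + r *\<^sub>R ?e)) has_vector_derivative pd k u (z + r *\<^sub>R ?e)) (at r within closed_segment 0 t)"
          by (rule pd_exists_has_vector_derivative[OF ex])
        have r': "\<bar>r\<bar> \<le> \<bar>t\<bar>" by (rule closed_segment_0_abs_le[OF r])
        have "norm (z + r *\<^sub>R ?e) \<le> norm x + \<sigma> + 1" using norm_triangle_ineq[of z "r *\<^sub>R ?e"] nz r' t by simp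
        then have "norm (pd k u (z + r *\<^sub>R ?e) - pd k u z) \<le> L * \<bar>r\<bar>" using L(2)[of "z + r *\<^sub>R ?e" z] nz by simp
        also have "\<dots> \<le> L * \<bar>t\<bar>" using r' L by (intro mult_left_mono) auto
        finally show "norm (pd k u (z + r *\<^sub>R ?e) - pd k u z) \<le> L * \<bar>t\<bar>" .
      qed
      then show "norm (?w z) \<le> L * t\<^sup>2" by (simp add: power2_eq_square mult.assoc)
    qed (use L in auto)
    then show "norm (mollify \<phi> \<sigma> u (x + t *\<^sub>R ?e) - mollify \<phi> \<sigma> u x - t *\<^sub>R mollify \<phi> \<sigma> (pd k u) x) \<le> C * unit_ball_vol (real DIM(real^'n)) * L * t\<^sup>2"
      unfolding e by (simp add: mult.assoc)
  qed simp
qed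

lemma deriv_lip_moll_close_upto: "deriv_lip r u \<Longrightarrow> moll_close_upto r u (\<lambda>\<sigma>. mollify \<phi> \<sigma> u)"
proof (induction r arbitrary: u)
  case base: 0
  have u: "ball_lip u" using base unfolding deriv_lip_def by (metis le_zero_eq length_0_conv loc_lip_imp_ball_lip pds.simps(1))
  have "C2_bound 0 0 0 (\<lambda>x. (0::'a)) x" for x unfolding C2_bound_def by (simp add: pd_const pd_const[abs_def])
  then show ?case using u Cinf_mollify[OF b ball_lip_cont[OF u]] by (auto simp: moll_close_def intro!: exI[of _ 0])
next
  case (Suc r)
  have u: "ball_lip u" using Suc.prems unfolding deriv_lip_def by (metis le0 list.size(3) loc_lip_imp_ball_lip pds.simps(1))
  have ex: "pd_exists k u x" for k x using Suc.prems unfolding deriv_lip_def by (metis list.size(3) pds.simps(1) zero_less_Suc)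
  have d: "deriv_lip r (pd k u)" for k
    unfolding deriv_lip_def
  proof (intro conjI allI impI)
    have eq: "pds ks (pd k u) = pds (ks @ [k]) u" for ks by (simp add: pds_append)
    show "pd_exists l (pds ks (pd k u)) x" if "length ks < r" for ks l x
      using Suc.prems that unfolding eq deriv_lip_def by simp
    show "loc_lip (pds ks (pd k u))" if "length ks \<le> r" for ks
      using Suc.prems that unfolding eq deriv_lip_def by simp
  qed
  have "ball_lip (pd k u)" for k using moll_close_upto_moll_close[OF Suc.IH[OF d]] by (simp add: moll_close_def)
  then have "moll_close_upto r (pd k u) (\<lambda>\<sigma>. pd k (mollify \<phi> \<sigma> u))" for k
    using moll_close_upto_cong[OF Suc.IH[OF d], of k "\<lambda>\<sigma>. pd k (mollify \<phi> \<sigma> u)"] mollify_pd_swap[OF ball_lip_cont[OF u] ex] by fastforce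
  moreover have "C2_bound 0 0 0 (\<lambda>x. (0::'a)) x" for x unfolding C2_bound_def by (simp add: pd_const pd_const[abs_def])
  then have "moll_close u (\<lambda>\<sigma>. mollify \<phi> \<sigma> u)" using u Cinf_mollify[OF b ball_lip_cont[OF u]] by (auto simp: moll_close_def intro!: exI[of _ 0])
  ultimately show ?case using ex unfolding moll_close_upto.simps(2) by blast
qed

end

lemma dir_norm_le:
  fixes g :: "real^'n \<Rightarrow> 'b::real_normed_vector"
  assumes "\<And>k. norm (pd k g x) \<le> P"
  shows "norm (dir g x h) \<le> real CARD('n) * P * norm h"
proof -
  have P: "0 \<le> P" using assms norm_ge_zero order_trans by blast
  have "norm (dir g x h) \<le> (\<Sum>k\<in>(UNIV::'n set). norm h * P)"
    unfolding dir_def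
  proof (rule sum_norm_le)
    fix k
    have "\<bar>h $ k\<bar> * norm (pd k g x) \<le> norm h * P"
      using assms component_le_norm_cart[of h k] P by (intro mult_mono) auto
    then show "norm (h $ k *\<^sub>R pd k g x) \<le> norm h * P" by simp
  qed
  then show ?thesis by (simp add: mult_ac)
qed

lemma Xop_norm_le:
  fixes g :: "real^'n \<Rightarrow> 'b::real_normed_vector"
  assumes "Ck (Suc 0) g" "\<And>k. norm (pd k g x) \<le> P"
  shows "norm (Xop F g x) \<le> real CARD('n) * P * norm (F x)"
  using dir_norm_le[OF assms(2)] has_derivative_imp_Xop(2)[OF Ck_has_derivative_dir[OF assms(1)], of F x] by simp

lemma lip_of_partials:
  fixes G :: "real^'n \<Rightarrow> 'b::real_normed_vector"
  assumes G: "Ck (Suc 0) G" and P: "\<And>\<xi> k. \<xi> \<in> closed_segment x x' \<Longrightarrow> norm (pd k G \<xi>) \<le> P"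
  shows "norm (G x' - G x) \<le> real CARD('n) * P * norm (x' - x)"
proof -
  let ?F = "\<lambda>r. G (x + r *\<^sub>R (x' - x))"
  have "norm (?F 1 - ?F 0) \<le> (real CARD('n) * P * norm (x' - x)) * \<bar>1\<bar>"
  proof (rule vector_mvt_bound)
    fix r :: real assume r: "r \<in> closed_segment 0 1"
    let ?xi = "x + r *\<^sub>R (x' - x)"
    have "((\<lambda>r. x + r *\<^sub>R (x' - x)) has_derivative (\<lambda>h. h *\<^sub>R (x' - x))) (at r within closed_segment 0 1)"
      by (auto intro!: derivative_eq_intros)
    from has_derivative_compose[OF this Ck_has_derivative_dir[OF G]]
    show "(?F has_vector_derivative dir G ?xi (x' - x)) (at r within closed_segment 0 1)"
      by (simp add: has_vector_derivative_def linear_cmul[OF bounded_linear.linear[OF bounded_linear_dir]])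
    have "?xi \<in> closed_segment x x'"
      using r by (auto simp: closed_segment_def closed_segment_eq_real_ivl algebra_simps intro!: exI[of _ r])
    then show "norm (dir G ?xi (x' - x)) \<le> real CARD('n) * P * norm (x' - x)" by (intro dir_norm_le P)
  qed
  then show ?thesis by simp
qed

lemma segment_norm_le: "\<xi> \<in> closed_segment x x' \<Longrightarrow> norm x \<le> R \<Longrightarrow> norm x' \<le> R \<Longrightarrow> norm \<xi> \<le> (R::real)"
proof -
  assume "\<xi> \<in> closed_segment x x'" "norm x \<le> R" "norm x' \<le> R"
  then have "closed_segment x x' \<subseteq> cball 0 R" by (intro closed_segment_subset) auto
  then show ?thesis using \<open>\<xi> \<in> closed_segment x x'\<close> by auto
qed

section \<open>Uniform bounds for mollified commutators\<close>

text \<open>Friedrichs' lemma in Lipschitz form. The derivative \<open>Xop F u\<close> exists only along \<open>F\<close>, so the remainder is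
  estimated as the limit of \<open>1/t\<close> times the mollified increments \<open>u (z + t F\<^sup>\<sigma> x) - u (z + t F z)\<close>.\<close>

lemma moll_commutator_lipschitz:
  fixes F u :: "real^'n \<Rightarrow> real^'n" and \<phi> :: "real^'n \<Rightarrow> real"
  assumes b: "bump \<phi>" and i1: "integral\<^sup>L lborel \<phi> = 1" and F: "ball_lip F" and u: "ball_lip u"
    and ex: "\<And>x. Xexists F u x" and cX: "continuous_on UNIV (Xop F u)"
  shows "\<exists>C\<ge>0. \<forall>\<sigma>\<in>{0<..1}. \<forall>x x'. norm x \<le> R \<longrightarrow> norm x' \<le> R \<longrightarrow> norm (x' - x) \<le> \<sigma> \<longrightarrow>
     norm ((Xop (mollify \<phi> \<sigma> F) (mollify \<phi> \<sigma> u) x' - mollify \<phi> \<sigma> (Xop F u) x') - (Xop (mollify \<phi> \<sigma> F) (mollify \<phi> \<sigma> u) x - mollify \<phi> \<sigma> (Xop F u) x))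
       \<le> C * norm (x' - x)"
proof -
  obtain MF where MF: "MF \<ge> 0" "\<And>z. norm z \<le> R + 2 \<Longrightarrow> norm (F z) \<le> MF" using ball_lip_bounded[OF F] by metis
  obtain CF where CF: "CF \<ge> 0" and CF1: "\<And>\<sigma> x. \<sigma>\<in>{0<..1} \<Longrightarrow> norm x \<le> R \<Longrightarrow> C2_bound CF CF (CF / \<sigma>) (mollify \<phi> \<sigma> F) x"
    and CF2: "\<And>\<sigma> x. \<sigma>\<in>{0<..1} \<Longrightarrow> norm x \<le> R \<Longrightarrow> C2_bound (CF * \<sigma>) CF (CF / \<sigma>) (mollify \<phi> \<sigma> (\<lambda>z. F z - F x)) x"
    using mollify_ball_lip_C2_bound[OF b i1 F, of R] by blast
  obtain LF where LF: "LF \<ge> 0" "\<And>x y. norm x \<le> R + 2 \<Longrightarrow> norm y \<le> R + 2 \<Longrightarrow> norm (F x - F y) \<le> LF * norm (x - y)" using ball_lip_E[OF F] by blast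
  \<comment> \<open>Large enough to contain the displaced points \<open>z + t c\<close> for
    \<open>t \<le> 1\<close>, with \<open>z\<close> in the enlarged ball and \<open>c\<close> either
    a value of \<open>F\<close> or of its mollification.\<close>
  define R1 where "R1 = R + 2 + MF + CF"
  obtain Lu where Lu: "Lu \<ge> 0" "\<And>x y. norm x \<le> R1 \<Longrightarrow> norm y \<le> R1 \<Longrightarrow> norm (u x - u y) \<le> Lu * norm (x - y)" using ball_lip_E[OF u] by blast
  obtain B where B: "B \<ge> 0" "\<And>\<sigma> (w :: real^'n \<Rightarrow> real^'n) A x. 0 < \<sigma> \<Longrightarrow> continuous_on UNIV w \<Longrightarrow> 0 \<le> A \<Longrightarrow>
      (\<And>z. norm (z - x) \<le> \<sigma> \<Longrightarrow> norm (w z) \<le> A) \<Longrightarrow> C2_bound (B * A) (B * A / \<sigma>) (B * A / \<sigma>\<^sup>2) (mollify \<phi> \<sigma> w) x"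
    using mollify_C2_bound[OF b] by metis
  have cF: "continuous_on UNIV F" and cu: "continuous_on UNIV u" using ball_lip_cont F u by auto
  have cuF: "continuous_on UNIV (\<lambda>z. u (z + t *\<^sub>R F z))" for t
    by (rule continuous_on_compose2[OF cu]) (auto intro!: continuous_intros cF)
  have cuc: "continuous_on UNIV (\<lambda>z. u (z + c))" for c by (rule cont_shift[OF cu])
  let ?n = "real CARD('n)"
  let ?C = "B * (Lu * (?n * CF)) + ?n * (B * (Lu * (CF + 2 * LF)))"
  have C0: "0 \<le> ?C" using B Lu CF LF by simp
  have main: "norm ((Xop (mollify \<phi> \<sigma> F) (mollify \<phi> \<sigma> u) x' - mollify \<phi> \<sigma> (Xop F u) x') - (Xop (mollify \<phi> \<sigma> F) (mollify \<phi> \<sigma> u) x - mollify \<phi> \<sigma> (Xop F u) x))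
       \<le> ?C * norm (x' - x)"
    if s: "\<sigma> \<in> {0<..1}" and x: "norm x \<le> R" and x': "norm x' \<le> R" and xx: "norm (x' - x) \<le> \<sigma>" for \<sigma> x x'
  proof -
    have s': "0 < \<sigma>" "\<sigma> \<le> 1" "0 \<le> \<sigma>" using s by auto
    let ?Fs = "mollify \<phi> \<sigma> F"
    define D where "D t x = mollify \<phi> \<sigma> (\<lambda>z. u (z + t *\<^sub>R ?Fs x) - u (z + t *\<^sub>R F z)) x" for t x
    have Fsb: "norm (?Fs y) \<le> CF" if "norm y \<le> R" for y using CF1[OF s that] by (simp add: C2_bound_def)
    have Fsn: "norm (?Fs y - F y) \<le> CF * \<sigma>" if "norm y \<le> R" for y
      using CF2[OF s that] mollify_sub_const[OF b i1 cF s'(3)] by (simp add: C2_bound_def)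
    have step: "norm (D t x' - D t x) \<le> ?C * t * norm (x' - x)" if t: "0 < t" "t \<le> 1" for t
    proof -
      define w where "w c z = u (z + t *\<^sub>R c) - u (z + t *\<^sub>R F z)" for c z
      have cw: "continuous_on UNIV (w c)" for c unfolding w_def by (intro continuous_on_diff cuF cuc)
      have arg: "norm (z + t *\<^sub>R c) \<le> R1" if "norm z \<le> R + 1" "norm c \<le> MF + CF" for z c
      proof -
        have "norm (t *\<^sub>R c) \<le> norm c" using t by (simp add: mult_left_le_one_le)
        then show ?thesis using norm_triangle_ineq[of z "t *\<^sub>R c"] that by (simp add: R1_def)
      qed
      have Fz: "norm (F z) \<le> MF + CF" if "norm z \<le> R + 1" for z using MF(2)[of z] that CF by simp
      have e: "D t x' - D t x = (mollify \<phi> \<sigma> (w (?Fs x')) x' - mollify \<phi> \<sigma> (w (?Fs x')) x) + mollify \<phi> \<sigma> (\<lambda>z. w (?Fs x') z - w (?Fs x) z) x"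
        unfolding mollify_diff[OF b cw cw s'(3)] by (simp add: D_def w_def[abs_def])
      have "norm (?Fs x' - ?Fs x) \<le> ?n * CF * norm (x' - x)"
        by (rule lip_of_partials[OF Ck_mollify[OF b cF s'(1)]]) (use CF1[OF s] segment_norm_le[OF _ x x'] in \<open>auto simp: C2_bound_def\<close>)
      then have dc: "norm (t *\<^sub>R ?Fs x' - t *\<^sub>R ?Fs x) \<le> t * (?n * CF * norm (x' - x))"
        using t by (simp add: scaleR_diff_right[symmetric] mult_left_mono)
      have 2: "norm (mollify \<phi> \<sigma> (\<lambda>z. w (?Fs x') z - w (?Fs x) z) x) \<le> B * (Lu * (t * (?n * CF * norm (x' - x))))"
      proof -
        have "C2_bound (B * (Lu * (t * (?n * CF * norm (x' - x))))) (B * (Lu * (t * (?n * CF * norm (x' - x)))) / \<sigma>) (B * (Lu * (t * (?n * CF * norm (x' - x)))) / \<sigma>\<^sup>2)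
           (mollify \<phi> \<sigma> (\<lambda>z. w (?Fs x') z - w (?Fs x) z)) x"
        proof (rule B(2)[OF s'(1)])
          fix z assume z: "norm (z - x) \<le> \<sigma>"
          have nz: "norm z \<le> R + 1" by (rule near_norm[OF x z s'(2)])
          have "norm (u (z + t *\<^sub>R ?Fs x') - u (z + t *\<^sub>R ?Fs x)) \<le> Lu * norm ((z + t *\<^sub>R ?Fs x') - (z + t *\<^sub>R ?Fs x))"
            using Fsb[OF x] Fsb[OF x'] MF by (intro Lu(2) arg nz) auto
          also have "\<dots> \<le> Lu * (t * (?n * CF * norm (x' - x)))" using dc Lu by (intro mult_left_mono) auto
          finally show "norm (w (?Fs x') z - w (?Fs x) z) \<le> Lu * (t * (?n * CF * norm (x' - x)))" by (simp add: w_def)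
        qed (use Lu t CF in \<open>auto intro!: continuous_on_diff cw\<close>)
        then show ?thesis by (simp add: C2_bound_def)
      qed
      \<comment> \<open>Moving the point differentiates the kernel and costs
        \<open>1/\<sigma>\<close>. Within distance \<sigma> of the segment the vectors
        \<open>?Fs x'\<close> and \<open>F z\<close> differ by O(\<sigma>), which compensates; this
        uses that \<open>x\<close> and \<open>x'\<close> are at most \<sigma> apart.\<close>
      have 1: "norm (mollify \<phi> \<sigma> (w (?Fs x')) x' - mollify \<phi> \<sigma> (w (?Fs x')) x) \<le> ?n * (B * (Lu * (t * (CF + 2 * LF)))) * norm (x' - x)"
      proof (rule lip_of_partials[OF Ck_mollify[OF b cw s'(1)]])
        fix \<xi> k assume xi: "\<xi> \<in> closed_segment x x'"
        have nxi: "norm \<xi> \<le> R" by (rule segment_norm_le[OF xi x x'])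
        let ?A = "Lu * (t * ((CF + 2 * LF) * \<sigma>))"
        have "C2_bound (B * ?A) (B * ?A / \<sigma>) (B * ?A / \<sigma>\<^sup>2) (mollify \<phi> \<sigma> (w (?Fs x'))) \<xi>"
        proof (rule B(2)[OF s'(1) cw])
          fix z assume z: "norm (z - \<xi>) \<le> \<sigma>"
          have nz: "norm z \<le> R + 1" by (rule near_norm[OF nxi z s'(2)])
          have "norm (\<xi> - x') \<le> \<sigma>" using segment_bound(2)[OF xi] xx by (simp add: norm_minus_commute)
          then have "norm (z - x') \<le> 2 * \<sigma>" using z norm_triangle_ineq[of "z - \<xi>" "\<xi> - x'"] by simp
          then have "LF * norm (z - x') \<le> LF * (2 * \<sigma>)" using LF by (intro mult_left_mono)
          moreover have "norm (F x' - F z) \<le> LF * norm (z - x')" using LF(2)[of x' z] x' nz by (simp add: norm_minus_commute)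
          ultimately have "norm (?Fs x' - F z) \<le> (CF + 2 * LF) * \<sigma>"
            using Fsn[OF x'] norm_triangle_ineq[of "?Fs x' - F x'" "F x' - F z"] by (simp add: algebra_simps)
          then have d: "norm ((z + t *\<^sub>R ?Fs x') - (z + t *\<^sub>R F z)) \<le> t * ((CF + 2 * LF) * \<sigma>)"
            using t by (simp add: scaleR_diff_right[symmetric] mult_left_mono)
          have "norm (w (?Fs x') z) \<le> Lu * norm ((z + t *\<^sub>R ?Fs x') - (z + t *\<^sub>R F z))"
            unfolding w_def using Fsb[OF x'] MF Fz[OF nz] by (intro Lu(2) arg nz) auto
          also have "\<dots> \<le> ?A" using d Lu by (intro mult_left_mono) auto
          finally show "norm (w (?Fs x') z) \<le> ?A" .
        qed (use Lu t CF LF s' in auto)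
        then have "norm (pd k (mollify \<phi> \<sigma> (w (?Fs x'))) \<xi>) \<le> B * ?A / \<sigma>" by (simp add: C2_bound_def)
        also have "\<dots> = B * (Lu * (t * (CF + 2 * LF)))" using s' by simp
        finally show "norm (pd k (mollify \<phi> \<sigma> (w (?Fs x'))) \<xi>) \<le> B * (Lu * (t * (CF + 2 * LF)))" .
      qed
      show ?thesis unfolding e using norm_triangle_mono[OF 1 2] by (simp add: algebra_simps)
    qed
    have lim: "((\<lambda>i. (1 / inverse (real (Suc i))) *\<^sub>R D (inverse (real (Suc i))) y) \<longlongrightarrow> Xop ?Fs (mollify \<phi> \<sigma> u) y - mollify \<phi> \<sigma> (Xop F u) y) sequentially"
      if y: "norm y \<le> R" for y
    proof -
      \<comment> \<open>A sequence of times, as dominated convergence demands. The Lipschitz bound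
        on \<open>u\<close> provides the dominating function, although \<open>u\<close> is
        differentiable only along \<open>F\<close>.\<close>
      let ?t = "\<lambda>i. inverse (real (Suc i))"
      have ft: "filterlim ?t (at 0) sequentially"
        unfolding filterlim_at using LIMSEQ_inverse_real_of_nat by (auto intro!: always_eventually)
      have "((\<lambda>h. (1/h) *\<^sub>R (mollify \<phi> \<sigma> u (y + h *\<^sub>R ?Fs y) - mollify \<phi> \<sigma> u y)) \<longlongrightarrow> dir (mollify \<phi> \<sigma> u) y (?Fs y)) (at 0)"
        using has_vector_derivative_along[OF Ck_has_derivative_dir[OF Ck_mollify[OF b cu s'(1)]], where v = "?Fs y"]
        unfolding has_vector_derivative_iff_quotient by simp
      then have l1: "((\<lambda>i. (1/?t i) *\<^sub>R (mollify \<phi> \<sigma> u (y + ?t i *\<^sub>R ?Fs y) - mollify \<phi> \<sigma> u y)) \<longlongrightarrow> Xop ?Fs (mollify \<phi> \<sigma> u) y) sequentially"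
        unfolding has_derivative_imp_Xop(2)[OF Ck_has_derivative_dir[OF Ck_mollify[OF b cu s'(1)]]]
        by (rule filterlim_compose[OF _ ft])
      let ?q = "\<lambda>i z. (1/?t i) *\<^sub>R (u (z + ?t i *\<^sub>R F z) - u z)"
      have cq: "continuous_on UNIV (?q i)" for i by (intro continuous_on_scaleR continuous_on_const continuous_on_diff cuF cu)
      obtain Q where Q: "Q \<ge> 0" "\<And>z. \<bar>\<phi> z\<bar> \<le> Q" using bump_bounded[OF b] by blast
      have l2: "((\<lambda>i. mollify \<phi> \<sigma> (?q i) y) \<longlongrightarrow> mollify \<phi> \<sigma> (Xop F u) y) sequentially"
        unfolding mollify_def
      proof (rule integral_dominated_convergence[where w = "\<lambda>z. Q * (Lu * MF) * indicator (cball 0 1) z"])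
        show "(\<lambda>z. \<phi> z *\<^sub>R Xop F u (y - \<sigma> *\<^sub>R z)) \<in> borel_measurable lborel"
          by (intro borel_cont continuous_on_scaleR Ck_cont[OF bump_Ck[OF b, of 0]] cont_mollify_arg cX)
        show "(\<lambda>z. \<phi> z *\<^sub>R ?q i (y - \<sigma> *\<^sub>R z)) \<in> borel_measurable lborel" for i
          by (intro borel_cont continuous_on_scaleR[OF Ck_cont[OF bump_Ck[OF b, of 0]]] cont_mollify_arg[of "?q i", OF cq])
        show "integrable lborel (\<lambda>z::real^'n. Q * (Lu * MF) * indicator (cball 0 1) z)"
          by (intro integrable_mult_right integrable_real_indicator) (auto simp: emeasure_bounded_finite[unfolded infinity_ennreal_def])
        show "AE z in lborel. (\<lambda>i. \<phi> z *\<^sub>R ?q i (y - \<sigma> *\<^sub>R z)) \<longlonglongrightarrow> \<phi> z *\<^sub>R Xop F u (y - \<sigma> *\<^sub>R z)"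
        proof (rule AE_I2)
          fix z
          let ?z = "y - \<sigma> *\<^sub>R z"
          have "((\<lambda>t. u (?z + t *\<^sub>R F ?z)) has_vector_derivative Xop F u ?z) (at 0)"
            using ex[of ?z] unfolding Xexists_def Xop_def by (simp add: vector_derivative_works)
          then have "((\<lambda>h. (1/h) *\<^sub>R (u (?z + h *\<^sub>R F ?z) - u ?z)) \<longlongrightarrow> Xop F u ?z) (at 0)"
            unfolding has_vector_derivative_iff_quotient by simp
          from filterlim_compose[OF this ft] show "(\<lambda>i. \<phi> z *\<^sub>R ?q i ?z) \<longlonglongrightarrow> \<phi> z *\<^sub>R Xop F u ?z"
            by (intro tendsto_scaleR tendsto_const)
        qed
        fix i
        show "AE z in lborel. norm (\<phi> z *\<^sub>R ?q i (y - \<sigma> *\<^sub>R z)) \<le> Q * (Lu * MF) * indicator (cball 0 1) z"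
        proof (rule AE_I2)
          fix z :: "real^'n"
          let ?z = "y - \<sigma> *\<^sub>R z"
          show "norm (\<phi> z *\<^sub>R ?q i ?z) \<le> Q * (Lu * MF) * indicator (cball 0 1) z"
          proof (cases "norm z \<le> 1")
            case True
            have "norm (\<sigma> *\<^sub>R z) \<le> \<sigma>" using True s' by (simp add: mult_le_cancel_left1)
            then have nz: "norm ?z \<le> R + 1" using near_norm[OF y, of ?z \<sigma>] s' by simp
            have t: "0 < ?t i" "?t i \<le> 1" by (auto simp: inverse_le_1_iff)
            have Fz: "norm (F ?z) \<le> MF" using MF(2)[of ?z] nz by simp
            have "norm (?t i *\<^sub>R F ?z) \<le> norm (F ?z)" using t by (simp add: mult_left_le_one_le)
            then have "norm (?z + ?t i *\<^sub>R F ?z) \<le> R1" using norm_triangle_ineq[of ?z "?t i *\<^sub>R F ?z"] nz Fz CF by (simp add: R1_def)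
            then have "norm (u (?z + ?t i *\<^sub>R F ?z) - u ?z) \<le> Lu * norm (?t i *\<^sub>R F ?z)"
              using Lu(2)[of "?z + ?t i *\<^sub>R F ?z" ?z] nz MF CF by (simp add: R1_def)
            also have "\<dots> \<le> Lu * (?t i * MF)" using Fz t Lu by (intro mult_left_mono) (auto intro: mult_left_mono)
            finally have "norm (u (?z + ?t i *\<^sub>R F ?z) - u ?z) \<le> ?t i * (Lu * MF)" by (simp add: mult_ac)
            then have "(1 / ?t i) * norm (u (?z + ?t i *\<^sub>R F ?z) - u ?z) \<le> (1 / ?t i) * (?t i * (Lu * MF))"
              using t by (intro mult_left_mono) auto
            then have "norm (?q i ?z) \<le> Lu * MF" using t by simp
            then have "\<bar>\<phi> z\<bar> * norm (?q i ?z) \<le> Q * (Lu * MF)" using Q by (intro mult_mono) auto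
            then show ?thesis using True by simp
          next
            case False
            then show ?thesis using bump_0[OF b, of z] by simp
          qed
        qed
      qed
      have "(1 / ?t i) *\<^sub>R D (?t i) y = (1/?t i) *\<^sub>R (mollify \<phi> \<sigma> u (y + ?t i *\<^sub>R ?Fs y) - mollify \<phi> \<sigma> u y) - mollify \<phi> \<sigma> (?q i) y" for i
      proof -
        have a: "mollify \<phi> \<sigma> (\<lambda>z. u (z + ?t i *\<^sub>R ?Fs y)) y = mollify \<phi> \<sigma> u (y + ?t i *\<^sub>R ?Fs y)" by (simp add: mollify_def algebra_simps)
        have "mollify \<phi> \<sigma> (?q i) y = (1/?t i) *\<^sub>R mollify \<phi> \<sigma> (\<lambda>z. u (z + ?t i *\<^sub>R F z) - u z) y"
          by (rule mollify_linear[OF bounded_linear_scaleR_right b continuous_on_diff[OF cuF cu] s'(3)])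
        also have "mollify \<phi> \<sigma> (\<lambda>z. u (z + ?t i *\<^sub>R F z) - u z) y = mollify \<phi> \<sigma> (\<lambda>z. u (z + ?t i *\<^sub>R F z)) y - mollify \<phi> \<sigma> u y"
          by (rule mollify_diff[OF b cuF cu s'(3)])
        finally show ?thesis unfolding D_def mollify_diff[OF b cuc cuF s'(3)] a by (simp add: scaleR_diff_right)
      qed
      then show ?thesis using tendsto_diff[OF l1 l2] by simp
    qed
    have "((\<lambda>i. norm ((1 / inverse (real (Suc i))) *\<^sub>R D (inverse (real (Suc i))) x' - (1 / inverse (real (Suc i))) *\<^sub>R D (inverse (real (Suc i))) x)) \<longlongrightarrow>
      norm ((Xop ?Fs (mollify \<phi> \<sigma> u) x' - mollify \<phi> \<sigma> (Xop F u) x') - (Xop ?Fs (mollify \<phi> \<sigma> u) x - mollify \<phi> \<sigma> (Xop F u) x))) sequentially"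
      by (intro tendsto_norm tendsto_diff lim x x')
    then show ?thesis
    proof (rule tendsto_upperbound)
      have "norm ((1 / t) *\<^sub>R D t x' - (1 / t) *\<^sub>R D t x) \<le> ?C * norm (x' - x)" if t: "0 < t" "t \<le> 1" for t
      proof -
        have "norm ((1 / t) *\<^sub>R D t x' - (1 / t) *\<^sub>R D t x) = (1 / t) * norm (D t x' - D t x)"
          using t by (simp add: scaleR_diff_right[symmetric])
        also have "\<dots> \<le> (1 / t) * (?C * t * norm (x' - x))" using step[OF t] t by (intro mult_left_mono) auto
        also have "\<dots> = ?C * norm (x' - x)" using t by simp
        finally show ?thesis .
      qed
      then show "\<forall>\<^sub>F i in sequentially. norm ((1 / inverse (real (Suc i))) *\<^sub>R D (inverse (real (Suc i))) x' - (1 / inverse (real (Suc i))) *\<^sub>R D (inverse (real (Suc i))) x) \<le> ?C * norm (x' - x)"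
        by (intro always_eventually allI) (simp add: inverse_le_1_iff del: of_nat_Suc)
    qed simp
  qed
  show ?thesis by (rule exI[of _ ?C]) (use C0 main in blast)
qed

section \<open>Mollifying the distributional derivative\<close>

lemma lebesgue_bounded_support:
  fixes f :: "'a::euclidean_space \<Rightarrow> 'b::euclidean_space"
  assumes m: "f \<in> borel_measurable lebesgue" and C: "0 \<le> C" and r: "0 \<le> \<rho>"
    and b: "AE z in lebesgue. norm (z - x) \<le> \<rho> \<longrightarrow> norm (f z) \<le> C" and z: "\<And>z. \<rho> < norm (z - x) \<Longrightarrow> f z = 0"
  shows "f integrable_on UNIV"
    and "norm (integral UNIV f) \<le> C * (unit_ball_vol (real DIM('a)) * \<rho> ^ DIM('a))"
proof -
  let ?g = "\<lambda>z. C * indicator (cball x \<rho>) z"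
  have "integrable lborel ?g"
    by (intro integrable_mult_right integrable_real_indicator) (auto simp: emeasure_bounded_finite[unfolded infinity_ennreal_def])
  then have g: "integrable lebesgue ?g" and gi: "integral\<^sup>L lebesgue ?g = integral\<^sup>L lborel ?g"
    by (subst integrable_completion integral_completion, auto)+
  have le: "AE y in lebesgue. norm (f y) \<le> ?g y"
    using b by eventually_elim (use z C in \<open>force simp: indicator_def dist_norm norm_minus_commute not_le\<close>)
  have le': "AE y in lebesgue. norm (f y) \<le> norm (?g y)" using le by eventually_elim simp
  have i: "integrable lebesgue f"
    by (rule Bochner_Integration.integrable_bound[OF g m le'])
  have hi: "(f has_integral (integral\<^sup>L lebesgue f)) UNIV" by (rule has_integral_integral_lebesgue[OF i])
  then show "f integrable_on UNIV" by blast
  have "norm (integral\<^sup>L lebesgue f) \<le> integral\<^sup>L lebesgue ?g"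
    by (rule order_trans[OF integral_norm_bound integral_mono_AE[OF integrable_norm[OF i] g le]])
  also have "\<dots> = C * (unit_ball_vol (real DIM('a)) * \<rho> ^ DIM('a))"
    unfolding gi using content_cball[OF r, of x] by simp
  finally show "norm (integral UNIV f) \<le> C * (unit_ball_vol (real DIM('a)) * \<rho> ^ DIM('a))"
    using hi by (simp add: integral_unique)
qed

lemma Ck_affine:
  fixes g :: "real^'n \<Rightarrow> 'b::real_normed_vector"
  shows "Ck r g \<Longrightarrow> Ck r (\<lambda>z. g (c *\<^sub>R (x - z)))"
proof (induction r arbitrary: g)
  case 0
  then show ?case by (auto intro!: continuous_on_compose2[of UNIV g] continuous_intros)
next
  case (Suc r)
  have aff: "((\<lambda>z. c *\<^sub>R (x - z)) has_derivative (\<lambda>h. c *\<^sub>R (0 - h))) (at z)" for z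
    by (intro derivative_intros)
  have dg: "((\<lambda>z. g (c *\<^sub>R (x - z))) has_derivative (\<lambda>h. dir g (c *\<^sub>R (x - z)) (c *\<^sub>R (0 - h)))) (at z)" for z
    by (rule has_derivative_compose[OF aff Ck_has_derivative_dir[OF Suc.prems]])
  have ax: "dir g y (c *\<^sub>R (0 - axis k 1)) = (- c) *\<^sub>R pd k g y" for y k
  proof -
    have "dir g y (c *\<^sub>R (0 - axis k 1)) = dir g y ((- c) *\<^sub>R axis k 1)" by simp
    also have "\<dots> = (- c) *\<^sub>R dir g y (axis k 1)"
      by (rule linear_cmul[OF bounded_linear.linear[OF bounded_linear_dir]])
    also have "dir g y (axis k 1) = pd k g y" unfolding dir_def by (rule sum_axis_scaleR)
    finally show ?thesis .
  qed
  show ?case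
    by (rule Ck_SucI[OF dg]) (unfold ax, intro Ck_bounded_linear[OF bounded_linear_scaleR_right] Suc.IH Ck_pd Suc.prems)
qed

lemma pd_affine:
  fixes g :: "real^'n \<Rightarrow> 'b::real_normed_vector"
  assumes "Ck (Suc 0) g"
  shows "pd k (\<lambda>z. g (c *\<^sub>R (x - z))) z = (- c) *\<^sub>R pd k g (c *\<^sub>R (x - z))"
proof -
  have aff: "((\<lambda>z. c *\<^sub>R (x - z)) has_derivative (\<lambda>h. c *\<^sub>R (0 - h))) (at z)" by (intro derivative_intros)
  have "pd k (\<lambda>z. g (c *\<^sub>R (x - z))) z = dir g (c *\<^sub>R (x - z)) (c *\<^sub>R (0 - axis k 1))"
    by (rule has_derivative_imp_pd(2)[OF has_derivative_compose[OF aff Ck_has_derivative_dir[OF assms]]])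
  also have "\<dots> = dir g (c *\<^sub>R (x - z)) ((- c) *\<^sub>R axis k 1)" by simp
  also have "\<dots> = (- c) *\<^sub>R dir g (c *\<^sub>R (x - z)) (axis k 1)"
    by (rule linear_cmul[OF bounded_linear.linear[OF bounded_linear_dir]])
  also have "dir g (c *\<^sub>R (x - z)) (axis k 1) = pd k g (c *\<^sub>R (x - z))" unfolding dir_def by (rule sum_axis_scaleR)
  finally show ?thesis .
qed

text \<open>The divergence in the distributional identity is integrated also over points where a
  partial derivative fails to exist. There \<open>pd\<close> takes this one default value, the same
  for all functions and points, which keeps it bounded and measurable.\<close>

lemma vector_derivative_nondifferentiable:
  "\<not> f differentiable (at a) \<Longrightarrow> vector_derivative f (at a) = (SOME c. False)"
proof -
  assume n: "\<not> f differentiable (at a)"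
  have "(\<lambda>f'. (f has_vector_derivative f') (at a)) = (\<lambda>_. False)"
    using n differentiableI_vector by blast
  then show ?thesis unfolding vector_derivative_def by metis
qed

text \<open>The Cauchy criterion with countable outer quantifiers and non-strict inner inequalities.
  Its purpose is measurability: for fixed \<open>p\<close> and \<open>q\<close> the condition is
  closed in a parameter on which \<open>f\<close> depends continuously.\<close>

lemma differentiable_iff_Cauchy_quotient:
  fixes f :: "real \<Rightarrow> real"
  shows "f differentiable (at 0) \<longleftrightarrow> (\<forall>p::nat. \<exists>q::nat. \<forall>t t'. t \<noteq> 0 \<and> \<bar>t\<bar> < inverse (Suc q) \<and> t' \<noteq> 0 \<and> \<bar>t'\<bar> < inverse (Suc q) \<longrightarrow>
     \<bar>(f t - f 0) / t - (f t' - f 0) / t'\<bar> \<le> inverse (Suc p))" (is "_ \<longleftrightarrow> ?C")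
proof
  assume "f differentiable (at 0)"
  then have "(f has_vector_derivative vector_derivative f (at 0)) (at 0)" by (simp add: vector_derivative_works)
  then have lim: "((\<lambda>h. (1/h) *\<^sub>R (f (0 + h) - f 0)) \<longlongrightarrow> vector_derivative f (at 0)) (at 0)" (is "(_ \<longlongrightarrow> ?l) _")
    by (simp only: has_vector_derivative_iff_quotient)
  show ?C
  proof
    fix p :: nat
    have "inverse (real (Suc p)) / 2 > 0" by simp
    from tendstoD[OF lim this] obtain d where d: "d > 0" "\<And>t. t \<noteq> 0 \<Longrightarrow> \<bar>t\<bar> < d \<Longrightarrow> \<bar>(f t - f 0) / t - ?l\<bar> < inverse (real (Suc p)) / 2"
      unfolding eventually_at by (auto simp: dist_real_def)
    obtain q where q: "inverse (real (Suc q)) < d" using reals_Archimedean[OF d(1)] by blast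
    have "\<bar>(f t - f 0) / t - (f t' - f 0) / t'\<bar> \<le> inverse (Suc p)"
      if "t \<noteq> 0 \<and> \<bar>t\<bar> < inverse (Suc q) \<and> t' \<noteq> 0 \<and> \<bar>t'\<bar> < inverse (Suc q)" for t t'
      using d(2)[of t] d(2)[of t'] q that by linarith
    then show "\<exists>q::nat. \<forall>t t'. t \<noteq> 0 \<and> \<bar>t\<bar> < inverse (Suc q) \<and> t' \<noteq> 0 \<and> \<bar>t'\<bar> < inverse (Suc q) \<longrightarrow>
       \<bar>(f t - f 0) / t - (f t' - f 0) / t'\<bar> \<le> inverse (Suc p)" by blast
  qed
next
  assume C: ?C
  let ?Q = "\<lambda>t. (f t - f 0) / t" and ?t = "\<lambda>i. inverse (real (Suc i))"
  have small: "?t i < inverse (Suc q)" if "i > q" for i q using that by simp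
  have "Cauchy (\<lambda>i. ?Q (?t i))"
  proof (rule CauchyI)
    fix e :: real assume "e > 0"
    then obtain p where p: "inverse (real (Suc p)) < e" using reals_Archimedean by blast
    obtain q where q: "\<And>t t'. t \<noteq> 0 \<and> \<bar>t\<bar> < inverse (Suc q) \<and> t' \<noteq> 0 \<and> \<bar>t'\<bar> < inverse (Suc q) \<Longrightarrow> \<bar>?Q t - ?Q t'\<bar> \<le> inverse (Suc p)"
      using C by blast
    have "norm (?Q (?t i) - ?Q (?t j)) < e" if "i \<ge> Suc q" "j \<ge> Suc q" for i j
    proof -
      have "\<bar>?Q (?t i) - ?Q (?t j)\<bar> \<le> inverse (Suc p)"
        by (rule q) (use small[of q i] small[of q j] that in auto)
      then show ?thesis using p by simp
    qed
    then show "\<exists>K. \<forall>i\<ge>K. \<forall>j\<ge>K. norm (?Q (?t i) - ?Q (?t j)) < e" by blast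
  qed
  then obtain l where l: "(\<lambda>i. ?Q (?t i)) \<longlonglongrightarrow> l" using Cauchy_convergent_iff convergent_def by blast
  have "((\<lambda>h. (1/h) *\<^sub>R (f (0 + h) - f 0)) \<longlongrightarrow> l) (at 0)"
  proof (rule tendstoI)
    fix e :: real assume "e > 0"
    then obtain p where p: "inverse (real (Suc p)) < e" using reals_Archimedean by blast
    obtain q where q: "\<And>t t'. t \<noteq> 0 \<and> \<bar>t\<bar> < inverse (Suc q) \<and> t' \<noteq> 0 \<and> \<bar>t'\<bar> < inverse (Suc q) \<Longrightarrow> \<bar>?Q t - ?Q t'\<bar> \<le> inverse (Suc p)"
      using C by blast
    have "\<bar>?Q t - l\<bar> \<le> inverse (Suc p)" if t: "t \<noteq> 0" "\<bar>t\<bar> < inverse (Suc q)" for t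
    proof (rule tendsto_upperbound[OF tendsto_rabs[OF tendsto_diff[OF tendsto_const l]]])
      show "\<forall>\<^sub>F i in sequentially. \<bar>?Q t - ?Q (?t i)\<bar> \<le> inverse (Suc p)"
        using eventually_gt_at_top[of q]
      proof eventually_elim
        case (elim i)
        then show ?case using small[OF elim] t by (intro q) auto
      qed
    qed simp
    then show "\<forall>\<^sub>F h in at 0. dist ((1/h) *\<^sub>R (f (0 + h) - f 0)) l < e"
      unfolding eventually_at using p
      by (intro exI[of _ "inverse (real (Suc q))"]) (force simp: dist_real_def)
  qed
  then show "f differentiable (at 0)"
    using differentiableI_vector has_vector_derivative_iff_quotient by blast
qed

text \<open>The set where the derivative exists is a countable intersection of countable unions of
  closed sets. On it the derivative is a limit of continuous quotients, and off it a
  constant.\<close>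

lemma pd_measurable:
  fixes u :: "real^'n \<Rightarrow> real"
  assumes c: "continuous_on UNIV u"
  shows "pd k u \<in> borel_measurable borel"
proof -
  let ?e = "axis k (1::real)" and ?t = "\<lambda>i. inverse (real (Suc i))"
  let ?Q = "\<lambda>t z. (u (z + t *\<^sub>R ?e) - u (z + 0 *\<^sub>R ?e)) / t"
  have cQ: "continuous_on UNIV (?Q t)" for t
  proof (cases "t = 0")
    case False
    have sh: "continuous_on UNIV (\<lambda>z. u (z + t *\<^sub>R ?e))" for t by (rule cont_shift[OF c])
    show ?thesis by (rule continuous_on_divide[OF continuous_on_diff[OF sh sh] continuous_on_const]) (use False in auto)
  qed simp
  have D: "{z. pd_exists k u z} \<in> sets borel"
  proof -
    have "{z. pd_exists k u z} = (\<Inter>p. \<Union>q. {z. \<forall>t t'. t \<noteq> 0 \<and> \<bar>t\<bar> < inverse (Suc q) \<and> t' \<noteq> 0 \<and> \<bar>t'\<bar> < inverse (Suc q) \<longrightarrow> \<bar>?Q t z - ?Q t' z\<bar> \<le> inverse (Suc p)})"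
      by (intro set_eqI) (simp only: mem_Collect_eq pd_exists_def differentiable_iff_Cauchy_quotient INT_iff UN_iff ball_UNIV bex_UNIV)
    moreover have "closed {z. \<forall>t t'. t \<noteq> 0 \<and> \<bar>t\<bar> < inverse (Suc q) \<and> t' \<noteq> 0 \<and> \<bar>t'\<bar> < inverse (Suc q) \<longrightarrow> \<bar>?Q t z - ?Q t' z\<bar> \<le> inverse (Suc p)}" for p q :: nat
      by (intro closed_Collect_all closed_Collect_imp open_Collect_const closed_Collect_le continuous_on_const
          continuous_on_rabs continuous_on_diff[OF cQ cQ])
    ultimately show ?thesis by (auto intro!: sets.countable_INT sets.countable_UN borel_closed)
  qed
  have eq: "pd k u = (\<lambda>z. if pd_exists k u z then lim (\<lambda>i. ?Q (?t i) z) else (SOME c. False))"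
  proof
    fix z
    show "pd k u z = (if pd_exists k u z then lim (\<lambda>i. ?Q (?t i) z) else (SOME c. False))"
    proof (cases "pd_exists k u z")
      case True
      have "((\<lambda>t. u (z + t *\<^sub>R ?e)) has_vector_derivative pd k u z) (at 0)"
        using True unfolding pd_exists_def pd_def by (simp add: vector_derivative_works)
      then have lim: "((\<lambda>h. ?Q h z) \<longlongrightarrow> pd k u z) (at 0)" unfolding has_vector_derivative_iff_quotient by simp
      have ft: "filterlim ?t (at 0) sequentially"
        unfolding filterlim_at using LIMSEQ_inverse_real_of_nat by (auto intro!: always_eventually)
      from filterlim_compose[OF lim ft] have "lim (\<lambda>i. ?Q (?t i) z) = pd k u z" by (rule limI)
      then show ?thesis using True by simp
    next
      case False
      then show ?thesis using vector_derivative_nondifferentiable unfolding pd_exists_def pd_def by auto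
    qed
  qed
  have "(\<lambda>z. lim (\<lambda>i. ?Q (?t i) z)) \<in> borel_measurable borel"
    by (intro borel_measurable_lim_metric borel_measurable_continuous_onI cQ)
  moreover have "{z \<in> space borel. pd_exists k u z} \<in> sets borel" using D by simp
  ultimately show ?thesis by (subst eq) (rule measurable_If[OF _ measurable_const], simp_all)
qed

lemma ball_lip_pd_bounded:
  fixes u :: "real^'n \<Rightarrow> real"
  assumes u: "ball_lip u" shows "\<exists>D\<ge>0. \<forall>z. norm z \<le> R \<longrightarrow> \<bar>pd k u z\<bar> \<le> D"
proof -
  obtain L where L: "L \<ge> 0" "\<And>x y. norm x \<le> R + 1 \<Longrightarrow> norm y \<le> R + 1 \<Longrightarrow> norm (u x - u y) \<le> L * norm (x - y)" using ball_lip_E[OF u] by blast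
  let ?e = "axis k (1::real)"
  \<comment> \<open>The second summand covers the default value at points of
    non-differentiability.\<close>
  have "\<bar>pd k u z\<bar> \<le> L + \<bar>SOME c. False\<bar>" if z: "norm z \<le> R" for z
  proof (cases "pd_exists k u z")
    case True
    have "((\<lambda>t. u (z + t *\<^sub>R ?e)) has_vector_derivative pd k u z) (at 0)"
      using True unfolding pd_exists_def pd_def by (simp add: vector_derivative_works)
    then have dd: "((\<lambda>t. u (z + t *\<^sub>R ?e)) has_derivative (\<lambda>h. h *\<^sub>R pd k u z)) (at 0)" by (simp add: has_vector_derivative_def)
    have "norm (1 *\<^sub>R pd k u z) \<le> L * norm (1::real)"
    proof (rule lipschitz_imp_derivative_bound[OF dd zero_less_one])
      fix y :: real assume y: "norm (y - 0) < 1"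
      have "norm (z + y *\<^sub>R ?e) \<le> R + 1" using norm_triangle_ineq[of z "y *\<^sub>R ?e"] y z by simp
      then show "norm (u (z + y *\<^sub>R ?e) - u (z + 0 *\<^sub>R ?e)) \<le> L * norm (y - 0)" using L(2)[of "z + y *\<^sub>R ?e" z] z by simp
    qed
    then show ?thesis by simp
  next
    case False
    then show ?thesis using vector_derivative_nondifferentiable[of "\<lambda>t. u (z + t *\<^sub>R ?e)" 0] L unfolding pd_exists_def pd_def by simp
  qed
  then show ?thesis using L by (intro exI[of _ "L + \<bar>SOME c. False\<bar>"]) auto
qed

lemma divg_facts:
  fixes F :: "real^'n \<Rightarrow> real^'n"
  assumes F: "ball_lip F"
  shows "divg F \<in> borel_measurable borel" "\<exists>D\<ge>0. \<forall>z. norm z \<le> R \<longrightarrow> \<bar>divg F z\<bar> \<le> D"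
proof -
  have l: "ball_lip (\<lambda>y. F y $ k)" for k by (rule ball_lip_linear[OF bounded_linear_vec_nth F])
  show "divg F \<in> borel_measurable borel"
    unfolding divg_def by (intro borel_measurable_sum pd_measurable ball_lip_cont l)
  have "\<forall>k. \<exists>D\<ge>0. \<forall>z. norm z \<le> R \<longrightarrow> \<bar>pd k (\<lambda>y. F y $ k) z\<bar> \<le> D" using ball_lip_pd_bounded[OF l] by blast
  then obtain D where D: "\<And>k. D k \<ge> 0" "\<And>k z. norm z \<le> R \<Longrightarrow> \<bar>pd k (\<lambda>y. F y $ k) z\<bar> \<le> D k" by metis
  have "\<bar>divg F z\<bar> \<le> (\<Sum>k\<in>UNIV. D k)" if "norm z \<le> R" for z
    unfolding divg_def by (rule order_trans[OF sum_abs sum_mono]) (use D that in auto)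
  then show "\<exists>D\<ge>0. \<forall>z. norm z \<le> R \<longrightarrow> \<bar>divg F z\<bar> \<le> D" using D by (intro exI[of _ "\<Sum>k\<in>UNIV. D k"]) (auto intro: sum_nonneg)
qed

lemma test_fn_bump:
  fixes \<phi> :: "real^'n \<Rightarrow> real"
  assumes b: "bump \<phi>" and s: "0 < \<sigma>"
  shows "test_fn (\<lambda>z. \<phi> ((1/\<sigma>) *\<^sub>R (x - z)))"
  unfolding test_fn_def
proof
  show "smooth_fn (\<lambda>z. \<phi> ((1/\<sigma>) *\<^sub>R (x - z)))"
    by (intro Ck_imp_smooth_fn Ck_affine bump_Ck[OF b])
  have "{z. \<phi> ((1/\<sigma>) *\<^sub>R (x - z)) \<noteq> 0} \<subseteq> cball x \<sigma>"
  proof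
    fix z assume "z \<in> {z. \<phi> ((1/\<sigma>) *\<^sub>R (x - z)) \<noteq> 0}"
    then have "norm ((1/\<sigma>) *\<^sub>R (x - z)) \<le> 1" using bump_0[OF b] by force
    then show "z \<in> cball x \<sigma>" using s by (simp add: dist_norm divide_le_eq)
  qed
  then show "bounded {z. \<phi> ((1/\<sigma>) *\<^sub>R (x - z)) \<noteq> 0}" using bounded_cball bounded_subset by blast
qed

lemma mollify_scaled:
  fixes u :: "real^'n \<Rightarrow> 'b::euclidean_space"
  assumes b: "bump \<psi>" and u: "continuous_on UNIV u" and s: "0 < \<sigma>"
  shows "((\<lambda>z. \<psi> ((1/\<sigma>) *\<^sub>R (x - z)) *\<^sub>R u z) has_integral (\<sigma> ^ DIM(real^'n)) *\<^sub>R mollify \<psi> \<sigma> u x) UNIV"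
proof -
  let ?f = "\<lambda>z. \<psi> ((1/\<sigma>) *\<^sub>R (x - z)) *\<^sub>R u z"
  have c: "continuous_on UNIV ?f"
    by (intro continuous_on_scaleR u Ck_cont[OF Ck_affine[OF bump_Ck[OF b, of 0]]])
  have m: "?f \<in> borel_measurable lborel" by (rule borel_cont[OF c])
  obtain C where C: "C \<ge> 0" "\<And>z. \<bar>\<psi> z\<bar> \<le> C" using bump_bounded[OF b] by blast
  obtain U where U: "U \<ge> 0" "\<And>z. norm (z - x) \<le> \<sigma> \<Longrightarrow> norm (u z) \<le> U" using cont_bounded_near[OF u] by metis
  have i: "integrable lborel ?f"
  proof (rule integral_bounded_support(1)[OF m, of "C * U" \<sigma> x])
    fix z
    show "norm (z - x) \<le> \<sigma> \<Longrightarrow> norm (?f z) \<le> C * U" using C U by (auto intro!: mult_mono)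
    assume "\<sigma> < norm (z - x)"
    then have "1 < norm ((1/\<sigma>) *\<^sub>R (x - z))" using s by (simp add: norm_minus_commute less_divide_eq)
    then show "?f z = 0" using bump_0[OF b] by simp
  qed (use C U s in auto)
  have "integral\<^sup>L lborel ?f = (\<bar>- \<sigma>\<bar> ^ DIM(real^'n)) *\<^sub>R (\<integral>y. ?f (x + (- \<sigma>) *\<^sub>R y) \<partial>lborel)"
    using m s by (intro integral_affine_lborel) auto
  also have "\<dots> = (\<sigma> ^ DIM(real^'n)) *\<^sub>R mollify \<psi> \<sigma> u x" using s by (simp add: mollify_def)
  finally show ?thesis using has_integral_integral_lborel[OF i] by simp
qed

text \<open>The rescaled kernel centred at \<open>x\<close> is the test function. The left-hand side
  freezes the mollified field at \<open>x\<close>, while the distributional identity has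
  \<open>F\<close> at the integration point; the two differ by O(\<sigma>) on the support, which
  cancels the \<open>1/\<sigma>\<close> of the differentiated kernel.\<close>

lemma moll_dist_derivative_bounded:
  fixes F g :: "real^'n \<Rightarrow> real^'n" and \<phi> :: "real^'n \<Rightarrow> real"
  assumes b: "bump \<phi>" and i1: "integral\<^sup>L lborel \<phi> = 1" and F: "ball_lip F" and g: "continuous_on UNIV g" and d: "distX_Linf F g"
  shows "\<exists>C\<ge>0. \<forall>\<sigma>\<in>{0<..1}. \<forall>x. norm x \<le> R \<longrightarrow> norm (Xop (mollify \<phi> \<sigma> F) (mollify \<phi> \<sigma> g) x) \<le> C"
proof -
  obtain G where G: "Linf_loc G" and dist: "\<And>\<psi>. test_fn \<psi> \<Longrightarrow> integral UNIV (\<lambda>x. \<psi> x *\<^sub>R G x) =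
        - integral UNIV (\<lambda>x. (Xop F \<psi> x + \<psi> x * divg F x) *\<^sub>R g x)"
    using d unfolding distX_Linf_def by blast
  have Gm: "G \<in> borel_measurable lebesgue" using G by (simp add: Linf_loc_def)
  obtain MG' where MG': "AE x in lebesgue. x \<in> cball 0 (R + 1) \<longrightarrow> norm (G x) \<le> MG'"
    using G compact_cball unfolding Linf_loc_def by blast
  define MG where "MG = max MG' 0"
  have MG: "0 \<le> MG" "AE x in lebesgue. x \<in> cball 0 (R + 1) \<longrightarrow> norm (G x) \<le> MG"
    using MG' unfolding MG_def by (auto elim!: eventually_mono)
  obtain Q where Q: "Q \<ge> 0" "\<And>z. \<bar>\<phi> z\<bar> \<le> Q" using bump_bounded[OF b] by blast
  have "\<forall>k. \<exists>C\<ge>0. \<forall>z. \<bar>pd k \<phi> z\<bar> \<le> C" using bump_bounded[OF bump_pd[OF b]] by blast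
  then obtain P where P: "\<And>k. P k \<ge> 0" "\<And>k z. \<bar>pd k \<phi> z\<bar> \<le> P k" by metis
  obtain D where D: "D \<ge> 0" "\<And>z. norm z \<le> R + 1 \<Longrightarrow> \<bar>divg F z\<bar> \<le> D" using divg_facts(2)[OF F, of "R + 1"] by blast
  obtain U where U: "U \<ge> 0" "\<And>z. norm z \<le> R + 1 \<Longrightarrow> norm (g z) \<le> U" using cont_bounded_ball[OF g] by metis
  obtain CF where CF: "CF \<ge> 0"
    and CF2: "\<And>\<sigma> x. \<sigma>\<in>{0<..1} \<Longrightarrow> norm x \<le> R \<Longrightarrow> C2_bound (CF * \<sigma>) CF (CF / \<sigma>) (mollify \<phi> \<sigma> (\<lambda>z. F z - F x)) x"
    using mollify_ball_lip_C2_bound[OF b i1 F, of R] by blast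
  obtain LF where LF: "LF \<ge> 0" "\<And>x y. norm x \<le> R + 1 \<Longrightarrow> norm y \<le> R + 1 \<Longrightarrow> norm (F x - F y) \<le> LF * norm (x - y)" using ball_lip_E[OF F] by blast
  have cF: "continuous_on UNIV F" by (rule ball_lip_cont[OF F])
  let ?w = "unit_ball_vol (real DIM(real^'n))"
  let ?S = "\<Sum>k\<in>UNIV. P k"
  have S0: "0 \<le> ?S" using P by (intro sum_nonneg) auto
  let ?C5 = "((CF + LF) * ?S) * U" and ?C3 = "(Q * D) * U" and ?C2 = "Q * MG"
  let ?C = "(?C5 + ?C3 + ?C2) * ?w"
  have main: "norm (Xop (mollify \<phi> \<sigma> F) (mollify \<phi> \<sigma> g) x) \<le> ?C" if s: "\<sigma> \<in> {0<..1}" and x: "norm x \<le> R" for \<sigma> x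
  proof -
    have s': "0 < \<sigma>" "\<sigma> \<le> 1" "0 \<le> \<sigma>" using s by auto
    let ?Fs = "mollify \<phi> \<sigma> F" and ?N = "\<sigma> ^ DIM(real^'n)"
    define a where "a z = (1/\<sigma>) *\<^sub>R (x - z)" for z
    define \<psi> where "\<psi> z = \<phi> (a z)" for z
    have out: "1 < norm (a z)" if "\<sigma> < norm (z - x)" for z
      using that s' by (simp add: a_def norm_minus_commute less_divide_eq)
    have nz: "norm z \<le> R + 1" if "norm (z - x) \<le> \<sigma>" for z by (rule near_norm[OF x that s'(2)])
    have Cpsi: "Ck r \<psi>" for r unfolding \<psi>_def a_def by (intro Ck_affine bump_Ck[OF b])
    have cpsi: "continuous_on UNIV \<psi>" by (rule Ck_cont[OF Cpsi])
    have cpd: "continuous_on UNIV (\<lambda>z. pd k \<phi> (a z))" for k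
      unfolding a_def by (rule Ck_cont[OF Ck_affine[OF bump_Ck[OF bump_pd[OF b], of 0]]])
    have XF: "Xop F \<psi> z = (\<Sum>k\<in>UNIV. F z $ k * (- (1/\<sigma>) * pd k \<phi> (a z)))" for z
    proof -
      have "pd k \<psi> z = - (1/\<sigma>) * pd k \<phi> (a z)" for k
        unfolding \<psi>_def a_def using pd_affine[OF bump_Ck[OF b], of k "1/\<sigma>" x z] by simp
      then show ?thesis using Ck_Xop_eq[OF Cpsi, of F z] by simp
    qed
    \<comment> \<open>\<open>h1\<close> integrates to the quantity wanted, up to the volume factor
      \<open>?N\<close>; \<open>h2\<close> is the L-infinity part, \<open>h3\<close> the divergence
      part, and \<open>h5\<close> the correction for freezing the field.\<close>
    define h1 where "h1 z = (\<Sum>k\<in>UNIV. (?Fs x $ k * (1/\<sigma>)) *\<^sub>R (pd k \<phi> (a z) *\<^sub>R g z))" for z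
    define h2 where "h2 z = \<psi> z *\<^sub>R G z" for z
    define h3 where "h3 z = (\<psi> z * divg F z) *\<^sub>R g z" for z
    define h5 where "h5 z = (\<Sum>k\<in>UNIV. ((?Fs x - F z) $ k * (1/\<sigma>)) * pd k \<phi> (a z)) *\<^sub>R g z" for z
    have I1: "(h1 has_integral ?N *\<^sub>R Xop ?Fs (mollify \<phi> \<sigma> g) x) UNIV"
    proof -
      have "(h1 has_integral (\<Sum>k\<in>UNIV. (?Fs x $ k * (1/\<sigma>)) *\<^sub>R (?N *\<^sub>R mollify (pd k \<phi>) \<sigma> g x))) UNIV"
        unfolding h1_def a_def by (intro has_integral_sum has_integral_cmul mollify_scaled bump_pd b g s') auto
      moreover have "Xop ?Fs (mollify \<phi> \<sigma> g) x = (\<Sum>k\<in>UNIV. ?Fs x $ k *\<^sub>R ((1/\<sigma>) *\<^sub>R mollify (pd k \<phi>) \<sigma> g x))"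
        unfolding Ck_Xop_eq[OF Ck_mollify[OF b g s'(1)]] pd_mollify(2)[OF b g s'(1)] ..
      ultimately show ?thesis by (simp add: scaleR_sum_right mult_ac)
    qed
    have B2: "h2 integrable_on UNIV \<and> norm (integral UNIV h2) \<le> ?C2 * (?w * ?N)"
    proof -
      have m: "h2 \<in> borel_measurable lebesgue"
        unfolding h2_def using measurable_completion[OF borel_cont[OF cpsi]] Gm by (intro borel_measurable_scaleR) auto
      have "AE z in lebesgue. norm (z - x) \<le> \<sigma> \<longrightarrow> norm (h2 z) \<le> ?C2"
        using MG(2)
      proof eventually_elim
        case (elim z)
        show ?case
        proof
          assume z: "norm (z - x) \<le> \<sigma>"
          then have "norm (G z) \<le> MG" using elim nz[OF z] by simp
          then show "norm (h2 z) \<le> ?C2" unfolding h2_def \<psi>_def using Q by (auto intro!: mult_mono)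
        qed
      qed
      moreover have "h2 z = 0" if "\<sigma> < norm (z - x)" for z using bump_0[OF b out[OF that]] by (simp add: h2_def \<psi>_def)
      ultimately show ?thesis using lebesgue_bounded_support[OF m, of ?C2 \<sigma> x] Q MG s' by auto
    qed
    have bs: "h integrable_on UNIV \<and> norm (integral UNIV h) \<le> C * (?w * ?N)"
      if "h \<in> borel_measurable borel" "0 \<le> C" "\<And>z. norm (z - x) \<le> \<sigma> \<Longrightarrow> norm (h z) \<le> C" "\<And>z. \<sigma> < norm (z - x) \<Longrightarrow> h z = 0"
      for h :: "real^'n \<Rightarrow> real^'n" and C
      using lebesgue_bounded_support[OF measurable_completion, of h C \<sigma> x] that s' by auto
    have B3: "h3 integrable_on UNIV \<and> norm (integral UNIV h3) \<le> ?C3 * (?w * ?N)"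
    proof (rule bs)
      show "h3 \<in> borel_measurable borel"
        unfolding h3_def using borel_cont[OF cpsi] borel_cont[OF g] divg_facts(1)[OF F]
        by (intro borel_measurable_scaleR borel_measurable_times) auto
      fix z
      show "norm (z - x) \<le> \<sigma> \<Longrightarrow> norm (h3 z) \<le> ?C3"
        unfolding h3_def \<psi>_def norm_scaleR real_norm_def abs_mult using Q D U nz by (intro mult_mono) auto
      show "\<sigma> < norm (z - x) \<Longrightarrow> h3 z = 0" using bump_0[OF b out] by (simp add: h3_def \<psi>_def)
    qed (use Q D U in auto)
    have B5: "h5 integrable_on UNIV \<and> norm (integral UNIV h5) \<le> ?C5 * (?w * ?N)"
    proof (rule bs)
      have "continuous_on UNIV h5" unfolding h5_def by (intro continuous_intros cF cpd g)
      then show "h5 \<in> borel_measurable borel" using borel_cont by simp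
      fix z
      show "\<sigma> < norm (z - x) \<Longrightarrow> h5 z = 0" using bump_0[OF bump_pd[OF b] out] by (simp add: h5_def)
      assume z: "norm (z - x) \<le> \<sigma>"
      have "norm (?Fs x - F x) \<le> CF * \<sigma>" using CF2[OF s x] mollify_sub_const[OF b i1 cF s'(3)] by (simp add: C2_bound_def)
      moreover have "norm (F x - F z) \<le> LF * \<sigma>"
        using LF(2)[of x z] nz[OF z] x mult_left_mono[OF z LF(1)] by (simp add: norm_minus_commute)
      ultimately have dF: "norm (?Fs x - F z) \<le> (CF + LF) * \<sigma>"
        using norm_triangle_ineq[of "?Fs x - F x" "F x - F z"] by (simp add: distrib_right)
      have "\<bar>\<Sum>k\<in>UNIV. ((?Fs x - F z) $ k * (1/\<sigma>)) * pd k \<phi> (a z)\<bar> \<le> (\<Sum>k\<in>UNIV. (CF + LF) * P k)"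
      proof (rule order_trans[OF sum_abs sum_mono])
        fix k
        have "\<bar>(?Fs x - F z) $ k\<bar> * (1/\<sigma>) \<le> ((CF + LF) * \<sigma>) * (1/\<sigma>)"
          using component_le_norm_cart[of "?Fs x - F z" k] dF s' by (intro mult_right_mono) auto
        then have "\<bar>(?Fs x - F z) $ k * (1/\<sigma>)\<bar> \<le> CF + LF" using s' by (simp add: abs_mult)
        then have "\<bar>(?Fs x - F z) $ k * (1/\<sigma>)\<bar> * \<bar>pd k \<phi> (a z)\<bar> \<le> (CF + LF) * P k"
          using P CF LF by (intro mult_mono) auto
        then show "\<bar>((?Fs x - F z) $ k * (1/\<sigma>)) * pd k \<phi> (a z)\<bar> \<le> (CF + LF) * P k" by (simp only: abs_mult)
      qed
      also have "\<dots> = (CF + LF) * ?S" by (simp add: sum_distrib_left)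
      finally show "norm (h5 z) \<le> ?C5" unfolding h5_def norm_scaleR using U nz[OF z] CF LF S0 by (intro mult_mono) auto
    qed (use U CF LF S0 in auto)
    have eq: "h1 z = h5 z - Xop F \<psi> z *\<^sub>R g z" for z
    proof -
      have "h1 z = (\<Sum>k\<in>UNIV. (?Fs x $ k * (1/\<sigma>)) * pd k \<phi> (a z)) *\<^sub>R g z"
        by (simp add: h1_def scaleR_sum_left)
      moreover have "(\<Sum>k\<in>UNIV. (?Fs x $ k * (1/\<sigma>)) * pd k \<phi> (a z)) =
        (\<Sum>k\<in>UNIV. ((?Fs x - F z) $ k * (1/\<sigma>)) * pd k \<phi> (a z)) - Xop F \<psi> z"
        unfolding XF sum_subtractf[symmetric] by (rule sum.cong) (auto simp: algebra_simps)
      ultimately show ?thesis by (simp add: h5_def scaleR_diff_left)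
    qed
    have h1i: "h1 integrable_on UNIV" using I1 by blast
    have "(\<lambda>z. h5 z - h1 z + h3 z) integrable_on UNIV" using B5 B3 h1i by (intro integrable_add integrable_diff) auto
    have "integral UNIV h2 = - integral UNIV (\<lambda>z. (Xop F \<psi> z + \<psi> z * divg F z) *\<^sub>R g z)"
      unfolding h2_def by (rule dist) (use test_fn_bump[OF b s'(1), of x] in \<open>simp add: \<psi>_def a_def\<close>)
    also have "(\<lambda>z. (Xop F \<psi> z + \<psi> z * divg F z) *\<^sub>R g z) = (\<lambda>z. (h5 z - h1 z) + h3 z)"
      using eq by (auto simp: h3_def scaleR_add_left)
    also have "integral UNIV (\<lambda>z. (h5 z - h1 z) + h3 z) = (integral UNIV h5 - integral UNIV h1) + integral UNIV h3"
      using B5 B3 h1i by (simp add: integral_add integral_diff integrable_diff)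
    finally have "integral UNIV h1 = integral UNIV h5 + integral UNIV h3 + integral UNIV h2" by (simp add: algebra_simps)
    then have "norm (integral UNIV h1) \<le> ?C5 * (?w * ?N) + ?C3 * (?w * ?N) + ?C2 * (?w * ?N)"
      using B5 B3 B2 by (auto intro!: norm_triangle_mono)
    then have "?N * norm (Xop ?Fs (mollify \<phi> \<sigma> g) x) \<le> ?N * ?C"
      using I1 s' by (simp add: integral_unique algebra_simps)
    then show ?thesis using s' by simp
  qed
  have "0 \<le> ?C" using CF LF S0 U Q D MG by (intro mult_nonneg_nonneg add_nonneg_nonneg) auto
  then show ?thesis using main by blast
qed

lemma Xop_add_smooth: "Cinf u \<Longrightarrow> Cinf v \<Longrightarrow> Xop F (\<lambda>x. u x + v x) x = Xop F u x + Xop F v x"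
  unfolding Ck_Xop_eq[OF CinfD[OF Cinf_add]] Ck_Xop_eq[OF CinfD]
  by (simp add: pd_add_fun scaleR_add_right sum.distrib)

lemma Xop_norm_le_mult:
  fixes g :: "real^'n \<Rightarrow> 'b::real_normed_vector"
  assumes "Cinf g" "\<And>k. norm (pd k g x) \<le> P" "norm (F x) \<le> q"
  shows "norm (Xop F g x) \<le> real CARD('n) * P * q"
proof -
  have "0 \<le> P" using assms(2) norm_ge_zero order_trans by blast
  then have "real CARD('n) * P * norm (F x) \<le> real CARD('n) * P * q" by (intro mult_left_mono[OF assms(3)]) simp
  then show ?thesis using Xop_norm_le[OF CinfD[OF assms(1)] assms(2), of F] by linarith
qed

lemma Xop_Xop_bound:
  fixes F H g :: "real^'n \<Rightarrow> real^'n"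
  assumes F: "Cinf F" and H: "Cinf H" and g: "Cinf g" and "norm (F x) \<le> a" "norm (H x) \<le> c" "\<And>k. norm (pd k H x) \<le> c"
    "\<And>k. norm (pd k g x) \<le> d" "\<And>k l. norm (pd k (pd l g) x) \<le> d"
  shows "norm (Xop F (Xop H g) x) \<le> 2 * (real CARD('n))\<^sup>2 * (a * c * d)"
proof -
  let ?n = "real CARD('n)"
  have nn: "0 \<le> a" "0 \<le> c" "0 \<le> d" using assms(4,5,7) norm_ge_zero order_trans by blast+
  have "Xop F (Xop H g) x = (\<Sum>i\<in>UNIV. \<Sum>j\<in>UNIV. (F x $ i * H x $ j) *\<^sub>R pd i (pd j g) x) + (\<Sum>j\<in>UNIV. Xop F H x $ j *\<^sub>R pd j g x)"
    by (rule Xop_Xop_expand) (use F H g CinfD in auto)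
  also have "norm \<dots> \<le> ?n * (?n * (a * c * d)) + ?n * ((?n * c * a) * d)"
  proof (rule norm_triangle_mono)
    have "norm (\<Sum>i\<in>UNIV. \<Sum>j\<in>UNIV. (F x $ i * H x $ j) *\<^sub>R pd i (pd j g) x) \<le> (\<Sum>i\<in>(UNIV::'n set). \<Sum>j\<in>(UNIV::'n set). a * c * d)"
    proof (intro sum_norm_le)
      fix i j :: 'n
      have "\<bar>F x $ i\<bar> \<le> a" "\<bar>H x $ j\<bar> \<le> c" using component_le_norm_cart[of "F x" i] component_le_norm_cart[of "H x" j] assms by auto
      then have "\<bar>F x $ i\<bar> * \<bar>H x $ j\<bar> * norm (pd i (pd j g) x) \<le> a * c * d" using assms(8) nn by (intro mult_mono) auto
      then show "norm ((F x $ i * H x $ j) *\<^sub>R pd i (pd j g) x) \<le> a * c * d" by (simp add: abs_mult)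
    qed
    then show "norm (\<Sum>i\<in>UNIV. \<Sum>j\<in>UNIV. (F x $ i * H x $ j) *\<^sub>R pd i (pd j g) x) \<le> ?n * (?n * (a * c * d))" by simp
    have XH: "norm (Xop F H x) \<le> ?n * c * a"
      by (rule Xop_norm_le_mult[OF H]) (use assms in auto)
    have "norm (\<Sum>j\<in>UNIV. Xop F H x $ j *\<^sub>R pd j g x) \<le> (\<Sum>j\<in>(UNIV::'n set). (?n * c * a) * d)"
    proof (rule sum_norm_le)
      fix j
      have "\<bar>Xop F H x $ j\<bar> \<le> ?n * c * a" using component_le_norm_cart[of "Xop F H x" j] XH by simp
      then have "\<bar>Xop F H x $ j\<bar> * norm (pd j g x) \<le> (?n * c * a) * d" using assms(7) nn by (intro mult_mono) auto
      then show "norm (Xop F H x $ j *\<^sub>R pd j g x) \<le> (?n * c * a) * d" by simp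
    qed
    then show "norm (\<Sum>j\<in>UNIV. Xop F H x $ j *\<^sub>R pd j g x) \<le> ?n * ((?n * c * a) * d)" by simp
  qed
  also have "\<dots> = 2 * ?n\<^sup>2 * (a * c * d)" by (simp add: power2_eq_square algebra_simps)
  finally show ?thesis .
qed

text \<open>\<open>U\<close> is the mollification of \<open>u\<close> plus an error with bounded
  second derivatives, and the derivative of that mollification along the second field is the
  mollification of \<open>Xop Fk u\<close> plus a Lipschitz remainder. Each of the three resulting
  terms is bounded for a different reason: the Lipschitz remainder, the distributional hypothesis,
  and the C^2 error.\<close>

lemma second_order_bounded:
  fixes Fj Fk u :: "real^'n \<Rightarrow> real^'n" and \<phi> :: "real^'n \<Rightarrow> real"
  assumes b: "bump \<phi>" and i1: "integral\<^sup>L lborel \<phi> = 1" and Fj: "ball_lip Fj" and Fk: "ball_lip Fk" and u: "moll_close \<phi> u U"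
    and ex: "\<And>x. Xexists Fk u x" and cX: "continuous_on UNIV (Xop Fk u)" and d: "distX_Linf Fj (Xop Fk u)"
  shows "\<exists>C\<ge>0. \<forall>\<sigma>\<in>{0<..1}. \<forall>x. norm x \<le> R \<longrightarrow> norm (Xop (mollify \<phi> \<sigma> Fj) (Xop (mollify \<phi> \<sigma> Fk) (U \<sigma>)) x) \<le> C"
proof -
  let ?n = "real CARD('n)"
  have uL: "ball_lip u" using u moll_close_def[OF b i1] by blast
  have cu: "continuous_on UNIV u" by (rule ball_lip_cont[OF uL])
  obtain A where A: "A \<ge> 0" "\<And>\<sigma> x. \<sigma>\<in>{0<..1} \<Longrightarrow> norm x \<le> R \<Longrightarrow> C2_bound A A (A / \<sigma>) (mollify \<phi> \<sigma> Fj) x"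
    using mollify_ball_lip_C2_bound[OF b i1 Fj, of R] by blast
  obtain K where K: "K \<ge> 0" "\<And>\<sigma> x. \<sigma>\<in>{0<..1} \<Longrightarrow> norm x \<le> R \<Longrightarrow> C2_bound K K (K / \<sigma>) (mollify \<phi> \<sigma> Fk) x"
    using mollify_ball_lip_C2_bound[OF b i1 Fk, of R] by blast
  obtain E where E: "E \<ge> 0" "\<And>\<sigma> x. \<sigma>\<in>{0<..1} \<Longrightarrow> norm x \<le> R \<Longrightarrow> C2_bound (E * \<sigma>) E E (\<lambda>x. U \<sigma> x - mollify \<phi> \<sigma> u x) x"
    using moll_close_E[OF b i1 u] by blast
  obtain C1 where C1: "C1 \<ge> 0" "\<And>\<sigma> x x'. \<sigma>\<in>{0<..1} \<Longrightarrow> norm x \<le> R + 1 \<Longrightarrow> norm x' \<le> R + 1 \<Longrightarrow> norm (x' - x) \<le> \<sigma> \<Longrightarrow>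
     norm ((Xop (mollify \<phi> \<sigma> Fk) (mollify \<phi> \<sigma> u) x' - mollify \<phi> \<sigma> (Xop Fk u) x') - (Xop (mollify \<phi> \<sigma> Fk) (mollify \<phi> \<sigma> u) x - mollify \<phi> \<sigma> (Xop Fk u) x))
       \<le> C1 * norm (x' - x)"
    using moll_commutator_lipschitz[OF b i1 Fk uL ex cX, of "R + 1"] by blast
  obtain C2 where C2: "C2 \<ge> 0" "\<And>\<sigma> x. \<sigma>\<in>{0<..1} \<Longrightarrow> norm x \<le> R \<Longrightarrow> norm (Xop (mollify \<phi> \<sigma> Fj) (mollify \<phi> \<sigma> (Xop Fk u)) x) \<le> C2"
    using moll_dist_derivative_bounded[OF b i1 Fj cX d, of R] by blast
  let ?C = "C1 * A + C2 + 2 * ?n\<^sup>2 * (A * K * E)"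
  have "norm (Xop (mollify \<phi> \<sigma> Fj) (Xop (mollify \<phi> \<sigma> Fk) (U \<sigma>)) x) \<le> ?C" if s: "\<sigma> \<in> {0<..1}" and x: "norm x \<le> R" for \<sigma> x
  proof -
    have s': "0 < \<sigma>" "\<sigma> \<le> 1" using s by auto
    let ?Zj = "mollify \<phi> \<sigma> Fj" and ?Zk = "mollify \<phi> \<sigma> Fk"
    have sU: "Cinf (U \<sigma>)" using u s moll_close_def[OF b i1] by blast
    have smo: "Cinf ?Zj" "Cinf ?Zk" "Cinf (mollify \<phi> \<sigma> u)" "Cinf (mollify \<phi> \<sigma> (Xop Fk u))"
      using Cinf_mollify[OF b _ s'(1)] ball_lip_cont[OF Fj] ball_lip_cont[OF Fk] cu cX by auto
    let ?E = "\<lambda>x. U \<sigma> x - mollify \<phi> \<sigma> u x" and ?Rs = "\<lambda>x. Xop ?Zk (mollify \<phi> \<sigma> u) x - mollify \<phi> \<sigma> (Xop Fk u) x"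
    have sE: "Cinf ?E" by (rule Cinf_diff[OF sU smo(3)])
    have sR: "Cinf ?Rs" by (intro Cinf_diff Cinf_Xop smo)
    have "Xop ?Zk (U \<sigma>) = Xop ?Zk (\<lambda>x. mollify \<phi> \<sigma> u x + ?E x)" by simp
    also have "\<dots> = (\<lambda>x. Xop ?Zk (mollify \<phi> \<sigma> u) x + Xop ?Zk ?E x)" using Xop_add_smooth[OF smo(3) sE] by blast
    also have "\<dots> = (\<lambda>x. (?Rs x + mollify \<phi> \<sigma> (Xop Fk u) x) + Xop ?Zk ?E x)" by simp
    finally have "Xop ?Zj (Xop ?Zk (U \<sigma>)) x = Xop ?Zj (\<lambda>x. (?Rs x + mollify \<phi> \<sigma> (Xop Fk u) x) + Xop ?Zk ?E x) x" by simp
    also have "\<dots> = Xop ?Zj ?Rs x + Xop ?Zj (mollify \<phi> \<sigma> (Xop Fk u)) x + Xop ?Zj (Xop ?Zk ?E) x"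
      using Xop_add_smooth[OF Cinf_add[OF sR smo(4)] Cinf_Xop[OF smo(2) sE]] Xop_add_smooth[OF sR smo(4)] by simp
    also have "norm \<dots> \<le> C1 * A + C2 + 2 * ?n\<^sup>2 * (A * K * E)"
    proof (intro norm_triangle_mono)
      have a: "norm (?Zj x) \<le> A" using A(2)[OF s x] by (simp add: C2_bound_def)
      have "norm (dir ?Rs x (?Zj x)) \<le> C1 * norm (?Zj x)"
      proof (rule lipschitz_imp_derivative_bound[OF Ck_has_derivative_dir[OF CinfD[OF sR]] s'(1)])
        fix y assume y: "norm (y - x) < \<sigma>"
        show "norm (?Rs y - ?Rs x) \<le> C1 * norm (y - x)"
          using near_norm[OF x, of y \<sigma>] y s' x by (intro C1(2)[OF s]) auto
      qed
      then show "norm (Xop ?Zj ?Rs x) \<le> C1 * A"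
        unfolding has_derivative_imp_Xop(2)[OF Ck_has_derivative_dir[OF CinfD[OF sR]]]
        using mult_left_mono[OF a C1(1)] by simp
      show "norm (Xop ?Zj (mollify \<phi> \<sigma> (Xop Fk u)) x) \<le> C2" by (rule C2(2)[OF s x])
      show "norm (Xop ?Zj (Xop ?Zk ?E) x) \<le> 2 * ?n\<^sup>2 * (A * K * E)"
        by (rule Xop_Xop_bound[OF smo(1,2) sE a]) (use K(2)[OF s x] E(2)[OF s x] in \<open>auto simp: C2_bound_def\<close>)
    qed
    finally show ?thesis .
  qed
  moreover have "0 \<le> ?C" using A C1 C2 K E by simp
  ultimately show ?thesis by blast
qed

lemma Xop_diff_smooth: "Cinf u \<Longrightarrow> Cinf v \<Longrightarrow> Xop F (\<lambda>x. u x - v x) x = Xop F u x - Xop F v x"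
  unfolding Ck_Xop_eq[OF CinfD[OF Cinf_diff]] Ck_Xop_eq[OF CinfD]
  by (simp add: pd_diff_fun scaleR_diff_right sum_subtractf)

text \<open>Up to length \<open>s - 1\<close> the approximation calculus suffices. Length
  \<open>s\<close> takes one derivative of it, still bounded. Length \<open>s + 1\<close> takes two,
  and the Leibniz expansion of the outer brackets leaves two second-order terms to treat.\<close>

lemma fw_mollify_bounded_single:
  fixes f :: "nat \<Rightarrow> real^'n \<Rightarrow> real^'n" and \<phi> :: "real^'n \<Rightarrow> real"
  assumes A: "class_A s m f" and b: "bump \<phi>" and i1: "integral\<^sup>L lborel \<phi> = 1"
    and v: "set v \<subseteq> {1..m}" "1 \<le> length v" "length v \<le> Suc s"
  shows "\<exists>B\<ge>0. \<forall>\<sigma>\<in>{0<..1}. \<forall>y. norm y \<le> R \<longrightarrow> norm (fw (\<lambda>i. mollify \<phi> \<sigma> (f i)) v y) \<le> B"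
proof -
  let ?n = "real CARD('n)"
  define Z where "Z \<sigma> i = mollify \<phi> \<sigma> (f i)" for \<sigma> i
  have s2: "2 \<le> s" using A by (simp add: class_A_def)
  have g: "moll_close_upto \<phi> (s - 2) (f j) (\<lambda>\<sigma>. Z \<sigma> j)" if "j \<in> {1..m}" for j
    using A that deriv_lip_moll_close_upto[OF b i1] unfolding class_A_def Z_def by blast
  have fL: "ball_lip (f j)" if "j \<in> {1..m}" for j using moll_close_upto_moll_close[OF b i1 g[OF that]] moll_close_def[OF b i1] by blast
  have smZ: "Cinf (Z \<sigma> j)" if "j \<in> {1..m}" "\<sigma> \<in> {0<..1}" for j \<sigma> by (rule moll_close_upto_Cinf[OF b i1 g[OF that(1)] that(2)])
  have gw: "moll_close \<phi> (fw f w) (\<lambda>\<sigma>. fw (Z \<sigma>) w)" if w: "set w \<subseteq> {1..m}" "w \<noteq> []" "length w \<le> s - 1" for w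
    by (rule moll_close_upto_moll_close[OF b i1 moll_close_upto_fw[OF b i1, of w "s - 2"]]) (use g w s2 in auto)
  have zb: "\<exists>C\<ge>0. \<forall>\<sigma>\<in>{0<..1}. \<forall>x. norm x \<le> R \<longrightarrow> C2_bound C C (C / \<sigma>) (Z \<sigma> j) x" if "j \<in> {1..m}" for j
    by (rule moll_close_C2_bound[OF b i1 moll_close_upto_moll_close[OF b i1 g[OF that]]])
  have smF: "Cinf (fw (Z \<sigma>) w)" if "set w \<subseteq> {1..m}" "\<sigma> \<in> {0<..1}" for w \<sigma>
    unfolding Cinf_def by (intro allI Ck_fw CinfD smZ) (use that in auto)
  define W where "W = {w. set w \<subseteq> {1..m} \<and> length w = s - 1}"
  have A2: "Xexists (f k) (fw f w) x" "continuous_on UNIV (Xop (f k) (fw f w))" "distX_Linf (f j) (Xop (f k) (fw f w))"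
    if "w \<in> W" "j \<in> {1..m}" "k \<in> {1..m}" for w j k x
    using A that unfolding class_A_def W_def by blast+
  have len_s: "\<exists>B\<ge>0. \<forall>\<sigma>\<in>{0<..1}. \<forall>y. norm y \<le> R \<longrightarrow> norm (fw (Z \<sigma>) (k # w) y) \<le> B"
    if w: "w \<in> W" and k: "k \<in> {1..m}" for k w
  proof -
    have w': "set w \<subseteq> {1..m}" "w \<noteq> []" "length w \<le> s - 1" using w s2 by (auto simp: W_def)
    obtain C where C: "C \<ge> 0" "\<And>\<sigma> x. \<sigma>\<in>{0<..1} \<Longrightarrow> norm x \<le> R \<Longrightarrow> C2_bound C C (C / \<sigma>) (fw (Z \<sigma>) w) x"
      using moll_close_C2_bound[OF b i1 gw[OF w'], of R] by blast
    obtain D where D: "D \<ge> 0" "\<And>\<sigma> x. \<sigma>\<in>{0<..1} \<Longrightarrow> norm x \<le> R \<Longrightarrow> C2_bound D D (D / \<sigma>) (Z \<sigma> k) x"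
      using zb[OF k] by blast
    have "norm (fw (Z \<sigma>) (k # w) y) \<le> ?n * C * D + ?n * D * C" if s: "\<sigma> \<in> {0<..1}" and y: "norm y \<le> R" for \<sigma> y
    proof -
      note c = C(2)[OF s y, unfolded C2_bound_def] and d = D(2)[OF s y, unfolded C2_bound_def]
      have 1: "norm (Xop (Z \<sigma> k) (fw (Z \<sigma>) w) y) \<le> ?n * C * D"
        by (rule Xop_norm_le_mult[OF smF[OF w'(1) s]]) (use c d in auto)
      have 2: "norm (Xop (fw (Z \<sigma>) w) (Z \<sigma> k) y) \<le> ?n * D * C"
        by (rule Xop_norm_le_mult[OF smZ[OF k s]]) (use c d in auto)
      show ?thesis unfolding fw_Cons[OF w'(2)] using order_trans[OF norm_triangle_ineq4 add_mono[OF 1 2]] .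
    qed
    then show ?thesis using C D by (intro exI[of _ "?n * C * D + ?n * D * C"]) auto
  qed
  consider "length v \<le> s - 1" | "length v = s" | "length v = Suc s" using v by linarith
  then have "\<exists>B\<ge>0. \<forall>\<sigma>\<in>{0<..1}. \<forall>y. norm y \<le> R \<longrightarrow> norm (fw (Z \<sigma>) v y) \<le> B"
  proof cases
    case 1
    have "v \<noteq> []" using v by auto
    then obtain C where C: "C \<ge> 0" "\<And>\<sigma> x. \<sigma>\<in>{0<..1} \<Longrightarrow> norm x \<le> R \<Longrightarrow> C2_bound C C (C / \<sigma>) (fw (Z \<sigma>) v) x"
      using moll_close_C2_bound[OF b i1 gw[OF v(1) _ 1], of R] by blast
    then show ?thesis unfolding C2_bound_def by blast
  next
    case 2
    then obtain k w where kw: "v = k # w" using v by (cases v) auto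
    then show ?thesis using len_s[of w k] v 2 by (simp add: W_def)
  next
    case 3
    obtain j k w where jkw: "v = j # k # w"
      using 3 s2 by (cases v; cases "tl v") auto
    have w: "w \<in> W" and j: "j \<in> {1..m}" and k: "k \<in> {1..m}" using v 3 jkw by (auto simp: W_def)
    have w': "set w \<subseteq> {1..m}" "w \<noteq> []" "length w \<le> s - 1" using w s2 by (auto simp: W_def)
    obtain BV where BV: "BV \<ge> 0" "\<And>\<sigma> y. \<sigma>\<in>{0<..1} \<Longrightarrow> norm y \<le> R \<Longrightarrow> norm (fw (Z \<sigma>) (k # w) y) \<le> BV" using len_s[OF w k] by blast
    obtain D where D: "D \<ge> 0" "\<And>\<sigma> x. \<sigma>\<in>{0<..1} \<Longrightarrow> norm x \<le> R \<Longrightarrow> C2_bound D D (D / \<sigma>) (Z \<sigma> j) x"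
      using zb[OF j] by blast
    have "\<exists>C\<ge>0. \<forall>\<sigma>\<in>{0<..1}. \<forall>x. norm x \<le> R \<longrightarrow> norm (Xop (mollify \<phi> \<sigma> (f j)) (Xop (mollify \<phi> \<sigma> (f k)) (fw (Z \<sigma>) w)) x) \<le> C"
      by (rule second_order_bounded[OF b i1 fL[OF j] fL[OF k] gw[OF w'] A2[OF w j k]])
    then obtain C1 where C1: "C1 \<ge> 0" "\<And>\<sigma> x. \<sigma>\<in>{0<..1} \<Longrightarrow> norm x \<le> R \<Longrightarrow> norm (Xop (Z \<sigma> j) (Xop (Z \<sigma> k) (fw (Z \<sigma>) w)) x) \<le> C1"
      unfolding Z_def by blast
    \<comment> \<open>The term in which X_w differentiates f_k. For \<open>s = 2\<close> the word
      \<open>w\<close> is a single letter, so the estimate for the other term applies with the roles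
      of \<open>k\<close> and that letter exchanged; for larger \<open>s\<close> the second
      derivatives of the mollified f_k are bounded.\<close>
    have "\<exists>C\<ge>0. \<forall>\<sigma>\<in>{0<..1}. \<forall>x. norm x \<le> R \<longrightarrow> norm (Xop (Z \<sigma> j) (Xop (fw (Z \<sigma>) w) (Z \<sigma> k)) x) \<le> C"
    proof (cases "s = 2")
      case True
      then obtain l where l: "w = [l]" using w by (auto simp: W_def length_Suc_conv)
      have lm: "l \<in> {1..m}" using w'(1) l by simp
      have kc: "[k] \<in> W" using k True by (simp add: W_def)
      have gk: "moll_close \<phi> (fw f [k]) (\<lambda>\<sigma>. fw (Z \<sigma>) [k])" by (rule gw) (use k s2 in auto)
      have "\<exists>C\<ge>0. \<forall>\<sigma>\<in>{0<..1}. \<forall>x. norm x \<le> R \<longrightarrow> norm (Xop (mollify \<phi> \<sigma> (f j)) (Xop (mollify \<phi> \<sigma> (f l)) (fw (Z \<sigma>) [k])) x) \<le> C"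
        by (rule second_order_bounded[OF b i1 fL[OF j] fL[OF lm] gk A2[OF kc j lm]])
      then show ?thesis unfolding l by (simp add: Z_def)
    next
      case False
      then obtain r where r: "s - 2 = Suc r" using s2 by (cases "s - 2") auto
      have "\<exists>C\<ge>0. \<forall>\<sigma>\<in>{0<..1}. \<forall>x. norm x \<le> R \<longrightarrow> C2_bound C C (C / \<sigma>) (pd l (Z \<sigma> k)) x" for l
        by (rule moll_close_C2_bound[OF b i1 moll_close_upto_moll_close[OF b i1 moll_close_upto_Suc_D(1)[OF b i1 g[OF k, unfolded r]]]])
      then obtain P where P: "\<And>l. P l \<ge> 0" "\<And>l \<sigma> x. \<sigma>\<in>{0<..1} \<Longrightarrow> norm x \<le> R \<Longrightarrow> C2_bound (P l) (P l) (P l / \<sigma>) (pd l (Z \<sigma> k)) x"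
        by metis
      have Pl: "P l \<le> (\<Sum>l\<in>UNIV. P l)" for l using P by (intro member_le_sum) auto
      obtain C where C: "C \<ge> 0" "\<And>\<sigma> x. \<sigma>\<in>{0<..1} \<Longrightarrow> norm x \<le> R \<Longrightarrow> C2_bound C C (C / \<sigma>) (fw (Z \<sigma>) w) x"
        using moll_close_C2_bound[OF b i1 gw[OF w'], of R] by blast
      let ?d = "\<Sum>l\<in>UNIV. P l"
      have "norm (Xop (Z \<sigma> j) (Xop (fw (Z \<sigma>) w) (Z \<sigma> k)) x) \<le> 2 * ?n\<^sup>2 * (D * C * ?d)" if s: "\<sigma> \<in> {0<..1}" and x: "norm x \<le> R" for \<sigma> x
      proof (rule Xop_Xop_bound[OF smZ[OF j s] smF[OF w'(1) s] smZ[OF k s]])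
        show "norm (Z \<sigma> j x) \<le> D" "norm (fw (Z \<sigma>) w x) \<le> C" "norm (pd l (fw (Z \<sigma>) w) x) \<le> C" for l
          using D(2)[OF s x] C(2)[OF s x] by (auto simp: C2_bound_def)
        show "norm (pd l (Z \<sigma> k) x) \<le> ?d" "norm (pd i (pd l (Z \<sigma> k)) x) \<le> ?d" for i l
          using P(2)[OF s x, of l] Pl[of l] by (auto simp: C2_bound_def intro: order_trans)
      qed
      moreover have "0 \<le> 2 * ?n\<^sup>2 * (D * C * ?d)" using C D P by (simp add: sum_nonneg)
      ultimately show ?thesis by blast
    qed
    then obtain C2 where C2: "C2 \<ge> 0" "\<And>\<sigma> x. \<sigma>\<in>{0<..1} \<Longrightarrow> norm x \<le> R \<Longrightarrow> norm (Xop (Z \<sigma> j) (Xop (fw (Z \<sigma>) w) (Z \<sigma> k)) x) \<le> C2" by blast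
    have "norm (fw (Z \<sigma>) v y) \<le> (C1 + C2) + ?n * D * BV" if s: "\<sigma> \<in> {0<..1}" and y: "norm y \<le> R" for \<sigma> y
    proof -
      have kwm: "set (k # w) \<subseteq> {1..m}" using k w' by simp
      have "Xop (Z \<sigma> j) (fw (Z \<sigma>) (k # w)) y = Xop (Z \<sigma> j) (Xop (Z \<sigma> k) (fw (Z \<sigma>) w)) y - Xop (Z \<sigma> j) (Xop (fw (Z \<sigma>) w) (Z \<sigma> k)) y"
        unfolding fw_Cons[OF w'(2)] by (intro Xop_diff_smooth Cinf_Xop smZ[OF k s] smF[OF w'(1) s])
      then have 1: "norm (Xop (Z \<sigma> j) (fw (Z \<sigma>) (k # w)) y) \<le> C1 + C2"
        using order_trans[OF norm_triangle_ineq4 add_mono[OF C1(2)[OF s y] C2(2)[OF s y]]] by simp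
      have 2: "norm (Xop (fw (Z \<sigma>) (k # w)) (Z \<sigma> j) y) \<le> ?n * D * BV"
        by (rule Xop_norm_le_mult[OF smZ[OF j s]])
          (use D(2)[OF s y] BV(2)[OF s y] in \<open>auto simp: C2_bound_def\<close>)
      have "fw (Z \<sigma>) v y = Xop (Z \<sigma> j) (fw (Z \<sigma>) (k # w)) y - Xop (fw (Z \<sigma>) (k # w)) (Z \<sigma> j) y" unfolding jkw by simp
      then show ?thesis using order_trans[OF norm_triangle_ineq4 add_mono[OF 1 2]] by simp
    qed
    moreover have "0 \<le> (C1 + C2) + ?n * D * BV" using C1 C2 D BV by simp
    ultimately show ?thesis by blast
  qed
  then show ?thesis unfolding Z_def by simp
qed

lemma fw_mollify_bounded:
  fixes f :: "nat \<Rightarrow> real^'n \<Rightarrow> real^'n" and \<phi> :: "real^'n \<Rightarrow> real"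
  assumes A: "class_A s m f" and b: "bump \<phi>" and i1: "integral\<^sup>L lborel \<phi> = 1"
  shows "\<exists>B\<ge>0. \<forall>\<sigma>\<in>{0<..1}. \<forall>v y. set v \<subseteq> {1..m} \<longrightarrow> 1 \<le> length v \<longrightarrow> length v \<le> Suc s \<longrightarrow> norm y \<le> R \<longrightarrow>
     norm (fw (\<lambda>i. mollify \<phi> \<sigma> (f i)) v y) \<le> B"
proof -
  let ?V = "{v. set v \<subseteq> {1..m} \<and> 1 \<le> length v \<and> length v \<le> Suc s}"
  have "?V = words (Suc s) m" by (auto simp: words_def)
  then have fin: "finite ?V" using finite_words[of "Suc s" m] by simp
  have "\<forall>v\<in>?V. \<exists>B\<ge>0. \<forall>\<sigma>\<in>{0<..1}. \<forall>y. norm y \<le> R \<longrightarrow> norm (fw (\<lambda>i. mollify \<phi> \<sigma> (f i)) v y) \<le> B"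
  proof
    fix v assume "v \<in> ?V"
    then show "\<exists>B\<ge>0. \<forall>\<sigma>\<in>{0<..1}. \<forall>y. norm y \<le> R \<longrightarrow> norm (fw (\<lambda>i. mollify \<phi> \<sigma> (f i)) v y) \<le> B"
      by (intro fw_mollify_bounded_single[OF A b i1]) auto
  qed
  from bchoice[OF this] obtain B where B':
    "\<forall>v\<in>?V. B v \<ge> 0 \<and> (\<forall>\<sigma>\<in>{0<..1}. \<forall>y. norm y \<le> R \<longrightarrow> norm (fw (\<lambda>i. mollify \<phi> \<sigma> (f i)) v y) \<le> B v)" ..
  then have B: "\<And>v. v \<in> ?V \<Longrightarrow> B v \<ge> 0"
    "\<And>v \<sigma> y. v \<in> ?V \<Longrightarrow> \<sigma>\<in>{0<..1} \<Longrightarrow> norm y \<le> R \<Longrightarrow> norm (fw (\<lambda>i. mollify \<phi> \<sigma> (f i)) v y) \<le> B v"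
    by fast+
  have le: "B v \<le> sum B ?V" if "v \<in> ?V" for v by (rule member_le_sum[OF that _ fin]) (use B(1) in auto)
  have "norm (fw (\<lambda>i. mollify \<phi> \<sigma> (f i)) v y) \<le> sum B ?V" if "\<sigma>\<in>{0<..1}" "v \<in> ?V" "norm y \<le> R" for \<sigma> v y
    by (rule order_trans[OF B(2)[OF that(2,1,3)] le[OF that(2)]])
  moreover have "0 \<le> sum B ?V" using B(1) by (intro sum_nonneg) auto
  ultimately show ?thesis by (intro exI[of _ "sum B ?V"]) auto
qed

section \<open>Conclusion\<close>

text \<open>Positivity and unit mass give the constant 1 exactly, so that mollification preserves
  the bounds \<open>L\<close> and \<open>M\<close> instead of enlarging them.\<close>

lemma mollifier_average_bound:
  fixes \<phi> :: "real^'n \<Rightarrow> real" and g :: "real^'n \<Rightarrow> 'b::euclidean_space"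
  assumes mol: "mollifier \<phi>" and i: "integrable lborel (\<lambda>y. \<phi> y *\<^sub>R g y)" and D: "\<And>y. norm y \<le> 1 \<Longrightarrow> norm (g y) \<le> D"
  shows "norm (\<integral>y. \<phi> y *\<^sub>R g y \<partial>lborel) \<le> D"
proof -
  note f = mollifier_facts[OF mol]
  have phi: "integrable lborel \<phi>" using mollify_integrable[OF f(1), of "\<lambda>_. 1::real" 0 0] by simp
  have "norm (\<integral>y. \<phi> y *\<^sub>R g y \<partial>lborel) \<le> (\<integral>y. \<phi> y * D \<partial>lborel)"
  proof (rule Bochner_Integration.integral_norm_bound_integral[OF i])
    show "integrable lborel (\<lambda>y. \<phi> y * D)" using phi by simp
    fix y
    show "norm (\<phi> y *\<^sub>R g y) \<le> \<phi> y * D"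
      using D[of y] f(3)[of y] bump_0[OF f(1), of y] by (cases "norm y \<le> 1") (auto intro: mult_left_mono)
  qed
  also have "\<dots> = D" using f(2) by simp
  finally show ?thesis .
qed

lemma mollify_norm_le:
  fixes u :: "real^'n \<Rightarrow> 'b::euclidean_space"
  assumes mol: "mollifier \<phi>" and u: "continuous_on UNIV u" and s: "0 \<le> \<sigma>" and D: "\<And>z. norm (u z) \<le> D"
  shows "norm (mollify \<phi> \<sigma> u x) \<le> D"
  unfolding mollify_def by (rule mollifier_average_bound[OF mol mollify_integrable[OF mollifier_facts(1)[OF mol] u s] D])

lemma mollify_diff_le:
  fixes u :: "real^'n \<Rightarrow> 'b::euclidean_space"
  assumes mol: "mollifier \<phi>" and u: "continuous_on UNIV u" and s: "0 \<le> \<sigma>"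
    and D: "\<And>y. norm y \<le> 1 \<Longrightarrow> norm (u (x - \<sigma> *\<^sub>R y) - u (x' - \<sigma> *\<^sub>R y)) \<le> D"
  shows "norm (mollify \<phi> \<sigma> u x - mollify \<phi> \<sigma> u x') \<le> D"
proof -
  have I: "integrable lborel (\<lambda>y. \<phi> y *\<^sub>R u (x - \<sigma> *\<^sub>R y))" for x by (rule mollify_integrable[OF mollifier_facts(1)[OF mol] u s])
  have "norm (\<integral>y. \<phi> y *\<^sub>R (u (x - \<sigma> *\<^sub>R y) - u (x' - \<sigma> *\<^sub>R y)) \<partial>lborel) \<le> D"
    using I[of x] I[of x'] by (intro mollifier_average_bound[OF mol _ D]) (simp_all add: scaleR_diff_right)
  then show ?thesis unfolding mollify_def using I[of x] I[of x'] by (simp add: scaleR_diff_right)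
qed

lemma ball_lip_mollify:
  fixes u :: "real^'n \<Rightarrow> 'b::euclidean_space"
  assumes mol: "mollifier \<phi>" and u: "ball_lip u" and s: "0 \<le> \<sigma>"
  shows "ball_lip (mollify \<phi> \<sigma> u)"
  unfolding ball_lip_def
proof
  fix R
  obtain L where L: "L \<ge> 0" "\<And>x y. norm x \<le> R + \<sigma> \<Longrightarrow> norm y \<le> R + \<sigma> \<Longrightarrow> norm (u x - u y) \<le> L * norm (x - y)" using ball_lip_E[OF u] by blast
  have nn: "norm (x - \<sigma> *\<^sub>R y) \<le> R + \<sigma>" if "norm x \<le> R" "norm y \<le> 1" for x y :: "real^'n"
    using norm_triangle_ineq4[of x "\<sigma> *\<^sub>R y"] mult_left_mono[OF that(2) s] that s by simp
  have "norm (mollify \<phi> \<sigma> u x - mollify \<phi> \<sigma> u y) \<le> L * norm (x - y)" if "norm x \<le> R" "norm y \<le> R" for x y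
  proof (rule mollify_diff_le[OF mol ball_lip_cont[OF u] s])
    fix z :: "real^'n" assume "norm z \<le> 1"
    then show "norm (u (x - \<sigma> *\<^sub>R z) - u (y - \<sigma> *\<^sub>R z)) \<le> L * norm (x - y)"
      using L(2)[OF nn nn, of x z y z] that by simp
  qed
  then show "\<exists>L\<ge>0. \<forall>x y. norm x \<le> R \<longrightarrow> norm y \<le> R \<longrightarrow> norm (mollify \<phi> \<sigma> u x - mollify \<phi> \<sigma> u y) \<le> L * norm (x - y)"
    using L(1) by blast
qed

text \<open>Only the second-order constant feels \<sigma>: two derivatives on the kernel give its
  inverse square. One factor \<open>n\<close> comes from turning partial derivatives into a
  Lipschitz bound, the other from the sum in \<open>dir\<close>.\<close>

lemma mollify_smooth_field:
  fixes u :: "real^'n \<Rightarrow> real^'n"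
  assumes mol: "mollifier \<phi>" and lip: "\<And>x y. norm (u x - u y) \<le> L * norm (x - y)" and bnd: "\<And>x. norm (u x) \<le> M"
    and s: "0 < \<sigma>" and L: "0 \<le> L" and T: "0 < T" "L * T \<le> 1/2" and n: "n = real CARD('n)"
    and B: "B \<ge> 0" "\<And>(w :: real^'n \<Rightarrow> real^'n) A x. continuous_on UNIV w \<Longrightarrow> 0 \<le> A \<Longrightarrow>
      (\<And>z. norm (z - x) \<le> \<sigma> \<Longrightarrow> norm (w z) \<le> A) \<Longrightarrow> C2_bound (B * A) (B * A / \<sigma>) (B * A / \<sigma>\<^sup>2) (mollify \<phi> \<sigma> w) x"
  shows "smooth_field (mollify \<phi> \<sigma> u) L M (n * (n * (B * M / \<sigma>\<^sup>2))) T"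
proof -
  note b = mollifier_facts(1)[OF mol]
  have "L-lipschitz_on UNIV u" using lip L by (auto simp: lipschitz_on_def dist_norm)
  then have cu: "continuous_on UNIV u" by (rule lipschitz_on_continuous_on)
  have M0: "0 \<le> M" using bnd norm_ge_zero order_trans by blast
  let ?Z = "mollify \<phi> \<sigma> u" and ?P = "B * M / \<sigma>\<^sup>2"
  have smZ: "Cinf ?Z" by (rule Cinf_mollify[OF b cu s])
  have P: "norm (pd k (pd l ?Z) x) \<le> ?P" for k l x
    using B(2)[OF cu M0, of x] bnd by (auto simp: C2_bound_def)
  have P0: "0 \<le> ?P" using B M0 by simp
  show ?thesis
  proof
    show "Ck (Suc 0) ?Z" by (rule CinfD[OF smZ])
    show "norm (?Z x - ?Z y) \<le> L * norm (x - y)" for x y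
    proof (rule mollify_diff_le[OF mol cu])
      fix z show "norm (u (x - \<sigma> *\<^sub>R z) - u (y - \<sigma> *\<^sub>R z)) \<le> L * norm (x - y)"
        using lip[of "x - \<sigma> *\<^sub>R z" "y - \<sigma> *\<^sub>R z"] by simp
    qed (use s in simp)
    show "norm (?Z x) \<le> M" for x by (rule mollify_norm_le[OF mol cu _ bnd]) (use s in simp)
    show "norm (dir ?Z x v - dir ?Z y v) \<le> n * (n * ?P) * norm (x - y) * norm v" for x y v
    proof -
      have "dir ?Z x v - dir ?Z y v = (\<Sum>k\<in>UNIV. v $ k *\<^sub>R (pd k ?Z x - pd k ?Z y))"
        unfolding dir_def by (simp add: scaleR_diff_right sum_subtractf)
      also have "norm \<dots> \<le> (\<Sum>k\<in>(UNIV::'n set). norm v * (n * ?P * norm (x - y)))"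
      proof (rule sum_norm_le)
        fix k
        have "norm (pd k ?Z x - pd k ?Z y) \<le> n * ?P * norm (x - y)"
          unfolding n by (rule lip_of_partials[OF CinfD[OF Cinf_pd[OF smZ]] P])
        then have "\<bar>v $ k\<bar> * norm (pd k ?Z x - pd k ?Z y) \<le> norm v * (n * ?P * norm (x - y))"
          using component_le_norm_cart[of v k] by (intro mult_mono) auto
        then show "norm (v $ k *\<^sub>R (pd k ?Z x - pd k ?Z y)) \<le> norm v * (n * ?P * norm (x - y))" by simp
      qed
      finally show ?thesis by (simp add: n mult_ac)
    qed
  qed (use L T mult_nonneg_nonneg[OF _ mult_nonneg_nonneg[OF _ P0]] n in auto)
qed

text \<open>The fields are cut off by composing with the projection onto a large ball, which keeps the Lipschitz constants
  and changes nothing on the ball of radius \<open>R\<close>.\<close>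

lemma mollified_vflows:
  fixes f :: "nat \<Rightarrow> real^'n \<Rightarrow> real^'n"
  assumes A: "class_A s m f" and mol: "mollifier \<phi>" and R: "0 < R"
  shows "\<exists>L M T B. 0 < T \<and> 0 \<le> M \<and> (\<forall>\<sigma>\<in>{0<..1}. \<exists>Z M2. vflows Z L M M2 T B R s m \<and> (\<forall>i\<in>{1..m}. \<forall>y. norm y < R \<longrightarrow> moll \<phi> \<sigma> (f i) y = Z i y) \<and>
       (\<forall>i\<in>{1..m}. ball_lip (moll \<phi> \<sigma> (f i))))"
proof -
  note b = mollifier_facts(1)[OF mol] and i1 = mollifier_facts(2)[OF mol]
  have s2: "2 \<le> s" using A by (simp add: class_A_def)
  have fL: "ball_lip (f i)" if "i \<in> {1..m}" for i
  proof -
    have "deriv_lip (s - 2) (f i)" using A that by (simp add: class_A_def)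
    then have "loc_lip (pds [] (f i))" unfolding deriv_lip_def by (metis le0 list.size(3))
    then show ?thesis by (simp add: loc_lip_imp_ball_lip)
  qed
  let ?S = "cball (0::real^'n) (R + 1)"
  \<comment> \<open>Radius \<open>R + 1\<close>, since a mollification with \<sigma> at most 1 at a
    point of norm below \<open>R\<close> reads values up to distance 1 away. Indices outside
    \<open>{1..m}\<close> get the zero field, because the locale asks for bounds at all
    indices.\<close>
  define F where "F i = (if i \<in> {1..m} then (\<lambda>z. f i (closest_point ?S z)) else (\<lambda>_. 0))" for i
  have cp: "norm (closest_point ?S z) \<le> R + 1" for z
    using closest_point_in_set[of ?S z] R by (simp add: not_le)
  have cpl: "norm (closest_point ?S x - closest_point ?S y) \<le> norm (x - y)" for x y
    using closest_point_lipschitz[of ?S x y] R by (simp add: dist_norm not_le)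
  have "\<forall>i\<in>{1..m}. \<exists>K\<ge>0. \<forall>x y. norm (F i x - F i y) \<le> K * norm (x - y)"
  proof
    fix i assume i: "i \<in> {1..m}"
    obtain K where K: "K \<ge> 0" "\<And>x y. norm x \<le> R + 1 \<Longrightarrow> norm y \<le> R + 1 \<Longrightarrow> norm (f i x - f i y) \<le> K * norm (x - y)" using ball_lip_E[OF fL[OF i]] by blast
    have "norm (F i x - F i y) \<le> K * norm (x - y)" for x y
      using order_trans[OF K(2)[OF cp cp] mult_left_mono[OF cpl K(1)]] i by (simp add: F_def)
    then show "\<exists>K\<ge>0. \<forall>x y. norm (F i x - F i y) \<le> K * norm (x - y)" using K(1) by blast
  qed
  from bchoice[OF this] obtain K where K: "\<forall>i\<in>{1..m}. K i \<ge> 0 \<and> (\<forall>x y. norm (F i x - F i y) \<le> K i * norm (x - y))" ..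
  have "\<forall>i\<in>{1..m}. \<exists>U\<ge>0. \<forall>x. norm (F i x) \<le> U"
  proof
    fix i assume i: "i \<in> {1..m}"
    obtain U where U: "U \<ge> 0" "\<forall>z. norm z \<le> R + 1 \<longrightarrow> norm (f i z) \<le> U" using ball_lip_bounded[OF fL[OF i]] by blast
    then have "norm (F i x) \<le> U" for x using cp i by (simp add: F_def)
    then show "\<exists>U\<ge>0. \<forall>x. norm (F i x) \<le> U" using U(1) by blast
  qed
  from bchoice[OF this] obtain U where U: "\<forall>i\<in>{1..m}. U i \<ge> 0 \<and> (\<forall>x. norm (F i x) \<le> U i)" ..
  define L where "L = sum K {1..m}"
  define M where "M = sum U {1..m}"
  have L0: "0 \<le> L" unfolding L_def using K by (intro sum_nonneg) auto
  have M0: "0 \<le> M" unfolding M_def using U by (intro sum_nonneg) auto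
  have Fl: "norm (F i x - F i y) \<le> L * norm (x - y)" for i x y
  proof (cases "i \<in> {1..m}")
    case True
    have "K i \<le> L" unfolding L_def by (rule member_le_sum) (use K True in auto)
    then have "K i * norm (x - y) \<le> L * norm (x - y)" by (rule mult_right_mono) simp
    then show ?thesis using K True by (meson order_trans)
  qed (use L0 in \<open>auto simp: F_def\<close>)
  have Fb: "norm (F i x) \<le> M" for i x
  proof (cases "i \<in> {1..m}")
    case True
    have "U i \<le> M" unfolding M_def by (rule member_le_sum) (use U True in auto)
    then show ?thesis using U True by (meson order_trans)
  qed (use M0 in \<open>auto simp: F_def\<close>)
  define T where "T = 1 / (2 * (L + 1))"
  have T: "0 < T" "L * T \<le> 1/2" using L0 by (auto simp: T_def field_simps)
  obtain B where B: "B \<ge> 0" "\<forall>\<sigma>\<in>{0<..1}. \<forall>v y. set v \<subseteq> {1..m} \<longrightarrow> 1 \<le> length v \<longrightarrow> length v \<le> Suc s \<longrightarrow> norm y \<le> R \<longrightarrow>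
     norm (fw (\<lambda>i. mollify \<phi> \<sigma> (f i)) v y) \<le> B" using fw_mollify_bounded[OF A b i1, of R] by blast
  obtain B1 where B1: "B1 \<ge> 0" "\<And>\<sigma> (w :: real^'n \<Rightarrow> real^'n) A x. 0 < \<sigma> \<Longrightarrow> continuous_on UNIV w \<Longrightarrow> 0 \<le> A \<Longrightarrow>
      (\<And>z. norm (z - x) \<le> \<sigma> \<Longrightarrow> norm (w z) \<le> A) \<Longrightarrow> C2_bound (B1 * A) (B1 * A / \<sigma>) (B1 * A / \<sigma>\<^sup>2) (mollify \<phi> \<sigma> w) x"
    using mollify_C2_bound[OF b, where 'b = "real^'n"] by blast
  have main: "\<exists>Z M2. vflows Z L M M2 T B R s m \<and> (\<forall>i\<in>{1..m}. \<forall>y. norm y < R \<longrightarrow> moll \<phi> \<sigma> (f i) y = Z i y) \<and>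
       (\<forall>i\<in>{1..m}. ball_lip (moll \<phi> \<sigma> (f i)))" if s: "\<sigma> \<in> {0<..1}" for \<sigma>
  proof -
    have s': "0 < \<sigma>" "\<sigma> \<le> 1" using s by auto
    define Z where "Z i = mollify \<phi> \<sigma> (F i)" for i
    have mm: "moll \<phi> \<sigma> (f i) = mollify \<phi> \<sigma> (f i)" if "i \<in> {1..m}" for i
      by (rule moll_eq_mollify[OF b ball_lip_cont[OF fL[OF that]]]) (use s' in simp)
    have eq: "mollify \<phi> \<sigma> (f i) y = Z i y" if i: "i \<in> {1..m}" and y: "norm y < R" for i y
    proof -
      have "\<phi> z *\<^sub>R f i (y - \<sigma> *\<^sub>R z) = \<phi> z *\<^sub>R F i (y - \<sigma> *\<^sub>R z)" for z
      proof (cases "norm z \<le> 1")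
        case True
        have "\<sigma> * norm z \<le> 1 * 1" using True s' by (intro mult_mono) auto
        then have "y - \<sigma> *\<^sub>R z \<in> ?S" using norm_triangle_ineq4[of y "\<sigma> *\<^sub>R z"] y s' by simp
        then have "closest_point ?S (y - \<sigma> *\<^sub>R z) = y - \<sigma> *\<^sub>R z" by (rule closest_point_self)
        then show ?thesis using i by (simp add: F_def)
      qed (use bump_0[OF b] in auto)
      then show ?thesis unfolding Z_def mollify_def by presburger
    qed
    have cF: "continuous_on UNIV (F i)" for i
    proof -
      have "L-lipschitz_on UNIV (F i)" using Fl L0 by (auto simp: lipschitz_on_def dist_norm)
      then show ?thesis by (rule lipschitz_on_continuous_on)
    qed
    have "vflows Z L M (real CARD('n) * (real CARD('n) * (B1 * M / \<sigma>\<^sup>2))) T B R s m"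
    proof (rule vflows.intro)
      show "Ck r (Z k)" for r k unfolding Z_def by (rule Ck_mollify[OF b cF s'(1)])
      show "smooth_field (Z k) L M (real CARD('n) * (real CARD('n) * (B1 * M / \<sigma>\<^sup>2))) T" for k
        unfolding Z_def by (rule mollify_smooth_field[OF mol Fl Fb s'(1) L0 T refl B1(1) B1(2)[OF s'(1)]])
      show "norm (fw Z v y) \<le> B" if v: "set v \<subseteq> {1..m}" "1 \<le> length v" "length v \<le> Suc s" "norm y < R" for v y
      proof -
        have "fw (\<lambda>i. mollify \<phi> \<sigma> (f i)) v y = fw Z v y"
          by (rule fw_cong_open[of "ball 0 R"]) (use v eq in auto)
        moreover have "norm (fw (\<lambda>i. mollify \<phi> \<sigma> (f i)) v y) \<le> B" using B(2) s v by simp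
        ultimately show ?thesis by simp
      qed
    qed (use B s2 in auto)
    moreover have "ball_lip (moll \<phi> \<sigma> (f i))" if "i \<in> {1..m}" for i
      unfolding mm[OF that] by (rule ball_lip_mollify[OF mol fL[OF that]]) (use s' in simp)
    ultimately show ?thesis using eq mm by metis
  qed
  show ?thesis by (intro exI[of _ L] exI[of _ M] exI[of _ T] exI[of _ B] conjI ballI T(1) M0 main)
qed

section \<open>Identification with the maps of the statement\<close>

lemma cseq_map:
  "cseq \<tau> (map g w) = map (\<lambda>(k, e). (g k, e * \<tau>)) (cseq 1 w)"
  and invseq_map: "invseq (map (\<lambda>(k, e). (g k, e * \<tau>)) ps) = map (\<lambda>(k, e). (g k, e * \<tau>)) (invseq ps)"
proof -
  show inv: "invseq (map (\<lambda>(k, e). (g k, e * \<tau>)) ps) = map (\<lambda>(k, e). (g k, e * \<tau>)) (invseq ps)" for ps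
    by (induction ps) (auto simp: invseq_def)
  show "cseq \<tau> (map g w) = map (\<lambda>(k, e). (g k, e * \<tau>)) (cseq 1 w)"
    by (induction "1::real" w rule: cseq.induct) (simp_all add: inv)
qed

context vflows
begin

text \<open>\<open>flow\<close> is a definite description, so agreement includes uniqueness among all integral curves of \<open>g\<close>, which may leave
  the region where \<open>g\<close> and \<open>Z k\<close> agree. Local Lipschitz continuity of \<open>g\<close> settles this.\<close>

lemma flow_eq_fl:
  assumes g: "\<And>y. norm y < R \<Longrightarrow> g y = Z k y" and l: "ball_lip g" and t: "\<bar>t\<bar> \<le> T" and y: "norm y + M * \<bar>t\<bar> < R"
  shows "flow g t y = \<Phi> k t y"
proof -
  let ?c = "\<lambda>r. \<Phi> k r y"
  have c: "norm (?c r) < R" if "r \<in> closed_segment 0 t" for r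
  proof -
    have "M * \<bar>r\<bar> \<le> M * \<bar>t\<bar>" using closed_segment_0_abs_le[OF that] M0 by (intro mult_left_mono)
    then show ?thesis using norm_fl[of k r y] y by linarith
  qed
  have dc: "(?c has_vector_derivative g (?c r)) (at r within closed_segment 0 t)" if "r \<in> closed_segment 0 t" for r
    unfolding g[OF c[OF that]] by (rule smooth_field.fl_deriv_seg[OF field t that])
  have c0: "?c 0 = y" by (rule smooth_field.fl_0[OF field])
  show ?thesis unfolding flow_def
  proof (rule the_equality)
    show "\<exists>\<gamma>. \<gamma> 0 = y \<and> \<gamma> t = \<Phi> k t y \<and>
      (\<forall>r\<in>closed_segment 0 t. (\<gamma> has_vector_derivative g (\<gamma> r)) (at r within closed_segment 0 t))"
      using c0 dc by (intro exI[of _ ?c]) auto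
  next
    fix z assume "\<exists>\<gamma>. \<gamma> 0 = y \<and> \<gamma> t = z \<and>
      (\<forall>r\<in>closed_segment 0 t. (\<gamma> has_vector_derivative g (\<gamma> r)) (at r within closed_segment 0 t))"
    then obtain \<gamma> where \<gamma>: "\<gamma> 0 = y" "\<gamma> t = z"
      and d: "\<And>r. r \<in> closed_segment 0 t \<Longrightarrow> (\<gamma> has_vector_derivative g (\<gamma> r)) (at r within closed_segment 0 t)" by blast
    have "continuous_on (closed_segment 0 t) \<gamma>"
      unfolding continuous_on_eq_continuous_within using d has_vector_derivative_continuous by blast
    then have "bounded (\<gamma> ` closed_segment 0 t)" by (intro compact_imp_bounded compact_continuous_image) auto
    then obtain R1 where R1: "\<And>r. r \<in> closed_segment 0 t \<Longrightarrow> norm (\<gamma> r) \<le> R1" unfolding bounded_iff by auto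
    \<comment> \<open>The constant depends on how far the competing curve travels, hence on the
      curve; \<open>gronwall_zero\<close> applies because it demands no smallness.\<close>
    obtain K where K: "K \<ge> 0" "\<And>x y. norm x \<le> max R R1 \<Longrightarrow> norm y \<le> max R R1 \<Longrightarrow> norm (g x - g y) \<le> K * norm (x - y)"
      using ball_lip_E[OF l] by blast
    have "\<gamma> t - ?c t = 0"
    proof (rule gronwall_zero[where w = "\<lambda>r. \<gamma> r - ?c r" and w' = "\<lambda>r. g (\<gamma> r) - g (?c r)" and L = K])
      fix r assume r: "r \<in> closed_segment 0 t"
      show "((\<lambda>r. \<gamma> r - ?c r) has_vector_derivative g (\<gamma> r) - g (?c r)) (at r within closed_segment 0 t)"
        by (rule has_vector_derivative_diff[OF d[OF r] dc[OF r]])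
      show "norm (g (\<gamma> r) - g (?c r)) \<le> K * norm (\<gamma> r - ?c r)"
        by (rule K(2)) (use R1[OF r] c[OF r] in auto)
    qed (use c0 \<gamma> in simp)
    then show "z = \<Phi> k t y" using \<gamma> by simp
  qed
qed

context
  fixes g :: "nat \<Rightarrow> real^'n \<Rightarrow> real^'n"
  assumes gZ: "\<And>k y. k \<in> {1..m} \<Longrightarrow> norm y < R \<Longrightarrow> g k y = Z k y" and gL: "\<And>k. k \<in> {1..m} \<Longrightarrow> ball_lip (g k)"
begin

lemma run_eq_run_fl:
  assumes "\<And>k e. (k, e) \<in> set es \<Longrightarrow> k \<in> {1..m} \<and> \<bar>e\<bar> = 1" "0 \<le> \<tau>" "\<tau> \<le> T" "norm x + M * \<tau> * length es < R"
  shows "run (map (\<lambda>(k, e). (g k, e * \<tau>)) es) x = run_fl \<tau> es x"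
  using assms
proof (induction es rule: rev_induct)
  case Nil then show ?case by (simp add: run_def)
next
  case (snoc p es)
  obtain k e where p: "p = (k, e)" by (cases p)
  have ke: "k \<in> {1..m}" "\<bar>e\<bar> = 1" using snoc.prems(1)[of k e] by (auto simp: p)
  have Mt: "0 \<le> M * \<tau>" using M0 snoc.prems(2) by simp
  have n: "norm x + M * \<tau> * length es + M * \<tau> < R" using snoc.prems(4) by (simp add: algebra_simps)
  have IH: "run (map (\<lambda>(k, e). (g k, e * \<tau>)) es) x = run_fl \<tau> es x"
    using snoc.prems n Mt by (intro snoc.IH) auto
  have "norm (run_fl \<tau> es x) \<le> norm x + M * \<tau> * length es"
    using snoc.prems by (intro run_fl_norm) auto
  then have "flow (g k) (e * \<tau>) (run_fl \<tau> es x) = \<Phi> k (e * \<tau>) (run_fl \<tau> es x)"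
    using snoc.prems ke n by (intro flow_eq_fl gZ gL) (auto simp: abs_mult)
  then show ?case using IH by (simp add: p run_fl_snoc run_def)
qed

lemma expstar_eq_exp_approx:
  assumes w: "w \<in> words s m" and t: "tau w t \<le> T" and x: "norm x + M * tau w t * NN < R"
  shows "expstar g w t x = exp_approx w t x"
proof -
  have es: "run (map (\<lambda>(k, e). (g k, e * tau w t)) (word_seq w b)) x = run_fl (tau w t) (word_seq w b) x" for b
    using word_seq_ok[OF w] t tau_nonneg x Mr_mono[OF tau_nonneg len_word_seq[OF w], of w t b]
    by (intro run_eq_run_fl) auto
  show ?thesis
    using es[of True] es[of False]
    by (auto simp: expstar_def Cmap_def Cmap_inv_def cseq_map invseq_map exp_approx_def word_seq_def tau_def)
qed

lemma foldr_expstar_eq_E_approx: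
  assumes "\<And>j. j \<in> set js \<Longrightarrow> ws j \<in> words s m \<and> tau (ws j) (h j) \<le> r" "0 \<le> r" "r \<le> T" "norm x + M * r * real (NN * length js) < R"
  shows "foldr (\<lambda>j y. expstar g (ws j) (h j) y) js x = E_approx ws h js x"
  using assms
proof (induction js)
  case Nil then show ?case by (simp add: E_approx_def)
next
  case (Cons j js)
  have Mr: "0 \<le> M * r * real NN" using M0 Cons.prems by simp
  have n: "norm x + M * r * real (NN * length js) + M * r * real NN < R" using Cons.prems(4) by (simp add: algebra_simps)
  have IH: "foldr (\<lambda>j y. expstar g (ws j) (h j) y) js x = E_approx ws h js x"
    using Cons.prems n Mr by (intro Cons.IH) auto
  have j: "ws j \<in> words s m" "tau (ws j) (h j) \<le> r" using Cons.prems(1)[of j] by auto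
  have "norm (E_approx ws h js x) \<le> norm x + M * r * real (NN * length js)"
    using Cons.prems by (intro E_approx_norm) auto
  moreover have "M * tau (ws j) (h j) * NN \<le> M * r * NN" using j M0 by (intro mult_right_mono mult_left_mono) auto
  ultimately have "expstar g (ws j) (h j) (E_approx ws h js x) = exp_approx (ws j) (h j) (E_approx ws h js x)"
    using n j order_trans[OF j(2) Cons.prems(3)] by (intro expstar_eq_exp_approx) auto
  then show ?case using IH by (simp add: E_approx_def)
qed

text \<open>All flows started by \<open>h\<close> in the quasi-ball stay inside the ball of radius
  \<open>R\<close>, where \<open>g\<close> and \<open>Z\<close> coincide. There the map of the
  statement equals \<open>E_approx\<close>, and its expansion is transferred.\<close>

lemma Emap_expansion:
  fixes Yw :: "nat \<Rightarrow> nat list" and I :: "nat \<Rightarrow> nat" and x :: "real^'n" and r0 :: real and j :: nat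
  defines "n \<equiv> CARD('n)" and "ws \<equiv> \<lambda>i. Yw (I i)"
  assumes ws: "\<And>i. i \<in> {1..n} \<Longrightarrow> ws i \<in> words s m" and j: "j \<in> {1..n}" and r0: "0 < r0" "r0 < T"
    and xR: "norm x + M * r0 * real (NN * (n + 2) + 1) < R"
  defines "Q \<equiv> QI n Yw I r0" and "N \<equiv> normI n Yw I" and "E \<equiv> Emap g Yw I x" and "d \<equiv> length (ws j)"
    and "a \<equiv> \<lambda>v h. E_coeff s m ws h [1..<j] (exp_coeff s m (ws j) (h j)) v" and "C \<equiv> KK ^ (NN * n) * AA"
  shows "continuous_on Q (pdh j E)"
    and "h \<in> Q \<Longrightarrow> (\<lambda>t. E (h(j := t))) differentiable (at (h j))"
    and "h \<in> Q \<Longrightarrow> \<bar>a v h\<bar> \<le> C * N h ^ (length v - d)"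
    and "h \<in> Q \<Longrightarrow> norm (pdh j E h - fw g (ws j) (E h)
        - (\<Sum>v\<in>{v\<in>words s m. d + 1 \<le> length v}. a v h *\<^sub>R fw g v (E h))) \<le> C * N h ^ (s + 1 - d)"
proof -
  have N: "N h = Max ((\<lambda>i. tau (ws i) (h i)) ` {1..n})" for h
    by (simp add: N_def normI_def tau_def ws_def)
  have ne: "(\<lambda>i. tau (ws i) (h i)) ` {1..n} \<noteq> {}" for h using j by auto
  have Q: "h \<in> Q \<longleftrightarrow> (\<forall>i\<in>{1..n}. tau (ws i) (h i) < r0)" for h
    using N[of h] Max_less_iff[OF _ ne, of h r0] by (simp add: Q_def QI_def N_def)
  have tN: "tau (ws i) (h i) \<le> N h" if "i \<in> {1..n}" for i h
    unfolding N using that by (intro Max_ge) auto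
  have N0: "0 \<le> N h" for h using tN[OF j, of h] tau_nonneg[of "ws j" "h j"] by linarith
  have NQ: "N h < r0" if "h \<in> Q" for h using that by (simp add: Q_def QI_def N_def)
  have Mr0: "0 \<le> M * r0" using M0 r0 by simp
  have small: "norm x + M * r0 * real (NN * n) < R"
  proof -
    have "M * r0 * real (NN * n) \<le> M * r0 * real (NN * (n + 2) + 1)"
      by (rule mult_left_mono[OF _ Mr0]) (simp add: algebra_simps del: of_nat_add of_nat_mult of_nat_Suc)
    then show ?thesis using xR by linarith
  qed
  have Eq: "E h = E_approx ws h [1..<n + 1] x" if "h \<in> Q" for h
  proof -
    have "foldr (\<lambda>i y. expstar g (ws i) (h i) y) [1..<n + 1] x = E_approx ws h [1..<n + 1] x"
      by (rule foldr_expstar_eq_E_approx[where r = r0]) (use that Q ws r0 small j in \<open>auto intro: less_imp_le\<close>)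
    then show ?thesis by (simp add: E_def Emap_def n_def ws_def)
  qed
  have ER: "norm (E h) < R" if "h \<in> Q" for h
  proof -
    have "norm (E_approx ws h [1..<n + 1] x) \<le> norm x + M * r0 * real (NN * length [1..<n + 1])"
      by (rule E_approx_norm) (use that Q ws in \<open>auto intro: less_imp_le\<close>)
    moreover have "length [1..<n + 1] = n" by simp
    ultimately show ?thesis using small unfolding Eq[OF that] by (simp only:)
  qed
  \<comment> \<open>The identification holds on the quasi-ball only; it is open in the j-th variable
    by continuity of \<open>tau\<close>, so derivatives at \<open>h j\<close> agree.\<close>
  have ev: "\<forall>\<^sub>F t in nhds (h j). E (h(j := t)) = E_approx ws (h(j := t)) [1..<n + 1] x" if h: "h \<in> Q" for h
  proof -
    have wj: "ws j \<noteq> []" using word_facts[OF ws[OF j]] by simp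
    have "((\<lambda>t. tau (ws j) t) \<longlongrightarrow> tau (ws j) (h j)) (nhds (h j))" by (rule tau_tendsto[OF wj]) (rule filterlim_ident)
    then have "\<forall>\<^sub>F t in nhds (h j). tau (ws j) t < r0" by (rule order_tendstoD(2)) (use h Q j in auto)
    then have "\<forall>\<^sub>F t in nhds (h j). h(j := t) \<in> Q" by (rule eventually_mono) (use h Q in auto)
    then show ?thesis by (rule eventually_mono) (rule Eq)
  qed
  have D: "((\<lambda>t. E_approx ws (h(j := t)) [1..<n + 1] x) has_vector_derivative E_partial ws n j x h) (at (h j))" if "h \<in> Q" for h
    by (rule E_partial_deriv[OF ws j r0 xR tN N0]) (use NQ[OF that] in auto)
  have pE: "pdh j E h = E_partial ws n j x h" if "h \<in> Q" for h
    unfolding pdh_def vector_derivative_cong_eventually(1)[OF ev[OF that]] by (rule vector_derivative_at[OF D[OF that]])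
  show "(\<lambda>t. E (h(j := t))) differentiable (at (h j))" if "h \<in> Q"
    unfolding vector_derivative_cong_eventually(2)[OF ev[OF that]] by (rule differentiableI_vector[OF D[OF that]])
  have "continuous_on Q (E_partial ws n j x)"
    unfolding continuous_on_def
  proof
    fix h0 assume h0: "h0 \<in> Q"
    \<comment> \<open>Functions on the naturals carry the product topology, so convergence of
      \<open>h\<close> supplies convergence of each coordinate.\<close>
    have "((\<lambda>a. a i) \<longlongrightarrow> h0 i) (at h0 within Q)" for i
      using continuous_on_subset[OF continuous_on_product_coordinates[of i] subset_UNIV[of Q]] h0 unfolding continuous_on_def by blast
    then show "(E_partial ws n j x \<longlongrightarrow> E_partial ws n j x h0) (at h0 within Q)"
      by (intro E_partial_tendsto[OF ws j r0 xR tN N0 less_imp_le[OF NQ[OF h0]], where h = "\<lambda>a. a"])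
  qed
  then show "continuous_on Q (pdh j E)" by (subst continuous_on_cong[OF refl pE])
  show "\<bar>a v h\<bar> \<le> C * N h ^ (length v - d)" if "h \<in> Q"
    unfolding a_def C_def d_def by (rule E_partial_comm_expansion(1)[OF ws j r0 xR tN N0 less_imp_le[OF NQ[OF that]]])
  show "norm (pdh j E h - fw g (ws j) (E h)
        - (\<Sum>v\<in>{v\<in>words s m. d + 1 \<le> length v}. a v h *\<^sub>R fw g v (E h))) \<le> C * N h ^ (s + 1 - d)" if h: "h \<in> Q"
  proof -
    have fe: "fw g v (E h) = fw Z v (E h)" if "v \<in> words s m" for v
      by (rule fw_cong_open[of "ball 0 R"]) (use ER[OF h] gZ word_facts[OF that] in auto)
    have S: "(\<Sum>v\<in>{v\<in>words s m. d + 1 \<le> length v}. a v h *\<^sub>R fw g v (E h)) = (\<Sum>v\<in>{v\<in>words s m. d + 1 \<le> length v}. a v h *\<^sub>R fw Z v (E h))"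
      by (rule sum.cong[OF refl]) (use fe in auto)
    show ?thesis unfolding S fe[OF ws[OF j]] pE[OF h] unfolding Eq[OF h] a_def C_def d_def
      by (rule E_partial_comm_expansion(2)[OF ws j r0 xR tN N0 less_imp_le[OF NQ[OF h]]])
  qed
qed

end

end

theorem theorem5p1:
  fixes f :: "nat \<Rightarrow> real^'n \<Rightarrow> real^'n" and m s q :: nat and Yw :: "nat \<Rightarrow> nat list"
    and \<Omega>' :: "(real^'n) set" and \<phi> :: "real^'n \<Rightarrow> real"
  assumes "class_A s m f" and "hormander s m f"
    and "bounded \<Omega>'" and "connected \<Omega>'" and "open \<Omega>'"
    and "bij_betw Yw {1..q} (words s m)"
    and "mollifier \<phi>"
  shows "\<exists>\<sigma>0>0. \<exists>r0>0. \<exists>C>0. \<forall>I. (\<forall>j\<in>{1..CARD('n)}. I j \<in> {1..q}) \<longrightarrow>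
     (\<forall>j\<in>{1..CARD('n)}. \<exists>a :: nat list \<Rightarrow> (nat \<Rightarrow> real) \<Rightarrow> real.
        (\<forall>h\<in>QI CARD('n) Yw I r0. \<forall>v\<in>words s m. length (Yw (I j)) + 1 \<le> length v \<longrightarrow>
            \<bar>a v h\<bar> \<le> C * normI CARD('n) Yw I h ^ (length v - length (Yw (I j)))) \<and>
        (\<forall>\<sigma>\<in>{0<..\<sigma>0}. \<forall>x\<in>closure \<Omega>'.
            continuous_on (QI CARD('n) Yw I r0) (pdh j (Emap (\<lambda>i. moll \<phi> \<sigma> (f i)) Yw I x)) \<and>
            (\<forall>h\<in>QI CARD('n) Yw I r0.
              (\<lambda>t. Emap (\<lambda>i. moll \<phi> \<sigma> (f i)) Yw I x (h(j := t))) differentiable (at (h j)) \<and>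
              norm (pdh j (Emap (\<lambda>i. moll \<phi> \<sigma> (f i)) Yw I x) h
                    - fw (\<lambda>i. moll \<phi> \<sigma> (f i)) (Yw (I j)) (Emap (\<lambda>i. moll \<phi> \<sigma> (f i)) Yw I x h)
                    - (\<Sum>v\<in>{v\<in>words s m. length (Yw (I j)) + 1 \<le> length v}.
                         a v h *\<^sub>R fw (\<lambda>i. moll \<phi> \<sigma> (f i)) v (Emap (\<lambda>i. moll \<phi> \<sigma> (f i)) Yw I x h)))
                \<le> C * normI CARD('n) Yw I h ^ (s + 1 - length (Yw (I j))))))"
proof -
  let ?n = "CARD('n)" and ?NN = "4 ^ s :: nat"
  obtain R0 where R0: "\<And>x. x \<in> closure \<Omega>' \<Longrightarrow> norm x \<le> R0"
    using bounded_closure[OF assms(3)] unfolding bounded_iff by blast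
  \<comment> \<open>The extra 1 is the margin that the flows may use up. The absolute value covers
    an empty closure, where \<open>R0\<close> is arbitrary.\<close>
  define R where "R = \<bar>R0\<bar> + 1"
  have R: "0 < R" by (simp add: R_def)
  obtain L M T B where T: "0 < T" and M: "0 \<le> M" and V':
    "\<forall>\<sigma>\<in>{0<..1}. \<exists>Z M2. vflows Z L M M2 T B R s m \<and> (\<forall>i\<in>{1..m}. \<forall>y. norm y < R \<longrightarrow> moll \<phi> \<sigma> (f i) y = Z i y) \<and>
       (\<forall>i\<in>{1..m}. ball_lip (moll \<phi> \<sigma> (f i)))"
    using mollified_vflows[OF assms(1,7) R] by (elim exE conjE)
  note V = bspec[OF V']
  \<comment> \<open>Total displacement per unit of \<open>r0\<close>: speed at most \<open>M\<close>
    through the whole budget of flows.\<close>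
  define D where "D = M * real (?NN * (?n + 2) + 1)"
  have D: "0 \<le> D" using M by (simp add: D_def)
  \<comment> \<open>Keeps every flow within the horizon \<open>T\<close> and the total displacement
    below the margin 1; the outer halving makes both inequalities strict.\<close>
  define r0 where "r0 = min (T / 2) (1 / (D + 1)) / 2"
  have r0: "0 < r0" "r0 < T" using T D by (auto simp: r0_def min_less_iff_disj)
  have rD: "r0 * D < 1"
  proof -
    have "r0 < 1 / (D + 1)" using D T by (auto simp: r0_def min_def field_simps)
    then have "r0 * (D + 1) < 1" using D by (simp add: field_simps)
    then show ?thesis using r0 by (simp add: algebra_simps)
  qed
  define K where "K = 2 + real s + 2 * B * card (words s m)"
  define C where "C = K ^ (?NN * ?n) * (K + 1) ^ ?NN"
  have xR: "norm x + M * r0 * real (?NN * (?n + 2) + 1) < R" if "norm x \<le> \<bar>R0\<bar>" for x :: "real^'n"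
    using that rD by (simp add: R_def D_def mult_ac)
  have C0: "0 < C"
  proof -
    obtain Z :: "nat \<Rightarrow> real^'n \<Rightarrow> real^'n" and M2 where "vflows Z L M M2 T B R s m" using V[of 1] by auto
    then have "0 \<le> B" by (rule vflows.B0)
    then have "0 < K" by (simp add: K_def add_pos_nonneg)
    then show ?thesis by (simp add: C_def)
  qed
  have main: "\<exists>a :: nat list \<Rightarrow> (nat \<Rightarrow> real) \<Rightarrow> real.
        (\<forall>h\<in>QI ?n Yw I r0. \<forall>v\<in>words s m. length (Yw (I j)) + 1 \<le> length v \<longrightarrow>
            \<bar>a v h\<bar> \<le> C * normI ?n Yw I h ^ (length v - length (Yw (I j)))) \<and>
        (\<forall>\<sigma>\<in>{0<..1}. \<forall>x\<in>closure \<Omega>'.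
            continuous_on (QI ?n Yw I r0) (pdh j (Emap (\<lambda>i. moll \<phi> \<sigma> (f i)) Yw I x)) \<and>
            (\<forall>h\<in>QI ?n Yw I r0.
              (\<lambda>t. Emap (\<lambda>i. moll \<phi> \<sigma> (f i)) Yw I x (h(j := t))) differentiable (at (h j)) \<and>
              norm (pdh j (Emap (\<lambda>i. moll \<phi> \<sigma> (f i)) Yw I x) h
                    - fw (\<lambda>i. moll \<phi> \<sigma> (f i)) (Yw (I j)) (Emap (\<lambda>i. moll \<phi> \<sigma> (f i)) Yw I x h)
                    - (\<Sum>v\<in>{v\<in>words s m. length (Yw (I j)) + 1 \<le> length v}.
                         a v h *\<^sub>R fw (\<lambda>i. moll \<phi> \<sigma> (f i)) v (Emap (\<lambda>i. moll \<phi> \<sigma> (f i)) Yw I x h)))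
                \<le> C * normI ?n Yw I h ^ (s + 1 - length (Yw (I j)))))"
    if I: "\<forall>i\<in>{1..?n}. I i \<in> {1..q}" and j: "j \<in> {1..?n}" for I j
  proof -
    have ws: "Yw (I i) \<in> words s m" if "i \<in> {1..?n}" for i
      using I that assms(6) by (auto simp: bij_betw_def)
    define a where "a v h = E_coeff s m (\<lambda>i. Yw (I i)) h [1..<j] (exp_coeff s m (Yw (I j)) (h j)) v" for v h
    note cs = vflows.NN_def vflows.AA_def vflows.KK_def
    \<comment> \<open>The coefficients involve neither \<sigma> nor the point, so their bound is
      read off at \<sigma> = 1 and at the origin, which is available even if the closure is
      empty.\<close>
    have A1: "\<bar>a v h\<bar> \<le> C * normI ?n Yw I h ^ (length v - length (Yw (I j)))" if h: "h \<in> QI ?n Yw I r0" for h v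
    proof -
      obtain Z M2 where Z: "vflows Z L M M2 T B R s m" "\<forall>i\<in>{1..m}. \<forall>y. norm y < R \<longrightarrow> moll \<phi> 1 (f i) y = Z i y"
       "\<forall>i\<in>{1..m}. ball_lip (moll \<phi> 1 (f i))" using V[of 1] by auto
      show ?thesis
        using vflows.Emap_expansion(3)[OF Z(1), of "\<lambda>i. moll \<phi> 1 (f i)" Yw I j r0 0 h v]
          Z(2,3) ws j r0 xR[of 0] h unfolding cs[OF Z(1)] a_def C_def K_def by simp
    qed
    have A2: "continuous_on (QI ?n Yw I r0) (pdh j (Emap (\<lambda>i. moll \<phi> \<sigma> (f i)) Yw I x)) \<and>
            (\<forall>h\<in>QI ?n Yw I r0.
              (\<lambda>t. Emap (\<lambda>i. moll \<phi> \<sigma> (f i)) Yw I x (h(j := t))) differentiable (at (h j)) \<and>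
              norm (pdh j (Emap (\<lambda>i. moll \<phi> \<sigma> (f i)) Yw I x) h
                    - fw (\<lambda>i. moll \<phi> \<sigma> (f i)) (Yw (I j)) (Emap (\<lambda>i. moll \<phi> \<sigma> (f i)) Yw I x h)
                    - (\<Sum>v\<in>{v\<in>words s m. length (Yw (I j)) + 1 \<le> length v}.
                         a v h *\<^sub>R fw (\<lambda>i. moll \<phi> \<sigma> (f i)) v (Emap (\<lambda>i. moll \<phi> \<sigma> (f i)) Yw I x h)))
                \<le> C * normI ?n Yw I h ^ (s + 1 - length (Yw (I j))))"
      if s: "\<sigma> \<in> {0<..1}" and x: "x \<in> closure \<Omega>'" for \<sigma> x
    proof -
      obtain Z M2 where Z: "vflows Z L M M2 T B R s m" "\<forall>i\<in>{1..m}. \<forall>y. norm y < R \<longrightarrow> moll \<phi> \<sigma> (f i) y = Z i y"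
       "\<forall>i\<in>{1..m}. ball_lip (moll \<phi> \<sigma> (f i))" using V[OF s] by auto
      have xR': "norm x + M * r0 * real (vflows.NN s * (?n + 2) + 1) < R"
        unfolding cs[OF Z(1)] by (rule xR) (use R0[OF x] in simp)
      note X = vflows.Emap_expansion[OF Z(1), of "\<lambda>i. moll \<phi> \<sigma> (f i)" Yw I j r0 x, OF Z(2)[rule_format] Z(3)[rule_format] ws j r0 xR']
      show ?thesis
        using X(1,2,4) unfolding cs[OF Z(1)] a_def C_def K_def by blast
    qed
    show ?thesis using A1 A2 by (intro exI[of _ a]) blast
  qed
  \<comment> \<open>\<sigma>0 = 1 is the range in which the kernel estimates were made: the support
    of the rescaled kernel then enlarges balls by at most 1.\<close>
  show ?thesis
    by (intro exI[of _ "1::real"] exI[of _ r0] exI[of _ C] conjI zero_less_one r0(1) C0 allI impI ballI main) blast+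
qed

end
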